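(* Let $K$ be a totally real number field of fundamental discriminant and degree $n\ge 3$. If $(\mathbb{Z}/n\mathbb{Z})^\times$ is cyclic, then for any number field $L$ the following are equivalent: (i) $K\cong L$. (ii) $(O_K^{\bot},\mathrm{tr}_{K/\mathbb{Q}})\cong(O_L^{\bot},\mathrm{tr}_{L/\mathbb{Q}})$. (iii) $\mathrm{Sh}(K)=\mathrm{Sh}(L)$ and $L$ is totally real with fundamental discriminant. If moreover $\gcd(n,\mathrm{Disc}(K))=1$, then the three items are also equivalent to (iv) $(O_K^{0},\mathrm{tr}_{K/\mathbb{Q}})\cong(O_L^{0},\mathrm{tr}_{L/\mathbb{Q}})$.
   Context: For a number field $K$ of degree $n$, $O_K$ is its ring of integers, $\mathrm{Disc}(K)$ its discriminant, $O_K^0:=\{x\in O_K:\mathrm{tr}_{K/\mathbb{Q}}(x)=0\}$, and $O_K^{\bot}:=\{n\alpha-\mathrm{tr}_{K/\mathbb{Q}}(\alpha):\alpha\in O_K\}=(\mathbb{Z}+nO_K)\cap O_K^0$. For $M=O_K^0$ or $O_K^{\bot}$, the pair $(M,\mathrm{tr}_{K/\mathbb{Q}})$ denotes the quadratic $\mathbb{Z}$-module obtained by restricting the trace pairing $(x,y)\mapsto\mathrm{tr}_{K/\mathbb{Q}}(xy)$ to $M$; $\cong$ between such pairs means isometry (an isomorphism of $\mathbb{Z}$-modules preserving the bilinear forms). Let $b_K$ be the real-valued symmetric $\mathbb{Q}$-bilinear form on $K$ with $b_K(x,x)=\sum_{\sigma:K\hookrightarrow\mathbb{C}}|\sigma(x)|^2$.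 The shape $\mathrm{Sh}(K)$ is the isometry class of $(O_K^{\bot},b_K)$ up to scalar multiplication: $\mathrm{Sh}(K)=\mathrm{Sh}(L)$ if and only if $(O_K^{\bot},b_K)\cong(O_L^{\bot},\lambda b_L)$ for some $\lambda\in\mathbb{R}^\times$. An integer $D$ is a fundamental discriminant if either $D\equiv 1\pmod 4$ and $D$ is square free, or $D=4m$ with $m$ square free and $m\equiv 2,3\pmod 4$; a number field has fundamental discriminant if its discriminant is a fundamental discriminant. *)

theory Defs
  imports
    Complex_Main
    "HOL-Library.FuncSet"
    "HOL-Computational_Algebra.Polynomial"
    "HOL-Computational_Algebra.Squarefree"
    "HOL-Algebra.Elementary_Groups"
    "HOL-Number_Theory.Residues"
    "Jordan_Normal_Form.Determinant"
begin

global_interpretation rat_vs: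
  vector_space "\<lambda>(q::rat) (x::'a::field_char_0). of_rat q * x"
  by unfold_locales (simp_all add: algebra_simps of_rat_add of_rat_mult)

global_interpretation int_mod:
  Modules.module "\<lambda>(k::int) (x::'a::field_char_0). of_int k * x"
  by unfold_locales (simp_all add: algebra_simps)

text \<open>A number field is a subfield \<open>K\<close> of an arbitrary field of characteristic zero (an arbitrary
  type of class \<open>field_char_0\<close>) that is finite-dimensional over the rationals. Taking \<open>K = UNIV\<close>
  covers fields that are not given inside a larger one.\<close>

definition is_subfield :: "'a::field_char_0 set \<Rightarrow> bool" where
  "is_subfield K \<longleftrightarrow> 0 \<in> K \<and> 1 \<in> K \<and>
     (\<forall>x\<in>K. \<forall>y\<in>K. x + y \<in> K \<and> x * y \<in> K) \<and> (\<forall>x\<in>K. - x \<in> K \<and> inverse x \<in> K)"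

definition rat_basis :: "'a::field_char_0 set \<Rightarrow> 'a set \<Rightarrow> bool" where
  "rat_basis K B \<longleftrightarrow> rat_vs.independent B \<and> rat_vs.span B = K"

definition number_field :: "'a::field_char_0 set \<Rightarrow> bool" where
  "number_field K \<longleftrightarrow> is_subfield K \<and> (\<exists>B. finite B \<and> rat_basis K B)"

definition nf_degree :: "'a::field_char_0 set \<Rightarrow> nat" where
  "nf_degree K = rat_vs.dim K"

definition field_hom :: "'a::field_char_0 set \<Rightarrow> 'b::field_char_0 set \<Rightarrow> ('a \<Rightarrow> 'b) \<Rightarrow> bool" where
  "field_hom K L f \<longleftrightarrow> f \<in> K \<rightarrow> L \<and> f 1 = 1 \<and>
     (\<forall>x\<in>K. \<forall>y\<in>K. f (x + y) = f x + f y \<and> f (x * y) = f x * f y)"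

definition field_isomorphic :: "'a::field_char_0 set \<Rightarrow> 'b::field_char_0 set \<Rightarrow> bool" where
  "field_isomorphic K L \<longleftrightarrow> (\<exists>f. field_hom K L f \<and> bij_betw f K L)"

text \<open>Embeddings are taken to be \<open>undefined\<close> outside \<open>K\<close>, so that each one is counted exactly once
  in sums over this set.\<close>

definition embeddings :: "'a::field_char_0 set \<Rightarrow> ('a \<Rightarrow> complex) set" where
  "embeddings K = {\<sigma> \<in> extensional K. field_hom K UNIV \<sigma>}"

definition totally_real :: "'a::field_char_0 set \<Rightarrow> bool" where
  "totally_real K \<longleftrightarrow> (\<forall>\<sigma>\<in>embeddings K. \<forall>x\<in>K. \<sigma> x \<in> \<real>)"

definition ring_of_integers :: "'a::field_char_0 set \<Rightarrow> 'a set" where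
  "ring_of_integers K = {x \<in> K. algebraic_int x}"

text \<open>The trace of the endomorphism \<open>y \<mapsto> x * y\<close> of the rational vector space \<open>K\<close>: the sum of the
  diagonal entries of its matrix. The result does not depend on the chosen basis.\<close>

definition field_trace :: "'a::field_char_0 set \<Rightarrow> 'a \<Rightarrow> rat" where
  "field_trace K x =
     (let B = (SOME B. rat_basis K B) in \<Sum>b\<in>B. rat_vs.representation B (x * b) b)"

definition trace_form :: "'a::field_char_0 set \<Rightarrow> 'a \<Rightarrow> 'a \<Rightarrow> rat" where
  "trace_form K x y = field_trace K (x * y)"

definition integral_basis :: "'a::field_char_0 set \<Rightarrow> 'a list \<Rightarrow> bool" where
  "integral_basis K bs \<longleftrightarrow> distinct bs \<and> int_mod.independent (set bs) \<and>
     int_mod.span (set bs) = ring_of_integers K"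

text \<open>The determinant below is an integer that is the same for all integral bases.\<close>

definition discriminant :: "'a::field_char_0 set \<Rightarrow> int" where
  "discriminant K = (THE d. \<exists>bs. integral_basis K bs \<and>
     of_int d = det (mat (length bs) (length bs) (\<lambda>(i, j). trace_form K (bs ! i) (bs ! j))))"

definition fundamental_discriminant :: "int \<Rightarrow> bool" where
  "fundamental_discriminant D \<longleftrightarrow>
     ([D = 1] (mod 4) \<and> squarefree D) \<or>
     (\<exists>m. D = 4 * m \<and> squarefree m \<and> ([m = 2] (mod 4) \<or> [m = 3] (mod 4)))"

definition trace_zero_integers :: "'a::field_char_0 set \<Rightarrow> 'a set" where
  "trace_zero_integers K = {x \<in> ring_of_integers K. field_trace K x = 0}"

definition integers_perp :: "'a::field_char_0 set \<Rightarrow> 'a set" where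
  "integers_perp K =
     (\<lambda>\<alpha>. of_nat (nf_degree K) * \<alpha> - of_rat (field_trace K \<alpha>)) ` ring_of_integers K"

definition isometric ::
  "'a::ab_group_add set \<Rightarrow> ('a \<Rightarrow> 'a \<Rightarrow> 'c) \<Rightarrow> 'b::ab_group_add set \<Rightarrow> ('b \<Rightarrow> 'b \<Rightarrow> 'c) \<Rightarrow> bool" where
  "isometric M \<beta> N \<gamma> \<longleftrightarrow> (\<exists>f. bij_betw f M N \<and>
     (\<forall>x\<in>M. \<forall>y\<in>M. f (x + y) = f x + f y) \<and> (\<forall>x\<in>M. \<forall>y\<in>M. \<gamma> (f x) (f y) = \<beta> x y))"

text \<open>The form \<open>b\<^sub>K\<close>, i.e. the polarization of \<open>x \<mapsto> \<Sum>\<^sub>\<sigma> \<bar>\<sigma> x\<bar>\<^sup>2\<close>; see the lemmas below.\<close>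

definition b_form :: "'a::field_char_0 set \<Rightarrow> 'a \<Rightarrow> 'a \<Rightarrow> real" where
  "b_form K x y = (\<Sum>\<sigma>\<in>embeddings K. Re (\<sigma> x * cnj (\<sigma> y)))"

lemma b_form_diag: "b_form K x x = (\<Sum>\<sigma>\<in>embeddings K. (cmod (\<sigma> x))\<^sup>2)"
  unfolding b_form_def
  by (intro sum.cong refl) (simp add: cmod_power2, simp add: power2_eq_square)

lemma b_form_commute: "b_form K x y = b_form K y x"
  by (simp add: b_form_def mult.commute)

lemma b_form_add_left:
  assumes "x \<in> K" "y \<in> K"
  shows "b_form K (x + y) z = b_form K x z + b_form K y z"
  unfolding b_form_def sum.distrib[symmetric]
  by (intro sum.cong refl)
     (use assms in \<open>auto simp: embeddings_def field_hom_def algebra_simps\<close>)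

text \<open>\<open>Sh(K) = Sh(L)\<close>.\<close>

definition same_shape :: "'a::field_char_0 set \<Rightarrow> 'b::field_char_0 set \<Rightarrow> bool" where
  "same_shape K L \<longleftrightarrow> (\<exists>c::real. c \<noteq> 0 \<and>
     isometric (integers_perp K) (b_form K) (integers_perp L) (\<lambda>x y. c * b_form L x y))"

end

theory Submission
  imports
    Defs
    "Jordan_Normal_Form.Char_Poly"
    "HOL-Computational_Algebra.Fundamental_Theorem_Algebra"
begin

text \<open>Let \<open>K\<close> have integral basis \<open>e\<^sub>1, \<dots>, e\<^sub>n\<close>, let \<open>V = (\<sigma>\<^sub>i e\<^sub>j)\<close> be its matrix of conjugates and \<open>S = V\<^sup>T V\<close>
  its Gram matrix for the trace form, so that \<open>det S\<close> is the discriminant \<open>d\<close>.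

  The heart of the proof is \<open>field_isomorphic_if_gram_eq\<close>: if \<open>K\<close> is totally real with fundamental
  discriminant, a bijective isometry \<open>\<Phi>\<close> from \<open>O\<^sub>K\<close> to \<open>O\<^sub>L\<close> with \<open>\<Phi> 1 = 1\<close> forces \<open>K \<cong> L\<close>. With \<open>V'\<close> the
  matrix of conjugates of the basis \<open>\<Phi> e\<^sub>j\<close>, the matrix \<open>U = V' V\<^sup>-\<^sup>1\<close> is orthogonal and real, and its rows have
  sum 1. If \<open>U\<close> is a permutation matrix, the embeddings of \<open>L\<close> composed with \<open>\<Phi>\<close> are embeddings of \<open>K\<close>, and \<open>\<Phi>\<close>
  is multiplicative. To see this one proves that \<open>2 U\<^sub>i\<^sub>j\<^sup>2\<close> is an algebraic integer. The numbers
  \<open>y = (2 U\<^sub>i\<^sub>j\<^sup>2 - 1)\<^sup>2\<close> lie in the unit interval, and their power sums over all \<open>i\<close> and \<open>j\<close> are rational,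
  hence integers; as these sums decrease, every \<open>y\<close> is 0 or 1. So \<open>U\<^sub>i\<^sub>j\<^sup>2\<close> is 0, 1/2 or 1, and a row with sum
  and norm 1 is a standard basis vector, because 2 is not a square.

  For the integrality of \<open>2 U\<^sub>i\<^sub>j\<^sup>2\<close>, note that \<open>U\<close> maps the columns of \<open>V\<close>, and up to sign also those of
  the cofactor matrix \<open>C\<close>, to integral vectors. By Cramer's rule (\<open>cramer_integral\<close>) the entries of \<open>U\<close>
  become integral when they are multiplied by \<open>det V\<close> or by an entry of the adjugate of \<open>S\<close>, and for odd \<open>p\<close>
  the prime \<open>p\<close> cannot divide \<open>d\<close> and all these entries, since \<open>p\<^sup>2\<close> does not divide \<open>d\<close>. At 2 there is
  a refinement of Stickelberger's theorem (\<open>stickelberger_dual_basis\<close>): \<open>C\<close> is congruent modulo 2 to \<open>V X\<close> with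
  an integer matrix \<open>X\<close>, because a determinant is congruent to a permanent. For \<open>d = 4 m\<close> the matrix \<open>X\<close>
  is an alternating form modulo 2 on a space of dimension at most 3. Comparing it with the form \<open>X'\<close> of \<open>V'\<close>
  produces a vector \<open>(V X f \<plusminus> C f) / 2\<close> that is integral together with its image under \<open>U\<close>, and Cramer's
  rule for it gives an integer \<open>N\<close> with \<open>N U\<^sub>i\<^sub>j\<^sup>2\<close> integral that is not divisible by 4 (\<open>even_multiplier\<close>).

  The other lattices are reduced to this case. The trace form of a field with fundamental discriminant is nearly
  regular modulo every prime (\<open>radical_mod_prime\<close>), so some integer of \<open>K\<close> has trace 1. An isometry of
  \<open>O\<^sub>K\<^sup>\<bottom>\<close> with \<open>O\<^sub>L\<^sup>\<bottom>\<close> preserves \<open>n tr (x y) - tr x tr y\<close>, so modulo \<open>n\<close> it multiplies traces by a square root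
  of 1; as the unit group modulo \<open>n\<close> is cyclic, that is a sign, and up to this sign the isometry extends to
  \<open>O\<^sub>K\<close> and fixes 1 (\<open>perp_isometry\<close>). Equal shapes are isometric up to a rational factor, which is 1 because the form
  \<open>n tr (x y) - tr x tr y\<close> is primitive (\<open>perp_form_primitive\<close>). If \<open>n\<close> is prime to \<open>d\<close>, an isometry of the
  lattices \<open>O\<^sup>0\<close> induces one of \<open>O\<^sub>L\<^sup>\<bottom>\<close> into \<open>O\<^sub>K\<^sup>\<bottom>\<close> (\<open>mem_integers_perp_if_dvd\<close>), which extends in the same way.\<close>

section \<open>Sums and products of algebraic integers\<close>

text \<open>Multiplication by \<open>x\<close> acts on the generators through an integer matrix that has \<open>x\<close> as an eigenvalue,
  so \<open>x\<close> is a root of a monic integer polynomial, the characteristic polynomial.\<close>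

lemma algebraic_int_if_stable_span:
  fixes x :: "'a::field_char_0"
  assumes fin: "finite W" and w: "w \<in> W" "w \<noteq> 0"
    and stable: "\<And>v. v \<in> W \<Longrightarrow> x * v \<in> int_mod.span W"
  shows "algebraic_int x"
proof -
  obtain vs where vs: "set vs = W" "distinct vs"
    using finite_distinct_list[OF fin] by blast
  define N where "N = length vs"
  have "\<exists>u. \<forall>v\<in>W. x * v = (\<Sum>t\<in>W. of_int (u v t) * t)"
  proof -
    have "\<forall>v\<in>W. \<exists>u. x * v = (\<Sum>t\<in>W. of_int (u t) * t)"
      using stable int_mod.span_finite[OF fin] by auto
    thus ?thesis by metis
  qed
  then obtain u where u: "\<And>v. v \<in> W \<Longrightarrow> x * v = (\<Sum>t\<in>W. of_int (u v t) * t)" by blast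
  define M :: "int mat" where "M = mat N N (\<lambda>(i, j). u (vs ! i) (vs ! j))"
  define A :: "'a mat" where "A = map_mat of_int M"
  have A: "A \<in> carrier_mat N N" and M: "M \<in> carrier_mat N N" by (auto simp: A_def M_def)
  have "A *\<^sub>v vec_of_list vs = x \<cdot>\<^sub>v vec_of_list vs"
  proof (intro eq_vecI)
    fix i assume "i < dim_vec (x \<cdot>\<^sub>v vec_of_list vs)"
    hence i: "i < N" by (simp add: N_def)
    have "(A *\<^sub>v vec_of_list vs) $ i = (\<Sum>j<N. of_int (u (vs ! i) (vs ! j)) * vs ! j)"
      using i by (auto simp: A_def M_def scalar_prod_def N_def vec_of_list_index atLeast0LessThan
          intro!: sum.cong)
    also have "\<dots> = (\<Sum>t\<in>W. of_int (u (vs ! i) t) * t)"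
      using sum.reindex_bij_betw[OF bij_betw_nth[OF vs(2) refl refl],
          of "\<lambda>t. of_int (u (vs ! i) t) * t"] vs(1) by (simp add: N_def)
    also have "\<dots> = x * vs ! i"
      using u[of "vs ! i"] i vs(1) by (auto simp: N_def)
    finally show "(A *\<^sub>v vec_of_list vs) $ i = (x \<cdot>\<^sub>v vec_of_list vs) $ i"
      using i by (simp add: vec_of_list_index N_def)
  qed (auto simp: A_def M_def N_def)
  moreover have "vec_of_list vs \<noteq> 0\<^sub>v N"
  proof
    assume *: "vec_of_list vs = 0\<^sub>v N"
    from w(1) vs(1) obtain i where i: "i < N" "vs ! i = w" by (auto simp: in_set_conv_nth N_def)
    have "vec_of_list vs $ i = 0" unfolding * using i by simp
    thus False using i w(2) by (simp add: vec_of_list_index)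
  qed
  moreover have "vec_of_list vs \<in> carrier_vec N" by (rule carrier_vecI) (simp add: N_def)
  moreover have "dim_row A = N" using A by simp
  ultimately have "eigenvector A (vec_of_list vs) x" unfolding eigenvector_def by simp
  hence "eigenvalue A x" unfolding eigenvalue_def by blast
  hence "poly (char_poly A) x = 0" using eigenvalue_root_char_poly[OF A] by simp
  moreover have "char_poly A = map_poly of_int (char_poly M)"
    unfolding A_def by (rule of_int_hom.char_poly_hom[OF M])
  ultimately have "poly (map_poly of_int (char_poly M)) x = 0" by simp
  thus ?thesis
    unfolding algebraic_int_altdef_ipoly using degree_monic_char_poly[OF M] by blast
qed

lemma algebraic_int_power_in_span:
  fixes x :: "'a::field_char_0"
  assumes "algebraic_int x"
  obtains m where "m > 0" "x ^ m \<in> int_mod.span ((\<lambda>i. x ^ i) ` {..<m})"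
proof -
  obtain p where p: "poly (map_poly of_int p) x = 0" "lead_coeff p = 1"
    using assms algebraic_int_altdef_ipoly by blast
  define m where "m = degree p"
  have deg: "degree (map_poly of_int p :: 'a poly) = m"
    unfolding m_def by (intro degree_map_poly) auto
  have "m > 0"
  proof (rule ccontr)
    assume "\<not> m > 0"
    hence "degree p = 0" by (simp add: m_def)
    then obtain c where "p = [:c:]" by (elim degree_eq_zeroE)
    with p show False by simp
  qed
  have "0 = (\<Sum>i\<le>m. of_int (coeff p i) * x ^ i)"
    using p(1) unfolding poly_altdef deg by (simp add: coeff_map_poly)
  also have "\<dots> = x ^ m + (\<Sum>i<m. of_int (coeff p i) * x ^ i)"
    using p(2) unfolding lessThan_Suc_atMost[symmetric] by (simp add: m_def)
  finally have "x ^ m = (\<Sum>i<m. of_int (- coeff p i) * x ^ i)"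
    by (simp add: eq_neg_iff_add_eq_0 sum_negf)
  also have "\<dots> \<in> int_mod.span ((\<lambda>i. x ^ i) ` {..<m})"
    by (intro int_mod.span_sum int_mod.span_scale int_mod.span_base) auto
  finally have "x ^ m \<in> int_mod.span ((\<lambda>i. x ^ i) ` {..<m})" .
  with \<open>m > 0\<close> show ?thesis by (rule that)
qed

text \<open>The products \<open>x ^ i * y ^ j\<close> with bounded exponents generate a group that is stable under \<open>x\<close> and \<open>y\<close>, hence
  under \<open>x + y\<close> and \<open>x * y\<close>.\<close>

lemma algebraic_int_span_two:
  fixes x y :: "'a::field_char_0"
  assumes "algebraic_int x" "algebraic_int y"
  obtains W where "finite W" "1 \<in> W"
    "\<forall>w\<in>int_mod.span W. x * w \<in> int_mod.span W"
    "\<forall>w\<in>int_mod.span W. y * w \<in> int_mod.span W"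
proof -
  obtain m where m: "m > 0" "x ^ m \<in> int_mod.span ((\<lambda>i. x ^ i) ` {..<m})"
    by (rule algebraic_int_power_in_span[OF assms(1)])
  obtain k where k: "k > 0" "y ^ k \<in> int_mod.span ((\<lambda>i. y ^ i) ` {..<k})"
    by (rule algebraic_int_power_in_span[OF assms(2)])
  define W where "W = (\<lambda>(i, j). x ^ i * y ^ j) ` ({..<m} \<times> {..<k})"
  have lift: "z * w \<in> int_mod.span W"
    if z: "\<And>v. v \<in> W \<Longrightarrow> z * v \<in> int_mod.span W" and w: "w \<in> int_mod.span W" for z w
    using w
  proof (induction rule: int_mod.span_induct_alt)
    case base
    show ?case by (simp add: int_mod.span_zero)
  next
    case (step c v w)
    have "z * (of_int c * v + w) = of_int c * (z * v) + z * w" by (simp add: algebra_simps)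
    thus ?case using z[OF step(1)] step(2)
      by (simp add: int_mod.span_add int_mod.span_scale)
  qed
  have mul: "b * a \<in> int_mod.span W" if a: "a \<in> int_mod.span (f ` I)"
    and f: "\<And>i. i \<in> I \<Longrightarrow> b * f i \<in> W" for a b and f :: "nat \<Rightarrow> 'a" and I
    using a
  proof (induction rule: int_mod.span_induct_alt)
    case base
    show ?case by (simp add: int_mod.span_zero)
  next
    case (step c v w)
    have "b * (of_int c * v + w) = of_int c * (b * v) + b * w" by (simp add: algebra_simps)
    moreover have "b * v \<in> int_mod.span W" using step(1) f by (auto intro: int_mod.span_base)
    ultimately show ?case using step(2)
      by (simp add: int_mod.span_add int_mod.span_scale)
  qed
  have 1: "x * v \<in> int_mod.span W" if "v \<in> W" for v
  proof -
    from that obtain i j where ij: "i < m" "j < k" "v = x ^ i * y ^ j" by (auto simp: W_def)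
    show ?thesis
    proof (cases "Suc i < m")
      case True
      have "x * v \<in> W" unfolding W_def using True ij by (intro image_eqI[of _ _ "(Suc i, j)"]) auto
      thus ?thesis by (rule int_mod.span_base)
    next
      case False
      hence eq: "x * v = y ^ j * x ^ m"
        using ij by (metis Suc_lessI mult.assoc mult.commute power_Suc)
      show ?thesis unfolding eq
        by (rule mul[OF m(2)]) (use ij in \<open>auto simp: W_def mult.commute\<close>)
    qed
  qed
  have 2: "y * v \<in> int_mod.span W" if "v \<in> W" for v
  proof -
    from that obtain i j where ij: "i < m" "j < k" "v = x ^ i * y ^ j" by (auto simp: W_def)
    show ?thesis
    proof (cases "Suc j < k")
      case True
      have "y * v \<in> W" unfolding W_def using True ij
        by (intro image_eqI[of _ _ "(i, Suc j)"]) (auto simp: algebra_simps)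
      thus ?thesis by (rule int_mod.span_base)
    next
      case False
      hence eq: "y * v = x ^ i * y ^ k"
        using ij by (metis Suc_lessI mult.left_commute power_Suc)
      show ?thesis unfolding eq
        by (rule mul[OF k(2)]) (use ij in \<open>auto simp: W_def\<close>)
    qed
  qed
  show ?thesis
  proof (rule that[of W])
    show "1 \<in> W" unfolding W_def using m(1) k(1) by (intro image_eqI[of _ _ "(0, 0)"]) auto
    show "finite W" by (simp add: W_def)
    show "\<forall>w\<in>int_mod.span W. x * w \<in> int_mod.span W" by (intro ballI lift[OF 1])
    show "\<forall>w\<in>int_mod.span W. y * w \<in> int_mod.span W" by (intro ballI lift[OF 2])
  qed
qed

lemma algebraic_int_add:
  fixes x y :: "'a::field_char_0"
  assumes "algebraic_int x" "algebraic_int y"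
  shows "algebraic_int (x + y)"
proof -
  obtain W where W: "finite W" "1 \<in> W"
    "\<forall>w\<in>int_mod.span W. x * w \<in> int_mod.span W"
    "\<forall>w\<in>int_mod.span W. y * w \<in> int_mod.span W"
    by (rule algebraic_int_span_two[OF assms])
  show ?thesis
  proof (rule algebraic_int_if_stable_span[OF W(1,2)])
    fix v assume "v \<in> W"
    hence "v \<in> int_mod.span W" by (rule int_mod.span_base)
    hence "x * v + y * v \<in> int_mod.span W" using W(3,4) by (intro int_mod.span_add) simp_all
    thus "(x + y) * v \<in> int_mod.span W" by (simp only: distrib_right)
  qed simp
qed

lemma algebraic_int_mult:
  fixes x y :: "'a::field_char_0"
  assumes "algebraic_int x" "algebraic_int y"
  shows "algebraic_int (x * y)"
proof -
  obtain W where W: "finite W" "1 \<in> W"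
    "\<forall>w\<in>int_mod.span W. x * w \<in> int_mod.span W"
    "\<forall>w\<in>int_mod.span W. y * w \<in> int_mod.span W"
    by (rule algebraic_int_span_two[OF assms])
  show ?thesis
  proof (rule algebraic_int_if_stable_span[OF W(1,2)])
    fix v assume "v \<in> W"
    hence "v \<in> int_mod.span W" by (rule int_mod.span_base)
    hence "x * (y * v) \<in> int_mod.span W" using W(3,4) by simp
    thus "x * y * v \<in> int_mod.span W" by (simp only: mult.assoc)
  qed simp
qed

lemma algebraic_int_diff:
  fixes x y :: "'a::field_char_0"
  assumes "algebraic_int x" "algebraic_int y"
  shows "algebraic_int (x - y)"
  using algebraic_int_add[OF assms(1) algebraic_int_minus[OF assms(2)]] by simp

lemma algebraic_int_sum:
  fixes f :: "'i \<Rightarrow> 'a::field_char_0"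
  assumes "\<And>i. i \<in> A \<Longrightarrow> algebraic_int (f i)"
  shows "algebraic_int (sum f A)"
  using assms by (induction A rule: infinite_finite_induct) (simp_all add: algebraic_int_add)

lemma algebraic_int_prod:
  fixes f :: "'i \<Rightarrow> 'a::field_char_0"
  assumes "\<And>i. i \<in> A \<Longrightarrow> algebraic_int (f i)"
  shows "algebraic_int (prod f A)"
  using assms by (induction A rule: infinite_finite_induct) (simp_all add: algebraic_int_mult)

lemma algebraic_int_power:
  fixes x :: "'a::field_char_0"
  assumes "algebraic_int x"
  shows "algebraic_int (x ^ k)"
proof (induction k)
  case (Suc k)
  thus ?case unfolding power_Suc by (rule algebraic_int_mult[OF assms])
qed simp

lemma algebraic_int_det:
  fixes A :: "'a::field_char_0 mat"
  assumes "A \<in> carrier_mat n n" "\<And>i j. i < n \<Longrightarrow> j < n \<Longrightarrow> algebraic_int (A $$ (i, j))"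
  shows "algebraic_int (det A)"
proof -
  have "algebraic_int (signof p * (\<Prod>i = 0..<n. A $$ (i, p i)))" if p: "p permutes {0..<n}" for p
  proof (rule algebraic_int_mult)
    show "algebraic_int (signof p :: 'a)" by (simp add: sign_def)
    show "algebraic_int (\<Prod>i = 0..<n. A $$ (i, p i))"
    proof (rule algebraic_int_prod)
      fix i assume i: "i \<in> {0..<n}"
      have "p i \<in> {0..<n}" using permutes_in_image[OF p, of i] i by simp
      thus "algebraic_int (A $$ (i, p i))" using i by (intro assms(2)) simp_all
    qed
  qed
  thus ?thesis
    unfolding det_def'[OF assms(1)] by (intro algebraic_int_sum) simp
qed

section \<open>Subfields and number fields\<close>

lemma subfieldD:
  assumes "is_subfield F"
  shows "0 \<in> F" "1 \<in> F" "x \<in> F \<Longrightarrow> y \<in> F \<Longrightarrow> x + y \<in> F" "x \<in> F \<Longrightarrow> y \<in> F \<Longrightarrow> x * y \<in> F"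
    "x \<in> F \<Longrightarrow> - x \<in> F" "x \<in> F \<Longrightarrow> inverse x \<in> F"
  using assms unfolding is_subfield_def by blast+

lemma subfield_diff: "is_subfield F \<Longrightarrow> x \<in> F \<Longrightarrow> y \<in> F \<Longrightarrow> x - y \<in> F"
  using subfieldD(3,5)[of F] by fastforce

lemma subfield_divide: "is_subfield F \<Longrightarrow> x \<in> F \<Longrightarrow> y \<in> F \<Longrightarrow> x / y \<in> F"
  using subfieldD(4,6)[of F] by (simp add: divide_inverse)

lemma subfield_sum: "is_subfield F \<Longrightarrow> (\<And>i. i \<in> A \<Longrightarrow> f i \<in> F) \<Longrightarrow> sum f A \<in> F"
  by (induction A rule: infinite_finite_induct) (simp_all add: subfieldD)

lemma subfield_power: "is_subfield F \<Longrightarrow> x \<in> F \<Longrightarrow> x ^ k \<in> F"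
  by (induction k) (simp_all add: subfieldD)

lemma subfield_of_nat: "is_subfield F \<Longrightarrow> of_nat k \<in> F"
  by (induction k) (simp_all add: subfieldD)

lemma subfield_of_int: "is_subfield F \<Longrightarrow> of_int k \<in> F"
  by (cases k rule: int_cases2) (simp_all add: subfieldD subfield_of_nat)

lemma subfield_of_rat:
  assumes "is_subfield F" shows "of_rat q \<in> F"
proof (cases q)
  case (Fract a b)
  thus ?thesis using assms
    by (simp add: of_rat_rat subfield_divide subfield_of_int)
qed

lemma subfield_subspace: "is_subfield F \<Longrightarrow> rat_vs.subspace F"
  unfolding rat_vs.subspace_def by (simp add: subfieldD subfield_of_rat)

lemma subfield_span_subset: "is_subfield F \<Longrightarrow> S \<subseteq> F \<Longrightarrow> rat_vs.span S \<subseteq> F"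
  by (rule rat_vs.span_minimal[OF _ subfield_subspace])

lemma number_fieldD:
  assumes "number_field K"
  shows "is_subfield K"
  using assms by (simp add: number_field_def)

lemma number_field_basis:
  assumes "number_field K"
  obtains B where "finite B" "rat_basis K B" "card B = nf_degree K"
proof -
  obtain B where B: "finite B" "rat_basis K B"
    using assms unfolding number_field_def by blast
  hence i: "rat_vs.independent B" and sp: "rat_vs.span B = K" by (simp_all add: rat_basis_def)
  have "rat_vs.span B = rat_vs.span K"
    by (simp only: sp[symmetric] rat_vs.span_span)
  from rat_vs.dim_eq_card[OF this i] have "card B = nf_degree K" by (simp add: nf_degree_def)
  with B show ?thesis by (rule that)
qed

text \<open>Sequences instead of sets, so that repeated elements count as a dependence.\<close>

lemma rat_dependent_sequence:
  fixes f :: "nat \<Rightarrow> 'a::field_char_0"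
  assumes fin: "finite T" and sp: "\<And>i. i < m \<Longrightarrow> f i \<in> rat_vs.span T" and m: "card T < m"
  shows "\<exists>u. (\<exists>i<m. u i \<noteq> 0) \<and> (\<Sum>i<m. of_rat (u i) * f i) = 0"
proof (cases "inj_on f {..<m}")
  case False
  then obtain i j where ij: "i < m" "j < m" "i \<noteq> j" "f i = f j" by (auto simp: inj_on_def)
  define u :: "nat \<Rightarrow> rat" where "u = (\<lambda>k. if k = i then 1 else if k = j then - 1 else 0)"
  have "(\<Sum>k<m. of_rat (u k) * f k) = (\<Sum>k\<in>{i, j}. of_rat (u k) * f k)"
    using ij by (intro sum.mono_neutral_right) (auto simp: u_def)
  also have "\<dots> = 0" using ij by (simp add: u_def)
  finally show ?thesis using ij by (intro exI[of _ u]) (auto simp: u_def)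
next
  case True
  have "rat_vs.dependent (f ` {..<m})"
  proof (rule ccontr)
    assume "\<not> rat_vs.dependent (f ` {..<m})"
    from rat_vs.independent_span_bound[OF fin this] have "card (f ` {..<m}) \<le> card T"
      using sp by auto
    thus False using m True by (simp add: card_image)
  qed
  then obtain u where u: "\<exists>v\<in>f ` {..<m}. u v \<noteq> 0" "(\<Sum>v\<in>f ` {..<m}. of_rat (u v) * v) = 0"
    using rat_vs.dependent_finite[of "f ` {..<m}"] by auto
  have "(\<Sum>i<m. of_rat (u (f i)) * f i) = 0"
    using u(2) True by (simp add: sum.reindex)
  thus ?thesis using u(1) by (intro exI[of _ "\<lambda>i. u (f i)"]) auto
qed

lemma number_field_algebraic:
  assumes K: "number_field K" and x: "x \<in> K"
  shows "algebraic x"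
proof -
  obtain B where B: "finite B" "rat_basis K B" "card B = nf_degree K"
    using K by (rule number_field_basis)
  have sp: "rat_vs.span B = K" using B(2) by (simp add: rat_basis_def)
  obtain u where u: "\<exists>i<Suc (card B). u i \<noteq> 0" "(\<Sum>i<Suc (card B). of_rat (u i) * x ^ i) = 0"
    using rat_dependent_sequence[OF B(1), of "Suc (card B)" "\<lambda>i. x ^ i"]
      subfield_power[OF number_fieldD[OF K] x] by (auto simp: sp)
  define p :: "'a poly" where "p = (\<Sum>i<Suc (card B). monom (of_rat (u i)) i)"
  have c: "coeff p i = (if i < Suc (card B) then of_rat (u i) else 0)" for i
    unfolding p_def coeff_sum by (simp add: if_distrib[of of_rat])
  show ?thesis unfolding algebraic_altdef
  proof (intro exI conjI)
    show "\<forall>i. coeff p i \<in> \<rat>" by (simp add: c)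
    show "p \<noteq> 0" using u(1) by (auto simp: poly_eq_iff c)
    show "poly p x = 0" using u(2) by (simp add: p_def poly_sum poly_monom)
  qed
qed

section \<open>Field homomorphisms\<close>

lemma field_homD:
  assumes "field_hom K UNIV \<sigma>"
  shows "\<sigma> 1 = 1" "x \<in> K \<Longrightarrow> y \<in> K \<Longrightarrow> \<sigma> (x + y) = \<sigma> x + \<sigma> y"
    "x \<in> K \<Longrightarrow> y \<in> K \<Longrightarrow> \<sigma> (x * y) = \<sigma> x * \<sigma> y"
  using assms by (auto simp: field_hom_def)

lemma field_hom_0: "is_subfield K \<Longrightarrow> field_hom K UNIV \<sigma> \<Longrightarrow> \<sigma> 0 = 0"
  using field_homD(2)[of K \<sigma> 0 0] by (simp add: subfieldD)

lemma field_hom_uminus: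
  "is_subfield K \<Longrightarrow> field_hom K UNIV \<sigma> \<Longrightarrow> x \<in> K \<Longrightarrow> \<sigma> (- x) = - \<sigma> x"
  using field_homD(2)[of K \<sigma> x "- x"] by (simp add: subfieldD field_hom_0 add_eq_0_iff)

lemma field_hom_diff:
  "is_subfield K \<Longrightarrow> field_hom K UNIV \<sigma> \<Longrightarrow> x \<in> K \<Longrightarrow> y \<in> K \<Longrightarrow> \<sigma> (x - y) = \<sigma> x - \<sigma> y"
  using field_homD(2)[of K \<sigma> x "- y"] by (simp add: subfieldD field_hom_uminus)

lemma field_hom_sum:
  assumes "is_subfield K" "field_hom K UNIV \<sigma>" "\<And>i. i \<in> A \<Longrightarrow> f i \<in> K"
  shows "\<sigma> (sum f A) = (\<Sum>i\<in>A. \<sigma> (f i))"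
  using assms(3)
  by (induction A rule: infinite_finite_induct)
     (simp_all add: field_hom_0[OF assms(1,2)] field_homD(2)[OF assms(2)] subfield_sum[OF assms(1)])

lemma field_hom_of_nat: "is_subfield K \<Longrightarrow> field_hom K UNIV \<sigma> \<Longrightarrow> \<sigma> (of_nat k) = of_nat k"
  by (induction k) (simp_all add: field_hom_0 field_homD subfieldD subfield_of_nat)

lemma field_hom_of_int: "is_subfield K \<Longrightarrow> field_hom K UNIV \<sigma> \<Longrightarrow> \<sigma> (of_int k) = of_int k"
  by (cases k rule: int_cases2)
     (simp_all add: field_hom_of_nat field_hom_uminus subfield_of_nat)

lemma field_hom_of_rat:
  assumes K: "is_subfield K" and s: "field_hom K UNIV \<sigma>"
  shows "\<sigma> (of_rat q) = of_rat q"
proof (cases q)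
  case (Fract a b)
  have "of_rat q * of_int b = (of_int a :: 'a)" using Fract by (simp add: of_rat_rat)
  hence "\<sigma> (of_rat q) * \<sigma> (of_int b) = \<sigma> (of_int a)"
    using field_homD(3)[OF s] subfield_of_rat[OF K] subfield_of_int[OF K] by metis
  thus ?thesis using Fract by (simp add: field_hom_of_int[OF K s] of_rat_rat field_simps)
qed

lemma field_hom_eq_0_iff:
  assumes K: "is_subfield K" and s: "field_hom K UNIV \<sigma>" and x: "x \<in> K"
  shows "\<sigma> x = 0 \<longleftrightarrow> x = 0"
proof
  assume 0: "\<sigma> x = 0"
  show "x = 0"
  proof (rule ccontr)
    assume "x \<noteq> 0"
    hence "\<sigma> x * \<sigma> (inverse x) = 1"
      using field_homD(1,3)[OF s] x subfieldD(6)[OF K x] by (metis right_inverse)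
    with 0 show False by simp
  qed
qed (use field_hom_0[OF K s] in simp)

lemma field_hom_inj:
  assumes K: "is_subfield K" and s: "field_hom K UNIV \<sigma>" and x: "x \<in> K" "y \<in> K" "\<sigma> x = \<sigma> y"
  shows "x = y"
  using field_hom_eq_0_iff[OF K s subfield_diff[OF K x(1,2)]] field_hom_diff[OF K s x(1,2)] x(3) by simp

section \<open>Adjoining one element\<close>

definition poly_over :: "'a::field_char_0 set \<Rightarrow> 'a poly \<Rightarrow> bool" where
  "poly_over F p \<longleftrightarrow> (\<forall>i. coeff p i \<in> F)"

lemma poly_over_intros:
  assumes "is_subfield F"
  shows "poly_over F 0" "poly_over F 1"
    "poly_over F p \<Longrightarrow> poly_over F q \<Longrightarrow> poly_over F (p + q)"
    "poly_over F p \<Longrightarrow> poly_over F q \<Longrightarrow> poly_over F (p - q)"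
    "poly_over F p \<Longrightarrow> poly_over F q \<Longrightarrow> poly_over F (p * q)"
    "poly_over F p \<Longrightarrow> poly_over F (- p)"
    "a \<in> F \<Longrightarrow> poly_over F [:a:]" "a \<in> F \<Longrightarrow> poly_over F (monom a k)"
    "a \<in> F \<Longrightarrow> poly_over F p \<Longrightarrow> poly_over F (smult a p)"
    "poly_over F p \<Longrightarrow> poly_over F (pderiv p)"
  unfolding poly_over_def
  by (auto simp: coeff_mult coeff_pCons coeff_pderiv coeff_1 assms subfieldD subfield_diff
      subfield_sum subfield_of_nat split: nat.splits simp del: of_nat_Suc)

lemma poly_over_division:
  assumes F: "is_subfield F" and g: "poly_over F g" "lead_coeff g = 1"
    and p: "poly_over F p"
  shows "\<exists>q r. poly_over F q \<and> poly_over F r \<and> p = q * g + r \<and> (r = 0 \<or> degree r < degree g)"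
  using p
proof (induction "degree p" arbitrary: p rule: less_induct)
  case less
  note I = poly_over_intros[OF F]
  show ?case
  proof (cases "degree p < degree g \<or> p = 0")
    case True
    thus ?thesis using less.prems I(1) by (intro exI[of _ 0] exI[of _ p]) auto
  next
    case False
    define k where "k = degree p - degree g"
    define h where "h = monom (lead_coeff p) k * g"
    have h: "poly_over F h" unfolding h_def
      using less.prems g by (intro I) (auto simp: poly_over_def)
    have g0: "g \<noteq> 0" using g(2) by auto
    have dh: "degree h = degree p"
      using False g0 unfolding h_def k_def
      by (subst degree_mult_eq) (auto simp: degree_monom_eq)
    have lm: "lead_coeff (monom c k) = c" for c :: 'a
      by (cases "c = 0") (simp_all add: degree_monom_eq)
    have lh: "lead_coeff h = lead_coeff p"
      using g(2) unfolding h_def lead_coeff_mult lm by simp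
    show ?thesis
    proof (cases "degree p = 0")
      case True
      hence "p = h" using dh lh by (metis degree_0_id)
      hence "p - h = 0" by simp
      hence "p = monom (lead_coeff p) k * g + 0" by (simp add: h_def)
      moreover have "poly_over F (monom (lead_coeff p) k)"
        using less.prems by (intro I) (auto simp: poly_over_def)
      ultimately show ?thesis using I(1) by blast
    next
      case pos: False
      have "degree (p - h) < degree p"
      proof (rule ccontr)
        assume "\<not> degree (p - h) < degree p"
        moreover have "degree (p - h) \<le> degree p" using dh by (intro degree_diff_le) auto
        ultimately have "degree (p - h) = degree p" by simp
        moreover have "coeff (p - h) (degree p) = 0" using lh dh by simp
        ultimately have "p - h = 0" by (metis leading_coeff_0_iff)
        thus False using pos \<open>degree (p - h) = degree p\<close> by simp
      qed
      from less.hyps[OF this I(4)[OF less.prems h]] obtain q r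
        where qr: "poly_over F q" "poly_over F r" "p - h = q * g + r" "r = 0 \<or> degree r < degree g"
        by blast
      have "p = (q + monom (lead_coeff p) k) * g + r"
        using qr(3) by (simp add: h_def algebra_simps)
      moreover have "poly_over F (q + monom (lead_coeff p) k)"
        using less.prems qr(1) by (intro I) (auto simp: poly_over_def)
      ultimately show ?thesis using qr by blast
    qed
  qed
qed

lemma poly_over_closed:
  assumes "is_subfield K" "F \<subseteq> K" "poly_over F p" "x \<in> K"
  shows "poly p x \<in> K"
  unfolding poly_altdef
proof (rule subfield_sum[OF assms(1)])
  fix i
  have "coeff p i \<in> K" using assms(2,3) by (auto simp: poly_over_def)
  thus "coeff p i * x ^ i \<in> K" using assms(1,4) by (simp add: subfieldD(4) subfield_power)
qed

lemma map_poly_hom: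
  assumes F: "is_subfield F" and s: "field_hom F UNIV \<sigma>" and p: "poly_over F p" and q: "poly_over F q"
  shows "map_poly \<sigma> (p + q) = map_poly \<sigma> p + map_poly \<sigma> q"
    "map_poly \<sigma> (p * q) = map_poly \<sigma> p * map_poly \<sigma> q"
    "map_poly \<sigma> (pderiv p) = pderiv (map_poly \<sigma> p)"
    "map_poly \<sigma> 1 = 1"
proof -
  note 0 = field_hom_0[OF F s]
  note c = coeff_map_poly[of \<sigma>, OF 0]
  have pc: "coeff p i \<in> F" "coeff q i \<in> F" for i using p q by (auto simp: poly_over_def)
  show "map_poly \<sigma> (p + q) = map_poly \<sigma> p + map_poly \<sigma> q"
    by (rule poly_eqI) (simp add: c field_homD(2)[OF s] pc)
  show "map_poly \<sigma> (p * q) = map_poly \<sigma> p * map_poly \<sigma> q"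
    by (rule poly_eqI)
       (simp add: c coeff_mult field_hom_sum[OF F s] field_homD(3)[OF s] pc subfieldD[OF F])
  show "map_poly \<sigma> (pderiv p) = pderiv (map_poly \<sigma> p)"
    by (rule poly_eqI)
       (simp add: c coeff_pderiv field_homD(3)[OF s] pc subfield_of_nat[OF F]
          field_hom_of_nat[OF F s] del: of_nat_Suc)
  show "map_poly \<sigma> 1 = 1"
    by (rule poly_eqI) (simp add: c coeff_1 0 field_homD(1)[OF s])
qed

text \<open>Rings between a field and an algebraic extension are fields: an equation of \<open>y\<close>
  with non-zero constant term exhibits \<open>1 / y\<close> as a polynomial in \<open>y\<close>.\<close>

lemma inverse_in_ring_if_root:
  fixes p :: "'a::field_char_0 poly"
  assumes R: "\<And>u v. u \<in> R \<Longrightarrow> v \<in> R \<Longrightarrow> u + v \<in> R" "\<And>u v. u \<in> R \<Longrightarrow> v \<in> R \<Longrightarrow> u * v \<in> R"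
    "\<And>q. q \<in> \<rat> \<Longrightarrow> q \<in> R"
    and y: "y \<in> R" "y \<noteq> 0"
    and p: "\<forall>i. coeff p i \<in> \<rat>" "p \<noteq> 0" "poly p y = 0"
  shows "inverse y \<in> R"
  using p
proof (induction p)
  case (pCons a p)
  have cp: "coeff p i \<in> \<rat>" for i using pCons.prems(1)[rule_format, of "Suc i"] by simp
  show ?case
  proof (cases "a = 0")
    case True
    thus ?thesis using pCons y(2) cp by auto
  next
    case False
    have a: "a \<in> \<rat>" using pCons.prems(1)[rule_format, of 0] by simp
    have pow: "y ^ i \<in> R" for i by (induction i) (simp_all add: R y)
    have trm: "coeff p i * y ^ i \<in> R" for i by (rule R(2)[OF R(3)[OF cp] pow])
    have "(\<Sum>i\<le>m. coeff p i * y ^ i) \<in> R" for m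
    proof (induction m)
      case 0
      show ?case using trm[of 0] by simp
    next
      case (Suc m)
      show ?case unfolding sum.atMost_Suc by (rule R(1)[OF Suc trm])
    qed
    hence "poly p y \<in> R" unfolding poly_altdef .
    moreover have "inverse y = (- inverse a) * poly p y"
    proof -
      have "a = - (y * poly p y)" using pCons.prems(3) by (simp add: add_eq_0_iff2)
      thus ?thesis using False y(2) by simp
    qed
    moreover have "- inverse a \<in> \<rat>" using a by simp
    ultimately show ?thesis using R(2)[OF R(3)] by (simp only:)
  qed
qed simp

lemma card_roots_if_separable:
  fixes p :: "complex poly"
  assumes "\<And>r. poly p r = 0 \<Longrightarrow> poly (pderiv p) r \<noteq> 0"
  shows "card {r. poly p r = 0} = degree p"
proof (cases "p = 0")
  case True
  with assms show ?thesis by auto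
next
  case False
  have "rsquarefree p" using assms unfolding rsquarefree_roots by blast
  from complex_poly_decompose_rsquarefree[OF this]
  have "degree p = degree (\<Prod>z|poly p z = 0. [:-z, 1:])"
    using False by (metis degree_smult_eq leading_coeff_0_iff)
  also have "\<dots> = card {r. poly p r = 0}"
    by (subst degree_prod_eq_sum_degree) simp_all
  finally show ?thesis by simp
qed

lemma subfield_finite_basis:
  assumes K: "number_field K" and F: "is_subfield F" "F \<subseteq> K"
  obtains B where "finite B" "rat_vs.independent B" "B \<subseteq> F" "F \<subseteq> rat_vs.span B"
    "card B = rat_vs.dim F"
proof -
  obtain T where T: "finite T" "rat_basis K T" "card T = nf_degree K"
    using K by (rule number_field_basis)
  obtain B where B: "B \<subseteq> F" "rat_vs.independent B" "F \<subseteq> rat_vs.span B" "card B = rat_vs.dim F"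
    by (rule rat_vs.basis_exists)
  have "B \<subseteq> rat_vs.span T" using B(1) F(2) T(2) by (auto simp: rat_basis_def)
  from rat_vs.independent_span_bound[OF T(1) B(2) this] have "finite B" by simp
  with B show ?thesis by (intro that)
qed

text \<open>Let \<open>g\<close> be the minimal polynomial of \<open>x\<close> over \<open>F\<close>. An embedding \<open>\<sigma>\<close> of \<open>F\<close> extends to \<open>F(x)\<close> once for every
  root of \<open>\<sigma> g\<close>, by sending \<open>x\<close> to that root. These roots are simple: the extension sends \<open>g'(x)\<close>, which is not 0
  as \<open>g\<close> is minimal, to the derivative of \<open>\<sigma> g\<close> at the root. So adjoining \<open>x\<close> multiplies the number of embeddings by
  \<open>degree g\<close>, and the dimension at most by this number.\<close>

lemma embeddings_adjoin:
  assumes K: "number_field K" and F: "is_subfield F" "F \<subseteq> K" and x: "x \<in> K"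
    and E: "finite E" "E \<subseteq> embeddings F" "rat_vs.dim F \<le> card E"
  shows "\<exists>F'. is_subfield F' \<and> F \<subseteq> F' \<and> x \<in> F' \<and> F' \<subseteq> K \<and>
    (\<exists>E'. finite E' \<and> E' \<subseteq> embeddings F' \<and> rat_vs.dim F' \<le> card E')"
proof -
  have Kf: "is_subfield K" using K by (rule number_fieldD)
  note I = poly_over_intros[OF F(1)]
  define P where "P p \<longleftrightarrow> poly_over F p \<and> p \<noteq> 0 \<and> poly p x = 0" for p
  have RatsF: "q \<in> \<rat> \<Longrightarrow> q \<in> F" for q using subfield_of_rat[OF F(1)] by (auto elim: Rats_cases)
  have "\<exists>p. P p"
    using number_field_algebraic[OF K x] RatsF
    unfolding algebraic_altdef P_def poly_over_def by blast
  then obtain g0 where g0: "P g0" "\<forall>p. P p \<longrightarrow> degree g0 \<le> degree p"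
    using ex_has_least_nat[of P _ degree] by blast
  define g where "g = smult (inverse (lead_coeff g0)) g0"
  have lc0: "lead_coeff g0 \<noteq> 0" using g0(1) by (simp add: P_def)
  have g: "poly_over F g" "lead_coeff g = 1" "poly g x = 0" "degree g = degree g0"
  proof -
    have g0': "poly_over F g0" "poly g0 x = 0" using g0(1) by (simp_all add: P_def)
    hence "inverse (lead_coeff g0) \<in> F" by (simp add: poly_over_def subfieldD(6)[OF F(1)])
    thus "poly_over F g" using g0'(1) unfolding g_def by (rule I(9))
    show "lead_coeff g = 1" "poly g x = 0" "degree g = degree g0"
      using lc0 g0'(2) by (simp_all add: g_def)
  qed
  have gmin: "r = 0" if "poly_over F r" "poly r x = 0" "degree r < degree g" for r
  proof (rule ccontr)
    assume "r \<noteq> 0"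
    hence "P r" using that by (simp add: P_def)
    hence "degree g0 \<le> degree r" using g0(2) by blast
    thus False using that(3) g(4) by simp
  qed
  have g_pos: "degree g > 0"
  proof (rule ccontr)
    assume "\<not> degree g > 0"
    then obtain c where c: "g = [:c:]" by (auto elim: degree_eq_zeroE)
    with g(2,3) show False by simp
  qed
  define F' where "F' = {poly p x | p. poly_over F p}"
  have F'I: "poly_over F p \<Longrightarrow> poly p x \<in> F'" for p by (auto simp: F'_def)
  have FF': "F \<subseteq> F'"
  proof
    fix a assume "a \<in> F"
    from F'I[OF I(7)[OF this]] show "a \<in> F'" by simp
  qed
  have xF': "x \<in> F'" using F'I[OF I(8)[OF subfieldD(2)[OF F(1)], of 1]] by (simp add: poly_monom)
  have F'K: "F' \<subseteq> K" using poly_over_closed[OF Kf F(2) _ x] by (auto simp: F'_def)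
  have add: "u + v \<in> F'" and mul: "u * v \<in> F'" if uv: "u \<in> F'" "v \<in> F'" for u v
  proof -
    obtain p q where "poly_over F p" "poly_over F q" "u = poly p x" "v = poly q x"
      using uv by (auto simp: F'_def)
    thus "u + v \<in> F'" "u * v \<in> F'" using F'I[OF I(3), of p q] F'I[OF I(5), of p q] by simp_all
  qed
  have F': "is_subfield F'"
    unfolding is_subfield_def
  proof (intro conjI ballI)
    show "0 \<in> F'" "1 \<in> F'" using FF' subfieldD[OF F(1)] by auto
    show "u + v \<in> F'" "u * v \<in> F'" if "u \<in> F'" "v \<in> F'" for u v using add mul that by auto
    show "- u \<in> F'" if "u \<in> F'" for u
    proof -
      have "- 1 \<in> F'" using FF' subfieldD(2,5)[OF F(1)] by auto
      from mul[OF this that] show ?thesis by simp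
    qed
    show "inverse u \<in> F'" if u: "u \<in> F'" for u
    proof (cases "u = 0")
      case True
      thus ?thesis using FF' subfieldD[OF F(1)] by auto
    next
      case False
      have "algebraic u" using u F'K by (intro number_field_algebraic[OF K]) auto
      then obtain p where "\<forall>i. coeff p i \<in> \<rat>" "p \<noteq> 0" "poly p u = 0"
        unfolding algebraic_altdef by blast
      thus ?thesis by (intro inverse_in_ring_if_root[of F' u p] add mul u False) (use RatsF FF' in auto)
    qed
  qed
  \<comment> \<open>the extension of \<open>\<sigma>\<close> that sends \<open>x\<close> to \<open>r\<close>; it depends only on the value \<open>y = p(x)\<close>, not on \<open>p\<close>\<close>
  define ext where "ext \<sigma> r = (\<lambda>y. if y \<in> F' then
      poly (map_poly \<sigma> (SOME p. poly_over F p \<and> poly p x = y)) r else undefined)"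
    for \<sigma> :: "'a \<Rightarrow> complex" and r
  have hom: "field_hom F UNIV \<sigma>" if "\<sigma> \<in> E" for \<sigma> using that E(2) by (auto simp: embeddings_def)
  have vanish: "poly (map_poly \<sigma> p) r = 0"
    if s: "\<sigma> \<in> E" and r: "poly (map_poly \<sigma> g) r = 0" and p: "poly_over F p" "poly p x = 0" for \<sigma> r p
  proof -
    obtain q h where qh: "poly_over F q" "poly_over F h" "p = q * g + h" "h = 0 \<or> degree h < degree g"
      using poly_over_division[OF F(1) g(1,2) p(1)] by blast
    have "poly h x = 0" using qh(3) p(2) g(3) by simp
    hence "h = 0" using qh(2,4) gmin by blast
    hence "map_poly \<sigma> p = map_poly \<sigma> q * map_poly \<sigma> g"
      using map_poly_hom(2)[OF F(1) hom[OF s] qh(1) g(1)] qh(3) by simp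
    thus ?thesis using r by simp
  qed
  have ext: "ext \<sigma> r (poly p x) = poly (map_poly \<sigma> p) r"
    if s: "\<sigma> \<in> E" and r: "poly (map_poly \<sigma> g) r = 0" and p: "poly_over F p" for \<sigma> r p
  proof -
    define q where "q = (SOME q. poly_over F q \<and> poly q x = poly p x)"
    have q: "poly_over F q \<and> poly q x = poly p x" unfolding q_def by (rule someI[of _ p]) (simp add: p)
    have "poly (map_poly \<sigma> (q - p)) r = 0" using q p by (intro vanish[OF s r I(4)]) auto
    moreover have "map_poly \<sigma> q = map_poly \<sigma> p + map_poly \<sigma> (q - p)"
      using map_poly_hom(1)[OF F(1) hom[OF s] p I(4), of q p] q p by simp
    ultimately show ?thesis using F'I[OF p] by (simp add: ext_def q_def)
  qed
  have 0: "\<sigma> 0 = 0" if "\<sigma> \<in> E" for \<sigma> using field_hom_0[OF F(1) hom[OF that]] .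
  have ext_emb: "ext \<sigma> r \<in> embeddings F'"
    if s: "\<sigma> \<in> E" and r: "poly (map_poly \<sigma> g) r = 0" for \<sigma> r
    unfolding embeddings_def
  proof (intro CollectI conjI)
    show "ext \<sigma> r \<in> extensional F'" by (auto simp: extensional_def ext_def)
    show "field_hom F' UNIV (ext \<sigma> r)" unfolding field_hom_def
    proof (intro conjI ballI)
      show "ext \<sigma> r 1 = 1"
        using ext[OF s r I(2)] map_poly_hom(4)[OF F(1) hom[OF s] I(1) I(1)] by simp
      fix u v assume "u \<in> F'" "v \<in> F'"
      then obtain p q where pq: "poly_over F p" "poly_over F q" "u = poly p x" "v = poly q x"
        by (auto simp: F'_def)
      show "ext \<sigma> r (u + v) = ext \<sigma> r u + ext \<sigma> r v"
        using ext[OF s r I(3)[OF pq(1,2)]] ext[OF s r pq(1)] ext[OF s r pq(2)]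
          map_poly_hom(1)[OF F(1) hom[OF s] pq(1,2)] pq(3,4) by simp
      show "ext \<sigma> r (u * v) = ext \<sigma> r u * ext \<sigma> r v"
        using ext[OF s r I(5)[OF pq(1,2)]] ext[OF s r pq(1)] ext[OF s r pq(2)]
          map_poly_hom(2)[OF F(1) hom[OF s] pq(1,2)] pq(3,4) by simp
    qed simp
  qed
  have ext_F: "ext \<sigma> r a = \<sigma> a"
    if s: "\<sigma> \<in> E" and r: "poly (map_poly \<sigma> g) r = 0" and a: "a \<in> F" for \<sigma> r a
  proof -
    have "map_poly \<sigma> [:a:] = [:\<sigma> a:]"
      by (rule poly_eqI) (simp add: coeff_map_poly[of \<sigma>, OF 0[OF s]] coeff_pCons 0[OF s] split: nat.split)
    thus ?thesis using ext[OF s r I(7)[OF a]] by simp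
  qed
  have ext_x: "ext \<sigma> r x = r"
    if s: "\<sigma> \<in> E" and r: "poly (map_poly \<sigma> g) r = 0" for \<sigma> r
    using ext[OF s r I(8)[OF subfieldD(2)[OF F(1)], of 1]] 0[OF s] field_homD(1)[OF hom[OF s]]
    by (simp add: poly_monom map_poly_monom)
  have roots: "card {r. poly (map_poly \<sigma> g) r = 0} = degree g" "map_poly \<sigma> g \<noteq> 0" if s: "\<sigma> \<in> E" for \<sigma>
  proof -
    note c = coeff_map_poly[of \<sigma>, OF 0[OF s]]
    have lc: "coeff (map_poly \<sigma> g) (degree g) = 1" using g(2) field_homD(1)[OF hom[OF s]] by (simp add: c)
    have "degree (map_poly \<sigma> g) = degree g"
      using lc by (intro antisym degree_le le_degree) (auto simp: c coeff_eq_0 0[OF s])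
    moreover show "map_poly \<sigma> g \<noteq> 0" using lc by force
    moreover have "card {r. poly (map_poly \<sigma> g) r = 0} = degree (map_poly \<sigma> g)"
    proof (rule card_roots_if_separable)
      fix r assume r: "poly (map_poly \<sigma> g) r = 0"
      have pd: "poly_over F (pderiv g)" by (rule I(10)[OF g(1)])
      have "pderiv g \<noteq> 0" using g_pos by (simp add: pderiv_eq_0_iff)
      moreover have "degree (pderiv g) < degree g" using g_pos by (simp add: degree_pderiv)
      ultimately have "poly (pderiv g) x \<noteq> 0" using gmin[OF pd] by blast
      have "ext \<sigma> r (poly (pderiv g) x) = poly (pderiv (map_poly \<sigma> g)) r"
        using ext[OF s r pd] map_poly_hom(3)[OF F(1) hom[OF s] g(1) g(1)] by simp
      moreover have "ext \<sigma> r (poly (pderiv g) x) \<noteq> 0"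
        using field_hom_eq_0_iff[OF F' _ F'I[OF pd]] ext_emb[OF s r] \<open>poly (pderiv g) x \<noteq> 0\<close>
        by (auto simp: embeddings_def)
      ultimately show "poly (pderiv (map_poly \<sigma> g)) r \<noteq> 0" by simp
    qed
    ultimately show "card {r. poly (map_poly \<sigma> g) r = 0} = degree g" by simp
  qed
  define S where "S = (SIGMA \<sigma>:E. {r. poly (map_poly \<sigma> g) r = 0})"
  define E' where "E' = (\<lambda>(\<sigma>, r). ext \<sigma> r) ` S"
  have finS: "finite S" unfolding S_def
    using E(1) roots(2) by (intro finite_SigmaI) (auto simp: poly_roots_finite)
  have "card S = card E * degree g"
    unfolding S_def using E(1) roots by (subst card_SigmaI) (auto simp: poly_roots_finite)
  moreover have "inj_on (\<lambda>(\<sigma>, r). ext \<sigma> r) S"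
  proof (rule inj_onI, clarify)
    fix \<sigma> r \<sigma>' r' assume S: "(\<sigma>, r) \<in> S" "(\<sigma>', r') \<in> S" and eq: "ext \<sigma> r = ext \<sigma>' r'"
    from S have s: "\<sigma> \<in> E" "\<sigma>' \<in> E" and r: "poly (map_poly \<sigma> g) r = 0" "poly (map_poly \<sigma>' g) r' = 0"
      by (auto simp: S_def)
    have sa: "\<sigma> a = \<sigma>' a" for a
    proof (cases "a \<in> F")
      case True
      have "\<sigma> a = ext \<sigma> r a" using ext_F[OF s(1) r(1) True] by (rule sym)
      also have "\<dots> = \<sigma>' a" unfolding eq by (rule ext_F[OF s(2) r(2) True])
      finally show ?thesis .
    next
      case False
      have "\<sigma> \<in> extensional F" "\<sigma>' \<in> extensional F" using s E(2) by (auto simp: embeddings_def)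
      from this[THEN extensional_arb, OF False] show ?thesis by simp
    qed
    have "\<sigma> = \<sigma>'" by (rule HOL.ext) (rule sa)
    moreover have "r = r'"
      using ext_x[OF s(1) r(1)] ext_x[OF s(2) r(2)] unfolding eq by (rule trans[OF sym])
    ultimately show "\<sigma> = \<sigma>' \<and> r = r'" by (rule conjI)
  qed
  ultimately have cardE': "card E' = card E * degree g" unfolding E'_def by (simp add: card_image)
  obtain B where B: "finite B" "rat_vs.independent B" "B \<subseteq> F" "F \<subseteq> rat_vs.span B" "card B = rat_vs.dim F"
    using K F by (rule subfield_finite_basis)
  define W where "W = (\<lambda>(b, i). b * x ^ i) ` (B \<times> {..<degree g})"
  have "F' \<subseteq> rat_vs.span W"
  proof
    fix y assume "y \<in> F'"
    then obtain p where p: "poly_over F p" "y = poly p x" by (auto simp: F'_def)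
    obtain q h where qh: "poly_over F q" "poly_over F h" "p = q * g + h" "h = 0 \<or> degree h < degree g"
      using poly_over_division[OF F(1) g(1,2) p(1)] by blast
    have "c * x ^ i \<in> rat_vs.span W" if c: "c \<in> rat_vs.span B" and i: "i < degree g" for c i
      using c
    proof (induction rule: rat_vs.span_induct_alt)
      case base
      show ?case by (simp add: rat_vs.span_zero)
    next
      case (step q b d)
      have "b * x ^ i \<in> rat_vs.span W"
        by (rule rat_vs.span_base) (use step(1) i in \<open>auto simp: W_def\<close>)
      from rat_vs.span_add[OF rat_vs.span_scale[OF this, of q] step(2)]
      show ?case by (simp add: algebra_simps)
    qed
    note span = this
    have "y = poly h x" using qh(3) g(3) p(2) by simp
    also have "\<dots> = (\<Sum>i\<le>degree h. coeff h i * x ^ i)" by (rule poly_altdef)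
    also have "\<dots> \<in> rat_vs.span W"
    proof (rule rat_vs.span_sum)
      fix i assume "i \<in> {..degree h}"
      hence "i < degree g" using qh(4) g_pos by auto
      moreover have "coeff h i \<in> rat_vs.span B" using qh(2) B(4) by (auto simp: poly_over_def)
      ultimately show "coeff h i * x ^ i \<in> rat_vs.span W" by (rule span[rotated])
    qed
    finally show "y \<in> rat_vs.span W" .
  qed
  hence "rat_vs.dim F' \<le> card W"
    by (rule rat_vs.dim_le_card) (simp add: W_def B(1))
  also have "\<dots> \<le> card (B \<times> {..<degree g})" unfolding W_def by (rule card_image_le) (simp add: B(1))
  also have "\<dots> = rat_vs.dim F * degree g" using B by simp
  also have "\<dots> \<le> card E'" unfolding cardE' using E(3) by simp
  finally have "rat_vs.dim F' \<le> card E'" .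
  moreover have "finite E'" "E' \<subseteq> embeddings F'"
    using finS ext_emb unfolding E'_def by (auto simp: S_def)
  ultimately show ?thesis using F' FF' xF' F'K by blast
qed

text \<open>Among the subfields with at least as many embeddings as their dimension, take one of largest dimension.
  Adjoining a further element of \<open>K\<close> would produce a larger one, so it is all of \<open>K\<close>.\<close>

lemma ex_embeddings:
  assumes K: "number_field K"
  shows "\<exists>E. finite E \<and> E \<subseteq> embeddings K \<and> nf_degree K \<le> card E"
proof -
  have Kf: "is_subfield K" using K by (rule number_fieldD)
  define G where "G F \<longleftrightarrow> is_subfield F \<and> F \<subseteq> K \<and>
      (\<exists>E. finite E \<and> E \<subseteq> embeddings F \<and> rat_vs.dim F \<le> card E)" for F
  obtain T where T: "finite T" "rat_basis K T" "card T = nf_degree K"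
    using K by (rule number_field_basis)
  have spT: "rat_vs.span T = K" using T(2) by (simp add: rat_basis_def)
  have bound: "rat_vs.dim F \<le> nf_degree K" if "F \<subseteq> K" for F
    using rat_vs.dim_le_card[OF _ T(1), of F] that spT T(3) by simp
  have "G \<rat>"
  proof -
    have sf: "is_subfield (\<rat> :: 'a set)" by (simp add: is_subfield_def)
    define \<sigma> where "\<sigma> = restrict (\<lambda>x. of_rat (inv_into UNIV of_rat x) :: complex) (\<rat> :: 'a set)"
    have [simp]: "\<sigma> (of_rat q) = of_rat q" for q
      by (simp add: \<sigma>_def inv_f_f[OF injI])
    have "\<sigma> \<in> embeddings \<rat>"
      unfolding embeddings_def field_hom_def
    proof (intro CollectI conjI ballI)
      show "\<sigma> \<in> extensional \<rat>" by (simp add: \<sigma>_def)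
      show "\<sigma> 1 = 1" using \<open>\<And>q. \<sigma> (of_rat q) = of_rat q\<close>[of 1] by simp
      fix x y :: 'a assume "x \<in> \<rat>" "y \<in> \<rat>"
      then obtain p q where "x = of_rat p" "y = of_rat q" by (auto elim!: Rats_cases)
      thus "\<sigma> (x + y) = \<sigma> x + \<sigma> y" "\<sigma> (x * y) = \<sigma> x * \<sigma> y"
        by (simp_all only: of_rat_add[symmetric] of_rat_mult[symmetric]
             \<open>\<And>q. \<sigma> (of_rat q) = of_rat q\<close>)
    qed simp
    moreover have "rat_vs.dim (\<rat> :: 'a set) \<le> card {1 :: 'a}"
    proof (rule rat_vs.dim_le_card)
      show "(\<rat> :: 'a set) \<subseteq> rat_vs.span {1}"
      proof
        fix x :: 'a assume "x \<in> \<rat>"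
        then obtain q where "x = of_rat q" by (auto elim: Rats_cases)
        thus "x \<in> rat_vs.span {1}"
          using rat_vs.span_scale[OF rat_vs.span_base[of 1 "{1 :: 'a}"], of q] by simp
      qed
    qed simp
    moreover have "\<rat> \<subseteq> K" using subfield_of_rat[OF Kf] by (auto elim: Rats_cases)
    ultimately show ?thesis unfolding G_def using sf
      by (intro conjI exI[of _ "{\<sigma>}"]) auto
  qed
  then obtain F where F: "G F" "\<And>F'. G F' \<Longrightarrow> rat_vs.dim F' \<le> rat_vs.dim F"
  proof -
    obtain F where "G F" "\<forall>F'. G F' \<longrightarrow> rat_vs.dim F' \<le> rat_vs.dim F"
    proof -
      have "\<forall>F. G F \<longrightarrow> rat_vs.dim F < Suc (nf_degree K)"
        using bound by (simp add: G_def less_Suc_eq_le)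
      from ex_has_greatest_nat[OF \<open>G \<rat>\<close> this] show ?thesis using that by blast
    qed
    thus thesis using that by blast
  qed
  have "F = K"
  proof (rule ccontr)
    assume "F \<noteq> K"
    then obtain x where x: "x \<in> K" "x \<notin> F" using F(1) by (auto simp: G_def)
    obtain E where E: "finite E" "E \<subseteq> embeddings F" "rat_vs.dim F \<le> card E"
      and Fs: "is_subfield F" "F \<subseteq> K" using F(1) by (auto simp: G_def)
    obtain F' where F': "is_subfield F'" "F \<subseteq> F'" "x \<in> F'" "F' \<subseteq> K"
      "\<exists>E'. finite E' \<and> E' \<subseteq> embeddings F' \<and> rat_vs.dim F' \<le> card E'"
      using embeddings_adjoin[OF K Fs x(1) E] by blast
    obtain B where B: "finite B" "rat_vs.independent B" "B \<subseteq> F" "F \<subseteq> rat_vs.span B" "card B = rat_vs.dim F"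
      using K Fs by (rule subfield_finite_basis)
    obtain B' where B': "finite B'" "rat_vs.independent B'" "B' \<subseteq> F'" "F' \<subseteq> rat_vs.span B'"
        "card B' = rat_vs.dim F'"
      using K F'(1,4) by (rule subfield_finite_basis)
    have "x \<notin> rat_vs.span B" using subfield_span_subset[OF Fs(1) B(3)] x(2) by auto
    hence "rat_vs.independent (insert x B)" using B(2) by (rule rat_vs.independent_insertI)
    moreover have "insert x B \<subseteq> rat_vs.span B'" using B(3) B'(4) F'(2,3) by auto
    ultimately have "card (insert x B) \<le> card B'"
      using rat_vs.independent_span_bound[OF B'(1)] by blast
    moreover have "card (insert x B) = Suc (card B)" using B(1,3) x(2) by (intro card_insert_disjoint) auto
    moreover have "rat_vs.dim F' \<le> rat_vs.dim F" using F' by (intro F(2)) (simp add: G_def)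
    ultimately show False using B(5) B'(5) by simp
  qed
  thus ?thesis using F(1) by (auto simp: G_def nf_degree_def)
qed

section \<open>Embeddings and the trace\<close>

lemma ex_bij_betw_lessThan: "finite A \<Longrightarrow> card A = n \<Longrightarrow> \<exists>h. bij_betw h {..<n} A"
  using ex_bij_betw_nat_finite[of A] by (simp add: atLeast0LessThan)

lemma embeddingsD:
  assumes "\<sigma> \<in> embeddings K"
  shows "field_hom K UNIV \<sigma>" "\<sigma> \<in> extensional K"
  using assms by (simp_all add: embeddings_def)

lemma embeddings_eqI:
  assumes "\<sigma> \<in> embeddings K" "\<tau> \<in> embeddings K" "\<And>x. x \<in> K \<Longrightarrow> \<sigma> x = \<tau> x"
  shows "\<sigma> = \<tau>"
  by (rule extensionalityI[OF embeddingsD(2)[OF assms(1)] embeddingsD(2)[OF assms(2)] assms(3)])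

text \<open>Dedekind's argument: multiplying a relation by the value of one homomorphism and subtracting
  removes that homomorphism from the relation.\<close>

lemma embeddings_independent:
  assumes K: "is_subfield K" and "finite E" "E \<subseteq> embeddings K"
    and "\<And>x. x \<in> K \<Longrightarrow> (\<Sum>\<sigma>\<in>E. c \<sigma> * \<sigma> x) = 0" and "\<tau> \<in> E"
  shows "c \<tau> = 0"
  using assms(2-)
proof (induction E arbitrary: c \<tau> rule: finite_induct)
  case (insert \<rho> E)
  note rel = insert.prems(2)
  have \<rho>: "\<rho> \<in> embeddings K" using insert.prems(1) by simp
  have E: "c \<sigma> = 0" if \<sigma>: "\<sigma> \<in> E" for \<sigma>
  proof -
    have \<sigma>K: "\<sigma> \<in> embeddings K" using insert.prems(1) \<sigma> by auto
    have key: "c \<sigma> * (\<sigma> y - \<rho> y) = 0" if y: "y \<in> K" for y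
    proof (rule insert.IH[where c = "\<lambda>\<sigma>. c \<sigma> * (\<sigma> y - \<rho> y)" and \<tau> = \<sigma>])
      show "E \<subseteq> embeddings K" using insert.prems(1) by simp
      show "\<sigma> \<in> E" by (rule \<sigma>)
      fix x assume x: "x \<in> K"
      have 1: "(\<Sum>\<sigma>\<in>insert \<rho> E. c \<sigma> * (\<sigma> y * \<sigma> x)) = 0"
      proof -
        have "(\<Sum>\<sigma>\<in>insert \<rho> E. c \<sigma> * (\<sigma> y * \<sigma> x)) = (\<Sum>\<sigma>\<in>insert \<rho> E. c \<sigma> * \<sigma> (y * x))"
        proof (rule sum.cong[OF refl])
          fix \<sigma> assume "\<sigma> \<in> insert \<rho> E"
          hence "field_hom K UNIV \<sigma>" using insert.prems(1) by (blast dest: embeddingsD(1))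
          from field_homD(3)[OF this y x] show "c \<sigma> * (\<sigma> y * \<sigma> x) = c \<sigma> * \<sigma> (y * x)" by simp
        qed
        also have "\<dots> = 0" by (rule rel[OF subfieldD(4)[OF K y x]])
        finally show ?thesis .
      qed
      have 2: "(\<Sum>\<sigma>\<in>insert \<rho> E. c \<sigma> * (\<rho> y * \<sigma> x)) = 0"
      proof -
        have "(\<Sum>\<sigma>\<in>insert \<rho> E. c \<sigma> * (\<rho> y * \<sigma> x)) = \<rho> y * (\<Sum>\<sigma>\<in>insert \<rho> E. c \<sigma> * \<sigma> x)"
          unfolding sum_distrib_left by (rule sum.cong[OF refl]) (simp add: mult_ac)
        thus ?thesis by (simp only: rel[OF x] mult_zero_right)
      qed
      have "(\<Sum>\<sigma>\<in>E. c \<sigma> * (\<sigma> y - \<rho> y) * \<sigma> x) = (\<Sum>\<sigma>\<in>insert \<rho> E. c \<sigma> * (\<sigma> y - \<rho> y) * \<sigma> x)"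
        using insert.hyps by simp
      also have "\<dots> = (\<Sum>\<sigma>\<in>insert \<rho> E. c \<sigma> * (\<sigma> y * \<sigma> x) - c \<sigma> * (\<rho> y * \<sigma> x))"
        by (rule sum.cong[OF refl]) (simp add: algebra_simps)
      also have "\<dots> = 0" by (simp only: sum_subtractf 1 2 diff_self)
      finally show "(\<Sum>\<sigma>\<in>E. c \<sigma> * (\<sigma> y - \<rho> y) * \<sigma> x) = 0" .
    qed
    have "\<sigma> \<noteq> \<rho>" using \<sigma> insert.hyps by auto
    then obtain y where y: "y \<in> K" "\<sigma> y \<noteq> \<rho> y" using embeddings_eqI[OF \<sigma>K \<rho>] by blast
    show ?thesis using key[OF y(1)] y(2) by simp
  qed
  have "c \<rho> = 0"
    using rel[OF subfieldD(2)[OF K]] insert.hyps E field_homD(1)[OF embeddingsD(1)[OF \<rho>]] by simp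
  thus ?case using insert.prems(3) E by auto
qed simp

lemma embedding_on_basis:
  assumes K: "is_subfield K" and s: "field_hom K UNIV \<sigma>" and e: "\<And>j. j < n \<Longrightarrow> e j \<in> K"
  shows "\<sigma> (\<Sum>j<n. of_rat (q j) * e j) = (\<Sum>j<n. of_rat (q j) * \<sigma> (e j))"
proof -
  have "\<sigma> (\<Sum>j<n. of_rat (q j) * e j) = (\<Sum>j<n. \<sigma> (of_rat (q j) * e j))"
    using e by (intro field_hom_sum[OF K s]) (simp_all add: subfieldD(4)[OF K] subfield_of_rat[OF K])
  also have "\<dots> = (\<Sum>j<n. of_rat (q j) * \<sigma> (e j))"
    using e by (intro sum.cong refl)
      (simp_all add: field_homD(3)[OF s] subfield_of_rat[OF K] field_hom_of_rat[OF K s])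
  finally show ?thesis .
qed

lemma number_field_basis_sequence:
  assumes "number_field K"
  obtains b where "\<And>i. i < nf_degree K \<Longrightarrow> b i \<in> K"
    "\<And>x. x \<in> K \<Longrightarrow> \<exists>q. x = (\<Sum>j<nf_degree K. of_rat (q j) * b j)"
    "inj_on b {..<nf_degree K}" "rat_basis K (b ` {..<nf_degree K})"
proof -
  obtain B where B: "finite B" "rat_basis K B" "card B = nf_degree K"
    using assms by (rule number_field_basis)
  obtain b where b: "bij_betw b {..<nf_degree K} B"
    using ex_bij_betw_lessThan[OF B(1,3)] by blast
  have sp: "rat_vs.span B = K" using B(2) by (simp add: rat_basis_def)
  show ?thesis
  proof (rule that[of b])
    show "b i \<in> K" if "i < nf_degree K" for i
      using that b rat_vs.span_base[of "b i" B] sp by (auto simp: bij_betw_def)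
    show "inj_on b {..<nf_degree K}" "rat_basis K (b ` {..<nf_degree K})"
      using b B(2) by (simp_all add: bij_betw_def)
    show "\<exists>q. x = (\<Sum>j<nf_degree K. of_rat (q j) * b j)" if "x \<in> K" for x
    proof -
      have "x \<in> rat_vs.span B" using that sp by simp
      then obtain u where "x = (\<Sum>v\<in>B. of_rat (u v) * v)"
        using rat_vs.span_finite[OF B(1)] by auto
      also have "\<dots> = (\<Sum>j<nf_degree K. of_rat (u (b j)) * b j)"
        by (rule sum.reindex_bij_betw[OF b, symmetric])
      finally show ?thesis by (intro exI[of _ "\<lambda>j. u (b j)"])
    qed
  qed
qed

text \<open>Adjoining elements one after the other provides as many embeddings as the degree. There are no more, because
  embeddings are linearly independent and each is given by its values on a basis.\<close>

lemma card_embeddings: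
  assumes K: "number_field K"
  shows "finite (embeddings K)" "card (embeddings K) = nf_degree K"
proof -
  have Kf: "is_subfield K" using K by (rule number_fieldD)
  define n where "n = nf_degree K"
  obtain b where b: "\<And>i. i < n \<Longrightarrow> b i \<in> K"
    "\<And>x. x \<in> K \<Longrightarrow> \<exists>q. x = (\<Sum>j<n. of_rat (q j) * b j)"
    using number_field_basis_sequence[OF K] unfolding n_def by metis
  have le: "card E \<le> n" if E: "finite E" "E \<subseteq> embeddings K" for E
  proof (rule ccontr)
    assume "\<not> card E \<le> n"
    then obtain E' where E': "E' \<subseteq> E" "card E' = Suc n"
      by (meson not_less_eq_eq obtain_subset_with_card_n)
    have finE': "finite E'" using E' E(1) finite_subset by blast
    obtain s where s: "bij_betw s {..<Suc n} E'"
      using ex_bij_betw_lessThan[OF finE' E'(2)] by blast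
    \<comment> \<open>A zero row completes the values on the basis to a square matrix of determinant 0, and a vector in
      its kernel is a linear relation between the homomorphisms.\<close>
    define A where "A = mat (Suc n) (Suc n) (\<lambda>(i, j). if i < n then s j (b i) else 0)"
    have A: "A \<in> carrier_mat (Suc n) (Suc n)" by (simp add: A_def)
    have "det A = (\<Sum>j<Suc n. A $$ (n, j) * cofactor A n j)"
      by (rule laplace_expansion_row[OF A]) simp
    also have "\<dots> = 0" by (rule sum.neutral) (simp add: A_def)
    finally have "det A = 0" .
    then obtain v where v: "v \<in> carrier_vec (Suc n)" "v \<noteq> 0\<^sub>v (Suc n)" "A *\<^sub>v v = 0\<^sub>v (Suc n)"
      using det_0_iff_vec_prod_zero_field[OF A] by blast
    have row: "(\<Sum>j<Suc n. v $ j * s j (b i)) = 0" if i: "i < n" for i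
    proof -
      have "(A *\<^sub>v v) $ i = 0" unfolding v(3) using i by simp
      moreover have "(A *\<^sub>v v) $ i = (\<Sum>j<Suc n. s j (b i) * v $ j)"
        using i v(1) unfolding A_def by (simp add: scalar_prod_def atLeast0LessThan)
      ultimately show ?thesis by (simp only: mult.commute)
    qed
    define c where "c \<sigma> = v $ (the_inv_into {..<Suc n} s \<sigma>)" for \<sigma>
    have cs: "c (s j) = v $ j" if "j < Suc n" for j
      using s that by (simp add: c_def the_inv_into_f_f bij_betw_def)
    have sE: "s j \<in> embeddings K" if "j < Suc n" for j
      using s that E' E(2) by (auto simp: bij_betw_def)
    have "(\<Sum>\<sigma>\<in>E'. c \<sigma> * \<sigma> x) = 0" if x: "x \<in> K" for x
    proof -
      obtain q where q: "x = (\<Sum>j<n. of_rat (q j) * b j)" using b(2)[OF x] by blast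
      have "(\<Sum>\<sigma>\<in>E'. c \<sigma> * \<sigma> x) = (\<Sum>j<Suc n. c (s j) * s j x)"
        by (rule sum.reindex_bij_betw[OF s, symmetric])
      also have "\<dots> = (\<Sum>j<Suc n. \<Sum>i<n. of_rat (q i) * (v $ j * s j (b i)))"
      proof (rule sum.cong[OF refl])
        fix j assume "j \<in> {..<Suc n}"
        hence j: "j < Suc n" by simp
        have "s j x = (\<Sum>i<n. of_rat (q i) * s j (b i))"
          unfolding q by (rule embedding_on_basis[OF Kf embeddingsD(1)[OF sE[OF j]] b(1)])
        thus "c (s j) * s j x = (\<Sum>i<n. of_rat (q i) * (v $ j * s j (b i)))"
          by (simp add: cs[OF j] sum_distrib_left mult_ac)
      qed
      also have "\<dots> = (\<Sum>i<n. of_rat (q i) * (\<Sum>j<Suc n. v $ j * s j (b i)))"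
        by (subst sum.swap) (simp only: sum_distrib_left)
      also have "\<dots> = 0" by (intro sum.neutral ballI) (subst row, simp_all)
      finally show ?thesis .
    qed
    from embeddings_independent[OF Kf finE' _ this] have "c \<sigma> = 0" if "\<sigma> \<in> E'" for \<sigma>
      using E' E(2) that by blast
    hence "v $ j = 0" if "j < Suc n" for j
      using cs[OF that] s that by (auto simp: bij_betw_def)
    hence "v = 0\<^sub>v (Suc n)" using v(1) by (intro eq_vecI) auto
    thus False using v(2) by simp
  qed
  show fin: "finite (embeddings K)"
  proof (rule ccontr)
    assume "infinite (embeddings K)"
    then obtain E where "E \<subseteq> embeddings K" "finite E" "card E = Suc n"
      using infinite_arbitrarily_large by blast
    with le[of E] show False by simp
  qed
  obtain E where "E \<subseteq> embeddings K" "n \<le> card E" using ex_embeddings[OF K] n_def by blast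
  hence "n \<le> card (embeddings K)" using card_mono[OF fin] by (meson le_trans)
  thus "card (embeddings K) = nf_degree K" using le[OF fin] n_def by simp
qed

text \<open>The embeddings are numbered so that they can index the rows of matrices.\<close>

definition emb :: "'a::field_char_0 set \<Rightarrow> nat \<Rightarrow> 'a \<Rightarrow> complex" where
  "emb K = (SOME s. bij_betw s {..<nf_degree K} (embeddings K))"

lemma emb_bij: "number_field K \<Longrightarrow> bij_betw (emb K) {..<nf_degree K} (embeddings K)"
  unfolding emb_def
  by (rule someI_ex[OF ex_bij_betw_lessThan[OF card_embeddings(1) card_embeddings(2)]])

lemma emb_in: "number_field K \<Longrightarrow> i < nf_degree K \<Longrightarrow> emb K i \<in> embeddings K"
  using emb_bij[of K] by (auto simp: bij_betw_def)

lemma emb_hom: "number_field K \<Longrightarrow> i < nf_degree K \<Longrightarrow> field_hom K UNIV (emb K i)"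
  by (rule embeddingsD(1)[OF emb_in])

definition conj_mat :: "'a::field_char_0 set \<Rightarrow> (nat \<Rightarrow> 'a) \<Rightarrow> complex mat" where
  "conj_mat K e = mat (nf_degree K) (nf_degree K) (\<lambda>(i, j). emb K i (e j))"

lemma conj_mat_carrier [simp]: "conj_mat K e \<in> carrier_mat (nf_degree K) (nf_degree K)"
  by (simp add: conj_mat_def)

lemma conj_mat_dim [simp]: "dim_row (conj_mat K e) = nf_degree K" "dim_col (conj_mat K e) = nf_degree K"
  by (simp_all add: conj_mat_def)

lemma conj_mat_index [simp]:
  "i < nf_degree K \<Longrightarrow> j < nf_degree K \<Longrightarrow> conj_mat K e $$ (i, j) = emb K i (e j)"
  by (simp add: conj_mat_def)

text \<open>A relation between the rows would be a linear relation between the embeddings.\<close>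

lemma det_conj_mat_nonzero:
  assumes K: "number_field K" and n: "n = nf_degree K"
    and e: "\<And>j. j < n \<Longrightarrow> e j \<in> K" "\<And>x. x \<in> K \<Longrightarrow> \<exists>q. x = (\<Sum>j<n. of_rat (q j) * e j)"
  shows "det (conj_mat K e) \<noteq> 0"
proof
  have Kf: "is_subfield K" using K by (rule number_fieldD)
  define A where "A = transpose_mat (conj_mat K e)"
  have A: "A \<in> carrier_mat n n" by (simp add: A_def n)
  assume "det (conj_mat K e) = 0"
  hence "det A = 0" unfolding A_def by (subst det_transpose[where n = n]) (simp_all add: n)
  then obtain v where v: "v \<in> carrier_vec n" "v \<noteq> 0\<^sub>v n" "A *\<^sub>v v = 0\<^sub>v n"
    using det_0_iff_vec_prod_zero_field[OF A] by blast
  have row: "(\<Sum>j<n. v $ j * emb K j (e i)) = 0" if i: "i < n" for i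
  proof -
    have "(A *\<^sub>v v) $ i = 0" unfolding v(3) using i by simp
    moreover have "(A *\<^sub>v v) $ i = (\<Sum>j<n. emb K j (e i) * v $ j)"
      using i v(1) unfolding A_def by (simp add: scalar_prod_def atLeast0LessThan n)
    ultimately show ?thesis by (simp only: mult.commute)
  qed
  define c where "c \<sigma> = v $ (the_inv_into {..<n} (emb K) \<sigma>)" for \<sigma>
  have bij: "bij_betw (emb K) {..<n} (embeddings K)" using emb_bij[OF K] n by simp
  have cs: "c (emb K j) = v $ j" if "j < n" for j
    using bij that by (simp add: c_def the_inv_into_f_f bij_betw_def)
  have "(\<Sum>\<sigma>\<in>embeddings K. c \<sigma> * \<sigma> x) = 0" if x: "x \<in> K" for x
  proof -
    obtain q where q: "x = (\<Sum>j<n. of_rat (q j) * e j)" using e(2)[OF x] by blast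
    have "(\<Sum>\<sigma>\<in>embeddings K. c \<sigma> * \<sigma> x) = (\<Sum>j<n. c (emb K j) * emb K j x)"
      by (rule sum.reindex_bij_betw[OF bij, symmetric])
    also have "\<dots> = (\<Sum>j<n. \<Sum>i<n. of_rat (q i) * (v $ j * emb K j (e i)))"
    proof (rule sum.cong[OF refl])
      fix j assume "j \<in> {..<n}"
      hence j: "j < n" by simp
      have "emb K j x = (\<Sum>i<n. of_rat (q i) * emb K j (e i))"
        unfolding q using j n by (intro embedding_on_basis[OF Kf emb_hom[OF K] e(1)]) simp_all
      thus "c (emb K j) * emb K j x = (\<Sum>i<n. of_rat (q i) * (v $ j * emb K j (e i)))"
        by (simp add: cs[OF j] sum_distrib_left mult_ac)
    qed
    also have "\<dots> = (\<Sum>i<n. of_rat (q i) * (\<Sum>j<n. v $ j * emb K j (e i)))"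
      by (subst sum.swap) (simp only: sum_distrib_left)
    also have "\<dots> = 0" by (rule sum.neutral) (simp add: row)
    finally show ?thesis .
  qed
  from embeddings_independent[OF Kf card_embeddings(1)[OF K] subset_refl this]
  have "c \<sigma> = 0" if "\<sigma> \<in> embeddings K" for \<sigma> using that by blast
  hence "v $ j = 0" if "j < n" for j
    using cs[OF that] emb_in[OF K] that n by metis
  hence "v = 0\<^sub>v n" using v(1) by (intro eq_vecI) auto
  thus False using v(2) by simp
qed

lemma mat_inverse_if_det_nonzero:
  fixes A :: "'a::field mat"
  assumes A: "A \<in> carrier_mat n n" and d: "det A \<noteq> 0"
  obtains B where "B \<in> carrier_mat n n" "A * B = 1\<^sub>m n" "B * A = 1\<^sub>m n"
proof (rule that[of "inverse (det A) \<cdot>\<^sub>m adj_mat A"])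
  show "inverse (det A) \<cdot>\<^sub>m adj_mat A \<in> carrier_mat n n" using adj_mat(1)[OF A] by simp
  show "A * (inverse (det A) \<cdot>\<^sub>m adj_mat A) = 1\<^sub>m n"
    using adj_mat[OF A] A d by (subst mult_smult_distrib[of _ n n _ n]) (auto intro!: eq_matI)
  show "inverse (det A) \<cdot>\<^sub>m adj_mat A * A = 1\<^sub>m n"
    using adj_mat[OF A] A d by (subst mult_smult_assoc_mat[of _ n n _ n]) (auto intro!: eq_matI)
qed

text \<open>The matrix of conjugates diagonalises all multiplications at once, and the trace is invariant
  under similarity.\<close>

theorem of_rat_field_trace:
  assumes K: "number_field K" and x: "x \<in> K"
  shows "of_rat (field_trace K x) = (\<Sum>i<nf_degree K. emb K i x)"
proof -
  have Kf: "is_subfield K" using K by (rule number_fieldD)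
  define B where "B = (SOME B. rat_basis K B)"
  define n where "n = nf_degree K"
  obtain B0 where B0: "finite B0" "rat_basis K B0" "card B0 = nf_degree K"
    using K by (rule number_field_basis)
  have B: "rat_basis K B" unfolding B_def by (rule someI[of _ B0]) (rule B0(2))
  hence ind: "rat_vs.independent B" and sp: "rat_vs.span B = K" by (simp_all add: rat_basis_def)
  have "B \<subseteq> rat_vs.span B0"
    using rat_vs.span_superset[of B] sp B0(2) by (simp add: rat_basis_def)
  from rat_vs.independent_span_bound[OF B0(1) ind this] have fin: "finite B" by simp
  have "rat_vs.span B = rat_vs.span K" by (simp only: sp[symmetric] rat_vs.span_span)
  from rat_vs.dim_eq_card[OF this ind] have cardB: "card B = n" by (simp add: nf_degree_def n_def)
  obtain b where b: "bij_betw b {..<n} B"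
    using ex_bij_betw_lessThan[OF fin cardB] by blast
  have bK: "b j \<in> K" if "j < n" for j
    using that b rat_vs.span_base[of "b j" B] sp by (auto simp: bij_betw_def)
  define m where "m k j = rat_vs.representation B (x * b j) (b k)" for k j
  have m: "x * b j = (\<Sum>k<n. of_rat (m k j) * b k)" if j: "j < n" for j
  proof -
    have "x * b j \<in> rat_vs.span B" using bK[OF j] x sp subfieldD(4)[OF Kf] by simp
    from rat_vs.sum_representation_eq[OF ind this fin subset_refl]
    have "x * b j = (\<Sum>v\<in>B. of_rat (rat_vs.representation B (x * b j) v) * v)" by simp
    also have "\<dots> = (\<Sum>k<n. of_rat (m k j) * b k)"
      unfolding m_def by (rule sum.reindex_bij_betw[OF b, symmetric])
    finally show ?thesis .
  qed
  have spans: "\<exists>q. y = (\<Sum>j<n. of_rat (q j) * b j)" if "y \<in> K" for y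
  proof -
    have "y \<in> rat_vs.span B" using that sp by simp
    then obtain u where "y = (\<Sum>v\<in>B. of_rat (u v) * v)" using rat_vs.span_finite[OF fin] by auto
    also have "\<dots> = (\<Sum>j<n. of_rat (u (b j)) * b j)"
      by (rule sum.reindex_bij_betw[OF b, symmetric])
    finally show ?thesis by (intro exI[of _ "\<lambda>j. u (b j)"])
  qed
  define V where "V = conj_mat K b"
  have V: "V \<in> carrier_mat n n" by (simp add: V_def n_def)
  have "det V \<noteq> 0" unfolding V_def by (rule det_conj_mat_nonzero[OF K n_def bK spans])
  then obtain W where W: "W \<in> carrier_mat n n" "V * W = 1\<^sub>m n" "W * V = 1\<^sub>m n"
    using mat_inverse_if_det_nonzero[OF V] by blast
  have WV: "(\<Sum>i<n. W $$ (k, i) * emb K i (b j)) = (if k = j then 1 else 0)" if "k < n" "j < n" for k j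
  proof -
    have "(W * V) $$ (k, j) = (\<Sum>i<n. W $$ (k, i) * emb K i (b j))"
      using that W(1) V by (simp add: scalar_prod_def atLeast0LessThan V_def n_def)
    thus ?thesis using that unfolding W(3) by simp
  qed
  have VW: "(\<Sum>k<n. emb K i (b k) * W $$ (k, j)) = (if i = j then 1 else 0)" if "i < n" "j < n" for i j
  proof -
    have "(V * W) $$ (i, j) = (\<Sum>k<n. emb K i (b k) * W $$ (k, j))"
      using that W(1) V by (simp add: scalar_prod_def atLeast0LessThan V_def n_def)
    thus ?thesis using that unfolding W(2) by simp
  qed
  have diag: "emb K i x * emb K i (b j) = (\<Sum>k<n. of_rat (m k j) * emb K i (b k))"
    if ij: "i < n" "j < n" for i j
  proof -
    have h: "field_hom K UNIV (emb K i)" using emb_hom[OF K] ij n_def by simp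
    have "emb K i x * emb K i (b j) = emb K i (x * b j)"
      using field_homD(3)[OF h x bK[OF ij(2)]] by simp
    also have "\<dots> = (\<Sum>k<n. of_rat (m k j) * emb K i (b k))"
      unfolding m[OF ij(2)] by (rule embedding_on_basis[OF Kf h bK])
    finally show ?thesis .
  qed
  have mjj: "of_rat (m j j) = (\<Sum>i<n. W $$ (j, i) * (emb K i x * emb K i (b j)))" if j: "j < n" for j
  proof -
    have "(\<Sum>i<n. W $$ (j, i) * (emb K i x * emb K i (b j))) =
        (\<Sum>i<n. \<Sum>k<n. of_rat (m k j) * (W $$ (j, i) * emb K i (b k)))"
      using j by (intro sum.cong refl) (simp add: diag sum_distrib_left mult_ac)
    also have "\<dots> = (\<Sum>k<n. of_rat (m k j) * (\<Sum>i<n. W $$ (j, i) * emb K i (b k)))"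
      by (subst sum.swap) (simp only: sum_distrib_left)
    also have "\<dots> = (\<Sum>k<n. if k = j then of_rat (m j j) else 0)"
      using j by (intro sum.cong refl) (simp add: WV)
    also have "\<dots> = of_rat (m j j)" using j by simp
    finally show ?thesis by (rule sym)
  qed
  have "field_trace K x = (\<Sum>v\<in>B. rat_vs.representation B (x * v) v)"
    unfolding field_trace_def B_def[symmetric] Let_def ..
  also have "\<dots> = (\<Sum>j<n. m j j)"
    unfolding m_def by (rule sum.reindex_bij_betw[OF b, symmetric])
  finally have "of_rat (field_trace K x) = (\<Sum>j<n. of_rat (m j j) :: complex)"
    by (simp add: of_rat_sum)
  also have "\<dots> = (\<Sum>j<n. \<Sum>i<n. emb K i x * (emb K i (b j) * W $$ (j, i)))"
    by (intro sum.cong refl) (simp add: mjj mult_ac)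
  also have "\<dots> = (\<Sum>i<n. emb K i x * (\<Sum>j<n. emb K i (b j) * W $$ (j, i)))"
    by (subst sum.swap) (simp only: sum_distrib_left)
  also have "\<dots> = (\<Sum>i<n. emb K i x)" by (intro sum.cong refl) (simp add: VW)
  finally show ?thesis by (simp add: n_def)
qed

section \<open>The ring of integers and integral traces\<close>

lemma roiD: "x \<in> ring_of_integers K \<Longrightarrow> x \<in> K" "x \<in> ring_of_integers K \<Longrightarrow> algebraic_int x"
  by (simp_all add: ring_of_integers_def)

lemma roi_closed:
  assumes "is_subfield K"
  shows "of_int k \<in> ring_of_integers K"
    "x \<in> ring_of_integers K \<Longrightarrow> y \<in> ring_of_integers K \<Longrightarrow> x + y \<in> ring_of_integers K"
    "x \<in> ring_of_integers K \<Longrightarrow> y \<in> ring_of_integers K \<Longrightarrow> x - y \<in> ring_of_integers K"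
    "x \<in> ring_of_integers K \<Longrightarrow> y \<in> ring_of_integers K \<Longrightarrow> x * y \<in> ring_of_integers K"
    "x \<in> ring_of_integers K \<Longrightarrow> - x \<in> ring_of_integers K"
  using assms unfolding ring_of_integers_def
  by (auto intro: subfieldD subfield_diff subfield_of_int algebraic_int_add algebraic_int_diff
      algebraic_int_mult)

lemma roi_sum:
  assumes "is_subfield K" "\<And>i. i \<in> A \<Longrightarrow> f i \<in> ring_of_integers K"
  shows "sum f A \<in> ring_of_integers K"
  using assms(2) roi_closed(1)[OF assms(1), of 0]
  by (induction A rule: infinite_finite_induct) (simp_all add: roi_closed(2)[OF assms(1)])

lemma roi_1: "is_subfield K \<Longrightarrow> 1 \<in> ring_of_integers K"
  using roi_closed(1)[of K 1] by simp

lemma algebraic_int_hom: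
  assumes K: "is_subfield K" and s: "field_hom K UNIV \<sigma>" and x: "x \<in> ring_of_integers K"
  shows "algebraic_int (\<sigma> x)"
proof -
  obtain p where p: "poly (map_poly of_int p) x = 0" "lead_coeff p = 1"
    using roiD(2)[OF x] algebraic_int_altdef_ipoly by blast
  have xK: "x \<in> K" using x by (rule roiD(1))
  have pow: "\<sigma> (x ^ i) = \<sigma> x ^ i" for i
    by (induction i) (simp_all add: field_homD[OF s] xK subfield_power[OF K])
  have deg: "degree (map_poly of_int p :: 'b::field_char_0 poly) = degree p"
    by (intro degree_map_poly) auto
  have "0 = \<sigma> (\<Sum>i\<le>degree p. of_int (coeff p i) * x ^ i)"
    using p(1) field_hom_0[OF K s] unfolding poly_altdef by (simp add: coeff_map_poly deg)
  also have "\<dots> = (\<Sum>i\<le>degree p. \<sigma> (of_int (coeff p i) * x ^ i))"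
    by (intro field_hom_sum[OF K s] subfieldD(4)[OF K] subfield_of_int[OF K] subfield_power[OF K] xK)
  also have "\<dots> = (\<Sum>i\<le>degree p. of_int (coeff p i) * \<sigma> x ^ i)"
    by (simp add: field_homD(3)[OF s] subfield_of_int[OF K] subfield_power[OF K] xK pow
        field_hom_of_int[OF K s])
  also have "\<dots> = poly (map_poly of_int p) (\<sigma> x)"
    unfolding poly_altdef by (simp add: coeff_map_poly deg)
  finally show ?thesis using p(2) algebraic_int_altdef_ipoly by metis
qed

text \<open>With \<open>a\<close> the leading coefficient of an integral equation of degree \<open>m\<close> for \<open>x\<close>, multiplying it by \<open>a ^ (m - 1)\<close>
  gives a monic equation for \<open>a x\<close>.\<close>

lemma integral_multiple:
  assumes K: "number_field K" and x: "x \<in> K"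
  obtains N :: int where "N > 0" "of_int N * x \<in> ring_of_integers K"
proof -
  have Kf: "is_subfield K" using K by (rule number_fieldD)
  obtain p where p: "\<forall>i. coeff p i \<in> \<int>" "p \<noteq> 0" "poly p x = 0"
    using number_field_algebraic[OF K x] unfolding algebraic_def by blast
  from p(1) have "\<forall>i. \<exists>k::int. coeff p i = of_int k" by (auto elim: Ints_cases)
  then obtain c :: "nat \<Rightarrow> int" where c: "coeff p i = of_int (c i)" for i by metis
  define m where "m = degree p"
  define a where "a = c m"
  have a: "a \<noteq> 0" using p(2) c[of m] by (auto simp: a_def m_def)
  have "m > 0"
  proof (rule ccontr)
    assume "\<not> m > 0"
    then obtain d where "p = [:d:]" unfolding m_def by (auto elim: degree_eq_zeroE)
    with p(2,3) show False by simp
  qed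
  define y where "y = of_int a * x"
  define W where "W = (\<lambda>i. y ^ i) ` {..<m}"
  have trm: "of_int (a ^ (m - 1)) * (of_int (c i) * x ^ i) = of_int (c i * a ^ (m - 1 - i)) * y ^ i"
    if "i < m" for i
  proof -
    have "m - 1 = (m - 1 - i) + i" using that by simp
    hence "a ^ (m - 1) = a ^ (m - 1 - i) * a ^ i" by (metis power_add)
    thus ?thesis by (simp add: y_def power_mult_distrib)
  qed
  have top: "of_int (a ^ (m - 1)) * (of_int (c m) * x ^ m) = y ^ m"
  proof -
    have "a ^ m = a ^ (m - 1) * a" using \<open>m > 0\<close> by (cases m) simp_all
    hence "(of_int a :: 'a) ^ m = of_int (a ^ (m - 1)) * of_int a" by (metis of_int_mult of_int_power)
    thus ?thesis by (simp add: y_def power_mult_distrib a_def)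
  qed
  have "0 = of_int (a ^ (m - 1)) * poly p x" using p(3) by simp
  also have "\<dots> = (\<Sum>i\<le>m. of_int (a ^ (m - 1)) * (of_int (c i) * x ^ i))"
    unfolding poly_altdef sum_distrib_left m_def by (simp add: c)
  also have "\<dots> = (\<Sum>i<m. of_int (a ^ (m - 1)) * (of_int (c i) * x ^ i)) + y ^ m"
    unfolding lessThan_Suc_atMost[symmetric] sum.lessThan_Suc top ..
  also have "(\<Sum>i<m. of_int (a ^ (m - 1)) * (of_int (c i) * x ^ i)) =
      (\<Sum>i<m. of_int (c i * a ^ (m - 1 - i)) * y ^ i)"
    by (intro sum.cong refl trm) simp
  finally have "y ^ m = - (\<Sum>i<m. of_int (c i * a ^ (m - 1 - i)) * y ^ i)"
    by (simp only: eq_neg_iff_add_eq_0 add.commute)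
  also have "\<dots> = (\<Sum>i<m. of_int (- (c i * a ^ (m - 1 - i))) * y ^ i)"
    by (simp add: sum_negf)
  also have "\<dots> \<in> int_mod.span W"
    by (intro int_mod.span_sum int_mod.span_scale int_mod.span_base) (auto simp: W_def)
  finally have ym: "y ^ m \<in> int_mod.span W" .
  have "algebraic_int y"
  proof (rule algebraic_int_if_stable_span[of W 1])
    show "finite W" by (simp add: W_def)
    show "1 \<in> W" using \<open>m > 0\<close> by (auto simp: W_def intro!: image_eqI[of _ _ 0])
    fix v assume "v \<in> W"
    then obtain i where i: "i < m" "v = y ^ i" by (auto simp: W_def)
    show "y * v \<in> int_mod.span W"
    proof (cases "Suc i = m")
      case True
      hence "y * v = y ^ m" using i by auto
      thus ?thesis using ym by simp
    next
      case False
      have "y ^ Suc i \<in> W" using False i unfolding W_def by (intro imageI) simp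
      thus ?thesis using i by (simp add: int_mod.span_base)
    qed
  qed simp
  hence y: "y \<in> ring_of_integers K"
    using x Kf by (simp add: ring_of_integers_def y_def subfieldD subfield_of_int)
  show ?thesis
  proof (cases "a > 0")
    case True
    thus ?thesis using y that[of a] by (simp add: y_def)
  next
    case False
    thus ?thesis using a roi_closed(5)[OF Kf y] that[of "- a"] by (simp add: y_def)
  qed
qed

lemma field_trace_add:
  assumes K: "number_field K" and xy: "x \<in> K" "y \<in> K"
  shows "field_trace K (x + y) = field_trace K x + field_trace K y"
proof -
  have Kf: "is_subfield K" using K by (rule number_fieldD)
  have "(of_rat (field_trace K (x + y)) :: complex) = of_rat (field_trace K x + field_trace K y)"
    using xy by (simp add: of_rat_field_trace[OF K] subfieldD[OF Kf] of_rat_add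
        field_homD(2)[OF emb_hom[OF K]] sum.distrib)
  thus ?thesis by simp
qed

lemma field_trace_scale:
  assumes K: "number_field K" and x: "x \<in> K"
  shows "field_trace K (of_rat q * x) = q * field_trace K x"
proof -
  have Kf: "is_subfield K" using K by (rule number_fieldD)
  have "(of_rat (field_trace K (of_rat q * x)) :: complex) = of_rat (q * field_trace K x)"
    using x by (simp add: of_rat_field_trace[OF K] subfieldD[OF Kf] subfield_of_rat[OF Kf] of_rat_mult
        field_homD(3)[OF emb_hom[OF K]] field_hom_of_rat[OF Kf emb_hom[OF K]] sum_distrib_left)
  thus ?thesis by simp
qed

lemma field_trace_of_rat:
  assumes K: "number_field K"
  shows "field_trace K (of_rat q) = of_nat (nf_degree K) * q"
proof -
  have Kf: "is_subfield K" using K by (rule number_fieldD)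
  have "(of_rat (field_trace K (of_rat q)) :: complex) = of_rat (of_nat (nf_degree K) * q)"
    by (simp add: of_rat_field_trace[OF K] subfield_of_rat[OF Kf] of_rat_mult
        field_hom_of_rat[OF Kf emb_hom[OF K]])
  thus ?thesis by (simp only: of_rat_eq_iff)
qed

lemma field_trace_diff:
  assumes K: "number_field K" and xy: "x \<in> K" "y \<in> K"
  shows "field_trace K (x - y) = field_trace K x - field_trace K y"
  using field_trace_add[OF K subfield_diff[OF number_fieldD[OF K] xy] xy(2)] by simp

definition itrace :: "'a::field_char_0 set \<Rightarrow> 'a \<Rightarrow> int" where
  "itrace K x = \<lfloor>field_trace K x\<rfloor>"

lemma itrace:
  assumes K: "number_field K" and x: "x \<in> ring_of_integers K"
  shows "of_int (itrace K x) = field_trace K x"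
proof -
  have Kf: "is_subfield K" using K by (rule number_fieldD)
  have "algebraic_int (of_rat (field_trace K x) :: complex)"
    unfolding of_rat_field_trace[OF K roiD(1)[OF x]]
    using x by (intro algebraic_int_sum algebraic_int_hom[OF Kf emb_hom[OF K]]) auto
  hence "(of_rat (field_trace K x) :: complex) \<in> \<int>"
    by (intro rational_algebraic_int_is_int) auto
  then obtain k where "(of_rat (field_trace K x) :: complex) = of_int k" by (auto elim: Ints_cases)
  hence "field_trace K x = of_int k" by (metis of_rat_eq_iff of_rat_of_int_eq)
  thus ?thesis by (simp add: itrace_def)
qed

lemma itrace_emb:
  assumes "number_field K" "x \<in> ring_of_integers K"
  shows "(of_int (itrace K x) :: complex) = (\<Sum>i<nf_degree K. emb K i x)"
  using of_rat_field_trace[OF assms(1) roiD(1)[OF assms(2)]] itrace[OF assms]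
  by (metis of_rat_of_int_eq)

definition gram :: "'a::field_char_0 set \<Rightarrow> (nat \<Rightarrow> 'a) \<Rightarrow> int mat" where
  "gram K e = mat (nf_degree K) (nf_degree K) (\<lambda>(i, j). itrace K (e i * e j))"

lemma gram_carrier [simp]: "gram K e \<in> carrier_mat (nf_degree K) (nf_degree K)"
  by (simp add: gram_def)

lemma gram_conj_mat:
  assumes K: "number_field K" and e: "\<And>j. j < nf_degree K \<Longrightarrow> e j \<in> ring_of_integers K"
  shows "map_mat of_int (gram K e) = transpose_mat (conj_mat K e) * conj_mat K e"
proof (rule eq_matI)
  have Kf: "is_subfield K" using K by (rule number_fieldD)
  fix i j assume "i < dim_row (transpose_mat (conj_mat K e) * conj_mat K e)"
    "j < dim_col (transpose_mat (conj_mat K e) * conj_mat K e)"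
  hence ij: "i < nf_degree K" "j < nf_degree K" by simp_all
  have "(of_int (itrace K (e i * e j)) :: complex) = (\<Sum>k<nf_degree K. emb K k (e i * e j))"
    using ij e by (intro itrace_emb[OF K] roi_closed(4)[OF Kf])
  also have "\<dots> = (\<Sum>k<nf_degree K. emb K k (e i) * emb K k (e j))"
    using ij e by (intro sum.cong refl field_homD(3)[OF emb_hom[OF K]]) (auto dest: roiD(1))
  finally show "map_mat of_int (gram K e) $$ (i, j) = (transpose_mat (conj_mat K e) * conj_mat K e) $$ (i, j)"
    using ij by (simp add: gram_def scalar_prod_def atLeast0LessThan)
qed (simp_all add: gram_def)

lemma det_gram:
  assumes K: "number_field K" and e: "\<And>j. j < nf_degree K \<Longrightarrow> e j \<in> ring_of_integers K"
  shows "(of_int (det (gram K e)) :: complex) = (det (conj_mat K e))\<^sup>2"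
proof -
  have "(of_int (det (gram K e)) :: complex) = det (map_mat of_int (gram K e))" by simp
  also have "\<dots> = det (transpose_mat (conj_mat K e) * conj_mat K e)"
    by (subst gram_conj_mat[OF assms]) simp_all
  also have "\<dots> = det (transpose_mat (conj_mat K e)) * det (conj_mat K e)"
    by (rule det_mult[where n = "nf_degree K"]) simp_all
  also have "\<dots> = (det (conj_mat K e))\<^sup>2"
    by (subst det_transpose[where n = "nf_degree K"]) (simp_all add: power2_eq_square)
  finally show ?thesis .
qed

text \<open>Coordinates with respect to a family of integers with non-zero discriminant are read off from
  traces, so they are rational.\<close>

lemma rational_coordinates:
  assumes K: "number_field K" and n: "n = nf_degree K"
    and e: "\<And>j. j < n \<Longrightarrow> e j \<in> ring_of_integers K" and d: "det (conj_mat K e) \<noteq> 0"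
    and x: "x \<in> K"
  shows "\<exists>q. x = (\<Sum>j<n. of_rat (q j) * e j)"
proof -
  have Kf: "is_subfield K" using K by (rule number_fieldD)
  have npos: "n > 0"
  proof (rule ccontr)
    assume "\<not> n > 0"
    hence "card (embeddings K) = 0" using card_embeddings(2)[OF K] n by simp
    hence "embeddings K = {}" using card_embeddings(1)[OF K] by simp
    moreover obtain b where "\<And>x. x \<in> K \<Longrightarrow> \<exists>q. x = (\<Sum>j<nf_degree K. of_rat (q j) * b j)"
      using number_field_basis_sequence[OF K] by metis
    ultimately have "\<And>x. x \<in> K \<Longrightarrow> x = 0" using \<open>\<not> n > 0\<close> n by simp
    with subfieldD(2)[OF Kf] show False by force
  qed
  define V where "V = conj_mat K e"
  define S where "S = gram K e"
  have V: "V \<in> carrier_mat n n" and S: "S \<in> carrier_mat n n" by (simp_all add: V_def S_def n)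
  define v where "v = vec n (\<lambda>i. emb K i x)"
  obtain W where W: "W \<in> carrier_mat n n" "V * W = 1\<^sub>m n"
    using mat_inverse_if_det_nonzero[OF V] d V_def by metis
  define c where "c = W *\<^sub>v v"
  have c: "c \<in> carrier_vec n" and v: "v \<in> carrier_vec n" using W(1) by (auto simp: c_def v_def)
  have "V *\<^sub>v c = (V * W) *\<^sub>v v" unfolding c_def by (rule assoc_mult_mat_vec[symmetric, OF V W(1) v])
  hence Vc: "V *\<^sub>v c = v" using W(2) v by simp
  define t where "t = vec n (\<lambda>k. field_trace K (e k * x))"
  have dS: "(of_int (det S) :: complex) = (det V)\<^sup>2"
    unfolding S_def V_def using e n by (intro det_gram[OF K]) simp
  have dS0: "det S \<noteq> 0" using d dS V_def by auto
  let ?S = "map_mat complex_of_int S"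
  have "?S *\<^sub>v c = transpose_mat V *\<^sub>v (V *\<^sub>v c)"
  proof -
    have "?S = transpose_mat V * V"
      unfolding S_def V_def using e n by (intro gram_conj_mat[OF K]) simp
    thus ?thesis using V c by (simp add: assoc_mult_mat_vec[of _ n n _ n])
  qed
  also have "\<dots> = map_vec of_rat t"
  proof (rule eq_vecI)
    fix k assume "k < dim_vec (map_vec complex_of_rat t)"
    hence k: "k < n" by (simp add: t_def)
    have "(of_rat (t $ k) :: complex) = (\<Sum>i<n. emb K i (e k * x))"
      using k x roiD(1)[OF e[OF k]] by (simp add: t_def n of_rat_field_trace[OF K] subfieldD[OF Kf])
    also have "\<dots> = (\<Sum>i<n. emb K i (e k) * emb K i x)"
      using k n x roiD(1)[OF e[OF k]] by (intro sum.cong refl field_homD(3)[OF emb_hom[OF K]]) auto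
    also have "\<dots> = (transpose_mat V *\<^sub>v v) $ k"
      using k V by (simp add: scalar_prod_def atLeast0LessThan V_def v_def n)
    finally show "(transpose_mat V *\<^sub>v (V *\<^sub>v c)) $ k = map_vec of_rat t $ k"
      using k by (simp add: t_def Vc)
  qed (use V in \<open>simp add: t_def\<close>)
  finally have Sc: "?S *\<^sub>v c = map_vec of_rat t" .
  define q where "q j = (\<Sum>k<n. of_int (adj_mat S $$ (j, k)) * t $ k) / of_int (det S)" for j
  have adj: "adj_mat S \<in> carrier_mat n n" "adj_mat S * S = det S \<cdot>\<^sub>m 1\<^sub>m n" using adj_mat[OF S] by simp_all
  have qj: "of_rat (q j) = c $ j" if j: "j < n" for j
  proof -
    let ?A = "map_mat complex_of_int (adj_mat S)"
    have "?A *\<^sub>v (?S *\<^sub>v c) = (?A * ?S) *\<^sub>v c"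
      using adj(1) S c by (intro assoc_mult_mat_vec[symmetric, of _ n n _ n]) auto
    also have "?A * ?S = map_mat of_int (det S \<cdot>\<^sub>m 1\<^sub>m n)"
      unfolding adj(2)[symmetric] by (rule of_int_hom.mat_hom_mult[OF adj(1) S, symmetric])
    finally have "(map_mat of_int (det S \<cdot>\<^sub>m 1\<^sub>m n) *\<^sub>v c) $ j = (?A *\<^sub>v map_vec of_rat t) $ j"
      using Sc by simp
    moreover have "(map_mat of_int (det S \<cdot>\<^sub>m 1\<^sub>m n) *\<^sub>v c) $ j = of_int (det S) * c $ j"
    proof -
      have "map_mat complex_of_int (det S \<cdot>\<^sub>m 1\<^sub>m n) = of_int (det S) \<cdot>\<^sub>m 1\<^sub>m n"
        by (rule eq_matI) (auto simp: one_mat_def)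
      hence "(map_mat complex_of_int (det S \<cdot>\<^sub>m 1\<^sub>m n) *\<^sub>v c) $ j =
          (\<Sum>k<n. (if k = j then of_int (det S) else 0) * c $ k)"
        using c j by (auto simp: scalar_prod_def atLeast0LessThan intro!: sum.cong)
      also have "\<dots> = of_int (det S) * c $ j"
        using j by (simp add: if_distrib[of "\<lambda>t. t * _"] cong: if_cong)
      finally show ?thesis .
    qed
    moreover have "(?A *\<^sub>v map_vec of_rat t) $ j = of_rat (\<Sum>k<n. of_int (adj_mat S $$ (j, k)) * t $ k)"
      using j adj(1) by (simp add: scalar_prod_def atLeast0LessThan of_rat_sum of_rat_mult t_def)
    ultimately show ?thesis using dS0 by (simp add: q_def of_rat_divide field_simps)
  qed
  have ex: "emb K i x = (\<Sum>j<n. of_rat (q j) * emb K i (e j))" if i: "i < n" for i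
  proof -
    have "emb K i x = (V *\<^sub>v c) $ i" using i unfolding Vc by (simp add: v_def)
    also have "\<dots> = (\<Sum>j<n. emb K i (e j) * c $ j)"
      using i V c by (simp add: scalar_prod_def atLeast0LessThan V_def n)
    finally show ?thesis by (simp add: qj mult.commute)
  qed
  have "emb K 0 x = emb K 0 (\<Sum>j<n. of_rat (q j) * e j)"
    unfolding ex[OF npos] using npos n e
    by (intro embedding_on_basis[OF Kf emb_hom[OF K], symmetric]) (auto dest: roiD(1))
  hence "x = (\<Sum>j<n. of_rat (q j) * e j)"
    using npos n e x
    by (intro field_hom_inj[OF Kf emb_hom[OF K, of 0]] subfield_sum[OF Kf] subfieldD(4)[OF Kf]
        subfield_of_rat[OF Kf]) (auto dest: roiD(1))
  thus ?thesis by blast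
qed

section \<open>Integral bases and the discriminant\<close>

text \<open>A sequence of exactly as many integers as the degree that spans the ring of integers is independent, so
  spanning is all that has to be required of an integral basis in this form.\<close>

definition zbasis :: "'a::field_char_0 set \<Rightarrow> (nat \<Rightarrow> 'a) \<Rightarrow> bool" where
  "zbasis K e \<longleftrightarrow> (\<forall>j<nf_degree K. e j \<in> ring_of_integers K) \<and>
     (\<forall>x\<in>ring_of_integers K. \<exists>q :: nat \<Rightarrow> int. x = (\<Sum>j<nf_degree K. of_int (q j) * e j))"

lemma zbasisD:
  assumes "zbasis K e"
  shows "j < nf_degree K \<Longrightarrow> e j \<in> ring_of_integers K"
    "x \<in> ring_of_integers K \<Longrightarrow> \<exists>q :: nat \<Rightarrow> int. x = (\<Sum>j<nf_degree K. of_int (q j) * e j)"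
  using assms by (auto simp: zbasis_def)

lemma zbasis_spans:
  assumes K: "number_field K" and e: "zbasis K e" and x: "x \<in> K"
  shows "\<exists>q. x = (\<Sum>j<nf_degree K. of_rat (q j) * e j)"
proof -
  obtain N where N: "N > 0" "of_int N * x \<in> ring_of_integers K" using K x by (rule integral_multiple)
  obtain q :: "nat \<Rightarrow> int" where q: "of_int N * x = (\<Sum>j<nf_degree K. of_int (q j) * e j)"
    using zbasisD(2)[OF e N(2)] by blast
  have "x = (of_int N * x) / of_int N" using N(1) by simp
  also have "\<dots> = (\<Sum>j<nf_degree K. of_rat (of_int (q j) / of_int N) * e j)"
    unfolding q sum_divide_distrib by (simp add: of_rat_divide)
  finally show ?thesis by (intro exI[of _ "\<lambda>j. of_int (q j) / of_int N"])
qed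

lemma det_zbasis_nonzero:
  assumes K: "number_field K" and e: "zbasis K e"
  shows "det (conj_mat K e) \<noteq> 0" "det (gram K e) \<noteq> 0"
proof -
  show "det (conj_mat K e) \<noteq> 0"
    by (rule det_conj_mat_nonzero[OF K refl]) (use zbasisD(1)[OF e] zbasis_spans[OF K e] roiD(1) in auto)
  thus "det (gram K e) \<noteq> 0" using det_gram[OF K, of e] zbasisD(1)[OF e] by auto
qed

lemma emb_int_combination:
  fixes q :: "nat \<Rightarrow> int"
  assumes K: "number_field K" and i: "i < nf_degree K" and e: "\<And>j. j < n \<Longrightarrow> e j \<in> K"
  shows "emb K i (\<Sum>j<n. of_int (q j) * e j) = (\<Sum>j<n. of_int (q j) * emb K i (e j))"
  using embedding_on_basis[OF number_fieldD[OF K] emb_hom[OF K i] e, where n = n and q = "\<lambda>j. of_int (q j)"]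
  by simp

lemma rat_combination_unique:
  assumes K: "number_field K" and n: "n = nf_degree K" and e: "\<And>j. j < n \<Longrightarrow> e j \<in> K"
    and d: "det (conj_mat K e) \<noteq> 0"
    and eq: "(\<Sum>j<n. of_rat (p j) * e j) = (\<Sum>j<n. of_rat (q j) * e j)" and j: "j < n"
  shows "p j = q j"
proof -
  have Kf: "is_subfield K" using K by (rule number_fieldD)
  have V: "conj_mat K e \<in> carrier_mat n n" by (simp add: n)
  obtain W where W: "W \<in> carrier_mat n n" "W * conj_mat K e = 1\<^sub>m n"
    using mat_inverse_if_det_nonzero[OF V d] by metis
  define c where "c = vec n (\<lambda>j. of_rat (p j - q j) :: complex)"
  have "conj_mat K e *\<^sub>v c = 0\<^sub>v n"
  proof (rule eq_vecI)
    fix i assume "i < dim_vec (0\<^sub>v n :: complex vec)"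
    hence i: "i < n" by simp
    have "(conj_mat K e *\<^sub>v c) $ i = (\<Sum>j<n. of_rat (p j - q j) * emb K i (e j))"
      using i by (simp add: scalar_prod_def atLeast0LessThan n[symmetric] c_def mult.commute
          conj_mat_def)
    also have "\<dots> = emb K i (\<Sum>j<n. of_rat (p j - q j) * e j)"
      using i n e by (intro embedding_on_basis[OF Kf emb_hom[OF K], symmetric]) auto
    also have "(\<Sum>j<n. of_rat (p j - q j) * e j) = 0"
      using eq by (simp add: of_rat_diff algebra_simps sum_subtractf)
    finally show "(conj_mat K e *\<^sub>v c) $ i = 0\<^sub>v n $ i"
      using i n field_hom_0[OF Kf emb_hom[OF K]] by simp
  qed (simp add: n)
  moreover have "c = (W * conj_mat K e) *\<^sub>v c" by (simp add: W c_def)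
  moreover have "\<dots> = W *\<^sub>v (conj_mat K e *\<^sub>v c)"
    by (rule assoc_mult_mat_vec[OF W(1) V]) (simp add: c_def)
  ultimately have "c = W *\<^sub>v 0\<^sub>v n" by simp
  hence "c $ j = 0" using j W(1) by simp
  thus ?thesis using j by (simp add: c_def)
qed

lemma int_combination_unique:
  assumes K: "number_field K" and e: "zbasis K e"
    and eq: "(\<Sum>j<nf_degree K. of_int (p j) * e j) = (\<Sum>j<nf_degree K. of_int (q j) * e j)"
    and j: "j < nf_degree K"
  shows "p j = q j"
  using rat_combination_unique[OF K refl _ det_zbasis_nonzero(1)[OF K e], of "\<lambda>j. of_int (p j)" "\<lambda>j. of_int (q j)" j]
    zbasisD(1)[OF e] roiD(1) eq j by auto

text \<open>A family of integers whose discriminant is minimal in absolute value is an integral basis: a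
  coordinate that is not an integer could be replaced by its fractional part, which scales the
  discriminant down.\<close>

lemma ex_zbasis:
  assumes K: "number_field K"
  shows "\<exists>e. zbasis K e"
proof -
  have Kf: "is_subfield K" using K by (rule number_fieldD)
  define n where "n = nf_degree K"
  define G where "G e \<longleftrightarrow> (\<forall>j<n. e j \<in> ring_of_integers K) \<and> det (conj_mat K e) \<noteq> 0" for e
  obtain b where b: "\<And>i. i < n \<Longrightarrow> b i \<in> K"
    "\<And>x. x \<in> K \<Longrightarrow> \<exists>q. x = (\<Sum>j<n. of_rat (q j) * b j)"
    using number_field_basis_sequence[OF K] unfolding n_def by metis
  have "\<forall>i. \<exists>N::int. i < n \<longrightarrow> N > 0 \<and> of_int N * b i \<in> ring_of_integers K"
    using integral_multiple[OF K b(1)] by metis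
  then obtain N :: "nat \<Rightarrow> int" where N: "\<And>i. i < n \<Longrightarrow> N i > 0"
      "\<And>i. i < n \<Longrightarrow> of_int (N i) * b i \<in> ring_of_integers K" by metis
  have "G (\<lambda>i. of_int (N i) * b i)"
    unfolding G_def
  proof (intro conjI allI impI)
    show "of_int (N j) * b j \<in> ring_of_integers K" if "j < n" for j using N that by simp
    show "det (conj_mat K (\<lambda>i. of_int (N i) * b i)) \<noteq> 0"
    proof (rule det_conj_mat_nonzero[OF K n_def])
      show "of_int (N j) * b j \<in> K" if "j < n" for j using N(2)[OF that] by (rule roiD(1))
      fix x assume "x \<in> K"
      then obtain q where q: "x = (\<Sum>j<n. of_rat (q j) * b j)" using b(2) by blast
      have "x = (\<Sum>j<n. of_rat (q j / of_int (N j)) * (of_int (N j) * b j))"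
        unfolding q
      proof (rule sum.cong[OF refl])
        fix j assume "j \<in> {..<n}"
        hence "N j \<noteq> 0" using N(1)[of j] by simp
        thus "of_rat (q j) * b j = of_rat (q j / of_int (N j)) * (of_int (N j) * b j)"
          by (simp add: of_rat_divide)
      qed
      thus "\<exists>q. x = (\<Sum>j<n. of_rat (q j) * (of_int (N j) * b j))"
        by (rule exI[of _ "\<lambda>j. q j / of_int (N j)"])
    qed
  qed
  then obtain e where e: "G e" and min: "\<And>e'. G e' \<Longrightarrow> nat \<bar>det (gram K e)\<bar> \<le> nat \<bar>det (gram K e')\<bar>"
    using ex_has_least_nat[of G _ "\<lambda>e. nat \<bar>det (gram K e)\<bar>"] by blast
  have eO: "\<And>j. j < n \<Longrightarrow> e j \<in> ring_of_integers K" and d: "det (conj_mat K e) \<noteq> 0"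
    using e by (auto simp: G_def)
  have eK: "e j \<in> K" if "j < n" for j using eO[OF that] by (rule roiD(1))
  have "zbasis K e" unfolding zbasis_def
  proof (intro conjI allI impI ballI)
    show "e j \<in> ring_of_integers K" if "j < nf_degree K" for j using eO that n_def by simp
    fix x assume x: "x \<in> ring_of_integers K"
    obtain q where q: "x = (\<Sum>j<n. of_rat (q j) * e j)"
      using rational_coordinates[OF K n_def eO d roiD(1)[OF x]] by blast
    have "q k \<in> \<int>" if k: "k < n" for k
    proof (rule ccontr)
      assume nint: "q k \<notin> \<int>"
      define f where "f = frac (q k)"
      have f: "0 < f" "f < 1" using nint by (simp_all add: f_def frac_lt_1 frac_gt_0_iff)
      define y where "y = x - of_int \<lfloor>q k\<rfloor> * e k"
      have y: "y = (\<Sum>j<n. of_rat ((q(k := f)) j) * e j)"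
      proof -
        have "(\<Sum>j<n. of_rat ((q(k := f)) j) * e j) =
            (\<Sum>j<n. of_rat (q j) * e j - (if j = k then of_int \<lfloor>q k\<rfloor> * e k else 0))"
          by (intro sum.cong refl)
             (auto simp: f_def frac_def of_rat_diff algebra_simps)
        thus ?thesis using k by (simp add: sum_subtractf y_def q)
      qed
      have yO: "y \<in> ring_of_integers K"
        unfolding y_def by (intro roi_closed[OF Kf] x eO k)
      define e' where "e' = e(k := y)"
      have V: "conj_mat K e \<in> carrier_mat n n" by (simp add: n_def)
      define c where "c = vec n (\<lambda>j. of_rat ((q(k := f)) j) :: complex)"
      have "conj_mat K e' = replace_col (conj_mat K e) (conj_mat K e *\<^sub>v c) k"
      proof (rule eq_matI)
        fix i j assume "i < dim_row (replace_col (conj_mat K e) (conj_mat K e *\<^sub>v c) k)"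
          "j < dim_col (replace_col (conj_mat K e) (conj_mat K e *\<^sub>v c) k)"
        hence ij: "i < n" "j < n" by (simp_all add: replace_col_def n_def)
        have "emb K i y = (\<Sum>j<n. of_rat ((q(k := f)) j) * emb K i (e j))"
          unfolding y using ij n_def by (intro embedding_on_basis[OF Kf emb_hom[OF K] eK]) simp_all
        also have "\<dots> = (conj_mat K e *\<^sub>v c) $ i"
          using ij by (simp add: scalar_prod_def atLeast0LessThan n_def[symmetric] c_def
              conj_mat_def mult.commute)
        finally show "conj_mat K e' $$ (i, j) =
            replace_col (conj_mat K e) (conj_mat K e *\<^sub>v c) k $$ (i, j)"
          using ij by (auto simp: replace_col_def n_def[symmetric] e'_def conj_mat_def)
      qed (simp_all add: replace_col_def)
      hence "det (conj_mat K e') = c $ k * det (conj_mat K e)"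
        using cramer_lemma_mat[OF V _ k, of c] by (simp add: c_def)
      hence de': "det (conj_mat K e') = of_rat f * det (conj_mat K e)" using k by (simp add: c_def)
      hence Ge': "G e'" unfolding G_def using d f yO eO by (auto simp: e'_def)
      have "(of_int (det (gram K e')) :: complex) = (of_rat f)\<^sup>2 * of_int (det (gram K e))"
        using Ge' eO unfolding G_def
        by (subst (1 2) det_gram[OF K]) (simp_all add: n_def de' power_mult_distrib)
      hence "of_rat (of_int (det (gram K e'))) = (of_rat (f\<^sup>2 * of_int (det (gram K e))) :: complex)"
        by (simp add: of_rat_mult of_rat_power)
      hence eq: "of_int (det (gram K e')) = f\<^sup>2 * of_int (det (gram K e))" by (simp only: of_rat_eq_iff)
      have "det (gram K e) \<noteq> 0"
        using d det_gram[OF K, of e] eO by (auto simp: n_def)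
      moreover have "f\<^sup>2 < 1" using f power_strict_mono[of f 1 2] by simp
      ultimately have "f\<^sup>2 * \<bar>of_int (det (gram K e))\<bar> < 1 * \<bar>of_int (det (gram K e)) :: rat\<bar>"
        by (intro mult_strict_right_mono) auto
      moreover have "\<bar>of_int (det (gram K e')) :: rat\<bar> = f\<^sup>2 * \<bar>of_int (det (gram K e))\<bar>"
        unfolding eq by (simp add: abs_mult)
      ultimately have "\<bar>of_int (det (gram K e')) :: rat\<bar> < \<bar>of_int (det (gram K e))\<bar>" by simp
      hence "\<bar>det (gram K e')\<bar> < \<bar>det (gram K e)\<bar>" by (metis of_int_abs of_int_less_iff)
      thus False using min[OF Ge'] by simp
    qed
    hence "\<forall>j. \<exists>k::int. j < n \<longrightarrow> q j = of_int k" by (auto elim!: Ints_cases)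
    then obtain k :: "nat \<Rightarrow> int" where k: "\<And>j. j < n \<Longrightarrow> q j = of_int (k j)" by metis
    have "x = (\<Sum>j<n. of_int (k j) * e j)" unfolding q by (intro sum.cong refl) (simp add: k)
    thus "\<exists>q :: nat \<Rightarrow> int. x = (\<Sum>j<nf_degree K. of_int (q j) * e j)" unfolding n_def by blast
  qed
  thus ?thesis by blast
qed

lemma conj_mat_int_combination:
  assumes K: "number_field K" and n: "n = nf_degree K" and e: "\<And>j. j < n \<Longrightarrow> e j \<in> K"
    and e': "\<And>j. j < n \<Longrightarrow> e' j = (\<Sum>k<n. of_int (P $$ (k, j)) * e k)" and P: "P \<in> carrier_mat n n"
  shows "conj_mat K e' = conj_mat K e * map_mat of_int P"
proof (rule eq_matI)
  fix i j assume "i < dim_row (conj_mat K e * map_mat of_int P)"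
    "j < dim_col (conj_mat K e * map_mat of_int P)"
  hence ij: "i < n" "j < n" using P n by auto
  have "emb K i (e' j) = (\<Sum>k<n. of_int (P $$ (k, j)) * emb K i (e k))"
    unfolding e'[OF ij(2)] using ij n e by (intro emb_int_combination[OF K]) auto
  thus "conj_mat K e' $$ (i, j) = (conj_mat K e * map_mat of_int P) $$ (i, j)"
    using ij P by (simp add: scalar_prod_def atLeast0LessThan n mult.commute)
qed (use P n in auto)

text \<open>Integral bases are related by integer matrices in both directions, so the base change has determinant 1 or -1,
  which enters the discriminant as a square.\<close>

lemma det_gram_unique:
  assumes K: "number_field K" and e: "zbasis K e" and e': "zbasis K e'"
  shows "det (gram K e) = det (gram K e')"
proof -
  define n where "n = nf_degree K"
  have ex: "\<exists>P. P \<in> carrier_mat n n \<and> conj_mat K f' = conj_mat K f * map_mat of_int P"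
    if f: "zbasis K f" and f': "zbasis K f'" for f f'
  proof -
    have "\<forall>j. \<exists>q :: nat \<Rightarrow> int. j < n \<longrightarrow> f' j = (\<Sum>k<n. of_int (q k) * f k)"
      using zbasisD(2)[OF f zbasisD(1)[OF f']] unfolding n_def by blast
    then obtain q :: "nat \<Rightarrow> nat \<Rightarrow> int" where q: "\<And>j. j < n \<Longrightarrow> f' j = (\<Sum>k<n. of_int (q j k) * f k)"
      by metis
    have "conj_mat K f' = conj_mat K f * map_mat of_int (mat n n (\<lambda>(k, j). q j k))"
      by (rule conj_mat_int_combination[OF K n_def])
         (use zbasisD(1)[OF f] q in \<open>auto dest: roiD(1) simp: n_def\<close>)
    thus ?thesis by (intro exI[of _ "mat n n (\<lambda>(k, j). q j k)"]) simp
  qed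
  obtain P where P: "P \<in> carrier_mat n n" "conj_mat K e' = conj_mat K e * map_mat of_int P"
    using ex[OF e e'] by blast
  obtain Q where Q: "Q \<in> carrier_mat n n" "conj_mat K e = conj_mat K e' * map_mat of_int Q"
    using ex[OF e' e] by blast
  have V: "conj_mat K f \<in> carrier_mat n n" for f by (simp add: n_def)
  have 1: "det (conj_mat K e') = det (conj_mat K e) * of_int (det P)"
    unfolding P(2) using P(1) V by (subst det_mult[of _ n]) auto
  have 2: "det (conj_mat K e) = det (conj_mat K e') * of_int (det Q)"
    by (subst Q(2)) (use Q(1) V in \<open>subst det_mult[of _ n], auto\<close>)
  have "of_int (det P * det Q) = (1 :: complex)"
    using 1 2 det_zbasis_nonzero(1)[OF K e] by (auto simp: mult.commute)
  hence "det P * det Q = 1" by (simp only: of_int_eq_1_iff)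
  hence "(of_int (det P) :: complex)\<^sup>2 = 1" by (auto simp: zmult_eq_1_iff)
  hence "(of_int (det (gram K e')) :: complex) = of_int (det (gram K e))"
    using e e' by (simp add: det_gram[OF K] zbasisD 1 power_mult_distrib)
  thus ?thesis by simp
qed

lemma zbasis_integral_basis:
  assumes K: "number_field K" and e: "zbasis K e"
  shows "integral_basis K (map e [0..<nf_degree K])"
proof -
  have Kf: "is_subfield K" using K by (rule number_fieldD)
  define n where "n = nf_degree K"
  have inj: "inj_on e {..<n}"
  proof (rule inj_onI, rule ccontr)
    fix i j assume ij: "i \<in> {..<n}" "j \<in> {..<n}" "e i = e j" "i \<noteq> j"
    have s: "(\<Sum>k<n. of_int (if k = i then 1 else 0) * e k) = e i" if "i < n" for i
    proof -
      have "(\<Sum>k<n. of_int (if k = i then 1 else 0) * e k) = (\<Sum>k<n. if k = i then e k else 0)"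
        by (intro sum.cong refl) simp
      thus ?thesis using that by simp
    qed
    have "(if i = i then 1 else 0 :: int) = (if i = j then 1 else 0)"
      by (rule int_combination_unique[OF K e, of "\<lambda>k. if k = i then 1 else 0" "\<lambda>k. if k = j then 1 else 0"])
         (use ij s[of i] s[of j] in \<open>simp_all add: n_def\<close>)
    thus False using ij by simp
  qed
  have set: "set (map e [0..<n]) = e ` {..<n}" by (auto simp: atLeast0LessThan)
  have fin: "finite (e ` {..<n})" by simp
  have reidx: "(\<Sum>v\<in>e ` {..<n}. of_int (u v) * v) = (\<Sum>j<n. of_int (u (e j)) * e j)" for u :: "'a \<Rightarrow> int"
    using inj by (simp add: sum.reindex)
  show ?thesis unfolding integral_basis_def n_def[symmetric] set
  proof (intro conjI)
    show "distinct (map e [0..<n])" using inj by (simp add: distinct_map atLeast0LessThan)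
    show "int_mod.independent (e ` {..<n})"
    proof
      assume "int_mod.dependent (e ` {..<n})"
      then obtain u where u: "\<exists>v\<in>e ` {..<n}. u v \<noteq> 0" "(\<Sum>v\<in>e ` {..<n}. of_int (u v) * v) = 0"
        using int_mod.dependent_finite[OF fin] by auto
      have "u (e j) = 0" if "j < n" for j
        by (rule int_combination_unique[OF K e, of "\<lambda>j. u (e j)" "\<lambda>_. 0"])
           (use u(2) reidx[of u] that in \<open>simp_all add: n_def\<close>)
      thus False using u(1) by auto
    qed
    show "int_mod.span (e ` {..<n}) = ring_of_integers K"
    proof (intro equalityI subsetI)
      fix x assume "x \<in> int_mod.span (e ` {..<n})"
      then obtain u where "x = (\<Sum>v\<in>e ` {..<n}. of_int (u v) * v)"
        using int_mod.span_finite[OF fin] by auto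
      hence x: "x = (\<Sum>j<n. of_int (u (e j)) * e j)" by (simp only: reidx)
      show "x \<in> ring_of_integers K" unfolding x
        by (rule roi_sum[OF Kf], rule roi_closed(4)[OF Kf])
           (use zbasisD(1)[OF e] roi_closed(1)[OF Kf] in \<open>auto simp: n_def\<close>)
    next
      fix x assume "x \<in> ring_of_integers K"
      then obtain q :: "nat \<Rightarrow> int" where q: "x = (\<Sum>j<n. of_int (q j) * e j)"
        using zbasisD(2)[OF e] n_def by blast
      show "x \<in> int_mod.span (e ` {..<n})" unfolding q
        by (intro int_mod.span_sum int_mod.span_scale int_mod.span_base) auto
    qed
  qed
qed

lemma common_denominator:
  assumes "finite A"
  shows "\<exists>N::int. N > 0 \<and> (\<forall>v\<in>A. \<exists>k::int. of_int N * (u v :: rat) = of_int k)"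
  using assms
proof (induction A rule: finite_induct)
  case (insert v A)
  then obtain N :: int where N: "N > 0" "\<forall>v\<in>A. \<exists>k::int. of_int N * u v = of_int k" by blast
  obtain a b where ab: "quotient_of (u v) = (a, b)" by force
  have b: "b > 0" using quotient_of_denom_pos[OF ab] .
  have uv: "u v = of_int a / of_int b" using quotient_of_div[OF ab] .
  show ?case
  proof (rule exI[of _ "N * b"], intro conjI ballI)
    show "N * b > 0" using N b by simp
    fix w assume w: "w \<in> insert v A"
    show "\<exists>k::int. of_int (N * b) * u w = of_int k"
    proof (cases "w = v")
      case True
      have "of_int (N * b) * u w = of_int (N * a)" using b by (simp add: True uv)
      thus ?thesis by blast
    next
      case False
      hence "w \<in> A" using w by simp
      then obtain k :: int where "of_int N * u w = of_int k" using N(2) by blast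
      moreover have "of_int (N * b) * u w = of_int b * (of_int N * u w)"
        by (simp only: of_int_mult mult_ac)
      ultimately have "of_int (N * b) * u w = of_int (b * k)" by (simp only: of_int_mult)
      thus ?thesis by blast
    qed
  qed
qed (auto intro: exI[of _ 1])

text \<open>Rational relations become integral ones after clearing denominators, and every element of \<open>K\<close> has an integral
  multiple, so an integral basis is also a basis of \<open>K\<close> over the rationals.\<close>

lemma integral_basis_zbasis:
  assumes K: "number_field K" and bs: "integral_basis K bs"
  shows "length bs = nf_degree K" "zbasis K (\<lambda>j. bs ! j)"
proof -
  have Kf: "is_subfield K" using K by (rule number_fieldD)
  have dist: "distinct bs" and ind: "int_mod.independent (set bs)"
    and sp: "int_mod.span (set bs) = ring_of_integers K" using bs by (simp_all add: integral_basis_def)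
  have fin: "finite (set bs)" by simp
  have sub: "set bs \<subseteq> ring_of_integers K" using int_mod.span_superset[of "set bs"] sp by simp
  have "rat_vs.independent (set bs)"
  proof
    assume "rat_vs.dependent (set bs)"
    then obtain u where u: "\<exists>v\<in>set bs. u v \<noteq> 0" "(\<Sum>v\<in>set bs. of_rat (u v) * v) = 0"
      using rat_vs.dependent_finite[OF fin] by auto
    obtain N :: int where N: "N > 0" "\<forall>v\<in>set bs. \<exists>k::int. of_int N * u v = of_int k"
      using common_denominator[OF fin] by blast
    then obtain k :: "'a \<Rightarrow> int" where k: "\<And>v. v \<in> set bs \<Longrightarrow> of_int N * u v = of_int (k v)" by metis
    have "(\<Sum>v\<in>set bs. of_int (k v) * v) = (\<Sum>v\<in>set bs. of_int N * (of_rat (u v) * v))"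
    proof (rule sum.cong[OF refl])
      fix v assume "v \<in> set bs"
      hence "of_rat (of_int (k v)) = (of_rat (of_int N * u v) :: 'a)" using k by simp
      hence "of_int (k v) = (of_int N * of_rat (u v) :: 'a)" by (simp add: of_rat_mult)
      thus "of_int (k v) * v = of_int N * (of_rat (u v) * v)" by (simp add: mult.assoc)
    qed
    also have "\<dots> = 0" by (simp only: sum_distrib_left[symmetric] u(2) mult_zero_right)
    finally have "(\<Sum>v\<in>set bs. of_int (k v) * v) = 0" .
    moreover have "\<exists>v\<in>set bs. k v \<noteq> 0" using u(1) N(1) k by force
    ultimately have "int_mod.dependent (set bs)" using int_mod.dependent_finite[OF fin] by blast
    thus False using ind by simp
  qed
  note rind = this
  have rsp: "rat_vs.span (set bs) = K"
  proof (intro equalityI)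
    show "rat_vs.span (set bs) \<subseteq> K"
      using sub by (intro subfield_span_subset[OF Kf]) (auto dest: roiD(1))
    show "K \<subseteq> rat_vs.span (set bs)"
    proof
      fix x assume "x \<in> K"
      then obtain N :: int where N: "N > 0" "of_int N * x \<in> ring_of_integers K"
        using integral_multiple[OF K] by blast
      then obtain u where u: "of_int N * x = (\<Sum>v\<in>set bs. of_int (u v) * v)"
        using sp int_mod.span_finite[OF fin] by auto
      have "x = (of_int N * x) / of_int N" using N(1) by simp
      also have "\<dots> = (\<Sum>v\<in>set bs. of_rat (of_int (u v) / of_int N) * v)"
        unfolding u sum_divide_distrib by (simp add: of_rat_divide)
      also have "\<dots> \<in> rat_vs.span (set bs)"
        by (intro rat_vs.span_sum rat_vs.span_scale rat_vs.span_base)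
      finally show "x \<in> rat_vs.span (set bs)" .
    qed
  qed
  have "rat_vs.span (set bs) = rat_vs.span K" by (simp only: rsp[symmetric] rat_vs.span_span)
  from rat_vs.dim_eq_card[OF this rind] show len: "length bs = nf_degree K"
    using distinct_card[OF dist] by (simp add: nf_degree_def)
  show "zbasis K (\<lambda>j. bs ! j)" unfolding zbasis_def
  proof (intro conjI allI impI ballI)
    show "bs ! j \<in> ring_of_integers K" if "j < nf_degree K" for j using sub that len by auto
    fix x assume "x \<in> ring_of_integers K"
    then obtain u where "x = (\<Sum>v\<in>set bs. of_int (u v) * v)"
      using sp int_mod.span_finite[OF fin] by auto
    also have "\<dots> = (\<Sum>j<nf_degree K. of_int (u (bs ! j)) * bs ! j)"
      by (rule sum.reindex_bij_betw[OF bij_betw_nth[OF dist], symmetric]) (simp_all add: len)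
    finally show "\<exists>q :: nat \<Rightarrow> int. x = (\<Sum>j<nf_degree K. of_int (q j) * bs ! j)"
      by (rule exI[of _ "\<lambda>j. u (bs ! j)"])
  qed
qed

theorem discriminant_eq_det_gram:
  assumes K: "number_field K" and e: "zbasis K e"
  shows "discriminant K = det (gram K e)"
proof -
  have Kf: "is_subfield K" using K by (rule number_fieldD)
  have disc: "det (mat (length bs) (length bs) (\<lambda>(i, j). trace_form K (bs ! i) (bs ! j))) =
      of_int (det (gram K (\<lambda>j. bs ! j)))" if bs: "integral_basis K bs" for bs
  proof -
    note z = integral_basis_zbasis[OF K bs]
    have "mat (length bs) (length bs) (\<lambda>(i, j). trace_form K (bs ! i) (bs ! j)) =
        map_mat of_int (gram K (\<lambda>j. bs ! j))"
      by (rule eq_matI)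
         (simp_all add: z(1) gram_def trace_form_def itrace[OF K] roi_closed(4)[OF Kf] zbasisD(1)[OF z(2)])
    thus ?thesis by simp
  qed
  show ?thesis unfolding discriminant_def
  proof (rule the_equality)
    show "\<exists>bs. integral_basis K bs \<and> of_int (det (gram K e)) =
        det (mat (length bs) (length bs) (\<lambda>(i, j). trace_form K (bs ! i) (bs ! j)))"
      using zbasis_integral_basis[OF K e] disc[OF zbasis_integral_basis[OF K e]]
        det_gram_unique[OF K e integral_basis_zbasis(2)[OF K zbasis_integral_basis[OF K e]]] by auto
    fix d assume "\<exists>bs. integral_basis K bs \<and> of_int d =
        det (mat (length bs) (length bs) (\<lambda>(i, j). trace_form K (bs ! i) (bs ! j)))"
    then obtain bs where bs: "integral_basis K bs" "of_int d = (of_int (det (gram K (\<lambda>j. bs ! j))) :: rat)"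
      using disc by auto
    thus "d = det (gram K e)"
      using det_gram_unique[OF K e integral_basis_zbasis(2)[OF K bs(1)]] by simp
  qed
qed

section \<open>Kernels modulo a prime\<close>

lemma mult_mat_vec_index_sum:
  assumes "M \<in> carrier_mat n m" "y \<in> carrier_vec m" "i < n"
  shows "(M *\<^sub>v y) $ i = (\<Sum>j<m. M $$ (i, j) * y $ j)"
  using assms by (simp add: scalar_prod_def atLeast0LessThan)

text \<open>If the kernel of \<open>S\<close> modulo \<open>p\<close> were not detected by few coordinates, one could replace
  columns of \<open>S\<close> one after the other by combinations that are divisible by \<open>p\<close>; each replacement
  extracts a factor \<open>p\<close> from the determinant.\<close>

lemma kernel_mod_prime_coordinates:
  fixes S :: "int mat" and p :: int
  assumes p: "prime p" and S: "S \<in> carrier_mat n n" and r: "\<not> p ^ Suc r dvd det S"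
  shows "\<exists>I \<subseteq> {..<n}. card I \<le> r \<and> (\<forall>y \<in> carrier_vec n.
    (\<forall>i<n. p dvd (S *\<^sub>v y) $ i) \<longrightarrow> (\<forall>a\<in>I. p dvd y $ a) \<longrightarrow> (\<forall>b<n. p dvd y $ b))"
proof (rule ccontr)
  assume neg: "\<not> ?thesis"
  have "\<exists>I M u. I \<subseteq> {..<n} \<and> card I = k \<and> M \<in> carrier_mat n n \<and> \<not> p dvd u \<and>
      det S * u = p ^ k * det M \<and> (\<forall>y \<in> carrier_vec n. (\<forall>i<n. p dvd (S *\<^sub>v y) $ i) \<longrightarrow>
        (\<forall>a\<in>I. p dvd y $ a) \<longrightarrow> (\<forall>i<n. p dvd (M *\<^sub>v y) $ i))" if "k \<le> Suc r" for k
    using that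
  proof (induction k)
    case 0
    have "\<not> p dvd 1" using p by (simp add: prime_int_iff)
    thus ?case using S by (intro exI[of _ "{}"] exI[of _ S] exI[of _ 1]) auto
  next
    case (Suc k)
    then obtain I M u where I: "I \<subseteq> {..<n}" "card I = k" and M: "M \<in> carrier_mat n n"
      and u: "\<not> p dvd u" "det S * u = p ^ k * det M"
      and ker: "\<And>y. y \<in> carrier_vec n \<Longrightarrow> \<forall>i<n. p dvd (S *\<^sub>v y) $ i \<Longrightarrow> \<forall>a\<in>I. p dvd y $ a \<Longrightarrow>
        \<forall>i<n. p dvd (M *\<^sub>v y) $ i" by auto
    have finI: "finite I" using I(1) finite_subset by blast
    have "card I \<le> r" using I(2) Suc.prems by simp
    then obtain z b where z: "z \<in> carrier_vec n" "\<forall>i<n. p dvd (S *\<^sub>v z) $ i" "\<forall>a\<in>I. p dvd z $ a"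
      and b: "b < n" "\<not> p dvd z $ b"
      using neg I(1) by blast
    have bI: "b \<notin> I" using b z(3) by auto
    define w where "w = vec n (\<lambda>i. (M *\<^sub>v z) $ i div p)"
    have w: "p \<cdot>\<^sub>v w = M *\<^sub>v z"
      using ker[OF z] M by (intro eq_vecI) (auto simp: w_def)
    define M' where "M' = replace_col M w b"
    have M': "M' \<in> carrier_mat n n" using M by (simp add: M'_def replace_col_def)
    have "det (replace_col M (M *\<^sub>v z) b) = p * det M'"
    proof -
      have "replace_col M (M *\<^sub>v z) b = mat n n (\<lambda>(i, j). (if j = b then p else 1) * M' $$ (i, j))"
        unfolding w[symmetric] M'_def using M
        by (intro eq_matI) (auto simp: replace_col_def w_def)
      hence "replace_col M (M *\<^sub>v z) b = M' * mat n n (\<lambda>(i, j). if i = j then if j = b then p else 1 else 0)"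
        (is "_ = M' * ?D")
        using M' by (auto intro!: eq_matI simp: scalar_prod_def if_distrib[of "\<lambda>t. _ * t"] cong: if_cong)
      hence "det (replace_col M (M *\<^sub>v z) b) = det M' * det ?D"
        using M' by (simp add: det_mult[of _ n])
      moreover have "det ?D = prod_list (diag_mat ?D)"
        by (rule det_upper_triangular[where n = n]) auto
      moreover have "prod_list (diag_mat ?D) = (\<Prod>i<n. if i = b then p else 1)"
        by (simp add: diag_mat_def prod.distinct_set_conv_list[symmetric] atLeast0LessThan)
      ultimately show ?thesis using b(1) by (simp add: mult.commute)
    qed
    hence "z $ b * det M = p * det M'" using cramer_lemma_mat[OF M z(1) b(1)] by simp
    hence det: "det S * (u * z $ b) = p ^ Suc k * det M'"
      using u(2) by (metis mult.assoc mult.commute power_Suc)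
    have "\<not> p dvd u * z $ b" using p u(1) b(2) by (simp add: prime_dvd_mult_iff)
    moreover have "\<forall>i<n. p dvd (M' *\<^sub>v y) $ i"
      if y: "y \<in> carrier_vec n" "\<forall>i<n. p dvd (S *\<^sub>v y) $ i" "\<forall>a\<in>insert b I. p dvd y $ a" for y
    proof (intro allI impI)
      fix i assume i: "i < n"
      have "p dvd (M *\<^sub>v y) $ i" using ker[OF y(1,2)] y(3) i by auto
      moreover have "(M' *\<^sub>v y) $ i = (M *\<^sub>v y) $ i + (w $ i - M $$ (i, b)) * y $ b"
      proof -
        have "(M' *\<^sub>v y) $ i = (\<Sum>j<n. M $$ (i, j) * y $ j + (if j = b then (w $ i - M $$ (i, b)) * y $ b else 0))"
          unfolding mult_mat_vec_index_sum[OF M' y(1) i] using i M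
          by (intro sum.cong refl) (auto simp: M'_def replace_col_def algebra_simps)
        thus ?thesis using b(1) by (simp add: sum.distrib mult_mat_vec_index_sum[OF M y(1) i])
      qed
      ultimately show "p dvd (M' *\<^sub>v y) $ i" using y(3) by simp
    qed
    ultimately show ?case using I finI bI b(1) M' det
      by (intro exI[of _ "insert b I"] exI[of _ M'] exI[of _ "u * z $ b"]) auto
  qed
  from this[of "Suc r"] obtain M u where "\<not> p dvd u" "det S * u = p ^ Suc r * det M" by auto
  moreover from this(1) have "coprime p u" by (rule prime_imp_coprime[OF p])
  ultimately have "p ^ Suc r dvd det S * u" "coprime (p ^ Suc r) u"
    by (simp_all add: coprime_power_left_iff del: power_Suc)
  thus False using r by (simp add: coprime_dvd_mult_left_iff)
qed

text \<open>A coefficient prime to \<open>p\<close> in one condition eliminates a coordinate from the other, which leaves one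
  condition on two further coordinates.\<close>

lemma two_congruences_solution:
  fixes g h :: "nat \<Rightarrow> int"
  assumes p: "prime p" and n: "n \<ge> 3"
  obtains y :: "int vec" and b where "y \<in> carrier_vec n" "b < n" "\<not> p dvd y $ b"
    "p dvd (\<Sum>j<n. g j * y $ j)" "p dvd (\<Sum>j<n. h j * y $ j)"
proof -
  have one: "\<not> p dvd 1" using p by (simp add: prime_int_iff)
  define y2 where "y2 u v b c = vec n (\<lambda>j. if j = b then u else if j = c then v else 0 :: int)" for u v :: int and b c
  have s2: "(\<Sum>j<n. f j * y2 u v b c $ j) = f b * u + f c * v" if "b < n" "c < n" "b \<noteq> c" for f u v b c
  proof -
    have "(\<Sum>j<n. f j * y2 u v b c $ j) = (\<Sum>j\<in>{b, c}. f j * y2 u v b c $ j)"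
      using that by (intro sum.mono_neutral_right) (auto simp: y2_def)
    thus ?thesis using that by (simp add: y2_def)
  qed
  \<comment> \<open>one condition and two coordinates\<close>
  have single: "\<exists>u v. (\<not> p dvd u \<or> \<not> p dvd v) \<and> p dvd f b * u + f c * v" for f :: "nat \<Rightarrow> int" and b c
  proof (cases "p dvd f b \<and> p dvd f c")
    case True
    thus ?thesis using one by (intro exI[of _ 1]) auto
  next
    case False
    thus ?thesis by (intro exI[of _ "f c"] exI[of _ "- f b"]) auto
  qed
  show ?thesis
  proof (cases "\<forall>i<n. p dvd g i")
    case True
    obtain u v where uv: "\<not> p dvd u \<or> \<not> p dvd v" "p dvd h 0 * u + h 1 * v" using single[of h 0 1] by blast
    have s: "p dvd (\<Sum>j<n. g j * y2 u v 0 1 $ j)" using True by (intro dvd_sum) auto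
    have t: "p dvd (\<Sum>j<n. h j * y2 u v 0 1 $ j)" using n uv(2) by (simp add: s2)
    show ?thesis
    proof (cases "p dvd u")
      case True
      show ?thesis by (rule that[of "y2 u v 0 1" 1, OF _ _ _ s t]) (use n True uv(1) in \<open>auto simp: y2_def\<close>)
    next
      case False
      show ?thesis by (rule that[of "y2 u v 0 1" 0, OF _ _ _ s t]) (use n False in \<open>auto simp: y2_def\<close>)
    qed
  next
    case False
    then obtain i where i: "i < n" "\<not> p dvd g i" by blast
    obtain b c where bc: "b < n" "c < n" "b \<noteq> i" "c \<noteq> i" "b \<noteq> c"
    proof (cases "i = 0")
      case True
      thus thesis using n by (intro that[of 1 2]) auto
    next
      case False
      show thesis
      proof (cases "i = 1")
        case True
        thus thesis using n by (intro that[of 0 2]) auto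
      next
        case False
        thus thesis using \<open>i \<noteq> 0\<close> n by (intro that[of 0 1]) auto
      qed
    qed
    define H where "H j = h j * g i - h i * g j" for j
    obtain u v where uv: "\<not> p dvd u \<or> \<not> p dvd v" "p dvd H b * u + H c * v" using single[of H b c] by blast
    define y where "y = vec n (\<lambda>j. if j = b then u * g i else if j = c then v * g i
        else if j = i then - (u * g b + v * g c) else 0)"
    have s3: "(\<Sum>j<n. f j * y $ j) = f b * (u * g i) + f c * (v * g i) - f i * (u * g b + v * g c)" for f
    proof -
      have "(\<Sum>j<n. f j * y $ j) = (\<Sum>j\<in>{b, c, i}. f j * y $ j)"
        using bc i by (intro sum.mono_neutral_right) (auto simp: y_def)
      thus ?thesis using bc i by (simp add: y_def algebra_simps)
    qed
    have s: "p dvd (\<Sum>j<n. g j * y $ j)" unfolding s3 by (simp add: algebra_simps)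
    have "(\<Sum>j<n. h j * y $ j) = H b * u + H c * v" unfolding s3 H_def by (simp add: algebra_simps)
    hence t: "p dvd (\<Sum>j<n. h j * y $ j)" using uv(2) by simp
    show ?thesis
    proof (cases "p dvd u")
      case True
      show ?thesis by (rule that[of y c, OF _ _ _ s t])
         (use bc p i True uv(1) in \<open>auto simp: y_def prime_dvd_mult_iff\<close>)
    next
      case False
      show ?thesis by (rule that[of y b, OF _ _ _ s t])
         (use bc p i False in \<open>auto simp: y_def prime_dvd_mult_iff\<close>)
    qed
  qed
qed

section \<open>Alternating forms modulo 2\<close>

text \<open>Modulo 2, \<open>X\<close> and \<open>X'\<close> are non-zero alternating forms whose columns lie in the kernel of \<open>S\<close>, which has
  dimension at most 3 because 16 does not divide \<open>det S\<close>. So they are determined by three rows and columns \<open>a\<close>, \<open>b\<close>,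
  \<open>c\<close>, where they are cross products with non-zero vectors \<open>x\<close> and \<open>x'\<close>. If \<open>x = x'\<close> the forms are equal, and otherwise
  \<open>x \<times> (x + x') = x \<times> x' = x' \<times> (x + x')\<close> is a common non-zero value.\<close>

lemma alternating_common_value:
  fixes X X' S :: "int mat"
  assumes n: "n \<ge> 3" and S: "S \<in> carrier_mat n n" and X: "X \<in> carrier_mat n n" and X': "X' \<in> carrier_mat n n"
    and d: "\<not> 16 dvd det S"
    and ker: "\<And>i j. i < n \<Longrightarrow> j < n \<Longrightarrow> even ((S * X) $$ (i, j))"
      "\<And>i j. i < n \<Longrightarrow> j < n \<Longrightarrow> even ((S * X') $$ (i, j))"
    and sym: "\<And>i j. i < n \<Longrightarrow> j < n \<Longrightarrow> even (X $$ (i, j) - X $$ (j, i))"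
      "\<And>i j. i < n \<Longrightarrow> j < n \<Longrightarrow> even (X' $$ (i, j) - X' $$ (j, i))"
    and alt: "\<And>i. i < n \<Longrightarrow> even (X $$ (i, i))" "\<And>i. i < n \<Longrightarrow> even (X' $$ (i, i))"
    and ne: "\<exists>i<n. \<exists>j<n. odd (X $$ (i, j))" "\<exists>i<n. \<exists>j<n. odd (X' $$ (i, j))"
  shows "\<exists>f \<in> carrier_vec n. (\<exists>j<n. odd ((X *\<^sub>v f) $ j)) \<and> (\<forall>i<n. even ((X *\<^sub>v f) $ i - (X' *\<^sub>v f) $ i))"
proof -
  have "\<not> 2 ^ Suc 3 dvd det S" using d by simp
  from kernel_mod_prime_coordinates[OF _ S this] obtain I0 where I0: "I0 \<subseteq> {..<n}" "card I0 \<le> 3"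
    and det0: "\<And>y. y \<in> carrier_vec n \<Longrightarrow> \<forall>i<n. even ((S *\<^sub>v y) $ i) \<Longrightarrow> \<forall>a\<in>I0. even (y $ a) \<Longrightarrow> \<forall>b<n. even (y $ b)"
    by auto
  obtain I where I: "I0 \<subseteq> I" "I \<subseteq> {..<n}" "card I = 3"
    using exists_subset_between[of I0 3 "{..<n}"] I0 n by auto
  then obtain a b c where abc: "I = {a, b, c}" "a \<noteq> b" "a \<noteq> c" "b \<noteq> c"
    by (auto simp: card_3_iff)
  have abcn: "a < n" "b < n" "c < n" using I abc by auto
  have det: "even (y $ k)" if "y \<in> carrier_vec n" "\<And>i. i < n \<Longrightarrow> even ((S *\<^sub>v y) $ i)"
    "even (y $ a)" "even (y $ b)" "even (y $ c)" "k < n" for y k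
    using det0[of y] that I(1) abc(1) by auto
  have comb: "even ((S *\<^sub>v (Z *\<^sub>v f)) $ i)"
    if Z: "Z \<in> carrier_mat n n" and f: "f \<in> carrier_vec n" and i: "i < n"
    and e: "\<And>i j. i < n \<Longrightarrow> j < n \<Longrightarrow> even ((S * Z) $$ (i, j))" for Z f i
  proof -
    have "S *\<^sub>v (Z *\<^sub>v f) = (S * Z) *\<^sub>v f" using assoc_mult_mat_vec[OF S Z f] by simp
    moreover have "((S * Z) *\<^sub>v f) $ i = (\<Sum>j<n. (S * Z) $$ (i, j) * f $ j)"
      by (rule mult_mat_vec_index_sum[OF _ f i]) (use S Z in auto)
    moreover have "even \<dots>" using e i by (intro dvd_sum) auto
    ultimately show ?thesis by simp
  qed
  \<comment> \<open>An alternating matrix with columns in the kernel of \<open>S\<close> modulo 2 is determined by its entries on \<open>I\<close>.\<close>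
  have zero: "even (Z $$ (i, j))"
    if Z: "Z \<in> carrier_mat n n" and e: "\<And>i j. i < n \<Longrightarrow> j < n \<Longrightarrow> even ((S * Z) $$ (i, j))"
    and s: "\<And>i j. i < n \<Longrightarrow> j < n \<Longrightarrow> even (Z $$ (i, j) - Z $$ (j, i))"
    and al: "\<And>i. i < n \<Longrightarrow> even (Z $$ (i, i))"
    and z: "even (Z $$ (a, b))" "even (Z $$ (a, c))" "even (Z $$ (b, c))" and ij: "i < n" "j < n" for Z i j
  proof -
    have col: "even (Z $$ (k, j))" if "even (Z $$ (a, j))" "even (Z $$ (b, j))" "even (Z $$ (c, j))"
      and kj: "k < n" "j < n" for k j
    proof -
      have "even (col Z j $ k)"
      proof (rule det)
        show "col Z j \<in> carrier_vec n" using Z kj by auto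
        show "even ((S *\<^sub>v col Z j) $ i)" if "i < n" for i
        proof -
          have "(S *\<^sub>v col Z j) $ i = (S * Z) $$ (i, j)" using that kj S Z by simp
          thus ?thesis using e[OF that kj(2)] by simp
        qed
      qed (use that Z abcn in auto)
      thus ?thesis using kj Z by simp
    qed
    have sw: "even (Z $$ (k, l)) \<Longrightarrow> even (Z $$ (l, k))" if "k < n" "l < n" for k l
      using s[OF that] by simp
    have "even (Z $$ (i, a))" "even (Z $$ (i, b))" "even (Z $$ (i, c))"
      by (rule col[OF al[OF abcn(1)] sw[OF abcn(1,2) z(1)] sw[OF abcn(1,3) z(2)] ij(1) abcn(1)]
          col[OF z(1) al[OF abcn(2)] sw[OF abcn(2,3) z(3)] ij(1) abcn(2)]
          col[OF z(2,3) al[OF abcn(3)] ij(1) abcn(3)])+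
    hence "even (Z $$ (a, i))" "even (Z $$ (b, i))" "even (Z $$ (c, i))"
      using sw abcn ij(1) by auto
    from col[OF this ij(2) ij(1)] have "even (Z $$ (j, i))" .
    thus ?thesis by (rule sw[OF ij(2) ij(1)])
  qed
  define x1 x2 x3 where x: "x1 = X $$ (b, c)" "x2 = X $$ (a, c)" "x3 = X $$ (a, b)"
  define y1 y2 y3 where y: "y1 = X' $$ (b, c)" "y2 = X' $$ (a, c)" "y3 = X' $$ (a, b)"
  have xne: "odd x1 \<or> odd x2 \<or> odd x3" using zero[OF X ker(1) sym(1) alt(1)] ne(1) unfolding x by blast
  have yne: "odd y1 \<or> odd y2 \<or> odd y3" using zero[OF X' ker(2) sym(2) alt(2)] ne(2) unfolding y by blast
  show ?thesis
  proof (cases "even (x1 - y1) \<and> even (x2 - y2) \<and> even (x3 - y3)")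
    case True
    have XX: "even ((X - X') $$ (i, j))" if "i < n" "j < n" for i j
    proof (rule zero[of "X - X'"])
      show "X - X' \<in> carrier_mat n n" using X X' by auto
      show "even ((S * (X - X')) $$ (i, j))" if "i < n" "j < n" for i j
      proof -
        have "i < dim_row (S * X')" "j < dim_col (S * X')" using that S X' by simp_all
        hence "(S * (X - X')) $$ (i, j) = (S * X) $$ (i, j) - (S * X') $$ (i, j)"
          unfolding mult_minus_distrib_mat[OF S X X'] by (rule index_minus_mat(1))
        thus ?thesis using dvd_diff[OF ker(1)[OF that] ker(2)[OF that]] by (simp only:)
      qed
      show "even ((X - X') $$ (i, j) - (X - X') $$ (j, i))" if "i < n" "j < n" for i j
        using sym[OF that] that X X' by auto
      show "even ((X - X') $$ (i, i))" if "i < n" for i using alt[OF that] that X X' by auto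
    qed (use True abcn X X' that in \<open>auto simp: x y\<close>)
    obtain i j where ij: "i < n" "j < n" "odd (X $$ (i, j))" using ne(1) by blast
    have un: "(Z *\<^sub>v unit_vec n j) $ k = Z $$ (k, j)" if "Z \<in> carrier_mat n n" "k < n" for Z :: "int mat" and k
    proof -
      have "(Z *\<^sub>v unit_vec n j) $ k = (\<Sum>l<n. Z $$ (k, l) * (if l = j then 1 else 0))"
        using ij that(2) by (subst mult_mat_vec_index_sum[OF that(1) _ that(2)]) (auto intro!: sum.cong)
      thus ?thesis using ij(2) by (simp add: if_distrib[of "(*) _"] cong: if_cong)
    qed
    show ?thesis
    proof (intro bexI[of _ "unit_vec n j"] conjI allI impI)
      show "\<exists>i<n. odd ((X *\<^sub>v unit_vec n j) $ i)" using ij un[OF X] by auto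
      show "even ((X *\<^sub>v unit_vec n j) $ i - (X' *\<^sub>v unit_vec n j) $ i)" if "i < n" for i
        using XX[OF that ij(2)] un[OF X that] un[OF X' that] that ij(2) X X' by auto
    qed simp
  next
    case False
    \<comment> \<open>the vector \<open>x + x'\<close> in the coordinates \<open>a\<close>, \<open>b\<close>, \<open>c\<close>\<close>
    define f where "f = vec n (\<lambda>k. if k = a then x1 - y1 else if k = b then x2 - y2 else if k = c then x3 - y3 else 0)"
    have f: "f \<in> carrier_vec n" by (simp add: f_def)
    have val: "(Z *\<^sub>v f) $ k = Z $$ (k, a) * (x1 - y1) + Z $$ (k, b) * (x2 - y2) + Z $$ (k, c) * (x3 - y3)"
      if Z: "Z \<in> carrier_mat n n" and k: "k < n" for Z k
    proof -
      have "(Z *\<^sub>v f) $ k = (\<Sum>j<n. Z $$ (k, j) * f $ j)" by (rule mult_mat_vec_index_sum[OF Z f k])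
      also have "\<dots> = (\<Sum>j\<in>{a, b, c}. Z $$ (k, j) * f $ j)"
        using abcn by (intro sum.mono_neutral_right) (auto simp: f_def)
      finally show ?thesis using abc abcn by (simp add: f_def)
    qed
    have sw: "even (X $$ (b, a) - x3)" "even (X $$ (c, a) - x2)" "even (X $$ (c, b) - x1)"
      "even (X' $$ (b, a) - y3)" "even (X' $$ (c, a) - y2)" "even (X' $$ (c, b) - y1)"
      using sym abcn unfolding x y by auto
    have al: "even (X $$ (a, a))" "even (X $$ (b, b))" "even (X $$ (c, c))"
      "even (X' $$ (a, a))" "even (X' $$ (b, b))" "even (X' $$ (c, c))" using alt abcn by auto
    have odds: "odd ((X *\<^sub>v f) $ a) \<or> odd ((X *\<^sub>v f) $ b) \<or> odd ((X *\<^sub>v f) $ c)"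
      unfolding val[OF X abcn(1)] val[OF X abcn(2)] val[OF X abcn(3)] x[symmetric]
      using sw al xne yne False by (simp only: even_diff even_add even_mult_iff) argo
    define y where "y = X *\<^sub>v f - X' *\<^sub>v f"
    have y: "y \<in> carrier_vec n" unfolding y_def using X X' f by auto
    have "even (y $ i)" if i: "i < n" for i
    proof (rule det[OF y])
      show "even ((S *\<^sub>v y) $ i)" if "i < n" for i
      proof -
        have "S *\<^sub>v y = S *\<^sub>v (X *\<^sub>v f) - S *\<^sub>v (X' *\<^sub>v f)"
          unfolding y_def using S X X' f by (intro mult_minus_distrib_mat_vec[of _ n n]) auto
        hence "(S *\<^sub>v y) $ i = (S *\<^sub>v (X *\<^sub>v f)) $ i - (S *\<^sub>v (X' *\<^sub>v f)) $ i" using that S X X' by simp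
        thus ?thesis using comb[OF X f that ker(1)] comb[OF X' f that ker(2)] by simp
      qed
      have ya: "y $ k = (X *\<^sub>v f) $ k - (X' *\<^sub>v f) $ k" if "k < n" for k using that X X' by (simp add: y_def)
      show "even (y $ a)" "even (y $ b)" "even (y $ c)"
        unfolding ya[OF abcn(1)] ya[OF abcn(2)] ya[OF abcn(3)]
          val[OF X abcn(1)] val[OF X abcn(2)] val[OF X abcn(3)]
          val[OF X' abcn(1)] val[OF X' abcn(2)] val[OF X' abcn(3)]
          x[symmetric] \<open>y1 = _\<close>[symmetric] \<open>y2 = _\<close>[symmetric] \<open>y3 = _\<close>[symmetric]
        using sw al by (simp_all only: even_diff even_add even_mult_iff) argo+
    qed (rule i)
    hence "\<forall>i<n. even ((X *\<^sub>v f) $ i - (X' *\<^sub>v f) $ i)" using X X' by (simp add: y_def)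
    thus ?thesis using odds abcn f by blast
  qed
qed

section \<open>Stickelberger's congruence for dual vectors\<close>

definition injections_avoiding :: "nat \<Rightarrow> nat \<Rightarrow> nat \<Rightarrow> nat list set" where
  "injections_avoiding n i m = {gs. length gs = m \<and> distinct gs \<and> set gs \<subseteq> {..<n} - {i}}"

lemma finite_injections_avoiding: "finite (injections_avoiding n i m)"
proof (rule finite_subset)
  show "injections_avoiding n i m \<subseteq> {gs. set gs \<subseteq> {..<n} \<and> length gs = m}"
    by (auto simp: injections_avoiding_def)
  show "finite {gs. set gs \<subseteq> {..<n} \<and> length gs = m}" by (rule finite_lists_length_eq) simp
qed

lemma sum_injections_avoiding_Suc:
  fixes f :: "nat list \<Rightarrow> 'c::comm_monoid_add"
  shows "(\<Sum>gs\<in>injections_avoiding n i (Suc m). f gs) =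
    (\<Sum>hs\<in>injections_avoiding n i m. \<Sum>a\<in>{..<n} - {i} - set hs. f (a # hs))"
proof -
  have "(\<Sum>hs\<in>injections_avoiding n i m. \<Sum>a\<in>{..<n} - {i} - set hs. f (a # hs)) =
      (\<Sum>(hs, a)\<in>(SIGMA hs:injections_avoiding n i m. {..<n} - {i} - set hs). f (a # hs))"
    by (rule sum.Sigma) (simp_all add: finite_injections_avoiding)
  also have "\<dots> = (\<Sum>gs\<in>injections_avoiding n i (Suc m). f gs)"
    by (rule sum.reindex_bij_witness[where i = "\<lambda>gs. (tl gs, hd gs)" and j = "\<lambda>(hs, a). a # hs"])
       (auto simp: injections_avoiding_def length_Suc_conv)
  finally show ?thesis by simp
qed

text \<open>A sum over injections into the embeddings other than \<open>\<sigma>\<^sub>i\<close> is the image under \<open>\<sigma>\<^sub>i\<close> of one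
  integer of the field, the same for all \<open>i\<close>. The value of a further argument ranges over
  all embeddings except \<open>\<sigma>\<^sub>i\<close> and those already used, so inclusion-exclusion expresses the sum through
  traces and shorter sums.\<close>

lemma injection_sum_in_field:
  fixes K :: "'a::field_char_0 set"
  assumes K: "number_field K" and xs: "set xs \<subseteq> ring_of_integers K"
  shows "\<exists>w\<in>ring_of_integers K. \<forall>i<nf_degree K. emb K i w =
    (\<Sum>gs\<in>injections_avoiding (nf_degree K) i (length xs). \<Prod>k<length xs. emb K (gs ! k) (xs ! k))"
  using xs
proof (induction "length xs" arbitrary: xs)
  case 0
  have "injections_avoiding (nf_degree K) i 0 = {[]}" for i by (auto simp: injections_avoiding_def)
  thus ?case using 0 roi_1[OF number_fieldD[OF K]] field_homD(1)[OF emb_hom[OF K]]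
    by (intro bexI[of _ 1]) auto
next
  case (Suc m)
  have Kf: "is_subfield K" using K by (rule number_fieldD)
  define n where "n = nf_degree K"
  obtain x ys where xs: "xs = x # ys" "length ys = m" using Suc(2) by (metis length_Suc_conv)
  have x: "x \<in> ring_of_integers K" and ys: "set ys \<subseteq> ring_of_integers K" using Suc(3) xs by auto
  define F where "F i zs = (\<Sum>gs\<in>injections_avoiding n i m. \<Prod>k<m. emb K (gs ! k) (zs ! k))" for i and zs :: "'a list"
  have IH: "\<exists>w\<in>ring_of_integers K. \<forall>i<n. emb K i w = F i zs"
    if "length zs = m" "set zs \<subseteq> ring_of_integers K" for zs
    using Suc(1)[of zs] that unfolding F_def n_def by simp
  define zs where "zs k = ys[k := ys ! k * x]" for k
  have zs: "length (zs k) = m" "set (zs k) \<subseteq> ring_of_integers K" if "k < m" for k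
  proof -
    show "length (zs k) = m" by (simp add: zs_def xs(2))
    have "ys ! k * x \<in> ring_of_integers K"
      using that ys x xs(2) by (intro roi_closed(4)[OF Kf]) auto
    thus "set (zs k) \<subseteq> ring_of_integers K"
      using ys set_update_subset_insert[of ys k "ys ! k * x"] unfolding zs_def by auto
  qed
  obtain w0 where w0: "w0 \<in> ring_of_integers K" "\<forall>i<n. emb K i w0 = F i ys"
    using IH[OF xs(2) ys] by blast
  have "\<forall>k. \<exists>w. k < m \<longrightarrow> w \<in> ring_of_integers K \<and> (\<forall>i<n. emb K i w = F i (zs k))"
    using IH[OF zs] by blast
  then obtain w where w: "\<And>k. k < m \<Longrightarrow> w k \<in> ring_of_integers K"
    "\<And>k i. k < m \<Longrightarrow> i < n \<Longrightarrow> emb K i (w k) = F i (zs k)" by metis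
  define W where "W = (of_int (itrace K x) - x) * w0 - (\<Sum>k<m. w k)"
  have W: "W \<in> ring_of_integers K"
    unfolding W_def by (intro roi_closed[OF Kf] roi_sum[OF Kf] x w0(1) w(1)) simp_all
  have "emb K i W = (\<Sum>gs\<in>injections_avoiding n i (Suc m). \<Prod>k<Suc m. emb K (gs ! k) (xs ! k))"
    if i: "i < n" for i
  proof -
    have h: "field_hom K UNIV (emb K a)" if "a < n" for a using emb_hom[OF K] that n_def by simp
    have inner: "(\<Sum>a\<in>{..<n} - {i} - set hs. emb K a x) =
        of_int (itrace K x) - emb K i x - (\<Sum>k<m. emb K (hs ! k) x)"
      if hs: "hs \<in> injections_avoiding n i m" for hs
    proof -
      have "(\<Sum>a<n. emb K a x) = (\<Sum>a\<in>insert i (set hs). emb K a x) + (\<Sum>a\<in>{..<n} - insert i (set hs). emb K a x)"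
        using hs i by (subst add.commute, intro sum.subset_diff) (auto simp: injections_avoiding_def)
      also have "(\<Sum>a\<in>insert i (set hs). emb K a x) = emb K i x + (\<Sum>a\<in>set hs. emb K a x)"
        using hs by (subst sum.insert) (auto simp: injections_avoiding_def)
      also have "(\<Sum>a\<in>set hs. emb K a x) = (\<Sum>k<m. emb K (hs ! k) x)"
        using hs sum.reindex_bij_betw[OF bij_betw_nth[of hs "{..<m}" "set hs"], of "\<lambda>a. emb K a x"]
        by (simp add: injections_avoiding_def)
      also have "{..<n} - insert i (set hs) = {..<n} - {i} - set hs" by auto
      finally show ?thesis using itrace_emb[OF K x] by (simp add: n_def)
    qed
    have "(\<Sum>gs\<in>injections_avoiding n i (Suc m). \<Prod>k<Suc m. emb K (gs ! k) (xs ! k)) =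
        (\<Sum>hs\<in>injections_avoiding n i m. \<Sum>a\<in>{..<n} - {i} - set hs.
          emb K a x * (\<Prod>k<m. emb K (hs ! k) (ys ! k)))"
      unfolding sum_injections_avoiding_Suc prod.lessThan_Suc_shift by (simp add: xs(1))
    also have "\<dots> = (\<Sum>hs\<in>injections_avoiding n i m.
        (of_int (itrace K x) - emb K i x - (\<Sum>k<m. emb K (hs ! k) x)) * (\<Prod>k<m. emb K (hs ! k) (ys ! k)))"
      by (intro sum.cong refl) (simp only: sum_distrib_right[symmetric] inner)
    also have "\<dots> = (\<Sum>hs\<in>injections_avoiding n i m.
        (of_int (itrace K x) - emb K i x) * (\<Prod>k<m. emb K (hs ! k) (ys ! k)) -
        (\<Sum>k<m. emb K (hs ! k) x * (\<Prod>l<m. emb K (hs ! l) (ys ! l))))"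
      by (intro sum.cong refl) (simp only: left_diff_distrib sum_distrib_right)
    also have "\<dots> = (of_int (itrace K x) - emb K i x) * F i ys -
        (\<Sum>k<m. \<Sum>hs\<in>injections_avoiding n i m. emb K (hs ! k) x * (\<Prod>l<m. emb K (hs ! l) (ys ! l)))"
      unfolding sum_subtractf F_def sum_distrib_left by (subst sum.swap) (rule refl)
    also have "(\<Sum>k<m. \<Sum>hs\<in>injections_avoiding n i m. emb K (hs ! k) x * (\<Prod>l<m. emb K (hs ! l) (ys ! l))) =
        (\<Sum>k<m. F i (zs k))"
      unfolding F_def
    proof (intro sum.cong refl)
      fix k hs assume k: "k \<in> {..<m}" and hs: "hs \<in> injections_avoiding n i m"
      have "hs ! k < n" using hs k by (force simp: injections_avoiding_def)
      moreover have "ys ! k \<in> ring_of_integers K" using k ys xs(2) by auto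
      hence "ys ! k \<in> K" "x \<in> K" using x by (simp_all add: roiD(1))
      ultimately have hk: "emb K (hs ! k) (ys ! k * x) = emb K (hs ! k) (ys ! k) * emb K (hs ! k) x"
        by (intro field_homD(3)[OF h])
      have "(\<Prod>l<m. emb K (hs ! l) (zs k ! l)) =
          (\<Prod>l<m. emb K (hs ! l) (ys ! l) * (if l = k then emb K (hs ! k) x else 1))"
        using k xs(2) hk by (intro prod.cong refl) (auto simp: zs_def nth_list_update)
      also have "\<dots> = (\<Prod>l<m. emb K (hs ! l) (ys ! l)) * emb K (hs ! k) x"
        using k by (simp add: prod.distrib)
      finally show "emb K (hs ! k) x * (\<Prod>l<m. emb K (hs ! l) (ys ! l)) = (\<Prod>l<m. emb K (hs ! l) (zs k ! l))"
        by (simp only: mult.commute)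
    qed
    also have "(of_int (itrace K x) - emb K i x) * F i ys - (\<Sum>k<m. F i (zs k)) = emb K i W"
    proof -
      have "emb K i W = emb K i ((of_int (itrace K x) - x) * w0) - emb K i (\<Sum>k<m. w k)"
        unfolding W_def using i w(1) w0(1) x
        by (intro field_hom_diff[OF Kf h] subfieldD(4)[OF Kf] subfield_diff[OF Kf] subfield_sum[OF Kf]
            subfield_of_int[OF Kf]) (auto dest: roiD(1))
      also have "emb K i (\<Sum>k<m. w k) = (\<Sum>k<m. F i (zs k))"
        using w i by (subst field_hom_sum[OF Kf h]) (auto dest: roiD(1))
      also have "emb K i ((of_int (itrace K x) - x) * w0) = (of_int (itrace K x) - emb K i x) * F i ys"
        using i w0 x subfield_of_int[OF Kf]
        by (simp add: field_homD(3)[OF h] field_hom_diff[OF Kf h] field_hom_of_int[OF Kf h]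
            subfield_diff[OF Kf] roiD(1))
      finally show ?thesis by simp
    qed
    finally show ?thesis by simp
  qed
  thus ?case using W unfolding Suc(2)[symmetric] n_def by blast
qed

text \<open>The bijections from the columns of a minor to the rows other than \<open>i\<close>, written once as permutations
  followed by the renumbering \<open>insert_index i\<close> and once as lists of row numbers.\<close>

lemma sum_permutations_injections_avoiding:
  fixes f :: "nat \<Rightarrow> nat \<Rightarrow> 'c::comm_semiring_1"
  assumes i: "i < Suc m"
  shows "(\<Sum>p | p permutes {0..<m}. \<Prod>b<m. f (insert_index i (p b)) b) =
    (\<Sum>gs\<in>injections_avoiding (Suc m) i m. \<Prod>b<m. f (gs ! b) b)"
proof (rule sum.reindex_bij_witness[where j = "\<lambda>p. map (\<lambda>b. insert_index i (p b)) [0..<m]"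
      and i = "\<lambda>gs b. if b < m then delete_index i (gs ! b) else b"])
  fix p assume "p \<in> {p. p permutes {0..<m}}"
  hence p: "p permutes {0..<m}" by simp
  have pm: "p b < m" if "b < m" for b using permutes_in_image[OF p, of b] that by simp
  show "(\<lambda>b. if b < m then delete_index i (map (\<lambda>b. insert_index i (p b)) [0..<m] ! b) else b) = p"
    using permutes_not_in[OF p] by (auto simp: fun_eq_iff)
  have "inj_on (\<lambda>b. insert_index i (p b)) {0..<m}"
  proof (rule inj_onI)
    fix b c assume "insert_index i (p b) = insert_index i (p c)"
    hence "p b = p c" by (metis delete_insert_index)
    thus "b = c" using permutes_inj[OF p] by (simp add: inj_eq)
  qed
  moreover have "insert_index i (p b) < Suc m" "insert_index i (p b) \<noteq> i" if "b < m" for b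
    using pm[OF that] by (auto simp: insert_index_def)
  ultimately show "map (\<lambda>b. insert_index i (p b)) [0..<m] \<in> injections_avoiding (Suc m) i m"
    by (auto simp: injections_avoiding_def distinct_map)
  show "(\<Prod>b<m. f (map (\<lambda>b. insert_index i (p b)) [0..<m] ! b) b) = (\<Prod>b<m. f (insert_index i (p b)) b)"
    by (intro prod.cong refl) simp
next
  fix gs assume gs: "gs \<in> injections_avoiding (Suc m) i m"
  have g: "gs ! b < Suc m" "gs ! b \<noteq> i" if "b < m" for b
  proof -
    have "gs ! b \<in> set gs" using that gs by (auto simp: injections_avoiding_def)
    thus "gs ! b < Suc m" "gs ! b \<noteq> i" using gs by (auto simp: injections_avoiding_def)
  qed
  have id: "insert_index i (delete_index i (gs ! b)) = gs ! b" if "b < m" for b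
    using g[OF that] by (simp add: insert_delete_index)
  show "map (\<lambda>b. insert_index i (if b < m then delete_index i (gs ! b) else b)) [0..<m] = gs"
    using gs id by (intro nth_equalityI) (auto simp: injections_avoiding_def)
  have "(\<lambda>b. if b < m then delete_index i (gs ! b) else b) permutes {0..<m}"
  proof (rule bij_imp_permutes)
    have inj: "inj_on (\<lambda>b. if b < m then delete_index i (gs ! b) else b) {0..<m}"
    proof (rule inj_onI)
      fix b c assume bc: "b \<in> {0..<m}" "c \<in> {0..<m}"
        "(if b < m then delete_index i (gs ! b) else b) = (if c < m then delete_index i (gs ! c) else c)"
      hence bm: "b < m" "c < m" and eq: "delete_index i (gs ! b) = delete_index i (gs ! c)" by simp_all
      have "gs ! b = gs ! c" using id[OF bm(1)] id[OF bm(2)] unfolding eq by (rule trans[OF sym])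
      thus "b = c" using gs bc by (simp add: injections_avoiding_def nth_eq_iff_index_eq)
    qed
    moreover have "(\<lambda>b. if b < m then delete_index i (gs ! b) else b) ` {0..<m} \<subseteq> {0..<m}"
    proof -
      have "delete_index i (gs ! b) < m" if "b < m" for b
        using g[OF that] i by (auto simp: delete_index_def)
      thus ?thesis by auto
    qed
    ultimately show "bij_betw (\<lambda>b. if b < m then delete_index i (gs ! b) else b) {0..<m} {0..<m}"
      by (intro bij_betw_imageI endo_inj_surj) simp_all
  qed auto
  thus "(\<lambda>b. if b < m then delete_index i (gs ! b) else b) \<in> {p. p permutes {0..<m}}" by simp
qed

text \<open>Up to the factor \<open>det V\<close>, the cofactors of the matrix \<open>V\<close> of conjugates of an integral basis are
  the conjugates of the dual basis. A determinant and the corresponding permanent differ by twice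
  the sum over the odd permutations; the permanents are the conjugates of integers of the field.\<close>

theorem stickelberger_dual_basis:
  assumes K: "number_field K" and n: "n = nf_degree K" and e: "zbasis K e"
  shows "\<exists>X\<in>carrier_mat n n. \<forall>i<n. \<forall>j<n.
    algebraic_int (((conj_mat K e * map_mat of_int X) $$ (i, j) + cofactor (conj_mat K e) i j) / 2)"
proof -
  have Kf: "is_subfield K" using K by (rule number_fieldD)
  define V where "V = conj_mat K e"
  have V: "V \<in> carrier_mat n n" by (simp add: V_def n)
  have Vint: "algebraic_int (V $$ (i, j))" if "i < n" "j < n" for i j
    using that n zbasisD(1)[OF e] by (auto simp: V_def intro!: algebraic_int_hom[OF Kf emb_hom[OF K]])
  have "\<exists>w\<in>ring_of_integers K. \<forall>i<n. algebraic_int ((emb K i w + cofactor V i j) / 2)" if j: "j < n" for j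
  proof -
    obtain m where m: "n = Suc m" using j by (cases n) auto
    define xs where "xs = map (\<lambda>b. e (insert_index j b)) [0..<m]"
    have ins: "insert_index k b < n" if "b < m" for k b using that m by (simp add: insert_index_def)
    have "set xs \<subseteq> ring_of_integers K"
      using ins n zbasisD(1)[OF e] by (auto simp: xs_def)
    from injection_sum_in_field[OF K this] obtain w where w: "w \<in> ring_of_integers K"
      "\<And>i. i < n \<Longrightarrow> emb K i w = (\<Sum>gs\<in>injections_avoiding n i m. \<Prod>b<m. emb K (gs ! b) (xs ! b))"
      unfolding n[symmetric] by (auto simp: xs_def)
    have "algebraic_int ((emb K i w + cofactor V i j) / 2)" if i: "i < n" for i
    proof -
      define T where "T p = (\<Prod>b<m. V $$ (insert_index i (p b), insert_index j b))" for p
      have perm: "emb K i w = (\<Sum>p | p permutes {0..<m}. T p)"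
      proof -
        have "(\<Sum>p | p permutes {0..<m}. T p) =
            (\<Sum>gs\<in>injections_avoiding (Suc m) i m. \<Prod>b<m. V $$ (gs ! b, insert_index j b))"
          unfolding T_def by (rule sum_permutations_injections_avoiding) (use i m in simp)
        also have "\<dots> = emb K i w" unfolding w(2)[OF i] m[symmetric]
        proof (intro sum.cong prod.cong refl)
          fix gs b assume gs: "gs \<in> injections_avoiding n i m" and b: "b \<in> {..<m}"
          have "gs ! b < n" using gs b by (force simp: injections_avoiding_def)
          thus "V $$ (gs ! b, insert_index j b) = emb K (gs ! b) (xs ! b)"
            using b ins[of b j] n by (simp add: V_def xs_def)
        qed
        finally show ?thesis by simp
      qed
      have D: "mat_delete V i j \<in> carrier_mat m m" using mat_delete_carrier[OF V, of i j] m by simp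
      have det: "det (mat_delete V i j) = (\<Sum>p | p permutes {0..<m}. signof p * T p)"
      proof -
        have "det (mat_delete V i j) = det (transpose_mat (mat_delete V i j))"
          using det_transpose[OF D] by simp
        also have "\<dots> = (\<Sum>p | p permutes {0..<m}. signof p *
            (\<Prod>b = 0..<m. transpose_mat (mat_delete V i j) $$ (b, p b)))"
          by (rule det_def') (use D in simp)
        also have "\<dots> = (\<Sum>p | p permutes {0..<m}. signof p * T p)"
        proof (intro sum.cong refl arg_cong2[where f = "(*)"])
          fix p assume "p \<in> {p. p permutes {0..<m}}"
          hence pm: "p b < m" if "b < m" for b using permutes_in_image[of p "{0..<m}" b] that by simp
          show "(\<Prod>b = 0..<m. transpose_mat (mat_delete V i j) $$ (b, p b)) = T p"
            unfolding T_def atLeast0LessThan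
          proof (intro prod.cong refl)
            fix b assume "b \<in> {..<m}"
            hence b: "b < m" by simp
            show "transpose_mat (mat_delete V i j) $$ (b, p b) = V $$ (insert_index i (p b), insert_index j b)"
              using b pm[OF b] D V m by (auto simp: mat_delete_def insert_index_def)
          qed
        qed
        finally show ?thesis .
      qed
      have Tint: "algebraic_int (T p)" if p: "p permutes {0..<m}" for p
        unfolding T_def
      proof (rule algebraic_int_prod)
        fix b assume "b \<in> {..<m}"
        hence b: "b < m" by simp
        have "p b < m" using permutes_in_image[OF p, of b] b by simp
        thus "algebraic_int (V $$ (insert_index i (p b), insert_index j b))"
          by (intro Vint ins b)
      qed
      have half: "algebraic_int ((emb K i w + det (mat_delete V i j)) / 2)"
      proof -
        have "(emb K i w + det (mat_delete V i j)) / 2 =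
            (\<Sum>p | p permutes {0..<m}. (if sign p = 1 then 1 else 0) * T p)"
          unfolding perm det sum.distrib[symmetric] sum_divide_distrib
          by (intro sum.cong refl) (auto simp: sign_def field_simps)
        also have "algebraic_int \<dots>"
          by (intro algebraic_int_sum algebraic_int_mult) (auto intro: Tint)
        finally show ?thesis .
      qed
      have dint: "algebraic_int (det (mat_delete V i j))"
        unfolding det
      proof (intro algebraic_int_sum algebraic_int_mult)
        fix p assume "p \<in> {p. p permutes {0..<m}}"
        thus "algebraic_int (signof p :: complex)" "algebraic_int (T p)" by (simp_all add: sign_def Tint)
      qed
      show ?thesis
      proof (cases "even (i + j)")
        case True
        thus ?thesis using half by (simp add: cofactor_def)
      next
        case False
        hence "(emb K i w + cofactor V i j) / 2 = (emb K i w + det (mat_delete V i j)) / 2 - det (mat_delete V i j)"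
          by (simp add: cofactor_def field_simps)
        thus ?thesis by (simp only: algebraic_int_diff[OF half dint])
      qed
    qed
    thus ?thesis using w(1) by blast
  qed
  hence "\<forall>j. \<exists>w. j < n \<longrightarrow> w \<in> ring_of_integers K \<and>
      (\<forall>i<n. algebraic_int ((emb K i w + cofactor V i j) / 2))" by blast
  then obtain w where w: "\<And>j. j < n \<Longrightarrow> w j \<in> ring_of_integers K"
    "\<And>i j. i < n \<Longrightarrow> j < n \<Longrightarrow> algebraic_int ((emb K i (w j) + cofactor V i j) / 2)" by metis
  have "\<forall>j. \<exists>q :: nat \<Rightarrow> int. j < n \<longrightarrow> w j = (\<Sum>k<n. of_int (q k) * e k)"
    using zbasisD(2)[OF e w(1)] n by blast
  then obtain q :: "nat \<Rightarrow> nat \<Rightarrow> int" where q: "\<And>j. j < n \<Longrightarrow> w j = (\<Sum>k<n. of_int (q j k) * e k)"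
    by metis
  define X where "X = mat n n (\<lambda>(k, j). q j k)"
  have X: "X \<in> carrier_mat n n" by (simp add: X_def)
  have "conj_mat K w = V * map_mat of_int X"
    unfolding V_def by (rule conj_mat_int_combination[OF K n _ _ X])
       (use zbasisD(1)[OF e] q n in \<open>auto dest: roiD(1) simp: X_def\<close>)
  hence "(V * map_mat of_int X) $$ (i, j) = emb K i (w j)" if "i < n" "j < n" for i j
    using that n by (metis conj_mat_index)
  thus ?thesis using w(2) X unfolding V_def by (intro bexI[of _ X]) auto
qed

section \<open>Fundamental discriminants\<close>

lemma fundamental_discriminant_cases:
  assumes "fundamental_discriminant d"
  obtains (odd) "d mod 4 = 1" "squarefree d"
  | (even) m where "d = 4 * m" "squarefree m" "m mod 4 = 2 \<or> m mod 4 = 3"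
  using assms by (auto simp: fundamental_discriminant_def cong_def)

lemma fundamental_discriminant_prime_square:
  assumes d: "fundamental_discriminant d" and p: "prime p" "p\<^sup>2 dvd d"
  shows "p = 2"
  using d
proof (cases rule: fundamental_discriminant_cases)
  case odd
  hence "is_unit p" using p(2) by (simp add: squarefree_def)
  thus ?thesis using p(1) by (simp add: prime_int_iff)
next
  case (even m)
  show ?thesis
  proof (rule ccontr)
    assume "p \<noteq> 2"
    hence "coprime p 2" using p(1) by (intro primes_coprime) auto
    hence "coprime (p\<^sup>2) (2\<^sup>2)" by (simp only: coprime_power_left_iff coprime_power_right_iff simp_thms)
    moreover have "(2 :: int)\<^sup>2 = 4" by simp
    ultimately have "coprime (p\<^sup>2) 4" by (simp only:)
    hence "p\<^sup>2 dvd m" using p(2) even(1) by (simp add: coprime_dvd_mult_right_iff)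
    hence "is_unit p" using even(2) by (simp add: squarefree_def)
    thus False using p(1) by (simp add: prime_int_iff)
  qed
qed

lemma fundamental_discriminant_not_16:
  assumes "fundamental_discriminant d"
  shows "\<not> 16 dvd d"
  using assms
proof (cases rule: fundamental_discriminant_cases)
  case odd
  thus ?thesis by presburger
next
  case (even m)
  thus ?thesis by presburger
qed

text \<open>The integers of \<open>\<rat>(\<surd>m)\<close> are \<open>\<int>[\<surd>m]\<close> for \<open>m \<equiv> 2, 3\<close> modulo 4: the trace \<open>2 r = a\<close> and the norm
  \<open>r\<^sup>2 - m s\<^sup>2\<close> are integers, so \<open>2 s = u\<close> is an integer with \<open>m u\<^sup>2 \<equiv> a\<^sup>2\<close> modulo 4, and \<open>u\<close> and \<open>a\<close> are even.\<close>

lemma integers_of_quadratic_field: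
  fixes t :: complex and r s :: rat and m :: int
  assumes t: "t\<^sup>2 = of_int m" and m: "squarefree m" "m mod 4 = 2 \<or> m mod 4 = 3"
    and i: "algebraic_int (of_rat r + of_rat s * t)" "algebraic_int (of_rat r - of_rat s * t)"
  shows "r \<in> \<int>" "s \<in> \<int>"
proof -
  have rat_int: "q \<in> \<int>" if "algebraic_int (of_rat q :: complex)" for q :: rat
  proof -
    have "(of_rat q :: complex) \<in> \<int>" using that by (intro rational_algebraic_int_is_int) auto
    then obtain k where "(of_rat q :: complex) = of_int k" by (auto elim: Ints_cases)
    hence "q = of_int k" by (metis of_rat_eq_iff of_rat_of_int_eq)
    thus ?thesis by simp
  qed
  have "algebraic_int (of_rat (2 * r) :: complex)"
    using algebraic_int_add[OF i] by (simp add: of_rat_mult)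
  then obtain a where a: "2 * r = of_int a" using rat_int[of "2 * r"] by (auto elim: Ints_cases)
  have "algebraic_int (of_rat (r\<^sup>2 - s\<^sup>2 * of_int m) :: complex)"
  proof -
    have "(of_rat r + of_rat s * t) * (of_rat r - of_rat s * t) = of_rat r ^ 2 - of_rat s ^ 2 * t\<^sup>2"
      by (simp add: algebra_simps power2_eq_square)
    also have "\<dots> = of_rat (r\<^sup>2 - s\<^sup>2 * of_int m)"
      unfolding t by (simp add: of_rat_diff of_rat_mult of_rat_power)
    finally show ?thesis using algebraic_int_mult[OF i] by simp
  qed
  then obtain c where c: "r\<^sup>2 - s\<^sup>2 * of_int m = of_int c" using rat_int by (auto elim: Ints_cases)
  obtain u v where uv: "quotient_of (2 * s) = (u, v)" by force
  have v: "v > 0" and cop: "coprime u v"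
    using quotient_of_denom_pos[OF uv] quotient_of_coprime[OF uv] .
  have s: "2 * s = of_int u / of_int v" using quotient_of_div[OF uv] .
  have "(2 * s)\<^sup>2 * of_int m = (2 * r)\<^sup>2 - 4 * of_int c"
    using c by (simp add: power2_eq_square algebra_simps)
  hence "of_int u ^ 2 * of_int m = (of_int a ^ 2 - 4 * of_int c) * (of_int v ^ 2 :: rat)"
    using v unfolding s a by (simp add: field_simps)
  hence "(of_int (u\<^sup>2 * m) :: rat) = of_int ((a\<^sup>2 - 4 * c) * v\<^sup>2)" by simp
  hence eq: "u\<^sup>2 * m = (a\<^sup>2 - 4 * c) * v\<^sup>2" by (simp only: of_int_eq_iff)
  hence "v\<^sup>2 dvd u\<^sup>2 * m" by simp
  moreover have "coprime (v\<^sup>2) (u\<^sup>2)" using cop by (simp add: coprime_commute)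
  ultimately have "v\<^sup>2 dvd m" by (simp add: coprime_dvd_mult_right_iff)
  hence "v dvd 1" using m(1) unfolding squarefree_def by blast
  hence "v = 1" using v by simp
  with eq have eq: "u\<^sup>2 * m = a\<^sup>2 - 4 * c" by simp
  have sq: "x\<^sup>2 mod 4 = (if even x then 0 else 1)" for x :: int
  proof (cases "even x")
    case True
    then obtain y where "x = 2 * y" by blast
    thus ?thesis by simp
  next
    case False
    then obtain y where "x = 2 * y + 1" by (elim oddE)
    hence "x\<^sup>2 = 4 * (y\<^sup>2 + y) + 1" by (simp add: power2_eq_square algebra_simps)
    thus ?thesis using False by presburger
  qed
  have "(u\<^sup>2 mod 4) * (m mod 4) mod 4 = a\<^sup>2 mod 4" using eq by (metis mod_mult_eq mod_diff_right_eq
      diff_zero mod_mult_self2_is_0 mult.commute)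
  hence "even u \<and> even a" using m(2) unfolding sq by (auto split: if_splits)
  then obtain u' a' where "u = 2 * u'" "a = 2 * a'" by (auto elim!: evenE)
  hence "s = of_int u'" "r = of_int a'" using a s \<open>v = 1\<close> by simp_all
  thus "r \<in> \<int>" "s \<in> \<int>" by simp_all
qed

text \<open>This is the second elementary symmetric function of the values of \<open>f\<close>.\<close>

lemma algebraic_int_second_symmetric:
  fixes f :: "nat \<Rightarrow> complex"
  assumes "\<And>k. k < n \<Longrightarrow> algebraic_int (f k)"
  shows "algebraic_int (((\<Sum>k<n. f k)\<^sup>2 - (\<Sum>k<n. f k * f k)) / 2)"
  using assms
proof (induction n)
  case (Suc n)
  have "((\<Sum>k<Suc n. f k)\<^sup>2 - (\<Sum>k<Suc n. f k * f k)) / 2 =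
      ((\<Sum>k<n. f k)\<^sup>2 - (\<Sum>k<n. f k * f k)) / 2 + (\<Sum>k<n. f k) * f n"
    by (simp add: power2_eq_square field_simps)
  also have "algebraic_int \<dots>"
    using Suc by (intro algebraic_int_add algebraic_int_mult algebraic_int_sum) auto
  finally show ?case .
qed simp

text \<open>The columns of \<open>V X\<close> are congruent modulo 2 to those of the cofactor matrix \<open>C\<close>. For \<open>d = 4 m\<close> the matrix \<open>X\<close>
  is alternating modulo 2, with columns in the kernel of \<open>S\<close>. With \<open>t = \<delta> / 2\<close>, a square root of \<open>m\<close>, the vectors
  \<open>a\<^sub>j = (V X + C)\<^sub>j / 2\<close> and \<open>b\<^sub>j = (V X - C)\<^sub>j / 2\<close> are integral, and their pairings with the columns of \<open>V\<close> and with
  each other are conjugate elements \<open>r \<plusminus> s t\<close>; by \<open>integers_of_quadratic_field\<close> the numbers \<open>r\<close> and \<open>s\<close> are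
  integers. The diagonal uses that the sum of squares of the entries of \<open>a\<^sub>j\<close> is congruent to the square of their
  sum modulo 2.\<close>

lemma stickelberger_matrix_alternating:
  fixes v c :: "nat \<Rightarrow> nat \<Rightarrow> complex" and S A X :: "nat \<Rightarrow> nat \<Rightarrow> int" and \<kappa> :: "nat \<Rightarrow> int"
  assumes vv: "\<And>i j. i < n \<Longrightarrow> j < n \<Longrightarrow> (\<Sum>k<n. v k i * v k j) = of_int (S i j)"
    and vc: "\<And>i j. i < n \<Longrightarrow> j < n \<Longrightarrow> (\<Sum>k<n. v k i * c k j) = (if i = j then \<delta> else 0)"
    and cc: "\<And>i j. i < n \<Longrightarrow> j < n \<Longrightarrow> (\<Sum>k<n. c k i * c k j) = of_int (A i j)"
    and iv: "\<And>i j. i < n \<Longrightarrow> j < n \<Longrightarrow> algebraic_int (v i j)"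
    and ic: "\<And>i j. i < n \<Longrightarrow> j < n \<Longrightarrow> algebraic_int (c i j)"
    and st: "\<And>i j. i < n \<Longrightarrow> j < n \<Longrightarrow> algebraic_int (((\<Sum>l<n. v i l * of_int (X l j)) + c i j) / 2)"
    and one: "\<And>k. k < n \<Longrightarrow> (\<Sum>l<n. v k l * of_int (\<kappa> l)) = 1"
    and d: "\<delta>\<^sup>2 = 4 * of_int m" and m: "squarefree m" "m mod 4 = 2 \<or> m mod 4 = 3"
    and ij: "i < n" "j < n"
  shows "even (\<Sum>l<n. S i l * X l j)" "even (X i j - X j i)" "even (X i i)"
proof -
  define t where "t = \<delta> / 2"
  have t: "t\<^sup>2 = of_int m" "\<delta> = 2 * t" using d by (simp_all add: t_def power_divide)
  note quad = integers_of_quadratic_field[OF t(1) m]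
  define w where "w k j = (\<Sum>l<n. v k l * of_int (X l j))" for k j
  define a where "a k j = (w k j + c k j) / 2" for k j
  define b where "b k j = (w k j - c k j) / 2" for k j
  have ia: "algebraic_int (a k j)" if "k < n" "j < n" for k j using st[OF that] by (simp add: a_def w_def)
  have ib: "algebraic_int (b k j)" if "k < n" "j < n" for k j
  proof -
    have "b k j = a k j - c k j" by (simp add: a_def b_def field_simps)
    thus ?thesis using algebraic_int_diff[OF ia[OF that] ic[OF that]] by simp
  qed
  define SX where "SX i j = (\<Sum>l<n. S i l * X l j)" for i j
  have vw: "(\<Sum>k<n. v k i * w k j) = of_int (SX i j)" if "i < n" "j < n" for i j
  proof -
    have "(\<Sum>k<n. v k i * w k j) = (\<Sum>l<n. (\<Sum>k<n. v k i * v k l) * of_int (X l j))"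
      unfolding w_def sum_distrib_left sum_distrib_right by (subst sum.swap) (simp add: mult.assoc)
    also have "\<dots> = of_int (SX i j)" using that by (simp add: vv SX_def)
    finally show ?thesis .
  qed
  have wc: "(\<Sum>k<n. w k i * c k j) = \<delta> * of_int (X j i)" if "i < n" "j < n" for i j
  proof -
    have "(\<Sum>k<n. w k i * c k j) = (\<Sum>l<n. (\<Sum>k<n. v k l * c k j) * of_int (X l i))"
      unfolding w_def sum_distrib_left sum_distrib_right by (subst sum.swap) (simp add: mult_ac)
    also have "\<dots> = (\<Sum>l<n. if l = j then \<delta> * of_int (X j i) else 0)"
      using that by (intro sum.cong refl) (simp add: vc)
    finally show ?thesis using that by simp
  qed
  have ww: "(\<Sum>k<n. w k i * w k j) = of_int (\<Sum>l<n. X l i * SX l j)" if "i < n" "j < n" for i j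
  proof -
    have "(\<Sum>k<n. w k i * w k j) = (\<Sum>l<n. (\<Sum>k<n. v k l * w k j) * of_int (X l i))"
      unfolding w_def[of _ i] sum_distrib_left sum_distrib_right by (subst sum.swap) (simp add: mult_ac)
    thus ?thesis using that by (simp add: vw mult.commute)
  qed
  \<comment> \<open>\<open>SX i j / 2\<close> is the rational part of the pairing of \<open>a\<^sub>j\<close> with a column of \<open>V\<close>\<close>
  have even_SX: "even (SX i j)" if ij: "i < n" "j < n" for i j
  proof -
    have "(\<Sum>k<n. v k i * a k j) = ((\<Sum>k<n. v k i * w k j) + (\<Sum>k<n. v k i * c k j)) / 2"
      unfolding a_def sum.distrib[symmetric] sum_divide_distrib by (intro sum.cong refl) (simp add: algebra_simps)
    hence va: "(\<Sum>k<n. v k i * a k j) = of_rat (of_int (SX i j) / 2) + of_rat (if i = j then 1 else 0) * t"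
      using ij by (simp add: vw vc t(2) of_rat_divide add_divide_distrib)
    have "(\<Sum>k<n. v k i * b k j) = ((\<Sum>k<n. v k i * w k j) - (\<Sum>k<n. v k i * c k j)) / 2"
      unfolding b_def sum_subtractf[symmetric] sum_divide_distrib by (intro sum.cong refl) (simp add: algebra_simps)
    hence vb: "(\<Sum>k<n. v k i * b k j) = of_rat (of_int (SX i j) / 2) - of_rat (if i = j then 1 else 0) * t"
      using ij by (simp add: vw vc t(2) of_rat_divide diff_divide_distrib)
    have "algebraic_int (\<Sum>k<n. v k i * a k j)" "algebraic_int (\<Sum>k<n. v k i * b k j)"
      using ij by (auto intro!: algebraic_int_sum algebraic_int_mult iv ia ib)
    hence "(of_int (SX i j) / 2 :: rat) \<in> \<int>" unfolding va vb by (rule quad(1))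
    then obtain z where "(of_int (SX i j) / 2 :: rat) = of_int z" by (auto elim: Ints_cases)
    hence "(of_int (SX i j) :: rat) = of_int (2 * z)" by simp
    hence "SX i j = 2 * z" by (simp only: of_int_eq_iff)
    thus ?thesis by simp
  qed
  thus "even (\<Sum>l<n. S i l * X l j)" using ij by (simp add: SX_def)
  define XSX where "XSX i j = (\<Sum>l<n. X l i * SX l j)" for i j
  define R where "R i j = (of_int (XSX i j + A i j) / 4 :: rat)" for i j
  have R: "of_rat (R i j) = (of_int (XSX i j) + of_int (A i j)) / (4 :: complex)" for i j
    by (simp add: R_def of_rat_divide of_rat_add)
  have half: "of_rat (of_int (X i j + X j i) / 2) = (of_int (X i j) + of_int (X j i)) / (2 :: complex)" for i j
    by (simp add: of_rat_divide of_rat_add)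
  have aa: "(\<Sum>k<n. a k i * a k j) = of_rat (R i j) + of_rat (of_int (X i j + X j i) / 2) * t"
    and bb: "(\<Sum>k<n. b k i * b k j) = of_rat (R i j) - of_rat (of_int (X i j + X j i) / 2) * t"
    if ij: "i < n" "j < n" for i j
  proof -
    have 1: "a k i * a k j = (w k i * w k j + c k i * c k j + (w k i * c k j + w k j * c k i)) / 4"
      and 2: "b k i * b k j = (w k i * w k j + c k i * c k j - (w k i * c k j + w k j * c k i)) / 4" for k
      by (simp_all add: a_def b_def field_simps)
    have 3: "(\<Sum>k<n. a k i * a k j) =
        (of_int (XSX i j) + of_int (A i j) + (\<delta> * of_int (X j i) + \<delta> * of_int (X i j))) / 4"
      unfolding 1 sum_divide_distrib[symmetric] sum.distrib
      by (simp only: ww[OF ij] cc[OF ij] wc[OF ij] wc[OF ij(2,1)] XSX_def)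
    have 4: "(\<Sum>k<n. b k i * b k j) =
        (of_int (XSX i j) + of_int (A i j) - (\<delta> * of_int (X j i) + \<delta> * of_int (X i j))) / 4"
      unfolding 2 sum_divide_distrib[symmetric] sum.distrib sum_subtractf
      by (simp only: ww[OF ij] cc[OF ij] wc[OF ij] wc[OF ij(2,1)] XSX_def)
    show "(\<Sum>k<n. a k i * a k j) = of_rat (R i j) + of_rat (of_int (X i j + X j i) / 2) * t"
      unfolding 3 R half t(2) by (simp add: field_simps)
    show "(\<Sum>k<n. b k i * b k j) = of_rat (R i j) - of_rat (of_int (X i j + X j i) / 2) * t"
      unfolding 4 R half t(2) by (simp add: field_simps)
  qed
  have "(of_int (X i j + X j i) / 2 :: rat) \<in> \<int>"
  proof (rule quad(2))
    show "algebraic_int (of_rat (R i j) + of_rat (of_int (X i j + X j i) / 2) * t)"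
      unfolding aa[OF ij, symmetric] using ij by (intro algebraic_int_sum algebraic_int_mult ia) auto
    show "algebraic_int (of_rat (R i j) - of_rat (of_int (X i j + X j i) / 2) * t)"
      unfolding bb[OF ij, symmetric] using ij by (intro algebraic_int_sum algebraic_int_mult ib) auto
  qed
  then obtain z where "(of_int (X i j + X j i) / 2 :: rat) = of_int z" by (auto elim: Ints_cases)
  hence "(of_int (X i j + X j i) :: rat) = of_int (2 * z)" by simp
  hence "X i j + X j i = 2 * z" by (simp only: of_int_eq_iff)
  thus "even (X i j - X j i)" by presburger
  \<comment> \<open>the diagonal, from the second elementary symmetric function of \<open>a\<^sub>i\<close>\<close>
  define P where "P = (\<Sum>l<n. \<kappa> l * SX l i)"
  have sw: "(\<Sum>k<n. w k i) = of_int P"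
  proof -
    have "(\<Sum>k<n. w k i) = (\<Sum>k<n. (\<Sum>l<n. v k l * of_int (\<kappa> l)) * w k i)"
      by (intro sum.cong refl) (simp add: one)
    also have "\<dots> = (\<Sum>l<n. of_int (\<kappa> l) * (\<Sum>k<n. v k l * w k i))"
      unfolding sum_distrib_right sum_distrib_left by (subst sum.swap) (simp add: mult_ac)
    finally show ?thesis using ij by (simp add: vw P_def)
  qed
  have sc: "(\<Sum>k<n. c k i) = \<delta> * of_int (\<kappa> i)"
  proof -
    have "(\<Sum>k<n. c k i) = (\<Sum>k<n. (\<Sum>l<n. v k l * of_int (\<kappa> l)) * c k i)"
      by (intro sum.cong refl) (simp add: one)
    also have "\<dots> = (\<Sum>l<n. of_int (\<kappa> l) * (\<Sum>k<n. v k l * c k i))"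
      unfolding sum_distrib_right sum_distrib_left by (subst sum.swap) (simp add: mult_ac)
    also have "\<dots> = (\<Sum>l<n. if l = i then \<delta> * of_int (\<kappa> i) else 0)"
      using ij by (intro sum.cong refl) (simp add: vc)
    finally show ?thesis using ij by simp
  qed
  have "even P" unfolding P_def using ij by (intro dvd_sum) (auto intro: even_SX)
  then obtain p where p: "P = 2 * p" by blast
  have sa: "(\<Sum>k<n. a k i) = of_int p + of_int (\<kappa> i) * t" and sb: "(\<Sum>k<n. b k i) = of_int p - of_int (\<kappa> i) * t"
    unfolding a_def b_def sum_divide_distrib[symmetric] sum.distrib sum_subtractf sw sc
    by (simp_all add: p t(2) field_simps)
  note e2 = algebraic_int_second_symmetric
  define \<alpha> where "\<alpha> = p\<^sup>2 + m * (\<kappa> i)\<^sup>2"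
  define \<beta> where "\<beta> = 2 * p * \<kappa> i"
  define R' where "R' = (of_int \<alpha> - R i i) / 2"
  define Q where "Q = (of_int (\<beta> - X i i) / 2 :: rat)"
  have R': "of_rat R' = (of_int \<alpha> - of_rat (R i i)) / (2 :: complex)"
    by (simp add: R'_def of_rat_divide of_rat_diff)
  have Q: "of_rat Q = (of_int \<beta> - of_int (X i i)) / (2 :: complex)"
    by (simp add: Q_def of_rat_divide of_rat_diff)
  have gen: "((x + y * t) - (r + z * t)) / 2 = (x - r) / 2 + (y - z) / 2 * t"
    "((x - y * t) - (r - z * t)) / 2 = (x - r) / 2 - (y - z) / 2 * t" for x y r z :: complex
    by (simp_all add: field_simps)
  have half': "of_rat (of_int (X i i + X i i) / 2) = (of_int (X i i) :: complex)"
    unfolding half by simp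
  have sq: "(of_int p + of_int (\<kappa> i) * t)\<^sup>2 = of_int \<alpha> + of_int \<beta> * t"
    "(of_int p - of_int (\<kappa> i) * t)\<^sup>2 = of_int \<alpha> - of_int \<beta> * t"
  proof -
    have g: "(x + y * t)\<^sup>2 = x\<^sup>2 + t\<^sup>2 * y\<^sup>2 + 2 * x * y * t" "(x - y * t)\<^sup>2 = x\<^sup>2 + t\<^sup>2 * y\<^sup>2 - 2 * x * y * t"
      for x y :: complex by (simp_all add: power2_eq_square algebra_simps)
    show "(of_int p + of_int (\<kappa> i) * t)\<^sup>2 = of_int \<alpha> + of_int \<beta> * t"
      "(of_int p - of_int (\<kappa> i) * t)\<^sup>2 = of_int \<alpha> - of_int \<beta> * t"
      unfolding g t(1) by (simp_all add: \<alpha>_def \<beta>_def)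
  qed
  have 1: "((\<Sum>k<n. a k i)\<^sup>2 - (\<Sum>k<n. a k i * a k i)) / 2 = of_rat R' + of_rat Q * t"
    unfolding sa aa[OF ij(1) ij(1)] sq half' R' Q by (rule gen(1))
  have 2: "((\<Sum>k<n. b k i)\<^sup>2 - (\<Sum>k<n. b k i * b k i)) / 2 = of_rat R' - of_rat Q * t"
    unfolding sb bb[OF ij(1) ij(1)] sq half' R' Q by (rule gen(2))
  have "Q \<in> \<int>"
  proof (rule quad(2))
    show "algebraic_int (of_rat R' + of_rat Q * t)" unfolding 1[symmetric] by (rule e2) (rule ia[OF _ ij(1)])
    show "algebraic_int (of_rat R' - of_rat Q * t)" unfolding 2[symmetric] by (rule e2) (rule ib[OF _ ij(1)])
  qed
  then obtain z where "Q = of_int z" by (auto elim: Ints_cases)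
  hence "(of_int (\<beta> - X i i) :: rat) = of_int (2 * z)" by (simp add: Q_def)
  hence "\<beta> - X i i = 2 * z" by (simp only: of_int_eq_iff)
  hence "X i i = 2 * (p * \<kappa> i - z)" by (simp add: \<beta>_def)
  thus "even (X i i)" by simp
qed

section \<open>Integrality of the transition matrix\<close>

lemma mult_mat_index_sum:
  assumes "A \<in> carrier_mat n m" "B \<in> carrier_mat m k" "i < n" "j < k"
  shows "(A * B) $$ (i, j) = (\<Sum>l<m. A $$ (i, l) * B $$ (l, j))"
  using assms by (simp add: scalar_prod_def atLeast0LessThan)

lemma algebraic_int_cofactor:
  fixes A :: "complex mat"
  assumes A: "A \<in> carrier_mat n n" and i: "\<And>i j. i < n \<Longrightarrow> j < n \<Longrightarrow> algebraic_int (A $$ (i, j))"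
    and ij: "i < n" "j < n"
  shows "algebraic_int (cofactor A i j)"
proof -
  obtain m where m: "n = Suc m" using ij by (cases n) auto
  have D: "mat_delete A i j \<in> carrier_mat m m" using mat_delete_carrier[OF A, of i j] m by simp
  have "algebraic_int (det (mat_delete A i j))"
  proof (rule algebraic_int_det[OF D])
    fix a b assume ab: "a < m" "b < m"
    hence "mat_delete A i j $$ (a, b) = A $$ (insert_index i a, insert_index j b)"
      using A m by (simp add: mat_delete_def insert_index_def)
    thus "algebraic_int (mat_delete A i j $$ (a, b))"
      using ab m by (auto intro!: i simp: insert_index_def)
  qed
  thus ?thesis
    unfolding cofactor_def by (cases "even (i + j)") auto
qed

text \<open>If \<open>U\<close> maps the columns of an integral matrix to integral vectors, then \<open>U\<close> becomes integral
  after multiplication by the determinant. Here one column of \<open>V\<close> is replaced by \<open>V x\<close>.\<close>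

lemma cramer_integral:
  fixes U V :: "complex mat" and x :: "complex vec"
  assumes U: "U \<in> carrier_mat n n" and V: "V \<in> carrier_mat n n" and x: "x \<in> carrier_vec n"
    and iV: "\<And>i j. i < n \<Longrightarrow> j < n \<Longrightarrow> algebraic_int (V $$ (i, j))"
    and iUV: "\<And>i j. i < n \<Longrightarrow> j < n \<Longrightarrow> algebraic_int ((U * V) $$ (i, j))"
    and ix: "\<And>i. i < n \<Longrightarrow> algebraic_int ((V *\<^sub>v x) $ i)"
    and iUx: "\<And>i. i < n \<Longrightarrow> algebraic_int ((U *\<^sub>v (V *\<^sub>v x)) $ i)"
    and ij: "i < n" "l < n" "j < n"
  shows "algebraic_int (x $ j * det V * U $$ (i, l))"
proof -
  define B where "B = replace_col V (V *\<^sub>v x) j"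
  have B: "B \<in> carrier_mat n n" using V by (simp add: B_def replace_col_def)
  have iB: "algebraic_int (B $$ (i, k))" if "i < n" "k < n" for i k
    using that V iV ix by (auto simp: B_def replace_col_def simp del: index_mult_mat_vec)
  have iUB: "algebraic_int ((U * B) $$ (i, k))" if ik: "i < n" "k < n" for i k
  proof -
    have UB: "(U * B) $$ (i, k) = (\<Sum>a<n. U $$ (i, a) * B $$ (a, k))"
      using ik U B by (simp add: scalar_prod_def atLeast0LessThan)
    show ?thesis
    proof (cases "k = j")
      case True
      have "(U * B) $$ (i, k) = (U *\<^sub>v (V *\<^sub>v x)) $ i"
        unfolding UB mult_mat_vec_index_sum[OF U mult_mat_vec_carrier[OF V x] ik(1)]
        using True V ik by (intro sum.cong refl) (simp add: B_def replace_col_def del: index_mult_mat_vec)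
      thus ?thesis using iUx[OF ik(1)] by simp
    next
      case False
      have "(U * B) $$ (i, k) = (U * V) $$ (i, k)"
        unfolding UB using False V U ik
        by (simp add: scalar_prod_def atLeast0LessThan B_def replace_col_def)
      thus ?thesis using iUV[OF ik] by simp
    qed
  qed
  note adj = adj_mat[OF B]
  have "(U * B) * adj_mat B = U * (det B \<cdot>\<^sub>m 1\<^sub>m n)"
    using assoc_mult_mat[OF U B adj(1)] adj(2) by simp
  also have "\<dots> = det B \<cdot>\<^sub>m U" using U by (simp add: mult_smult_distrib[of U n n "1\<^sub>m n" n])
  finally have "det B * U $$ (i, l) = ((U * B) * adj_mat B) $$ (i, l)" using U ij by simp
  also have "\<dots> = (\<Sum>k<n. (U * B) $$ (i, k) * adj_mat B $$ (k, l))"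
    by (rule mult_mat_index_sum[OF mult_carrier_mat[OF U B] adj(1) ij(1,2)])
  also have "algebraic_int \<dots>"
    using ij iUB algebraic_int_cofactor[OF B iB] B
    by (intro algebraic_int_sum algebraic_int_mult) (auto simp: adj_mat_def simp del: index_mult_mat(1))
  finally have "algebraic_int (det B * U $$ (i, l))" .
  thus ?thesis using cramer_lemma_mat[OF V x ij(3)] by (simp add: B_def)
qed

lemma int_ideal_generator:
  fixes P :: "int \<Rightarrow> bool"
  assumes add: "\<And>a b. P a \<Longrightarrow> P b \<Longrightarrow> P (a + b)" and mul: "\<And>a c. P a \<Longrightarrow> P (c * a)"
    and ex: "P d" "d \<noteq> 0"
  obtains t where "t > 0" "P t" "\<And>a. P a \<Longrightarrow> t dvd a"
proof -
  have "sgn d * d = \<bar>d\<bar>" by (simp add: sgn_if abs_if)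
  hence "\<bar>d\<bar> > 0 \<and> P \<bar>d\<bar>" using ex(2) mul[OF ex(1), of "sgn d"] by simp
  hence "\<exists>k::nat. 0 < k \<and> P (int k)" by (intro exI[of _ "nat \<bar>d\<bar>"]) simp
  then obtain k where k: "0 < k" "P (int k)" "\<And>l. 0 < l \<Longrightarrow> P (int l) \<Longrightarrow> k \<le> l"
    using exists_least_iff[of "\<lambda>k. 0 < k \<and> P (int k)"] by (metis not_less)
  have "int k dvd a" if a: "P a" for a
  proof -
    have "a mod int k = a + (- (a div int k)) * int k" by (simp add: minus_div_mult_eq_mod[symmetric])
    hence "P (a mod int k)" using add[OF a mul[OF k(2)]] by metis
    moreover have "0 \<le> a mod int k" "a mod int k < int k" using k(1) by simp_all
    ultimately have "a mod int k = 0"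
      using k(3)[of "nat (a mod int k)"] by (cases "a mod int k = 0") auto
    thus ?thesis by (simp add: dvd_eq_mod_eq_0)
  qed
  thus ?thesis using k(1,2) by (intro that[of "int k"]) auto
qed

text \<open>Cancelling \<open>p\<close> from \<open>S adj S = det S\<close> gives an integer matrix \<open>A\<close> with \<open>S A = det S / p\<close>; taking determinants,
  \<open>p\<close> divides a power of \<open>det S / p\<close>.\<close>

lemma adj_mat_divisible_imp_prime_square:
  fixes S :: "int mat"
  assumes p: "prime p" and S: "S \<in> carrier_mat n n" and pd: "p dvd det S"
    and a: "\<And>i j. i < n \<Longrightarrow> j < n \<Longrightarrow> p dvd adj_mat S $$ (i, j)"
  shows "p\<^sup>2 dvd det S"
proof -
  define A where "A = mat n n (\<lambda>(i, j). adj_mat S $$ (i, j) div p)"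
  obtain q where q: "det S = p * q" using pd by blast
  have p0: "p \<noteq> 0" using p by auto
  have A: "A \<in> carrier_mat n n" by (simp add: A_def)
  have "S * A = q \<cdot>\<^sub>m 1\<^sub>m n"
  proof (rule eq_matI)
    fix i j assume "i < dim_row (q \<cdot>\<^sub>m 1\<^sub>m n)" "j < dim_col (q \<cdot>\<^sub>m 1\<^sub>m n)"
    hence ij: "i < n" "j < n" by auto
    have "p * (S * A) $$ (i, j) = (\<Sum>k<n. S $$ (i, k) * (p * A $$ (k, j)))"
      using ij S A by (simp add: scalar_prod_def atLeast0LessThan sum_distrib_left mult_ac)
    also have "\<dots> = (\<Sum>k<n. S $$ (i, k) * adj_mat S $$ (k, j))"
      using ij a by (intro sum.cong refl) (simp add: A_def)
    also have "\<dots> = (S * adj_mat S) $$ (i, j)"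
      using ij S adj_mat(1)[OF S] by (simp add: scalar_prod_def atLeast0LessThan)
    also have "\<dots> = p * (q \<cdot>\<^sub>m 1\<^sub>m n) $$ (i, j)" unfolding adj_mat(2)[OF S] q using ij by simp
    finally show "(S * A) $$ (i, j) = (q \<cdot>\<^sub>m 1\<^sub>m n) $$ (i, j)" using p0 by simp
  qed (use S A in auto)
  hence "det S * det A = q ^ n" using det_mult[OF S A] by simp
  hence "p dvd q ^ n" using pd by (metis dvd_mult2)
  hence "p dvd q" using p by (rule prime_dvd_power[rotated])
  thus ?thesis unfolding q power2_eq_square by (rule mult_dvd_mono[OF dvd_refl])
qed

lemma dvd_2_if_only_prime_factor_2:
  fixes t :: int
  assumes t: "t > 0" "\<not> 4 dvd t" and p: "\<And>p. prime p \<Longrightarrow> p dvd t \<Longrightarrow> p = 2"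
  shows "t dvd 2"
proof -
  have odd1: "u = 1" if u: "u > 0" "odd u" "u dvd t" for u :: int
  proof (rule ccontr)
    assume "u \<noteq> 1"
    hence "\<not> is_unit u" using u(1) by simp
    then obtain q where "prime q" "q dvd u" using prime_divisor_exists[of u] u(1) by auto
    thus False using p[of q] u by (metis dvd_trans)
  qed
  show ?thesis
  proof (cases "even t")
    case True
    then obtain u where u: "t = 2 * u" by blast
    hence "odd u" using t(2) by auto
    hence "u = 1" using odd1[of u] t(1) u by simp
    thus ?thesis using u by simp
  next
    case False
    thus ?thesis using odd1[of t] t(1) by simp
  qed
qed

text \<open>By Stickelberger's argument such an \<open>X\<close> exists for the matrix \<open>V\<close> of conjugates of an integral basis.\<close>

definition stickelberger_matrix :: "nat \<Rightarrow> complex mat \<Rightarrow> int mat \<Rightarrow> bool" where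
  "stickelberger_matrix n V X \<longleftrightarrow> X \<in> carrier_mat n n \<and> (\<forall>i<n. \<forall>j<n.
     algebraic_int (((V * map_mat of_int X) $$ (i, j) + cofactor V i j) / 2))"

text \<open>\<open>V\<close> is the matrix of conjugates of an integral basis with Gram matrix \<open>S\<close>, and \<open>\<kappa>\<close> is the coordinate vector
  of 1. The columns of the cofactor matrix \<open>C\<close> are \<open>\<delta>\<close> times the conjugates of the dual basis.\<close>

locale conjugate_matrix =
  fixes n :: nat and S :: "int mat" and V :: "complex mat" and X :: "int mat" and \<kappa> :: "int vec"
  assumes S: "S \<in> carrier_mat n n" and V: "V \<in> carrier_mat n n"
    and gram: "transpose_mat V * V = map_mat of_int S"
    and iV: "\<And>i j. i < n \<Longrightarrow> j < n \<Longrightarrow> algebraic_int (V $$ (i, j))"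
    and X: "stickelberger_matrix n V X"
    and \<kappa>: "\<And>i. i < n \<Longrightarrow> (\<Sum>l<n. V $$ (i, l) * of_int (\<kappa> $ l)) = 1"
    and fund: "fundamental_discriminant (det S)"
begin

definition "\<delta> = det V"
definition "C = mat n n (\<lambda>(i, j). cofactor V i j)"

lemma carriers: "C \<in> carrier_mat n n" "X \<in> carrier_mat n n" "transpose_mat C = adj_mat V"
  using X V by (auto simp: C_def stickelberger_matrix_def adj_mat_def)

lemma det_S_nonzero: "det S \<noteq> 0"
  using fund by (cases rule: fundamental_discriminant_cases) auto

lemma \<delta>_square: "\<delta>\<^sup>2 = of_int (det S)"
proof -
  have "of_int (det S) = det (transpose_mat V * V)" unfolding gram by simp
  also have "\<dots> = det (transpose_mat V) * det V" by (rule det_mult[of _ n]) (use V in auto)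
  finally show ?thesis using det_transpose[OF V] by (simp add: \<delta>_def power2_eq_square)
qed

lemma \<delta>_nonzero: "\<delta> \<noteq> 0"
  using \<delta>_square det_S_nonzero by auto

lemma V_C: "V * transpose_mat C = \<delta> \<cdot>\<^sub>m 1\<^sub>m n" "transpose_mat C * V = \<delta> \<cdot>\<^sub>m 1\<^sub>m n"
  using adj_mat[OF V] by (simp_all add: carriers \<delta>_def)

lemma VT_C: "transpose_mat V * C = \<delta> \<cdot>\<^sub>m 1\<^sub>m n"
proof -
  have "transpose_mat (transpose_mat C * V) = transpose_mat V * C"
    using transpose_mult[of "transpose_mat C" n n V n] carriers(1) V by simp
  moreover have "transpose_mat (\<delta> \<cdot>\<^sub>m 1\<^sub>m n) = \<delta> \<cdot>\<^sub>m 1\<^sub>m n" by (auto intro!: eq_matI)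
  ultimately show ?thesis unfolding V_C(2) by simp
qed

lemma C_C: "transpose_mat C * C = map_mat of_int (adj_mat S)"
proof -
  let ?S = "map_mat of_int S :: complex mat" and ?A = "map_mat of_int (adj_mat S) :: complex mat"
  have A: "adj_mat S \<in> carrier_mat n n" by (rule adj_mat(1)[OF S])
  have CT: "transpose_mat C \<in> carrier_mat n n" and VT: "transpose_mat V \<in> carrier_mat n n"
    and S': "?S \<in> carrier_mat n n" and A': "?A \<in> carrier_mat n n"
    using carriers(1) V S A by auto
  have "?S * (transpose_mat C * C) = transpose_mat V * ((V * transpose_mat C) * C)"
    unfolding gram[symmetric] using assoc_mult_mat[OF VT V mult_carrier_mat[OF CT carriers(1)]]
      assoc_mult_mat[OF V CT carriers(1)] by simp
  also have "\<dots> = \<delta> \<cdot>\<^sub>m (\<delta> \<cdot>\<^sub>m 1\<^sub>m n)"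
    unfolding V_C using carriers(1) VT VT_C
    by (simp add: mult_smult_assoc_mat[of "1\<^sub>m n" n n] mult_smult_distrib[of _ n n])
  also have "\<dots> = of_int (det S) \<cdot>\<^sub>m 1\<^sub>m n"
    using \<delta>_square by (auto intro!: eq_matI simp: power2_eq_square)
  finally have 1: "?S * (transpose_mat C * C) = of_int (det S) \<cdot>\<^sub>m 1\<^sub>m n" .
  have "?A * ?S = map_mat of_int (det S \<cdot>\<^sub>m 1\<^sub>m n)"
    unfolding adj_mat(3)[OF S, symmetric] by (rule of_int_hom.mat_hom_mult[OF A S, symmetric])
  also have "\<dots> = of_int (det S) \<cdot>\<^sub>m 1\<^sub>m n" by (auto intro!: eq_matI)
  finally have AS: "?A * ?S = of_int (det S) \<cdot>\<^sub>m 1\<^sub>m n" .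
  have "of_int (det S) \<cdot>\<^sub>m (transpose_mat C * C) = (?A * ?S) * (transpose_mat C * C)"
    unfolding AS using CT carriers(1) by (subst mult_smult_assoc_mat[of "1\<^sub>m n" n n]) auto
  also have "\<dots> = ?A * (?S * (transpose_mat C * C))"
    by (rule assoc_mult_mat[OF A' S' mult_carrier_mat[OF CT carriers(1)]])
  also have "\<dots> = of_int (det S) \<cdot>\<^sub>m ?A"
    unfolding 1 using A' by (subst mult_smult_distrib[of _ n n]) auto
  finally have eq: "of_int (det S) \<cdot>\<^sub>m (transpose_mat C * C) = of_int (det S) \<cdot>\<^sub>m ?A" .
  show ?thesis
  proof (rule eq_matI)
    fix i j assume ij: "i < dim_row ?A" "j < dim_col ?A"
    have "(of_int (det S) \<cdot>\<^sub>m (transpose_mat C * C)) $$ (i, j) = (of_int (det S) \<cdot>\<^sub>m ?A) $$ (i, j)"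
      unfolding eq ..
    hence "of_int (det S) * (transpose_mat C * C) $$ (i, j) = of_int (det S) * ?A $$ (i, j)"
      using ij A' CT carriers(1) by (simp del: index_mult_mat(1))
    thus "(transpose_mat C * C) $$ (i, j) = ?A $$ (i, j)" using det_S_nonzero by simp
  qed (use A' carriers(1) in simp_all)
qed

lemma iC: "i < n \<Longrightarrow> j < n \<Longrightarrow> algebraic_int (C $$ (i, j))"
  using algebraic_int_cofactor[OF V iV] by (simp add: C_def)

lemma V_index: "i < n \<Longrightarrow> j < n \<Longrightarrow> (V * map_mat of_int X) $$ (i, j) = (\<Sum>l<n. V $$ (i, l) * of_int (X $$ (l, j)))"
  using V carriers(2) by (simp add: scalar_prod_def atLeast0LessThan)

lemma X_alternating:
  assumes "det S = 4 * m" "squarefree m" "m mod 4 = 2 \<or> m mod 4 = 3" and ij: "i < n" "j < n"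
  shows "even ((S * X) $$ (i, j))" "even (X $$ (i, j) - X $$ (j, i))" "even (X $$ (i, i))"
proof -
  have sp: "(transpose_mat A * B) $$ (i, j) = (\<Sum>k<n. A $$ (k, i) * B $$ (k, j))"
    if "A \<in> carrier_mat n n" "B \<in> carrier_mat n n" "i < n" "j < n" for A B :: "complex mat" and i j
    using that by (simp add: scalar_prod_def atLeast0LessThan)
  have A: "adj_mat S \<in> carrier_mat n n" by (rule adj_mat(1)[OF S])
  have vv: "(\<Sum>k<n. V $$ (k, i) * V $$ (k, j)) = of_int (S $$ (i, j))" if "i < n" "j < n" for i j
    using sp[OF V V that] S that unfolding gram by simp
  have vc: "(\<Sum>k<n. V $$ (k, i) * C $$ (k, j)) = (if i = j then \<delta> else 0)" if "i < n" "j < n" for i j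
  proof -
    have "(\<Sum>k<n. V $$ (k, i) * C $$ (k, j)) = (\<delta> \<cdot>\<^sub>m 1\<^sub>m n) $$ (i, j)"
      using sp[OF V carriers(1) that] unfolding VT_C by (rule sym)
    thus ?thesis using that by simp
  qed
  have cc: "(\<Sum>k<n. C $$ (k, i) * C $$ (k, j)) = of_int (adj_mat S $$ (i, j))" if "i < n" "j < n" for i j
    using sp[OF carriers(1) carriers(1) that] that A unfolding C_C by simp
  have st: "algebraic_int (((\<Sum>l<n. V $$ (i, l) * of_int (X $$ (l, j))) + C $$ (i, j)) / 2)"
    if "i < n" "j < n" for i j
  proof -
    have "algebraic_int (((V * map_mat of_int X) $$ (i, j) + cofactor V i j) / 2)"
      using X that unfolding stickelberger_matrix_def by blast
    thus ?thesis unfolding V_index[OF that] using that by (simp add: C_def)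
  qed
  have d: "\<delta>\<^sup>2 = 4 * of_int m" using \<delta>_square assms(1) by simp
  note alt = stickelberger_matrix_alternating[where v = "\<lambda>i j. V $$ (i, j)" and c = "\<lambda>i j. C $$ (i, j)"
      and S = "\<lambda>i j. S $$ (i, j)" and A = "\<lambda>i j. adj_mat S $$ (i, j)" and X = "\<lambda>i j. X $$ (i, j)"
      and \<kappa> = "\<lambda>l. \<kappa> $ l", OF vv vc cc iV iC st \<kappa> d assms(2,3) ij]
  show "even ((S * X) $$ (i, j))"
    using alt(1) ij S carriers(2) by (simp add: scalar_prod_def atLeast0LessThan)
  show "even (X $$ (i, j) - X $$ (j, i))" "even (X $$ (i, i))" using alt(2,3) by simp_all
qed

lemma stickelberger_half:
  assumes "i < n" "j < n" "\<epsilon> = 1 \<or> \<epsilon> = -1"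
  shows "algebraic_int (((V * map_mat of_int X) $$ (i, j) + \<epsilon> * C $$ (i, j)) / 2)"
proof -
  have 1: "algebraic_int (((V * map_mat of_int X) $$ (i, j) + C $$ (i, j)) / 2)"
    using X assms unfolding stickelberger_matrix_def by (simp add: C_def del: index_mult_mat(1))
  have "((V * map_mat of_int X) $$ (i, j) - C $$ (i, j)) / 2 =
      ((V * map_mat of_int X) $$ (i, j) + C $$ (i, j)) / 2 - C $$ (i, j)"
    by (simp add: field_simps del: index_mult_mat(1))
  hence "algebraic_int (((V * map_mat of_int X) $$ (i, j) - C $$ (i, j)) / 2)"
    using algebraic_int_diff[OF 1 iC[OF assms(1,2)]] by (simp only:)
  thus ?thesis using 1 assms(3) by (auto simp del: index_mult_mat(1))
qed

lemma V_adj: "V * map_mat of_int (adj_mat S) = \<delta> \<cdot>\<^sub>m C"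
proof -
  have CT: "transpose_mat C \<in> carrier_mat n n" using carriers(1) by simp
  have "V * map_mat of_int (adj_mat S) = (V * transpose_mat C) * C"
    unfolding C_C[symmetric] by (rule assoc_mult_mat[OF V CT carriers(1), symmetric])
  thus ?thesis unfolding V_C using carriers(1) by (simp add: mult_smult_assoc_mat[of "1\<^sub>m n" n n C n])
qed

text \<open>The vector \<open>(X f \<plusminus> adj S f / \<delta>) / 2\<close> is the coordinate vector of \<open>(V X f \<plusminus> C f) / 2\<close>.\<close>

definition "half_coords \<epsilon> f = vec n (\<lambda>j. (of_int ((X *\<^sub>v f) $ j) + \<epsilon> * of_int ((adj_mat S *\<^sub>v f) $ j) / \<delta>) / 2)"

lemma V_half_coords:
  assumes f: "f \<in> carrier_vec n" and i: "i < n" and V0: "V0 \<in> carrier_mat n n"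
    and V0A: "V0 * map_mat of_int (adj_mat S) = \<delta> \<cdot>\<^sub>m C0" and C0: "C0 \<in> carrier_mat n n"
  shows "(V0 *\<^sub>v half_coords \<epsilon> f) $ i =
    ((\<Sum>j<n. V0 $$ (i, j) * of_int ((X *\<^sub>v f) $ j)) + (\<Sum>l<n. \<epsilon> * C0 $$ (i, l) * of_int (f $ l))) / 2"
proof -
  have A: "adj_mat S \<in> carrier_mat n n" by (rule adj_mat(1)[OF S])
  have "(\<Sum>j<n. V0 $$ (i, j) * of_int ((adj_mat S *\<^sub>v f) $ j)) =
      (\<Sum>j<n. \<Sum>l<n. V0 $$ (i, j) * of_int (adj_mat S $$ (j, l)) * of_int (f $ l))"
    by (intro sum.cong refl) (simp add: mult_mat_vec_index_sum[OF A f] sum_distrib_left mult.assoc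
        del: index_mult_mat_vec)
  also have "\<dots> = (\<Sum>l<n. (V0 * map_mat of_int (adj_mat S)) $$ (i, l) * of_int (f $ l))"
    using A by (subst sum.swap, intro sum.cong refl)
      (subst mult_mat_index_sum[OF V0 _ i], auto simp: sum_distrib_right)
  also have "\<dots> = \<delta> * (\<Sum>l<n. C0 $$ (i, l) * of_int (f $ l))"
    unfolding V0A sum_distrib_left using C0 i by (intro sum.cong refl) (simp add: mult.assoc)
  finally have VA: "(\<Sum>j<n. V0 $$ (i, j) * of_int ((adj_mat S *\<^sub>v f) $ j)) =
      \<delta> * (\<Sum>l<n. C0 $$ (i, l) * of_int (f $ l))" .
  have "(V0 *\<^sub>v half_coords \<epsilon> f) $ i = (\<Sum>j<n. (V0 $$ (i, j) * of_int ((X *\<^sub>v f) $ j) +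
      \<epsilon> / \<delta> * (V0 $$ (i, j) * of_int ((adj_mat S *\<^sub>v f) $ j))) / 2)"
    using i by (subst mult_mat_vec_index_sum[OF V0 _ i])
      (auto simp: half_coords_def field_simps simp del: index_mult_mat_vec intro!: sum.cong)
  also have "\<dots> = ((\<Sum>j<n. V0 $$ (i, j) * of_int ((X *\<^sub>v f) $ j)) +
      \<epsilon> / \<delta> * (\<delta> * (\<Sum>l<n. C0 $$ (i, l) * of_int (f $ l)))) / 2"
    unfolding sum_divide_distrib[symmetric] sum.distrib sum_distrib_left[symmetric] VA ..
  also have "\<epsilon> / \<delta> * (\<delta> * (\<Sum>l<n. C0 $$ (i, l) * of_int (f $ l))) = (\<Sum>l<n. \<epsilon> * C0 $$ (i, l) * of_int (f $ l))"
    using \<delta>_nonzero by (simp add: sum_distrib_left mult.assoc)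
  finally show ?thesis .
qed

lemma sum_V_X:
  assumes f: "f \<in> carrier_vec n" and i: "i < n" and V0: "V0 \<in> carrier_mat n n"
  shows "(\<Sum>j<n. V0 $$ (i, j) * of_int ((X *\<^sub>v f) $ j)) =
    (\<Sum>l<n. (V0 * map_mat of_int X) $$ (i, l) * of_int (f $ l))"
proof -
  have "(\<Sum>j<n. V0 $$ (i, j) * of_int ((X *\<^sub>v f) $ j)) =
      (\<Sum>j<n. \<Sum>l<n. V0 $$ (i, j) * of_int (X $$ (j, l)) * of_int (f $ l))"
    by (intro sum.cong refl) (simp add: mult_mat_vec_index_sum[OF carriers(2) f] sum_distrib_left mult.assoc
        del: index_mult_mat_vec)
  also have "\<dots> = (\<Sum>l<n. (V0 * map_mat of_int X) $$ (i, l) * of_int (f $ l))"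
    using carriers(2) by (subst sum.swap, intro sum.cong refl)
      (subst mult_mat_index_sum[OF V0 _ i], auto simp: sum_distrib_right)
  finally show ?thesis .
qed

end

text \<open>Two fields with integral bases that have the same Gram matrix and the same coordinates of 1.\<close>

locale two_conjugate_matrices =
  L: conjugate_matrix n S V X \<kappa> + R: conjugate_matrix n S V' X' \<kappa>
  for n S V V' X X' \<kappa> +
  assumes n3: "n \<ge> 3"
begin

text \<open>This is \<open>V' V\<^sup>-\<^sup>1\<close>, since the transpose of \<open>C\<close> is the adjugate of \<open>V\<close>.\<close>

definition "U = inverse L.\<delta> \<cdot>\<^sub>m (V' * transpose_mat L.C)"

lemma U: "U \<in> carrier_mat n n" and CT: "transpose_mat L.C \<in> carrier_mat n n"
  using R.V L.carriers(1) by (auto simp: U_def)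

lemma U_V: "U * V = V'"
proof -
  have "U * V = inverse L.\<delta> \<cdot>\<^sub>m (V' * (transpose_mat L.C * V))"
    unfolding U_def using CT L.V R.V
    by (simp add: mult_smult_assoc_mat[of _ n n _ n] assoc_mult_mat[of _ n n _ n _ n])
  also have "\<dots> = inverse L.\<delta> \<cdot>\<^sub>m (L.\<delta> \<cdot>\<^sub>m V')"
    unfolding L.V_C using R.V by (simp add: mult_smult_distrib[of V' n n _ n])
  also have "\<dots> = V'" using L.\<delta>_nonzero by (auto intro!: eq_matI)
  finally show ?thesis .
qed

lemma VT'_U: "transpose_mat V' * U = transpose_mat V"
proof -
  have VT: "transpose_mat V' \<in> carrier_mat n n" "transpose_mat V \<in> carrier_mat n n"
    using R.V L.V by auto
  have "transpose_mat V' * U = inverse L.\<delta> \<cdot>\<^sub>m ((transpose_mat V' * V') * transpose_mat L.C)"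
    unfolding U_def using CT VT R.V
    by (simp add: mult_smult_distrib[of _ n n _ n] assoc_mult_mat[of _ n n _ n _ n])
  also have "\<dots> = inverse L.\<delta> \<cdot>\<^sub>m (transpose_mat V * (V * transpose_mat L.C))"
    unfolding R.gram L.gram[symmetric] using CT VT L.V by (simp add: assoc_mult_mat[of _ n n _ n _ n])
  also have "\<dots> = inverse L.\<delta> \<cdot>\<^sub>m (L.\<delta> \<cdot>\<^sub>m transpose_mat V)"
    unfolding L.V_C using VT by (simp add: mult_smult_distrib[of _ n n _ n])
  also have "\<dots> = transpose_mat V" using L.\<delta>_nonzero by (auto intro!: eq_matI)
  finally show ?thesis .
qed

lemma U_orthogonal: "transpose_mat U * U = 1\<^sub>m n"
proof -
  have UT: "transpose_mat U = inverse L.\<delta> \<cdot>\<^sub>m (L.C * transpose_mat V')"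
  proof -
    have "transpose_mat (a \<cdot>\<^sub>m M) = a \<cdot>\<^sub>m transpose_mat M" for a and M :: "complex mat"
      by (auto intro!: eq_matI)
    thus ?thesis unfolding U_def using transpose_mult[OF R.V CT] by simp
  qed
  have VT: "transpose_mat V' \<in> carrier_mat n n" "transpose_mat V \<in> carrier_mat n n"
    using R.V L.V by auto
  have CV: "L.C * transpose_mat V = L.\<delta> \<cdot>\<^sub>m 1\<^sub>m n"
  proof -
    have "transpose_mat (V * transpose_mat L.C) = L.C * transpose_mat V"
      using transpose_mult[OF L.V CT] by simp
    moreover have "transpose_mat (L.\<delta> \<cdot>\<^sub>m 1\<^sub>m n) = L.\<delta> \<cdot>\<^sub>m 1\<^sub>m n" by (auto intro!: eq_matI)
    ultimately show ?thesis unfolding L.V_C by simp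
  qed
  have "transpose_mat U * U = inverse L.\<delta> \<cdot>\<^sub>m (L.C * (transpose_mat V' * U))"
    unfolding UT using L.carriers(1) VT U
    by (simp add: mult_smult_assoc_mat[of _ n n _ n] assoc_mult_mat[of _ n n _ n _ n])
  also have "\<dots> = 1\<^sub>m n" unfolding VT'_U CV using L.\<delta>_nonzero by (auto intro!: eq_matI)
  finally show ?thesis .
qed

text \<open>The orthogonal matrix \<open>U\<close> maps the dual basis of \<open>V\<close> to that of \<open>V'\<close>; the sign compares the two square roots
  \<open>det V\<close> and \<open>det V'\<close> of \<open>det S\<close>.\<close>

lemma U_C: obtains \<epsilon> where "\<epsilon> = 1 \<or> \<epsilon> = -1" "U * L.C = \<epsilon> \<cdot>\<^sub>m R.C" "L.\<delta> = \<epsilon> * R.\<delta>"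
proof -
  have VT: "transpose_mat V' \<in> carrier_mat n n" using R.V by auto
  have CV: "R.C * transpose_mat V' = R.\<delta> \<cdot>\<^sub>m 1\<^sub>m n"
  proof -
    have "transpose_mat (V' * transpose_mat R.C) = R.C * transpose_mat V'"
      using transpose_mult[OF R.V, of "transpose_mat R.C" n] R.carriers(1) by simp
    moreover have "transpose_mat (R.\<delta> \<cdot>\<^sub>m 1\<^sub>m n) = R.\<delta> \<cdot>\<^sub>m 1\<^sub>m n" by (auto intro!: eq_matI)
    ultimately show ?thesis unfolding R.V_C by simp
  qed
  have "R.\<delta> \<cdot>\<^sub>m (U * L.C) = (R.C * transpose_mat V') * (U * L.C)"
    unfolding CV using U L.carriers(1) by (subst mult_smult_assoc_mat[of _ n n _ n]) auto
  also have "\<dots> = R.C * ((transpose_mat V' * U) * L.C)"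
    using R.carriers(1) VT U L.carriers(1) by (simp add: assoc_mult_mat[of _ n n _ n _ n])
  also have "\<dots> = L.\<delta> \<cdot>\<^sub>m R.C"
    unfolding VT'_U L.VT_C using R.carriers(1) by (simp add: mult_smult_distrib[of _ n n _ n])
  finally have eq: "R.\<delta> \<cdot>\<^sub>m (U * L.C) = L.\<delta> \<cdot>\<^sub>m R.C" .
  define \<epsilon> where "\<epsilon> = L.\<delta> / R.\<delta>"
  have "L.\<delta>\<^sup>2 = R.\<delta>\<^sup>2" using L.\<delta>_square R.\<delta>_square by simp
  hence e: "\<epsilon> = 1 \<or> \<epsilon> = -1" using R.\<delta>_nonzero by (auto simp: \<epsilon>_def power2_eq_iff)
  have "U * L.C = \<epsilon> \<cdot>\<^sub>m R.C"
  proof (rule eq_matI)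
    fix i j assume "i < dim_row (\<epsilon> \<cdot>\<^sub>m R.C)" "j < dim_col (\<epsilon> \<cdot>\<^sub>m R.C)"
    hence ij: "i < n" "j < n" using R.carriers(1) by auto
    have "(R.\<delta> \<cdot>\<^sub>m (U * L.C)) $$ (i, j) = (L.\<delta> \<cdot>\<^sub>m R.C) $$ (i, j)" unfolding eq ..
    hence "R.\<delta> * (U * L.C) $$ (i, j) = L.\<delta> * R.C $$ (i, j)"
      using ij U L.carriers(1) R.carriers(1) by (simp del: index_mult_mat(1))
    thus "(U * L.C) $$ (i, j) = (\<epsilon> \<cdot>\<^sub>m R.C) $$ (i, j)"
      using ij R.\<delta>_nonzero R.carriers(1) by (simp add: \<epsilon>_def field_simps del: index_mult_mat(1))
  qed (use U L.carriers(1) R.carriers(1) in auto)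
  thus ?thesis using e R.\<delta>_nonzero by (intro that[of \<epsilon>]) (auto simp: \<epsilon>_def)
qed

lemma cramer:
  assumes "x \<in> carrier_vec n" "\<And>i. i < n \<Longrightarrow> algebraic_int ((V *\<^sub>v x) $ i)"
    "\<And>i. i < n \<Longrightarrow> algebraic_int ((V' *\<^sub>v x) $ i)" "i < n" "l < n" "j < n"
  shows "algebraic_int (x $ j * L.\<delta> * U $$ (i, l))"
  unfolding L.\<delta>_def
proof (rule cramer_integral[OF U L.V assms(1) L.iV _ assms(2) _ assms(4-6)])
  show "algebraic_int ((U * V) $$ (i, j))" if "i < n" "j < n" for i j
    unfolding U_V using R.iV that by simp
  show "algebraic_int ((U *\<^sub>v (V *\<^sub>v x)) $ i)" if "i < n" for i
    unfolding assoc_mult_mat_vec[OF U L.V assms(1), symmetric] U_V using assms(3) that by simp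
qed

lemma V'_adj: obtains \<epsilon> where "\<epsilon> = 1 \<or> \<epsilon> = -1"
  "V' * map_mat of_int (adj_mat S) = L.\<delta> \<cdot>\<^sub>m (\<epsilon> \<cdot>\<^sub>m R.C)"
proof -
  obtain \<epsilon> where e: "\<epsilon> = 1 \<or> \<epsilon> = -1" "L.\<delta> = \<epsilon> * R.\<delta>" by (rule U_C)
  have "V' * map_mat of_int (adj_mat S) = L.\<delta> \<cdot>\<^sub>m (\<epsilon> \<cdot>\<^sub>m R.C)"
    unfolding R.V_adj using e by (auto intro!: eq_matI)
  with e(1) show ?thesis by (rule that)
qed

text \<open>The vector \<open>C\<^sub>k\<close> is integral, as is its image under \<open>U\<close>, and its \<open>j\<close>-th coordinate with respect to the
  columns of \<open>V\<close> is \<open>adj S\<^sub>j\<^sub>k / \<delta>\<close>.\<close>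

lemma adj_U_integral:
  assumes ij: "i < n" "l < n" "j < n" "k < n"
  shows "algebraic_int (of_int (adj_mat S $$ (j, k)) * U $$ (i, l))"
proof -
  have A: "adj_mat S \<in> carrier_mat n n" by (rule adj_mat(1)[OF L.S])
  define x where "x = vec n (\<lambda>j. of_int (adj_mat S $$ (j, k)) / L.\<delta>)"
  have x: "x \<in> carrier_vec n" by (simp add: x_def)
  have Vx: "(V0 *\<^sub>v x) $ a = C0 $$ (a, k)" if V0: "V0 \<in> carrier_mat n n" and C0: "C0 \<in> carrier_mat n n"
    and eq: "V0 * map_mat of_int (adj_mat S) = L.\<delta> \<cdot>\<^sub>m C0" and a: "a < n" for V0 C0 a
  proof -
    have "L.\<delta> * (V0 *\<^sub>v x) $ a = (V0 * map_mat of_int (adj_mat S)) $$ (a, k)"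
      using a ij(4) A L.\<delta>_nonzero
      by (subst mult_mat_vec_index_sum[OF V0 x a], subst mult_mat_index_sum[OF V0 _ a ij(4)])
         (auto simp: x_def sum_distrib_left intro!: sum.cong)
    also have "\<dots> = L.\<delta> * C0 $$ (a, k)" unfolding eq using C0 a ij(4) by simp
    finally show ?thesis using L.\<delta>_nonzero by simp
  qed
  obtain \<epsilon> where e: "\<epsilon> = 1 \<or> \<epsilon> = -1" "V' * map_mat of_int (adj_mat S) = L.\<delta> \<cdot>\<^sub>m (\<epsilon> \<cdot>\<^sub>m R.C)"
    by (rule V'_adj)
  have "algebraic_int (x $ j * L.\<delta> * U $$ (i, l))"
  proof (rule cramer[OF x _ _ ij(1-3)])
    fix a assume a: "a < n"
    show "algebraic_int ((V *\<^sub>v x) $ a)"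
      unfolding Vx[OF L.V L.carriers(1) L.V_adj a] using a ij by (intro L.iC)
    have "\<epsilon> \<cdot>\<^sub>m R.C \<in> carrier_mat n n" using R.carriers(1) by simp
    from Vx[OF R.V this e(2) a] show "algebraic_int ((V' *\<^sub>v x) $ a)"
      using e(1) R.iC[OF a ij(4)] R.carriers(1) a ij(4) by auto
  qed
  thus ?thesis using ij L.\<delta>_nonzero by (simp add: x_def)
qed

lemma \<delta>_U_integral:
  assumes "i < n" "l < n"
  shows "algebraic_int (L.\<delta> * U $$ (i, l))"
proof -
  have "L.\<delta> * U $$ (i, l) = (V' * transpose_mat L.C) $$ (i, l)"
    using assms L.\<delta>_nonzero CT R.V by (simp add: U_def del: index_mult_mat(1))
  also have "\<dots> = (\<Sum>k<n. V' $$ (i, k) * L.C $$ (l, k))"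
    using assms L.carriers(1) by (subst mult_mat_index_sum[OF R.V CT assms]) simp
  finally show ?thesis
    using assms by (auto intro!: algebraic_int_sum algebraic_int_mult R.iV L.iC)
qed

text \<open>In the even case some integer that is not divisible by 4 makes all squares of entries integral.
  It is \<open>m\<close> if one of the alternating forms vanishes modulo 2. Otherwise it is, up to a factor 4, the product of
  two conjugate determinants: those of \<open>V\<close> with one column replaced by \<open>(V X f \<plusminus> C f) / 2\<close>, where
  \<open>f\<close> is chosen such that \<open>X f\<close> and \<open>X' f\<close> agree modulo 2 and are not 0.\<close>

lemma even_multiplier:
  assumes d: "det S = 4 * m" "squarefree m" "m mod 4 = 2 \<or> m mod 4 = 3"
  shows "\<exists>N::int. \<not> 4 dvd N \<and> (\<forall>i<n. \<forall>l<n. algebraic_int (of_int N * (U $$ (i, l))\<^sup>2))"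
proof -
  define t where "t = L.\<delta> / 2"
  have t: "t\<^sup>2 = of_int m" "L.\<delta> = 2 * t" using L.\<delta>_square d(1) by (simp_all add: t_def power_divide)
  have m4: "\<not> 4 dvd m" using d(3) by auto
  have half: "algebraic_int (M $$ (i, j) / 2)"
    if X: "X0 \<in> carrier_mat n n" and V: "V0 \<in> carrier_mat n n"
    and iV: "\<And>i j. i < n \<Longrightarrow> j < n \<Longrightarrow> algebraic_int (V0 $$ (i, j))"
    and ev: "\<forall>i<n. \<forall>j<n. even (X0 $$ (i, j))"
    and st: "algebraic_int (((V0 * map_mat of_int X0) $$ (i, j) + 1 * M $$ (i, j)) / 2)"
    and ij: "i < n" "j < n" for X0 V0 and M :: "complex mat" and i j
  proof -
    have "(V0 * map_mat of_int X0) $$ (i, j) / 2 = (\<Sum>l<n. V0 $$ (i, l) * of_int (X0 $$ (l, j) div 2))"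
    proof -
      have "(V0 * map_mat of_int X0) $$ (i, j) = (\<Sum>l<n. V0 $$ (i, l) * of_int (X0 $$ (l, j)))"
        using X ij by (subst mult_mat_index_sum[OF V _ ij]) auto
      also have "\<dots> = (\<Sum>l<n. V0 $$ (i, l) * of_int (X0 $$ (l, j) div 2) * 2)"
      proof (intro sum.cong refl)
        fix l assume "l \<in> {..<n}"
        hence "X0 $$ (l, j) = X0 $$ (l, j) div 2 * 2" using ev ij by simp
        hence "(of_int (X0 $$ (l, j)) :: complex) = of_int (X0 $$ (l, j) div 2) * 2"
          by (metis of_int_mult of_int_numeral)
        thus "V0 $$ (i, l) * of_int (X0 $$ (l, j)) = V0 $$ (i, l) * of_int (X0 $$ (l, j) div 2) * 2"
          by simp
      qed
      finally show ?thesis by (simp add: sum_distrib_right[symmetric])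
    qed
    hence "algebraic_int ((V0 * map_mat of_int X0) $$ (i, j) / 2)"
      using ij by (auto intro!: algebraic_int_sum algebraic_int_mult iV)
    from algebraic_int_diff[OF st this] show ?thesis by (simp add: add_divide_distrib del: index_mult_mat(1))
  qed
  show ?thesis
  proof (cases "(\<forall>i<n. \<forall>j<n. even (X $$ (i, j))) \<or> (\<forall>i<n. \<forall>j<n. even (X' $$ (i, j)))")
    case True
    have "algebraic_int (t * U $$ (i, l))" if il: "i < n" "l < n" for i l
      using True
    proof
      assume ev: "\<forall>i<n. \<forall>j<n. even (X $$ (i, j))"
      have C2: "algebraic_int (L.C $$ (a, b) / 2)" if "a < n" "b < n" for a b
        by (rule half[OF L.carriers(2) L.V L.iV ev L.stickelberger_half]) (use that in auto)
      have "t * U $$ (i, l) = (L.\<delta> * U $$ (i, l)) / 2" by (simp add: t(2))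
      also have "L.\<delta> * U $$ (i, l) = (\<Sum>k<n. V' $$ (i, k) * L.C $$ (l, k))"
      proof -
        have "L.\<delta> * U $$ (i, l) = (V' * transpose_mat L.C) $$ (i, l)"
          using il L.\<delta>_nonzero CT R.V by (simp add: U_def del: index_mult_mat(1))
        thus ?thesis using il L.carriers(1) by (subst (asm) mult_mat_index_sum[OF R.V CT il]) simp
      qed
      also have "(\<Sum>k<n. V' $$ (i, k) * L.C $$ (l, k)) / 2 = (\<Sum>k<n. V' $$ (i, k) * (L.C $$ (l, k) / 2))"
        by (simp add: sum_divide_distrib)
      also have "algebraic_int (\<Sum>k<n. V' $$ (i, k) * (L.C $$ (l, k) / 2))"
        using il by (intro algebraic_int_sum algebraic_int_mult R.iV C2) simp_all
      finally show ?thesis .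
    next
      assume ev: "\<forall>i<n. \<forall>j<n. even (X' $$ (i, j))"
      have C2: "algebraic_int (R.C $$ (a, b) / 2)" if "a < n" "b < n" for a b
        by (rule half[OF R.carriers(2) R.V R.iV ev R.stickelberger_half]) (use that in auto)
      obtain \<epsilon> where e: "\<epsilon> = 1 \<or> \<epsilon> = -1" "U * L.C = \<epsilon> \<cdot>\<^sub>m R.C" by (rule U_C)
      have "L.\<delta> \<cdot>\<^sub>m U = U * (L.C * transpose_mat V)"
      proof -
        have "transpose_mat (V * transpose_mat L.C) = L.C * transpose_mat V"
          using transpose_mult[OF L.V CT] by simp
        moreover have "transpose_mat (L.\<delta> \<cdot>\<^sub>m 1\<^sub>m n) = L.\<delta> \<cdot>\<^sub>m 1\<^sub>m n" by (auto intro!: eq_matI)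
        ultimately have "L.C * transpose_mat V = L.\<delta> \<cdot>\<^sub>m 1\<^sub>m n" unfolding L.V_C by simp
        thus ?thesis using U by (simp add: mult_smult_distrib[of U n n _ n])
      qed
      also have "\<dots> = (\<epsilon> \<cdot>\<^sub>m R.C) * transpose_mat V"
        unfolding e(2)[symmetric] using U L.carriers(1) L.V
        by (intro assoc_mult_mat[symmetric, of _ n n _ n _ n]) auto
      finally have "(L.\<delta> \<cdot>\<^sub>m U) $$ (i, l) = ((\<epsilon> \<cdot>\<^sub>m R.C) * transpose_mat V) $$ (i, l)" by simp
      moreover have "(L.\<delta> \<cdot>\<^sub>m U) $$ (i, l) = L.\<delta> * U $$ (i, l)" using il U by simp
      moreover have "((\<epsilon> \<cdot>\<^sub>m R.C) * transpose_mat V) $$ (i, l) = (\<Sum>k<n. \<epsilon> * R.C $$ (i, k) * V $$ (l, k))"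
        using il R.carriers(1) L.V by (subst mult_mat_index_sum[of _ n n _ n]) auto
      ultimately have "t * U $$ (i, l) = (\<Sum>k<n. \<epsilon> * R.C $$ (i, k) * V $$ (l, k)) / 2"
        by (simp add: t(2))
      also have "\<dots> = (\<Sum>k<n. \<epsilon> * (R.C $$ (i, k) / 2) * V $$ (l, k))"
        by (simp add: sum_divide_distrib)
      also have "algebraic_int (\<Sum>k<n. \<epsilon> * (R.C $$ (i, k) / 2) * V $$ (l, k))"
      proof -
        have "algebraic_int \<epsilon>" using e(1) by auto
        thus ?thesis using il by (intro algebraic_int_sum algebraic_int_mult L.iV C2) simp_all
      qed
      finally show ?thesis .
    qed
    hence "algebraic_int ((t * U $$ (i, l))\<^sup>2)" if "i < n" "l < n" for i l
      using that by (intro algebraic_int_power) simp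
    hence "\<forall>i<n. \<forall>l<n. algebraic_int (of_int m * (U $$ (i, l))\<^sup>2)"
      by (simp add: power_mult_distrib t(1))
    thus ?thesis using m4 by blast
  next
    case False
    have d16: "\<not> 16 dvd det S" by (rule fundamental_discriminant_not_16[OF L.fund])
    note LX = L.X_alternating[OF d] and RX = R.X_alternating[OF d]
    have "\<exists>f\<in>carrier_vec n. (\<exists>j<n. odd ((X *\<^sub>v f) $ j)) \<and> (\<forall>i<n. even ((X *\<^sub>v f) $ i - (X' *\<^sub>v f) $ i))"
    proof (rule alternating_common_value[OF n3 L.S L.carriers(2) R.carriers(2) d16])
      show "even ((S * X) $$ (i, j))" "even ((S * X') $$ (i, j))" "even (X $$ (i, j) - X $$ (j, i))"
        "even (X' $$ (i, j) - X' $$ (j, i))" if "i < n" "j < n" for i j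
        using LX(1,2)[OF that] RX(1,2)[OF that] by (simp_all only:)
      show "even (X $$ (i, i))" "even (X' $$ (i, i))" if "i < n" for i
        using LX(3)[OF that that] RX(3)[OF that that] by simp_all
      show "\<exists>i<n. \<exists>j<n. odd (X $$ (i, j))" "\<exists>i<n. \<exists>j<n. odd (X' $$ (i, j))" using False by blast+
    qed
    then obtain f j where f: "f \<in> carrier_vec n" and j: "j < n" "odd ((X *\<^sub>v f) $ j)"
      and eq: "\<And>i. i < n \<Longrightarrow> even ((X *\<^sub>v f) $ i - (X' *\<^sub>v f) $ i)" by blast
    define x where "x = (X *\<^sub>v f) $ j"
    define y where "y = (adj_mat S *\<^sub>v f) $ j"
    \<comment> \<open>Cramer's rule with the vector \<open>(V X f \<plusminus> C f) / 2\<close> in place of the \<open>j\<close>-th basis vector\<close>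
    have key: "algebraic_int ((of_int x * t + \<epsilon> * of_int y / 2) * U $$ (i, l))"
      if e: "\<epsilon> = 1 \<or> \<epsilon> = -1" and il: "i < n" "l < n" for \<epsilon> i l
    proof -
      define h where "h = L.half_coords \<epsilon> f"
      have h: "h \<in> carrier_vec n" by (simp add: h_def L.half_coords_def)
      have "algebraic_int (h $ j * L.\<delta> * U $$ (i, l))"
      proof (rule cramer[OF h _ _ il j(1)])
        fix a assume a: "a < n"
        have "(V *\<^sub>v h) $ a = (\<Sum>b<n. ((V * map_mat of_int X) $$ (a, b) + \<epsilon> * L.C $$ (a, b)) / 2 * of_int (f $ b))"
          unfolding h_def L.V_half_coords[OF f a L.V L.V_adj L.carriers(1)] L.sum_V_X[OF f a L.V]
            sum.distrib[symmetric] sum_divide_distrib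
          by (intro sum.cong refl) (simp add: algebra_simps add_divide_distrib del: index_mult_mat(1))
        also have "algebraic_int \<dots>"
          using a by (intro algebraic_int_sum algebraic_int_mult L.stickelberger_half e) auto
        finally show "algebraic_int ((V *\<^sub>v h) $ a)" .
        obtain \<eta> where n: "\<eta> = 1 \<or> \<eta> = -1" "V' * map_mat of_int (adj_mat S) = L.\<delta> \<cdot>\<^sub>m (\<eta> \<cdot>\<^sub>m R.C)"
          by (rule V'_adj)
        have RC: "\<eta> \<cdot>\<^sub>m R.C \<in> carrier_mat n n" using R.carriers(1) by simp
        have en: "\<epsilon> * \<eta> = 1 \<or> \<epsilon> * \<eta> = -1" using e n(1) by auto
        have "(\<Sum>b<n. V' $$ (a, b) * of_int ((X *\<^sub>v f) $ b)) = (\<Sum>b<n. V' $$ (a, b) * of_int ((X' *\<^sub>v f) $ b))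
            + (\<Sum>b<n. V' $$ (a, b) * of_int (((X *\<^sub>v f) $ b - (X' *\<^sub>v f) $ b) div 2)) * 2"
          unfolding sum_distrib_right sum.distrib[symmetric]
        proof (intro sum.cong refl)
          fix b assume "b \<in> {..<n}"
          hence "((X *\<^sub>v f) $ b - (X' *\<^sub>v f) $ b) div 2 * 2 = (X *\<^sub>v f) $ b - (X' *\<^sub>v f) $ b"
            using eq[of b] by simp
          hence "(X *\<^sub>v f) $ b = (X' *\<^sub>v f) $ b + ((X *\<^sub>v f) $ b - (X' *\<^sub>v f) $ b) div 2 * 2"
            by linarith
          from arg_cong[OF this, of "of_int :: int \<Rightarrow> complex"]
          have "(of_int ((X *\<^sub>v f) $ b) :: complex) = of_int ((X' *\<^sub>v f) $ b) +
              of_int (((X *\<^sub>v f) $ b - (X' *\<^sub>v f) $ b) div 2) * 2"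
            by (simp only: of_int_add of_int_mult of_int_numeral)
          thus "V' $$ (a, b) * of_int ((X *\<^sub>v f) $ b) = V' $$ (a, b) * of_int ((X' *\<^sub>v f) $ b) +
              V' $$ (a, b) * of_int (((X *\<^sub>v f) $ b - (X' *\<^sub>v f) $ b) div 2) * 2"
            by (simp add: algebra_simps)
        qed
        hence "(V' *\<^sub>v h) $ a =
            ((\<Sum>b<n. V' $$ (a, b) * of_int ((X' *\<^sub>v f) $ b)) + (\<Sum>b<n. \<epsilon> * (\<eta> \<cdot>\<^sub>m R.C) $$ (a, b) * of_int (f $ b))) / 2
            + (\<Sum>b<n. V' $$ (a, b) * of_int (((X *\<^sub>v f) $ b - (X' *\<^sub>v f) $ b) div 2))"
          unfolding h_def L.V_half_coords[OF f a R.V n(2) RC] by (simp add: add_divide_distrib)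
        also have "((\<Sum>b<n. V' $$ (a, b) * of_int ((X' *\<^sub>v f) $ b)) + (\<Sum>b<n. \<epsilon> * (\<eta> \<cdot>\<^sub>m R.C) $$ (a, b) * of_int (f $ b))) / 2
          = (\<Sum>b<n. ((V' * map_mat of_int X') $$ (a, b) + \<epsilon> * \<eta> * R.C $$ (a, b)) / 2 * of_int (f $ b))"
          unfolding R.sum_V_X[OF f a R.V] sum.distrib[symmetric] sum_divide_distrib
          using a R.carriers(1)
          by (intro sum.cong refl) (simp add: algebra_simps add_divide_distrib del: index_mult_mat(1))
        also have "algebraic_int (\<dots> + (\<Sum>b<n. V' $$ (a, b) * of_int (((X *\<^sub>v f) $ b - (X' *\<^sub>v f) $ b) div 2)))"
          using a by (intro algebraic_int_add algebraic_int_sum algebraic_int_mult R.stickelberger_half en R.iV) auto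
        finally show "algebraic_int ((V' *\<^sub>v h) $ a)" .
      qed
      moreover have "h $ j * L.\<delta> = of_int x * t + \<epsilon> * of_int y / 2"
        using j(1) L.\<delta>_nonzero unfolding h_def L.half_coords_def x_def y_def
        by (simp add: t_def field_simps del: index_mult_mat_vec)
      ultimately show ?thesis by simp
    qed
    \<comment> \<open>the product of the two determinants for \<open>\<epsilon> = 1\<close> and \<open>\<epsilon> = -1\<close>, up to sign a norm from \<open>\<rat>(\<surd>m)\<close>\<close>
    define c :: complex where "c = of_int m * of_int x ^ 2 - of_int y ^ 2 / 4"
    have prod: "algebraic_int (c * (U $$ (i, l))\<^sup>2)" if il: "i < n" "l < n" for i l
    proof -
      have gen: "(p * t + q / 2) * (p * t - q / 2) = t\<^sup>2 * p ^ 2 - q ^ 2 / 4" for p q :: complex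
        by (simp add: power2_eq_square algebra_simps)
      have "c * (U $$ (i, l))\<^sup>2 =
          ((of_int x * t + of_int y / 2) * (of_int x * t - of_int y / 2)) * (U $$ (i, l))\<^sup>2"
        unfolding gen t(1) c_def ..
      also have "\<dots> = ((of_int x * t + of_int y / 2) * U $$ (i, l)) * ((of_int x * t - of_int y / 2) * U $$ (i, l))"
        by (simp only: power2_eq_square mult_ac)
      finally show ?thesis using algebraic_int_mult[OF key[of 1 i l] key[of "-1" i l]] il by simp
    qed
    show ?thesis
    proof (cases "even y")
      case False
      have "algebraic_int (of_int (4 * m * x\<^sup>2 - y\<^sup>2) * (U $$ (i, l))\<^sup>2)" if il: "i < n" "l < n" for i l
      proof -
        have "of_int (4 * m * x\<^sup>2 - y\<^sup>2) = 4 * c" by (simp add: c_def)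
        moreover have "algebraic_int (4 * (c * (U $$ (i, l))\<^sup>2))"
          by (rule algebraic_int_mult[OF algebraic_int_numeral prod[OF il]])
        ultimately show ?thesis by (simp only: mult.assoc)
      qed
      moreover have "\<not> 4 dvd 4 * m * x\<^sup>2 - y\<^sup>2"
      proof
        assume "4 dvd 4 * m * x\<^sup>2 - y\<^sup>2"
        hence "even (4 * m * x\<^sup>2 - y\<^sup>2)" by (rule dvd_trans[rotated]) simp
        thus False using False by simp
      qed
      ultimately show ?thesis by blast
    next
      case True
      then obtain z where z: "y = 2 * z" by blast
      obtain w where w: "x = 2 * w + 1" using j(2) unfolding x_def by (elim oddE)
      have N: "c = of_int (m * x\<^sup>2 - z\<^sup>2)" by (simp add: c_def z power_mult_distrib)
      have "\<not> 4 dvd m * x\<^sup>2 - z\<^sup>2"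
      proof
        assume "4 dvd m * x\<^sup>2 - z\<^sup>2"
        moreover have "m * x\<^sup>2 - z\<^sup>2 = 4 * (m * (w\<^sup>2 + w)) + m - z\<^sup>2"
          by (simp add: w power2_eq_square algebra_simps)
        hence "m - z\<^sup>2 = (m * x\<^sup>2 - z\<^sup>2) - 4 * (m * (w\<^sup>2 + w))" by linarith
        ultimately have "4 dvd m - z\<^sup>2" by (simp only: dvd_diff dvd_triv_left)
        hence mz: "m mod 4 = z\<^sup>2 mod 4" by (simp add: mod_eq_dvd_iff)
        show False
        proof (cases "even z")
          case True
          then obtain q where "z = 2 * q" by blast
          thus False using mz d(3) by simp
        next
          case False
          then obtain q where "z = 2 * q + 1" by (elim oddE)
          hence "z\<^sup>2 = 4 * (q\<^sup>2 + q) + 1" by (simp add: power2_eq_square algebra_simps)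
          hence "z\<^sup>2 mod 4 = 1" by presburger
          thus False using mz d(3) by simp
        qed
      qed
      thus ?thesis using prod unfolding N by blast
    qed
  qed
qed

text \<open>The integers \<open>N\<close> for which all \<open>N U\<^sub>i\<^sub>l\<^sup>2\<close> are integral form an ideal with a generator \<open>t\<close>. It contains
  \<open>det S = \<delta>\<^sup>2\<close> and the squares of the entries of \<open>adj S\<close>, so \<open>p\<^sup>2\<close> divides \<open>det S\<close> for every prime \<open>p\<close> that divides
  \<open>t\<close>, and \<open>p = 2\<close>. Since the ideal also contains a number that is not divisible by 4, \<open>t\<close> divides 2.\<close>

theorem two_U_square_integral:
  assumes ij: "i < n" "l < n"
  shows "algebraic_int (2 * (U $$ (i, l))\<^sup>2)"
proof -
  define P where "P N \<longleftrightarrow> (\<forall>i<n. \<forall>l<n. algebraic_int (of_int N * (U $$ (i, l))\<^sup>2))" for N :: int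
  have add: "P (a + b)" if "P a" "P b" for a b
    using that unfolding P_def by (simp add: distrib_right algebraic_int_add)
  have mul: "P (c * a)" if "P a" for a c
    unfolding P_def
  proof (intro allI impI)
    fix i l assume "i < n" "l < n"
    hence "algebraic_int (of_int a * (U $$ (i, l))\<^sup>2)" using that unfolding P_def by blast
    from algebraic_int_mult[OF algebraic_int_of_int this]
    show "algebraic_int (of_int (c * a) * (U $$ (i, l))\<^sup>2)" unfolding of_int_mult mult.assoc .
  qed
  have Pd: "P (det S)"
    unfolding P_def
  proof (intro allI impI)
    fix i l assume "i < n" "l < n"
    hence "algebraic_int ((L.\<delta> * U $$ (i, l))\<^sup>2)" by (intro algebraic_int_power \<delta>_U_integral)
    thus "algebraic_int (of_int (det S) * (U $$ (i, l))\<^sup>2)"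
      unfolding power_mult_distrib L.\<delta>_square .
  qed
  obtain t where t: "t > 0" "P t" "\<And>a. P a \<Longrightarrow> t dvd a"
    using int_ideal_generator[of P "det S" thesis, OF add mul Pd L.det_S_nonzero] that by simp
  have PA: "P ((adj_mat S $$ (j, k))\<^sup>2)" if "j < n" "k < n" for j k
    unfolding P_def
  proof (intro allI impI)
    fix i l assume "i < n" "l < n"
    hence "algebraic_int ((of_int (adj_mat S $$ (j, k)) * U $$ (i, l))\<^sup>2)"
      using that by (intro algebraic_int_power adj_U_integral)
    thus "algebraic_int (of_int ((adj_mat S $$ (j, k))\<^sup>2) * (U $$ (i, l))\<^sup>2)"
      by (simp only: power_mult_distrib of_int_power)
  qed
  have two: "p = 2" if p: "prime p" "p dvd t" for p
  proof -
    have "p dvd adj_mat S $$ (i, j)" if "i < n" "j < n" for i j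
      using dvd_trans[OF p(2) t(3)[OF PA[OF that]]] p(1) by (rule prime_dvd_power[rotated])
    moreover have "p dvd det S" using p(2) t(3)[OF Pd] by (rule dvd_trans)
    ultimately have "p\<^sup>2 dvd det S" using adj_mat_divisible_imp_prime_square[OF p(1) L.S] by blast
    thus ?thesis using fundamental_discriminant_prime_square[OF L.fund p(1)] by simp
  qed
  have "\<not> 4 dvd t"
    using L.fund
  proof (cases rule: fundamental_discriminant_cases)
    case odd
    show ?thesis
    proof
      assume "4 dvd t"
      hence "4 dvd det S" using t(3)[OF Pd] by (rule dvd_trans)
      thus False using odd(1) by presburger
    qed
  next
    case (even m)
    obtain N where "\<not> 4 dvd N" "P N" using even_multiplier[OF even] unfolding P_def by blast
    thus ?thesis using t(3)[of N] dvd_trans by blast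
  qed
  from dvd_2_if_only_prime_factor_2[OF t(1) this two] have "t dvd 2" .
  then obtain c where "2 = t * c" by blast
  hence "P 2" using mul[OF t(2), of c] by (simp add: mult.commute)
  thus ?thesis using ij by (simp add: P_def)
qed

end

section \<open>Isometries that fix 1 come from field isomorphisms\<close>

text \<open>Finite sums of products of a conjugate of an element of \<open>L\<close> and a conjugate of an element of
  \<open>K\<close>: summed over all pairs of embeddings they become rational, because the double sum of a
  product is a product of traces.\<close>

inductive bisum :: "'a::field_char_0 set \<Rightarrow> 'b::field_char_0 set \<Rightarrow> (nat \<Rightarrow> nat \<Rightarrow> complex) \<Rightarrow> bool"
  for K :: "'a::field_char_0 set" and L :: "'b::field_char_0 set" where
  base: "y \<in> L \<Longrightarrow> x \<in> K \<Longrightarrow> (\<And>i l. i < nf_degree L \<Longrightarrow> l < nf_degree K \<Longrightarrow> F i l = emb L i y * emb K l x) \<Longrightarrow>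
    bisum K L F"
| add: "bisum K L F \<Longrightarrow> bisum K L G \<Longrightarrow>
    (\<And>i l. i < nf_degree L \<Longrightarrow> l < nf_degree K \<Longrightarrow> H i l = F i l + G i l) \<Longrightarrow> bisum K L H"

lemma bisum_mult:
  assumes K: "number_field K" and L: "number_field L" and F: "bisum K L F" and G: "bisum K L G"
  shows "bisum K L (\<lambda>i l. F i l * G i l)"
  using F
proof (induction rule: bisum.induct)
  case F: (base y x F)
  from G show ?case
  proof (induction rule: bisum.induct)
    case (base y' x' G)
    show ?case
    proof (rule bisum.base[of "y * y'" L "x * x'"])
      show "y * y' \<in> L" using F(1) base(1) by (rule subfieldD(4)[OF number_fieldD[OF L]])
      show "x * x' \<in> K" using F(2) base(2) by (rule subfieldD(4)[OF number_fieldD[OF K]])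
      show "F i l * G i l = emb L i (y * y') * emb K l (x * x')" if "i < nf_degree L" "l < nf_degree K" for i l
        using that F base by (simp add: field_homD(3)[OF emb_hom[OF K]] field_homD(3)[OF emb_hom[OF L]])
    qed
  next
    case (add G1 G2 H)
    show ?case by (rule bisum.add[OF add.IH]) (simp add: add.hyps(3) distrib_left)
  qed
next
  case (add F1 F2 H)
  show ?case by (rule bisum.add[OF add.IH]) (simp add: add.hyps(3) distrib_right)
qed

lemma bisum_const:
  assumes K: "number_field K" and L: "number_field L"
  shows "bisum K L (\<lambda>i l. of_rat q)"
  by (rule bisum.base[of "of_rat q" L 1])
     (use K L in \<open>simp_all add: number_fieldD subfield_of_rat subfieldD field_homD(1)[OF emb_hom]
        field_hom_of_rat[OF number_fieldD emb_hom]\<close>)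

lemma bisum_sum:
  assumes K: "number_field K" and L: "number_field L" and "\<And>a. a \<in> I \<Longrightarrow> bisum K L (F a)"
  shows "bisum K L (\<lambda>i l. \<Sum>a\<in>I. F a i l)"
  using assms(3)
proof (induction I rule: infinite_finite_induct)
  case (insert a I)
  show ?case by (rule bisum.add[OF insert.prems[of a] insert.IH]) (use insert in simp_all)
qed (use bisum_const[OF K L, of 0] in simp_all)

lemma bisum_power:
  assumes K: "number_field K" and L: "number_field L" and F: "bisum K L F"
  shows "bisum K L (\<lambda>i l. F i l ^ k)"
proof (induction k)
  case 0
  show ?case using bisum_const[OF K L, of 1] by simp
next
  case (Suc k)
  show ?case using bisum_mult[OF K L F Suc] by simp
qed

lemma bisum_rational:
  assumes K: "number_field K" and L: "number_field L" and F: "bisum K L F"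
  shows "(\<Sum>i<nf_degree L. \<Sum>l<nf_degree K. F i l) \<in> \<rat>"
  using F
proof (induction rule: bisum.induct)
  case (base y x F)
  have "(\<Sum>i<nf_degree L. \<Sum>l<nf_degree K. F i l) = (\<Sum>i<nf_degree L. emb L i y) * (\<Sum>l<nf_degree K. emb K l x)"
    unfolding sum_product by (intro sum.cong refl) (simp add: base(3))
  also have "\<dots> = of_rat (field_trace L y) * of_rat (field_trace K x)"
    by (simp only: of_rat_field_trace[OF K base(2)] of_rat_field_trace[OF L base(1)])
  finally show ?case by simp
next
  case (add F G H)
  have "(\<Sum>i<nf_degree L. \<Sum>l<nf_degree K. H i l) =
      (\<Sum>i<nf_degree L. \<Sum>l<nf_degree K. F i l) + (\<Sum>i<nf_degree L. \<Sum>l<nf_degree K. G i l)"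
    unfolding sum.distrib[symmetric] by (intro sum.cong refl) (simp add: add.hyps(3))
  thus ?case using add.IH by simp
qed

text \<open>Numbers in the unit interval all of whose power sums are integers are 0 or 1: the power sums
  decrease, so two of them agree.\<close>

lemma unit_interval_integral_power_sums:
  fixes r :: "'i \<Rightarrow> real"
  assumes fin: "finite I" and r: "\<And>a. a \<in> I \<Longrightarrow> 0 \<le> r a" "\<And>a. a \<in> I \<Longrightarrow> r a \<le> 1"
    and int: "\<And>k. (\<Sum>a\<in>I. r a ^ k) \<in> \<int>" and a: "a \<in> I"
  shows "r a = 0 \<or> r a = 1"
proof -
  define p where "p k = (\<Sum>a\<in>I. r a ^ k)" for k
  have nonneg: "0 \<le> p k" for k unfolding p_def using r by (intro sum_nonneg) simp
  have nn: "real (nat \<lfloor>p k\<rfloor>) = p k" for k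
    using int[of k] nonneg[of k] by (auto simp: p_def[symmetric] elim!: Ints_cases)
  obtain k where k: "\<And>l. nat \<lfloor>p k\<rfloor> \<le> nat \<lfloor>p l\<rfloor>"
    using ex_has_least_nat[of "\<lambda>_. True" 0 "\<lambda>k. nat \<lfloor>p k\<rfloor>"] by blast
  have "p k \<le> p (Suc k)" using k[of "Suc k"] nn by (metis of_nat_le_iff)
  moreover have "(\<Sum>a\<in>I. r a ^ k * (1 - r a)) = p k - p (Suc k)"
    unfolding p_def sum_subtractf[symmetric] by (intro sum.cong refl) (simp add: algebra_simps)
  ultimately have "(\<Sum>a\<in>I. r a ^ k * (1 - r a)) \<le> 0" by simp
  moreover have ge: "0 \<le> r a ^ k * (1 - r a)" if "a \<in> I" for a using r[OF that] by simp
  ultimately have "(\<Sum>a\<in>I. r a ^ k * (1 - r a)) = 0"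
    using sum_nonneg[of I "\<lambda>a. r a ^ k * (1 - r a)"] by fastforce
  hence "r a ^ k * (1 - r a) = 0" using sum_nonneg_eq_0_iff[OF fin, of "\<lambda>a. r a ^ k * (1 - r a)"] ge a by blast
  thus ?thesis by auto
qed

text \<open>A real unit vector with coordinate sum 1 and squares of coordinates in \<open>{0, 1/2, 1}\<close>
  is a standard basis vector, because 2 is not the square of an integer.\<close>

lemma unit_vector_half_squares:
  fixes u :: "nat \<Rightarrow> real"
  assumes sq: "(\<Sum>j<n. (u j)\<^sup>2) = 1" and s: "(\<Sum>j<n. u j) = 1"
    and half: "\<And>j. j < n \<Longrightarrow> (u j)\<^sup>2 = 0 \<or> (u j)\<^sup>2 = 1 / 2 \<or> (u j)\<^sup>2 = 1"
  shows "\<exists>j<n. u j = 1 \<and> (\<forall>k<n. k \<noteq> j \<longrightarrow> u k = 0)"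
proof (cases "\<exists>j<n. (u j)\<^sup>2 = 1")
  case True
  then obtain j where j: "j < n" "(u j)\<^sup>2 = 1" by blast
  have "(\<Sum>k\<in>{..<n} - {j}. (u k)\<^sup>2) = 0" using sq j sum.remove[of "{..<n}" j "\<lambda>k. (u k)\<^sup>2"] by simp
  hence z: "u k = 0" if "k < n" "k \<noteq> j" for k using that by (subst (asm) sum_nonneg_eq_0_iff) auto
  have "(\<Sum>k<n. u k) = u j + (\<Sum>k\<in>{..<n} - {j}. u k)" using j by (simp add: sum.remove)
  also have "(\<Sum>k\<in>{..<n} - {j}. u k) = 0" using z by (intro sum.neutral) auto
  finally show ?thesis using s j(1) z by auto
next
  case False
  have "\<exists>z::int. of_int z = sqrt 2 * u j" if j: "j < n" for j
  proof -
    have "(sqrt 2 * u j)\<^sup>2 = 0 \<or> (sqrt 2 * u j)\<^sup>2 = 1"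
      using half[OF j] False j by (auto simp: power_mult_distrib)
    hence "sqrt 2 * u j = 0 \<or> sqrt 2 * u j = 1 \<or> sqrt 2 * u j = -1" by (simp add: power2_eq_1_iff)
    thus ?thesis by (metis of_int_0 of_int_1 of_int_minus)
  qed
  then obtain z :: "nat \<Rightarrow> int" where z: "\<And>j. j < n \<Longrightarrow> of_int (z j) = sqrt 2 * u j" by metis
  define Z where "Z = (\<Sum>j<n. z j)"
  have "of_int Z = (\<Sum>j<n. sqrt 2 * u j)" by (simp add: Z_def z)
  also have "\<dots> = sqrt 2" by (simp only: sum_distrib_left[symmetric] s mult_1_right)
  finally have "(of_int Z :: real)\<^sup>2 = 2" by simp
  hence "(of_int (Z\<^sup>2) :: real) = of_int 2" by simp
  hence Z2: "Z\<^sup>2 = 2" by (simp only: of_int_eq_iff)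
  have "\<bar>Z\<bar> \<le> 1 \<or> 2 \<le> \<bar>Z\<bar>" by linarith
  hence "Z\<^sup>2 \<le> 1\<^sup>2 \<or> 2\<^sup>2 \<le> Z\<^sup>2" by (metis abs_ge_zero power2_abs power_mono zero_le_numeral)
  with Z2 show ?thesis by simp
qed

lemma cnj_emb:
  assumes L: "number_field L" and i: "i < nf_degree L"
  shows "\<exists>i'<nf_degree L. \<forall>x\<in>L. emb L i' x = cnj (emb L i x)"
proof -
  define \<tau> where "\<tau> = restrict (\<lambda>x. cnj (emb L i x)) L"
  have Lf: "is_subfield L" using L by (rule number_fieldD)
  have "\<tau> \<in> embeddings L"
    unfolding embeddings_def field_hom_def using emb_hom[OF L i]
    by (auto simp: \<tau>_def subfieldD[OF Lf] field_homD[OF emb_hom[OF L i]])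
  hence "\<tau> \<in> emb L ` {..<nf_degree L}" using emb_bij[OF L] unfolding bij_betw_def by blast
  then obtain i' where "i' < nf_degree L" "emb L i' = \<tau>" by auto
  thus ?thesis by (intro exI[of _ i']) (simp add: \<tau>_def)
qed

text \<open>The matrix \<open>U\<close> is real, orthogonal, has row sums 1, and \<open>2 U\<^sub>i\<^sub>l\<^sup>2\<close> is integral. The power sums of the numbers
  \<open>(2 U\<^sub>i\<^sub>l\<^sup>2 - 1)\<^sup>2\<close> are rational integers, so \<open>U\<^sub>i\<^sub>l\<^sup>2\<close> is 0, 1/2 or 1, and each row of \<open>U\<close> selects one embedding of \<open>K\<close>.\<close>

theorem embeddings_correspond:
  fixes K :: "'a::field_char_0 set" and L :: "'b::field_char_0 set"
  assumes K: "number_field K" and L: "number_field L" and n: "n = nf_degree K" "n = nf_degree L" "n \<ge> 3"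
    and real: "totally_real K" and fund: "fundamental_discriminant (discriminant K)"
    and e: "zbasis K e" and e': "zbasis L e'" and gram: "gram K e = gram L e'"
    and one: "1 = (\<Sum>j<n. of_int (\<kappa> $ j) * e j)" "1 = (\<Sum>j<n. of_int (\<kappa> $ j) * e' j)"
    and i: "i < n"
  shows "\<exists>j<n. \<forall>k<n. emb L i (e' k) = emb K j (e k)"
proof -
  have Kf: "is_subfield K" using K by (rule number_fieldD)
  have Lf: "is_subfield L" using L by (rule number_fieldD)
  define S where "S = gram K e"
  define V where "V = conj_mat K e"
  define V' where "V' = conj_mat L e'"
  obtain X where X: "stickelberger_matrix n V X"
    using stickelberger_dual_basis[OF K n(1) e] unfolding stickelberger_matrix_def V_def by blast
  obtain X' where X': "stickelberger_matrix n V' X'"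
    using stickelberger_dual_basis[OF L n(2) e'] unfolding stickelberger_matrix_def V'_def by blast
  have eK: "e j \<in> K" and eL: "e' j \<in> L" if "j < n" for j
    using zbasisD(1)[OF e] zbasisD(1)[OF e'] that n(1,2) by (auto dest: roiD(1))
  have fundS: "fundamental_discriminant (det S)"
    using fund discriminant_eq_det_gram[OF K e] by (simp add: S_def)
  interpret two_conjugate_matrices n S V V' X X' \<kappa>
  proof unfold_locales
    show "S \<in> carrier_mat n n" "V \<in> carrier_mat n n" "V' \<in> carrier_mat n n"
      unfolding S_def V_def V'_def by (simp_all add: n(1)) (simp_all add: n(1)[symmetric] n(2))
    show "transpose_mat V * V = map_mat of_int S"
      unfolding V_def S_def using zbasisD(1)[OF e] by (rule gram_conj_mat[OF K, symmetric])
    show "transpose_mat V' * V' = map_mat of_int S"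
      unfolding V'_def S_def gram using zbasisD(1)[OF e'] by (rule gram_conj_mat[OF L, symmetric])
    show "algebraic_int (V $$ (i, j))" if "i < n" "j < n" for i j
      using that n zbasisD(1)[OF e] unfolding V_def by (auto intro!: algebraic_int_hom[OF Kf emb_hom[OF K]])
    show "algebraic_int (V' $$ (i, j))" if "i < n" "j < n" for i j
      using that n zbasisD(1)[OF e'] unfolding V'_def by (auto intro!: algebraic_int_hom[OF Lf emb_hom[OF L]])
    show "(\<Sum>l<n. V $$ (i, l) * of_int (\<kappa> $ l)) = 1" if "i < n" for i
    proof -
      have "(\<Sum>l<n. V $$ (i, l) * of_int (\<kappa> $ l)) = emb K i (\<Sum>j<n. of_int (\<kappa> $ j) * e j)"
        using that n eK by (subst emb_int_combination[OF K]) (auto simp: V_def mult.commute)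
      thus ?thesis unfolding one(1)[symmetric] using that n by (simp add: field_homD(1)[OF emb_hom[OF K]])
    qed
    show "(\<Sum>l<n. V' $$ (i, l) * of_int (\<kappa> $ l)) = 1" if "i < n" for i
    proof -
      have "(\<Sum>l<n. V' $$ (i, l) * of_int (\<kappa> $ l)) = emb L i (\<Sum>j<n. of_int (\<kappa> $ j) * e' j)"
        using that n eL by (subst emb_int_combination[OF L]) (auto simp: V'_def mult.commute)
      thus ?thesis unfolding one(2)[symmetric] using that n by (simp add: field_homD(1)[OF emb_hom[OF L]])
    qed
  qed (use X X' fundS n in simp_all)
  have UV: "(\<Sum>l<n. U $$ (i, l) * V $$ (l, k)) = V' $$ (i, k)" if "i < n" "k < n" for i k
    using mult_mat_index_sum[OF U L.V that] unfolding U_V by simp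
  have UUT: "U * transpose_mat U = 1\<^sub>m n"
    using mat_mult_left_right_inverse[of "transpose_mat U" n U] U U_orthogonal by simp
  have rows: "(\<Sum>l<n. U $$ (i, l) * U $$ (i', l)) = (if i = i' then 1 else 0)" if "i < n" "i' < n" for i i'
  proof -
    have "(U * transpose_mat U) $$ (i, i') = (\<Sum>l<n. U $$ (i, l) * U $$ (i', l))"
      using that U by (subst mult_mat_index_sum[of _ n n _ n]) auto
    thus ?thesis unfolding UUT using that by simp
  qed
  \<comment> \<open>Complex conjugation permutes the rows of \<open>U\<close>, since \<open>V\<close> is real. Distinct rows are orthogonal, and a
      non-zero row is not orthogonal to its conjugate, so each row is real.\<close>
  have Vreal: "cnj (V $$ (l, k)) = V $$ (l, k)" if "l < n" "k < n" for l k
    using real emb_in[OF K, of l] eK[OF that(2)] that n(1)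
    by (auto simp: totally_real_def V_def complex_is_Real_iff complex_eq_iff)
  have Vcancel: "w = w'" if w: "w \<in> carrier_vec n" "w' \<in> carrier_vec n"
    and eq: "\<And>k. k < n \<Longrightarrow> (\<Sum>l<n. w $ l * V $$ (l, k)) = (\<Sum>l<n. w' $ l * V $$ (l, k))" for w w' :: "complex vec"
  proof -
    have VT: "transpose_mat V \<in> carrier_mat n n" using L.V by simp
    have "det (transpose_mat V) \<noteq> 0" using det_transpose[OF L.V] L.\<delta>_nonzero by (simp add: L.\<delta>_def)
    then obtain W where W: "W \<in> carrier_mat n n" "W * transpose_mat V = 1\<^sub>m n"
      using mat_inverse_if_det_nonzero[OF VT] by metis
    have "transpose_mat V *\<^sub>v w = transpose_mat V *\<^sub>v w'"
    proof (rule eq_vecI)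
      fix k assume "k < dim_vec (transpose_mat V *\<^sub>v w')"
      hence k: "k < n" using L.V by simp
      show "(transpose_mat V *\<^sub>v w) $ k = (transpose_mat V *\<^sub>v w') $ k"
        using eq[OF k] k L.V w
        by (subst (1 2) mult_mat_vec_index_sum[OF VT _ k]) (simp_all add: mult.commute)
    qed simp
    hence "(W * transpose_mat V) *\<^sub>v w = (W * transpose_mat V) *\<^sub>v w'"
      using assoc_mult_mat_vec[OF W(1) VT] w by simp
    thus ?thesis unfolding W(2) using w by simp
  qed
  have Ureal: "U $$ (i, l) \<in> \<real>" if i: "i < n" and l: "l < n" for i l
  proof -
    obtain i' where i': "i' < n" "\<forall>x\<in>L. emb L i' x = cnj (emb L i x)" using cnj_emb[OF L, of i] i n(2) by blast
    have cn: "cnj (U $$ (i, l)) = U $$ (i', l)" if "l < n" for l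
    proof -
      have "vec n (\<lambda>l. cnj (U $$ (i, l))) = vec n (\<lambda>l. U $$ (i', l))"
      proof (rule Vcancel)
        fix k assume k: "k < n"
        have "(\<Sum>l<n. vec n (\<lambda>l. cnj (U $$ (i, l))) $ l * V $$ (l, k)) = cnj (\<Sum>l<n. U $$ (i, l) * V $$ (l, k))"
          using k by (simp add: Vreal)
        also have "\<dots> = V' $$ (i', k)" unfolding UV[OF i k] using i i' k eL n(2) by (simp add: V'_def)
        also have "\<dots> = (\<Sum>l<n. vec n (\<lambda>l. U $$ (i', l)) $ l * V $$ (l, k))" using UV[OF i'(1) k] by simp
        finally show "(\<Sum>l<n. vec n (\<lambda>l. cnj (U $$ (i, l))) $ l * V $$ (l, k)) =
            (\<Sum>l<n. vec n (\<lambda>l. U $$ (i', l)) $ l * V $$ (l, k))" .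
      qed auto
      from arg_cong[OF this, of "\<lambda>v. v $ l"] show ?thesis using that by simp
    qed
    have "i' = i"
    proof (rule ccontr)
      assume "i' \<noteq> i"
      hence "(\<Sum>l<n. U $$ (i, l) * cnj (U $$ (i, l))) = 0" using rows[OF i i'(1)] cn by simp
      hence "of_real (\<Sum>l<n. (cmod (U $$ (i, l)))\<^sup>2) = (0 :: complex)"
        unfolding of_real_sum complex_norm_square .
      hence "(\<Sum>l<n. (cmod (U $$ (i, l)))\<^sup>2) = 0" by (simp only: of_real_eq_0_iff)
      hence "\<forall>l<n. U $$ (i, l) = 0" by (subst (asm) sum_nonneg_eq_0_iff) auto
      hence "(\<Sum>l<n. U $$ (i, l) * U $$ (i, l)) = 0" by simp
      thus False using rows[OF i i] by simp
    qed
    thus ?thesis using cn[OF l] by (simp add: Reals_cnj_iff)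
  qed
  define u where "u i l = Re (U $$ (i, l))" for i l
  have uU: "U $$ (i, l) = of_real (u i l)" if "i < n" "l < n" for i l
    using Ureal[OF that] by (simp add: u_def)
  have usq: "(\<Sum>l<n. (u i l)\<^sup>2) = 1" if "i < n" for i
  proof -
    have "complex_of_real (\<Sum>l<n. (u i l)\<^sup>2) = (\<Sum>l<n. U $$ (i, l) * U $$ (i, l))"
      using that by (simp add: uU power2_eq_square)
    thus ?thesis using rows[OF that that] by (metis of_real_eq_1_iff)
  qed
  have usum: "(\<Sum>l<n. u i l) = 1" if i: "i < n" for i
  proof -
    have "(\<Sum>l<n. U $$ (i, l)) = (\<Sum>l<n. U $$ (i, l) * (\<Sum>k<n. V $$ (l, k) * of_int (\<kappa> $ k)))"
      by (intro sum.cong refl) (simp add: L.\<kappa>)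
    also have "\<dots> = (\<Sum>k<n. (\<Sum>l<n. U $$ (i, l) * V $$ (l, k)) * of_int (\<kappa> $ k))"
      unfolding sum_distrib_left sum_distrib_right by (subst sum.swap) (simp add: mult.assoc)
    also have "\<dots> = 1" using i by (simp add: UV R.\<kappa>)
    finally have "complex_of_real (\<Sum>l<n. u i l) = 1" using i by (simp add: uU)
    thus ?thesis by (simp only: of_real_eq_1_iff)
  qed
  have ule: "(u i l)\<^sup>2 \<le> 1" if "i < n" "l < n" for i l
    using member_le_sum[of l "{..<n}" "\<lambda>l. (u i l)\<^sup>2"] usq[OF that(1)] that by simp
  define Y where "Y i l = (2 * (U $$ (i, l))\<^sup>2 - 1)\<^sup>2" for i l
  define r where "r = (\<lambda>(i, l). (2 * (u i l)\<^sup>2 - 1)\<^sup>2)"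
  have Yr: "Y i l = of_real (r (i, l))" if "i < n" "l < n" for i l
    using that by (simp add: Y_def r_def uU)
  \<comment> \<open>\<open>U = V' S\<^sup>-\<^sup>1 V\<^sup>T\<close> has rational coefficients with respect to products of conjugates\<close>
  have "bisum K L (\<lambda>i l. U $$ (i, l))"
  proof -
    have Uil: "U $$ (i, l) = (\<Sum>j<n. \<Sum>k<n. of_rat (of_int (adj_mat S $$ (k, j)) / of_int (det S)) *
        (emb L i (e' j) * emb K l (e k)))" if il: "i < n" "l < n" for i l
    proof -
      have A: "map_mat of_int (adj_mat S) \<in> carrier_mat n n" using adj_mat(1)[OF L.S] by simp
      have C: "L.C $$ (l, j) = inverse L.\<delta> * (\<Sum>k<n. V $$ (l, k) * of_int (adj_mat S $$ (k, j)))"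
        if "j < n" for j
      proof -
        have "L.\<delta> * L.C $$ (l, j) = (V * map_mat of_int (adj_mat S)) $$ (l, j)"
          unfolding L.V_adj using il that L.carriers(1) by simp
        also have "\<dots> = (\<Sum>k<n. V $$ (l, k) * of_int (adj_mat S $$ (k, j)))"
          using il that adj_mat(1)[OF L.S] by (subst mult_mat_index_sum[OF L.V A]) auto
        finally show ?thesis using L.\<delta>_nonzero by (simp add: field_simps)
      qed
      have "U $$ (i, l) = inverse L.\<delta> * (V' * transpose_mat L.C) $$ (i, l)"
        using il CT R.V by (simp add: U_def del: index_mult_mat(1))
      also have "(V' * transpose_mat L.C) $$ (i, l) = (\<Sum>j<n. V' $$ (i, j) * L.C $$ (l, j))"
        using il L.carriers(1) by (subst mult_mat_index_sum[OF R.V CT il]) simp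
      also have "inverse L.\<delta> * \<dots> = (\<Sum>j<n. \<Sum>k<n. inverse (L.\<delta>\<^sup>2) *
          (of_int (adj_mat S $$ (k, j)) * (V' $$ (i, j) * V $$ (l, k))))"
        unfolding sum_distrib_left
        by (intro sum.cong refl) (simp add: C sum_distrib_left power2_eq_square mult_ac)
      also have "\<dots> = (\<Sum>j<n. \<Sum>k<n. of_rat (of_int (adj_mat S $$ (k, j)) / of_int (det S)) *
          (emb L i (e' j) * emb K l (e k)))"
        unfolding L.\<delta>_square using il n
        by (intro sum.cong refl) (simp add: V_def V'_def of_rat_divide field_simps)
      finally show ?thesis .
    qed
    have "bisum K L (\<lambda>i l. \<Sum>j<n. \<Sum>k<n. of_rat (of_int (adj_mat S $$ (k, j)) / of_int (det S)) *
        (emb L i (e' j) * emb K l (e k)))"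
    proof (intro bisum_sum[OF K L] bisum_mult[OF K L bisum_const[OF K L]])
      fix j k assume "j \<in> {..<n}" "k \<in> {..<n}"
      hence jk: "e' j \<in> L" "e k \<in> K" by (simp_all add: eL eK)
      show "bisum K L (\<lambda>i l. emb L i (e' j) * emb K l (e k))" by (rule bisum.base[OF jk]) simp
    qed
    moreover have "bisum K L (\<lambda>_ _. 0)" using bisum_const[OF K L, of 0] by simp
    ultimately show ?thesis by (rule bisum.add) (use Uil n in simp)
  qed
  hence bY: "bisum K L (\<lambda>i l. Y i l ^ k)" for k
  proof -
    assume U: "bisum K L (\<lambda>i l. U $$ (i, l))"
    have 1: "bisum K L (\<lambda>i l. of_rat 2 * (U $$ (i, l))\<^sup>2)"
      by (rule bisum_mult[OF K L bisum_const[OF K L] bisum_power[OF K L U]])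
    have "bisum K L (\<lambda>i l. 2 * (U $$ (i, l))\<^sup>2 - 1)"
      by (rule bisum.add[OF 1 bisum_const[OF K L, of "-1"]]) simp
    from bisum_power[OF K L bisum_power[OF K L this, of 2], of k] show ?thesis unfolding Y_def .
  qed
  have rint: "(\<Sum>a\<in>{..<n} \<times> {..<n}. r a ^ k) \<in> \<int>" for k
  proof -
    have eq: "complex_of_real (\<Sum>a\<in>{..<n} \<times> {..<n}. r a ^ k) = (\<Sum>i<n. \<Sum>l<n. Y i l ^ k)"
      unfolding of_real_sum of_real_power sum.cartesian_product
      by (intro sum.cong refl) (auto simp: Yr)
    have "(\<Sum>i<n. \<Sum>l<n. Y i l ^ k) \<in> \<rat>" using bisum_rational[OF K L bY] n by simp
    moreover have "algebraic_int (\<Sum>i<n. \<Sum>l<n. Y i l ^ k)"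
      unfolding Y_def
      by (intro algebraic_int_sum algebraic_int_power algebraic_int_diff two_U_square_integral) auto
    ultimately have "complex_of_real (\<Sum>a\<in>{..<n} \<times> {..<n}. r a ^ k) \<in> \<int>"
      unfolding eq by (intro rational_algebraic_int_is_int)
    then obtain z where "complex_of_real (\<Sum>a\<in>{..<n} \<times> {..<n}. r a ^ k) = of_int z" by (elim Ints_cases)
    hence "complex_of_real (\<Sum>a\<in>{..<n} \<times> {..<n}. r a ^ k) = complex_of_real (of_int z)"
      by (simp only: of_real_of_int_eq)
    hence "(\<Sum>a\<in>{..<n} \<times> {..<n}. r a ^ k) = of_int z" by (simp only: of_real_eq_iff)
    thus ?thesis by simp
  qed
  have r01: "r (i, l) = 0 \<or> r (i, l) = 1" if il: "i < n" "l < n" for i l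
  proof (rule unit_interval_integral_power_sums[OF _ _ _ rint])
    fix a assume "a \<in> {..<n} \<times> {..<n}"
    then obtain i l where a: "a = (i, l)" "i < n" "l < n" by auto
    show "0 \<le> r a" by (simp add: r_def a)
    have "\<bar>2 * (u i l)\<^sup>2 - 1\<bar> \<le> 1" using ule[OF a(2,3)] by (simp add: abs_le_iff)
    thus "r a \<le> 1" using abs_le_square_iff[of "2 * (u i l)\<^sup>2 - 1" 1] by (simp add: r_def a)
  qed (use il in auto)
  have half: "(u i l)\<^sup>2 = 0 \<or> (u i l)\<^sup>2 = 1 / 2 \<or> (u i l)\<^sup>2 = 1" if "i < n" "l < n" for i l
    using r01[OF that] by (auto simp: r_def power2_eq_1_iff)
  from unit_vector_half_squares[OF usq[OF i] usum[OF i] half[OF i]] obtain j where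
    j: "j < n" "u i j = 1" "\<And>k. k < n \<Longrightarrow> k \<noteq> j \<Longrightarrow> u i k = 0" by blast
  have "emb L i (e' k) = emb K j (e k)" if k: "k < n" for k
  proof -
    have "emb L i (e' k) = V' $$ (i, k)" using i k n by (simp add: V'_def)
    also have "\<dots> = (\<Sum>l<n. U $$ (i, l) * V $$ (l, k))" using UV[OF i k] by simp
    also have "\<dots> = (\<Sum>l<n. if l = j then V $$ (j, k) else 0)"
      using i j by (intro sum.cong refl) (auto simp: uU)
    finally show ?thesis using j(1) k n by (simp add: V_def)
  qed
  thus ?thesis using j(1) by blast
qed

text \<open>If an embedding \<open>\<sigma>\<close> of \<open>K\<close> and an embedding \<open>\<tau>\<close> of \<open>L\<close> take the same values on the two bases, they have the same
  image, and \<open>\<tau>\<^sup>-\<^sup>1 \<sigma>\<close> is an isomorphism.\<close>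

theorem field_isomorphic_if_gram_eq:
  fixes K :: "'a::field_char_0 set" and L :: "'b::field_char_0 set"
  assumes K: "number_field K" and L: "number_field L" and n: "n = nf_degree K" "n = nf_degree L" "n \<ge> 3"
    and real: "totally_real K" and fund: "fundamental_discriminant (discriminant K)"
    and e: "zbasis K e" and e': "zbasis L e'" and gram: "gram K e = gram L e'"
    and one: "1 = (\<Sum>j<n. of_int (\<kappa> $ j) * e j)" "1 = (\<Sum>j<n. of_int (\<kappa> $ j) * e' j)"
  shows "field_isomorphic K L"
proof -
  have Kf: "is_subfield K" using K by (rule number_fieldD)
  have Lf: "is_subfield L" using L by (rule number_fieldD)
  have 0: "0 < n" using n(3) by simp
  obtain j where j: "j < n" "\<forall>k<n. emb L 0 (e' k) = emb K j (e k)"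
    using embeddings_correspond[OF assms 0] by blast
  define \<sigma> where "\<sigma> = emb K j"
  define \<tau> where "\<tau> = emb L 0"
  have s: "field_hom K UNIV \<sigma>" and t: "field_hom L UNIV \<tau>"
    using emb_hom[OF K, of j] emb_hom[OF L, of 0] j(1) 0 n by (simp_all add: \<sigma>_def \<tau>_def)
  have eK: "e k \<in> K" and eL: "e' k \<in> L" if "k < n" for k
    using zbasisD(1)[OF e] zbasisD(1)[OF e'] that n(1,2) by (auto dest: roiD(1))
  have st: "\<sigma> (\<Sum>k<n. of_rat (q k) * e k) = \<tau> (\<Sum>k<n. of_rat (q k) * e' k)" for q
    using j(2) by (simp add: embedding_on_basis[OF Kf s eK] embedding_on_basis[OF Lf t eL] \<sigma>_def[symmetric] \<tau>_def[symmetric])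
  have LK: "(\<Sum>k<n. of_rat (q k) * e' k) \<in> L" "(\<Sum>k<n. of_rat (q k) * e k) \<in> K" for q
    using eK eL by (auto intro!: subfield_sum[OF Lf] subfield_sum[OF Kf] subfieldD(4)[OF Lf] subfieldD(4)[OF Kf]
        subfield_of_rat[OF Lf] subfield_of_rat[OF Kf])
  have ex: "\<exists>y\<in>L. \<tau> y = \<sigma> x" if "x \<in> K" for x
    using zbasis_spans[OF K e that] st LK n(1) by metis
  define f where "f x = (SOME y. y \<in> L \<and> \<tau> y = \<sigma> x)" for x
  have f: "f x \<in> L" "\<tau> (f x) = \<sigma> x" if "x \<in> K" for x
    using someI_ex[of "\<lambda>y. y \<in> L \<and> \<tau> y = \<sigma> x"] ex[OF that] unfolding f_def by blast+
  have "field_hom K L f"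
    unfolding field_hom_def
  proof (intro conjI ballI)
    show "f \<in> K \<rightarrow> L" using f by auto
    show "f 1 = 1"
      by (rule field_hom_inj[OF Lf t]) (use f[of 1] subfieldD(2)[OF Kf] subfieldD(2)[OF Lf]
          field_homD(1)[OF s] field_homD(1)[OF t] in auto)
    fix x y assume xy: "x \<in> K" "y \<in> K"
    show "f (x + y) = f x + f y"
      by (rule field_hom_inj[OF Lf t])
         (use xy f subfieldD(3)[OF Kf] subfieldD(3)[OF Lf] field_homD(2)[OF s] field_homD(2)[OF t] in auto)
    show "f (x * y) = f x * f y"
      by (rule field_hom_inj[OF Lf t])
         (use xy f subfieldD(4)[OF Kf] subfieldD(4)[OF Lf] field_homD(3)[OF s] field_homD(3)[OF t] in auto)
  qed
  moreover have "bij_betw f K L"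
    unfolding bij_betw_def
  proof (intro conjI equalityI subsetI)
    show "inj_on f K"
    proof (rule inj_onI)
      fix x y assume "x \<in> K" "y \<in> K" "f x = f y"
      thus "x = y" using f field_hom_inj[OF Kf s] by metis
    qed
    show "y \<in> L" if "y \<in> f ` K" for y using that f by auto
    fix y assume y: "y \<in> L"
    obtain q where q: "y = (\<Sum>k<n. of_rat (q k) * e' k)" using zbasis_spans[OF L e' y] n(2) by blast
    define x where "x = (\<Sum>k<n. of_rat (q k) * e k)"
    have x: "x \<in> K" "\<sigma> x = \<tau> y" using LK(2) st by (simp_all add: x_def q)
    have "f x = y" using f[OF x(1)] x(2) y by (intro field_hom_inj[OF Lf t]) auto
    thus "y \<in> f ` K" using x(1) by blast
  qed
  ultimately show ?thesis unfolding field_isomorphic_def by blast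
qed

section \<open>The trace form modulo a prime\<close>

lemma itrace_closed:
  assumes K: "number_field K" and xy: "x \<in> ring_of_integers K" "y \<in> ring_of_integers K"
  shows "itrace K (x + y) = itrace K x + itrace K y" "itrace K (x - y) = itrace K x - itrace K y"
    "itrace K (of_int c * x) = c * itrace K x"
proof -
  note Kf = number_fieldD[OF K]
  have "(of_int (itrace K (x + y)) :: rat) = of_int (itrace K x + itrace K y)"
    using xy by (simp add: itrace[OF K] roi_closed[OF Kf] field_trace_add[OF K] roiD(1))
  thus "itrace K (x + y) = itrace K x + itrace K y" by (simp only: of_int_eq_iff)
  have "(of_int (itrace K (x - y)) :: rat) = of_int (itrace K x - itrace K y)"
    using xy by (simp add: itrace[OF K] roi_closed[OF Kf] field_trace_diff[OF K] roiD(1))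
  thus "itrace K (x - y) = itrace K x - itrace K y" by (simp only: of_int_eq_iff)
  have "(of_int (itrace K (of_int c * x)) :: rat) = of_int (c * itrace K x)"
    using xy field_trace_scale[OF K roiD(1)[OF xy(1)], of "of_int c"]
    by (simp add: itrace[OF K] roi_closed[OF Kf])
  thus "itrace K (of_int c * x) = c * itrace K x" by (simp only: of_int_eq_iff)
qed

lemma itrace_of_int: "number_field K \<Longrightarrow> itrace K (of_int c) = int (nf_degree K) * c"
  using itrace[of K "of_int c"] roi_closed(1)[OF number_fieldD, of K c] field_trace_of_rat[of K "of_int c"]
  by (simp flip: of_int_eq_iff[where 'a = rat])

lemma int_combination_integral:
  fixes n :: nat
  assumes "number_field K" "\<And>j. j < n \<Longrightarrow> e j \<in> ring_of_integers K"
  shows "(\<Sum>j<n. of_int (q j) * e j) \<in> ring_of_integers K"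
  using assms by (intro roi_sum roi_closed(4)) (auto intro: roi_closed(1) number_fieldD)

lemma itrace_int_combination:
  fixes n :: nat and q :: "nat \<Rightarrow> int"
  assumes K: "number_field K" and e: "\<And>j. j < n \<Longrightarrow> e j \<in> ring_of_integers K"
    and x: "x \<in> ring_of_integers K"
  shows "itrace K (x * (\<Sum>j<n. of_int (q j) * e j)) = (\<Sum>j<n. q j * itrace K (x * e j))"
  using e
proof (induction n)
  case 0
  show ?case using itrace_of_int[OF K, of 0] by simp
next
  case (Suc n)
  note Kf = number_fieldD[OF K]
  have 1: "x * (\<Sum>j<n. of_int (q j) * e j) \<in> ring_of_integers K"
    using Suc.prems x by (intro roi_closed(4)[OF Kf] int_combination_integral[OF K]) auto
  have 2: "x * e n \<in> ring_of_integers K" using Suc.prems x by (intro roi_closed(4)[OF Kf]) auto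
  have "x * (\<Sum>j<Suc n. of_int (q j) * e j) = x * (\<Sum>j<n. of_int (q j) * e j) + of_int (q n) * (x * e n)"
    by (simp add: algebra_simps)
  hence "itrace K (x * (\<Sum>j<Suc n. of_int (q j) * e j)) =
      itrace K (x * (\<Sum>j<n. of_int (q j) * e j)) + itrace K (of_int (q n) * (x * e n))"
    using itrace_closed(1)[OF K 1 roi_closed(4)[OF Kf roi_closed(1)[OF Kf] 2]] by simp
  thus ?case using Suc itrace_closed(3)[OF K 2 2] by simp
qed

lemma gram_mult_vec:
  assumes K: "number_field K" and e: "zbasis K e" and i: "i < nf_degree K"
  shows "(gram K e *\<^sub>v vec (nf_degree K) q) $ i = itrace K (e i * (\<Sum>j<nf_degree K. of_int (q j) * e j))"
proof -
  have "(gram K e *\<^sub>v vec (nf_degree K) q) $ i = (\<Sum>j<nf_degree K. gram K e $$ (i, j) * vec (nf_degree K) q $ j)"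
    by (rule mult_mat_vec_index_sum[OF gram_carrier _ i]) simp
  also have "\<dots> = (\<Sum>j<nf_degree K. q j * itrace K (e i * e j))"
    using i by (intro sum.cong refl) (simp add: gram_def)
  finally show ?thesis using itrace_int_combination[OF K zbasisD(1)[OF e] zbasisD(1)[OF e i]] by simp
qed

text \<open>The radical of the trace form modulo \<open>p\<close>: its elements are determined modulo \<open>p\<close> by their coordinates in
  \<open>I\<close>, so its dimension is at most \<open>r\<close>.\<close>

lemma radical_mod_prime:
  assumes K: "number_field K" and e: "zbasis K e" and p: "prime p" and r: "\<not> p ^ Suc r dvd discriminant K"
  shows "\<exists>I \<subseteq> {..<nf_degree K}. card I \<le> r \<and> (\<forall>q.
    (\<forall>x\<in>ring_of_integers K. p dvd itrace K (x * (\<Sum>j<nf_degree K. of_int (q j) * e j))) \<longrightarrow>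
      (\<forall>a\<in>I. p dvd q a) \<longrightarrow> (\<forall>b<nf_degree K. p dvd q b))"
proof -
  have "\<not> p ^ Suc r dvd det (gram K e)" using r discriminant_eq_det_gram[OF K e] by simp
  from kernel_mod_prime_coordinates[OF p gram_carrier this] obtain I where
    I: "I \<subseteq> {..<nf_degree K}" "card I \<le> r" and ker: "\<And>y. y \<in> carrier_vec (nf_degree K) \<Longrightarrow>
      (\<forall>i<nf_degree K. p dvd (gram K e *\<^sub>v y) $ i) \<Longrightarrow> (\<forall>a\<in>I. p dvd y $ a) \<Longrightarrow> (\<forall>b<nf_degree K. p dvd y $ b)"
    by blast
  show ?thesis
  proof (intro exI[of _ I] conjI I allI impI)
    fix q b assume q: "\<forall>x\<in>ring_of_integers K. p dvd itrace K (x * (\<Sum>j<nf_degree K. of_int (q j) * e j))"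
      "\<forall>a\<in>I. p dvd q a" and b: "b < nf_degree K"
    have "\<forall>b<nf_degree K. p dvd vec (nf_degree K) q $ b"
    proof (rule ker)
      show "\<forall>i<nf_degree K. p dvd (gram K e *\<^sub>v vec (nf_degree K) q) $ i"
        using q(1) zbasisD(1)[OF e] by (simp add: gram_mult_vec[OF K e] del: index_mult_mat_vec)
      show "\<forall>a\<in>I. p dvd vec (nf_degree K) q $ a" using q(2) I(1) by auto
    qed simp
    thus "p dvd q b" using b by simp
  qed
qed

lemma fundamental_discriminant_prime_exponent:
  assumes d: "fundamental_discriminant d" and p: "prime p"
  shows "\<not> p ^ Suc (if p = 2 then 3 else 1) dvd d"
proof (cases "p = 2")
  case True
  thus ?thesis using fundamental_discriminant_not_16[OF d] by simp
next
  case False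
  hence "\<not> p\<^sup>2 dvd d" using fundamental_discriminant_prime_square[OF d p] by blast
  thus ?thesis using False by (simp add: power2_eq_square)
qed

lemma trace_1_if_not_divisible:
  assumes K: "number_field K" and p: "\<And>p :: int. prime p \<Longrightarrow> \<exists>x\<in>ring_of_integers K. \<not> p dvd itrace K x"
  shows "\<exists>x\<in>ring_of_integers K. itrace K x = 1"
proof -
  note Kf = number_fieldD[OF K]
  define P where "P k \<longleftrightarrow> (\<exists>x\<in>ring_of_integers K. itrace K x = k)" for k
  have add: "P (a + b)" if "P a" "P b" for a b
    using that itrace_closed(1)[OF K] roi_closed(2)[OF Kf] unfolding P_def by metis
  have mul: "P (c * a)" if "P a" for a c
    using that itrace_closed(3)[OF K] roi_closed(4)[OF Kf roi_closed(1)[OF Kf]] unfolding P_def by metis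
  obtain x where x: "x \<in> ring_of_integers K" "\<not> 2 dvd itrace K x" using p[of 2] by auto
  hence "P (itrace K x)" "itrace K x \<noteq> 0" by (auto simp: P_def)
  from int_ideal_generator[of P, OF add mul this] obtain t where
    t: "t > 0" "P t" "\<And>a. P a \<Longrightarrow> t dvd a" by metis
  have "t = 1"
  proof (rule ccontr)
    assume "t \<noteq> 1"
    hence "\<not> is_unit t" using t(1) by simp
    then obtain q where q: "prime q" "q dvd t" using t(1) prime_divisor_exists[of t] by auto
    then obtain x where "x \<in> ring_of_integers K" "\<not> q dvd itrace K x" using p by blast
    thus False using t(3)[of "itrace K x"] q(2) dvd_trans unfolding P_def by blast
  qed
  thus ?thesis using t(2) unfolding P_def by simp
qed

text \<open>If a prime \<open>p\<close> divided all traces, the trace form would vanish modulo \<open>p\<close> and \<open>p ^ n\<close> would divide the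
  discriminant. The only case not excluded by this is \<open>p = 2\<close>, \<open>n = 3\<close>, but there the trace of 1 is odd.\<close>

theorem fundamental_discriminant_trace_1:
  assumes K: "number_field K" and d: "fundamental_discriminant (discriminant K)" and n: "nf_degree K \<ge> 3"
  shows "\<exists>x\<in>ring_of_integers K. itrace K x = 1"
proof (rule trace_1_if_not_divisible[OF K], rule ccontr)
  note Kf = number_fieldD[OF K]
  fix p :: int assume p: "prime p" and "\<not> (\<exists>x\<in>ring_of_integers K. \<not> p dvd itrace K x)"
  hence div: "p dvd itrace K x" if "x \<in> ring_of_integers K" for x using that by blast
  obtain e where e: "zbasis K e" using ex_zbasis[OF K] by blast
  obtain I where I: "I \<subseteq> {..<nf_degree K}" "card I \<le> (if p = 2 then 3 else 1)" and rad:
    "\<And>q. (\<forall>x\<in>ring_of_integers K. p dvd itrace K (x * (\<Sum>j<nf_degree K. of_int (q j) * e j))) \<Longrightarrow>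
      (\<forall>a\<in>I. p dvd q a) \<Longrightarrow> \<forall>b<nf_degree K. p dvd q b"
    using radical_mod_prime[OF K e p fundamental_discriminant_prime_exponent[OF d p]] by blast
  have "p dvd int (nf_degree K)" using div[OF roi_1[OF Kf]] itrace_of_int[OF K, of 1] by simp
  hence "\<not> (p = 2 \<and> nf_degree K = 3)" by auto
  hence "card I < card {..<nf_degree K}" using I(2) n by (auto split: if_splits)
  hence "I \<noteq> {..<nf_degree K}" by auto
  then obtain b where b: "b < nf_degree K" "b \<notin> I" using I(1) by auto
  have "\<forall>j<nf_degree K. p dvd (if j = b then 1 else 0)"
  proof (rule rad[of "\<lambda>j. if j = b then 1 else 0"], intro ballI)
    fix x assume "x \<in> ring_of_integers K"
    thus "p dvd itrace K (x * (\<Sum>j<nf_degree K. of_int (if j = b then 1 else 0) * e j))"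
      by (rule div[OF roi_closed(4)[OF Kf _ int_combination_integral[OF K zbasisD(1)[OF e]]]])
  qed (use b in auto)
  thus False using p b(1) by (auto simp: prime_int_iff)
qed

lemma even_trace_square:
  assumes K: "number_field K" and x: "x \<in> ring_of_integers K"
  shows "even (itrace K (x * x) - (itrace K x)\<^sup>2)"
proof -
  note Kf = number_fieldD[OF K]
  have xx: "x * x \<in> ring_of_integers K" by (rule roi_closed(4)[OF Kf x x])
  define q where "q = (of_int ((itrace K x)\<^sup>2 - itrace K (x * x)) / 2 :: rat)"
  have hom: "emb K i (x * x) = emb K i x * emb K i x" if "i < nf_degree K" for i
    using field_homD(3)[OF emb_hom[OF K that]] roiD(1)[OF x] by simp
  have "of_rat q = ((\<Sum>i<nf_degree K. emb K i x)\<^sup>2 - (\<Sum>i<nf_degree K. emb K i x * emb K i x)) / (2 :: complex)"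
    using itrace_emb[OF K x] itrace_emb[OF K xx] hom
    by (simp add: q_def of_rat_divide of_rat_diff of_rat_power)
  also have "algebraic_int \<dots>"
    by (rule algebraic_int_second_symmetric) (rule algebraic_int_hom[OF Kf emb_hom[OF K] x])
  finally have "(of_rat q :: complex) \<in> \<int>" by (rule rational_algebraic_int_is_int) simp
  then obtain z where "(of_rat q :: complex) = of_int z" by (elim Ints_cases)
  hence "(of_rat q :: complex) = of_rat (of_int z)" by simp
  hence "q = of_int z" by (simp only: of_rat_eq_iff)
  hence "(of_int ((itrace K x)\<^sup>2 - itrace K (x * x)) :: rat) = of_int (2 * z)" by (simp add: q_def)
  hence "(itrace K x)\<^sup>2 - itrace K (x * x) = 2 * z" by (simp only: of_int_eq_iff)
  thus ?thesis by presburger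
qed

text \<open>The form \<open>(x, y) \<mapsto> n tr (x y) - tr x tr y\<close>, which is the trace form on the image of
  \<open>x \<mapsto> n x - tr x\<close> divided by \<open>n\<close>.\<close>

definition perp_form :: "'a::field_char_0 set \<Rightarrow> 'a \<Rightarrow> 'a \<Rightarrow> int" where
  "perp_form K x y = int (nf_degree K) * itrace K (x * y) - itrace K x * itrace K y"

lemma det_3x3:
  fixes A :: "'a::comm_ring_1 mat"
  assumes A: "A \<in> carrier_mat 3 3"
  shows "det A = A $$ (0,0) * (A $$ (1,1) * A $$ (2,2) - A $$ (1,2) * A $$ (2,1))
    - A $$ (1,0) * (A $$ (0,1) * A $$ (2,2) - A $$ (0,2) * A $$ (2,1))
    + A $$ (2,0) * (A $$ (0,1) * A $$ (1,2) - A $$ (0,2) * A $$ (1,1))"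
proof -
  have det2: "det B = B $$ (0,0) * B $$ (1,1) - B $$ (1,0) * B $$ (0,1)" if B: "B \<in> carrier_mat 2 2" for B :: "'a mat"
  proof -
    have c: "mat_delete B i 0 \<in> carrier_mat 1 1" for i using mat_delete_carrier[OF B] by simp
    have "det B = B $$ (0,0) * cofactor B 0 0 + B $$ (1,0) * cofactor B 1 0"
      using laplace_expansion_column[OF B, of 0] by (simp add: lessThan_Suc numeral_2_eq_2)
    also have "cofactor B 0 0 = B $$ (1,1)"
      unfolding cofactor_def det_single[OF c] using B by (simp add: mat_delete_def)
    also have "cofactor B 1 0 = - B $$ (0,1)"
      unfolding cofactor_def det_single[OF c] using B by (simp add: mat_delete_def)
    finally show ?thesis by simp
  qed
  have c: "mat_delete A i 0 \<in> carrier_mat 2 2" for i using mat_delete_carrier[OF A] by simp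
  have "det A = A $$ (0,0) * cofactor A 0 0 + A $$ (1,0) * cofactor A 1 0 + A $$ (2,0) * cofactor A 2 0"
    using laplace_expansion_column[OF A, of 0] by (simp add: lessThan_Suc numeral_3_eq_3 numeral_2_eq_2 add_ac)
  also have "cofactor A 0 0 = A $$ (1,1) * A $$ (2,2) - A $$ (1,2) * A $$ (2,1)"
    unfolding cofactor_def det2[OF c] using A by (simp add: mat_delete_def numeral_2_eq_2)
  also have "cofactor A 1 0 = - (A $$ (0,1) * A $$ (2,2) - A $$ (0,2) * A $$ (2,1))"
    unfolding cofactor_def det2[OF c] using A by (simp add: mat_delete_def numeral_2_eq_2)
  also have "cofactor A 2 0 = A $$ (0,1) * A $$ (1,2) - A $$ (0,2) * A $$ (1,1)"
    unfolding cofactor_def det2[OF c] using A by (simp add: mat_delete_def numeral_2_eq_2)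
  finally show ?thesis by (simp add: algebra_simps)
qed

text \<open>If \<open>3 S = s s\<^sup>T + 2 Q\<close> with \<open>s\<close> the vector of traces and \<open>Q\<close> symmetric with even diagonal, then expanding the
  determinant gives \<open>27 det S \<equiv> - 4 t\<^sup>2\<close> modulo 16 with \<open>t = s\<^sub>0 Q\<^sub>1\<^sub>2 + s\<^sub>1 Q\<^sub>0\<^sub>2 + s\<^sub>2 Q\<^sub>0\<^sub>1\<close>. So \<open>det S = 4 m\<close> with
  \<open>m\<close> congruent to a square modulo 4, which does not happen for a fundamental discriminant.\<close>

lemma cubic_discriminant_mod_4:
  assumes K: "number_field K" and n: "nf_degree K = 3"
    and X: "\<And>x y. x \<in> ring_of_integers K \<Longrightarrow> y \<in> ring_of_integers K \<Longrightarrow> even (perp_form K x y)"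
    and X4: "\<And>x. x \<in> ring_of_integers K \<Longrightarrow> 4 dvd perp_form K x x"
  shows "\<not> fundamental_discriminant (discriminant K)"
proof
  assume fund: "fundamental_discriminant (discriminant K)"
  obtain e where e: "zbasis K e" using ex_zbasis[OF K] by blast
  define S where "S = gram K e"
  define s where "s i = itrace K (e i)" for i
  define Q where "Q i j = (3 * S $$ (i, j) - s i * s j) div 2" for i j
  have eO: "e j \<in> ring_of_integers K" if "j < 3" for j using zbasisD(1)[OF e] that n by simp
  have pf: "perp_form K (e i) (e j) = 3 * S $$ (i, j) - s i * s j" if "i < 3" "j < 3" for i j
    using that n by (simp add: perp_form_def S_def gram_def s_def)
  have Q: "3 * S $$ (i, j) = s i * s j + 2 * Q i j" if "i < 3" "j < 3" for i j
    using X[OF eO[OF that(1)] eO[OF that(2)]] pf[OF that] by (simp add: Q_def)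
  have sym: "Q j i = Q i j" if "i < 3" "j < 3" for i j
    using that n by (simp add: Q_def S_def gram_def mult.commute)
  have "\<exists>q. Q i i = 2 * q" if "i < 3" for i
  proof -
    have "4 dvd 2 * Q i i" using X4[OF eO[OF that]] pf[OF that that] Q[OF that that] by simp
    hence "even (Q i i)" by presburger
    thus ?thesis by blast
  qed
  then obtain q where q: "\<And>i. i < 3 \<Longrightarrow> Q i i = 2 * q i" by metis
  have S: "S \<in> carrier_mat 3 3" unfolding S_def n[symmetric] by (rule gram_carrier)
  define t where "t = s 0 * Q 1 2 + s 1 * Q 0 2 + s 2 * Q 0 1"
  \<comment> \<open>one sixteenth of the remaining terms of the determinant, in the entries of \<open>Q\<close> and \<open>s\<close>\<close>
  define w where "w = (\<lambda>a b c f g h (u::int) v x. 4 * a * b * c + f * g * h - a * h\<^sup>2 - b * g\<^sup>2 - c * f\<^sup>2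
      + u\<^sup>2 * b * c + v\<^sup>2 * a * c + x\<^sup>2 * a * b + (u * v * g * h + u * x * f * h + v * x * f * g)
      - (u * v * f * c + u * x * g * b + v * x * h * a) :: int)"
  have "\<exists>z. 27 * det S = - 4 * t\<^sup>2 + 16 * z"
  proof -
    have i: "(0::nat) < 3" "(1::nat) < 3" "(2::nat) < 3" by simp_all
    have "27 * det S = (3 * S $$ (0,0)) * ((3 * S $$ (1,1)) * (3 * S $$ (2,2)) - (3 * S $$ (1,2)) * (3 * S $$ (2,1)))
      - (3 * S $$ (1,0)) * ((3 * S $$ (0,1)) * (3 * S $$ (2,2)) - (3 * S $$ (0,2)) * (3 * S $$ (2,1)))
      + (3 * S $$ (2,0)) * ((3 * S $$ (0,1)) * (3 * S $$ (1,2)) - (3 * S $$ (0,2)) * (3 * S $$ (1,1)))"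
      unfolding det_3x3[OF S] by (simp add: algebra_simps)
    also have "\<dots> = - 4 * t\<^sup>2 + 16 * w (q 0) (q 1) (q 2) (Q 0 1) (Q 0 2) (Q 1 2) (s 0) (s 1) (s 2)"
      unfolding Q[OF i(1) i(1)] Q[OF i(1) i(2)] Q[OF i(1) i(3)] Q[OF i(2) i(1)] Q[OF i(2) i(2)] Q[OF i(2) i(3)]
        Q[OF i(3) i(1)] Q[OF i(3) i(2)] Q[OF i(3) i(3)]
        q[OF i(1)] q[OF i(2)] q[OF i(3)] sym[OF i(1,2)] sym[OF i(1,3)] sym[OF i(2,3)]
      by (simp add: t_def w_def power2_eq_square algebra_simps)
    finally show ?thesis by blast
  qed
  then obtain z where z: "27 * det S = - 4 * t\<^sup>2 + 16 * z" by blast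
  have d: "discriminant K = det S" using discriminant_eq_det_gram[OF K e] by (simp add: S_def)
  from fund show False
  proof (cases rule: fundamental_discriminant_cases)
    case odd
    have "det S = 4 * (7 * det S + t\<^sup>2 - 4 * z)" using z by simp
    hence "4 dvd det S" by (metis dvd_triv_left)
    thus False using odd(1) unfolding d by presburger
  next
    case (even m)
    have m: "27 * m = - t\<^sup>2 + 4 * z" using z even(1) unfolding d by simp
    have m4: "m mod 4 = 0 \<or> m mod 4 = 1" if "27 * m = 4 * w \<or> 27 * m = 4 * w - 1" for w
    proof -
      have "m = 4 * (7 * m - w) \<or> m - 1 = 4 * (7 * m - w)" using that by auto
      hence "4 dvd m \<or> 4 dvd m - 1" by (elim disjE) (rule disjI1, erule dvdI, rule disjI2, erule dvdI)
      thus ?thesis by presburger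
    qed
    show False
    proof (cases "even t")
      case True
      then obtain u where "t = 2 * u" by blast
      hence "t\<^sup>2 = 4 * u\<^sup>2" by (simp add: power2_eq_square)
      hence "27 * m = 4 * (z - u\<^sup>2)" using m by simp
      hence "m mod 4 = 0 \<or> m mod 4 = 1" by (intro m4 disjI1)
      thus False using even(3) by linarith
    next
      case False
      then obtain u where "t = 2 * u + 1" by (elim oddE)
      hence "t\<^sup>2 = 4 * (u\<^sup>2 + u) + 1" by (simp add: power2_eq_square algebra_simps)
      hence "27 * m = 4 * (z - u\<^sup>2 - u) - 1" using m by (simp add: algebra_simps)
      hence "m mod 4 = 0 \<or> m mod 4 = 1" by (intro m4 disjI2)
      thus False using even(3) by linarith
    qed
  qed
qed

text \<open>Let \<open>p\<close> divide \<open>n tr (x y) - tr x tr y\<close> for all \<open>x\<close> and \<open>y\<close>. An element of trace 1 shows that \<open>p\<close> does not divide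
  \<open>n\<close>, so the trace form has rank at most 1 modulo \<open>p\<close> and \<open>p ^ (n - 1)\<close> divides the discriminant. For \<open>p = 2\<close> and
  \<open>n = 3\<close> this is possible, and divisibility of the diagonal values by 4 is used in addition.\<close>

theorem perp_form_primitive:
  assumes K: "number_field K" and d: "fundamental_discriminant (discriminant K)" and n: "nf_degree K \<ge> 3"
    and p: "prime p"
    and X: "\<And>x y. x \<in> ring_of_integers K \<Longrightarrow> y \<in> ring_of_integers K \<Longrightarrow> p dvd perp_form K x y"
    and X4: "\<And>x. p = 2 \<Longrightarrow> nf_degree K = 3 \<Longrightarrow> x \<in> ring_of_integers K \<Longrightarrow> 4 dvd perp_form K x x"
  shows False
proof -
  note Kf = number_fieldD[OF K]
  define N where "N = nf_degree K"
  obtain x1 where x1: "x1 \<in> ring_of_integers K" "itrace K x1 = 1"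
    using fundamental_discriminant_trace_1[OF K d n] by blast
  have pN: "\<not> p dvd int N"
  proof
    assume "p dvd int N"
    hence "p dvd int N * itrace K (x1 * x1) - perp_form K x1 x1" using X[OF x1(1) x1(1)] by (simp add: dvd_diff)
    hence "p dvd 1" using x1(2) by (simp add: perp_form_def N_def)
    thus False using p by (simp add: prime_int_iff)
  qed
  have "\<not> (p = 2 \<and> N = 3)" using cubic_discriminant_mod_4[OF K] X X4 d by (auto simp: N_def)
  moreover have "\<not> (p = 2 \<and> N = 4)" using pN by auto
  ultimately have r: "(if p = 2 then 3 else 1) + 2 \<le> N" using n by (auto simp: N_def)
  obtain e where e: "zbasis K e" using ex_zbasis[OF K] by blast
  obtain I where I: "I \<subseteq> {..<N}" "card I \<le> (if p = 2 then 3 else 1)" and rad: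
    "\<And>q. (\<forall>x\<in>ring_of_integers K. p dvd itrace K (x * (\<Sum>j<N. of_int (q j) * e j))) \<Longrightarrow>
      (\<forall>a\<in>I. p dvd q a) \<Longrightarrow> \<forall>b<N. p dvd q b"
    using radical_mod_prime[OF K e p fundamental_discriminant_prime_exponent[OF d p]] unfolding N_def by blast
  have eO: "e j \<in> ring_of_integers K" if "j < N" for j using zbasisD(1)[OF e] that by (simp add: N_def)
  have "card ({..<N} - I) \<ge> 2" using I r card_Diff_subset[of I "{..<N}"] finite_subset[OF I(1)] by auto
  then obtain b c where bc: "b < N" "c < N" "b \<notin> I" "c \<notin> I" "b \<noteq> c"
    using card_le_Suc0_iff_eq[of "{..<N} - I"] by fastforce
  \<comment> \<open>a combination of two basis vectors outside \<open>I\<close> whose trace is divisible by \<open>p\<close>\<close>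
  have no: "p dvd u \<and> p dvd v" if uv: "p dvd u * itrace K (e b) + v * itrace K (e c)" for u v
  proof -
    define q where "q = (\<lambda>j. if j = b then u else if j = c then v else 0)"
    have "(\<Sum>j<N. of_int (q j) * e j) = (\<Sum>j\<in>{b, c}. of_int (q j) * e j)"
      using bc by (intro sum.mono_neutral_right) (auto simp: q_def)
    hence sum: "(\<Sum>j<N. of_int (q j) * e j) = of_int u * e b + of_int v * e c" using bc by (simp add: q_def)
    have qO: "(\<Sum>j<N. of_int (q j) * e j) \<in> ring_of_integers K" by (rule int_combination_integral[OF K eO])
    have tr: "p dvd itrace K (\<Sum>j<N. of_int (q j) * e j)"
      using uv eO[OF bc(1)] eO[OF bc(2)] unfolding sum
      by (simp add: itrace_closed[OF K] roi_closed[OF Kf])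
    have "\<forall>j<N. p dvd q j"
    proof (rule rad, intro ballI)
      fix x assume x: "x \<in> ring_of_integers K"
      have "int N * itrace K (x * (\<Sum>j<N. of_int (q j) * e j)) =
          perp_form K x (\<Sum>j<N. of_int (q j) * e j) + itrace K x * itrace K (\<Sum>j<N. of_int (q j) * e j)"
        by (simp add: perp_form_def N_def)
      hence "p dvd int N * itrace K (x * (\<Sum>j<N. of_int (q j) * e j))"
        using X[OF x qO] tr by simp
      thus "p dvd itrace K (x * (\<Sum>j<N. of_int (q j) * e j))"
        using pN p by (simp add: prime_dvd_mult_iff)
    qed (use bc in \<open>auto simp: q_def\<close>)
    hence "p dvd q b" "p dvd q c" using bc(1,2) by blast+
    thus ?thesis using bc(5) by (simp add: q_def)
  qed
  have "p dvd itrace K (e c) \<and> p dvd - itrace K (e b)" by (rule no) simp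
  hence "p dvd 1 \<and> p dvd (0::int)" by (intro no) simp
  thus False using p by (simp add: prime_int_iff)
qed

section \<open>Isometries of the orthogonal complement of 1\<close>

text \<open>A cyclic group has at most one element of order 2, and -1 is one because \<open>n\<close> is at least 3.\<close>

lemma square_roots_of_1_mod_cyclic:
  fixes u :: int
  assumes n: "n \<ge> 3" and cyc: "cyclic_group (units_of (residue_ring n))" and u: "[u\<^sup>2 = 1] (mod n)"
  shows "[u = 1] (mod n) \<or> [u = -1] (mod n)"
proof -
  interpret residues n "residue_ring n" by unfold_locales (use n in simp_all)
  define G where "G = units_of (residue_ring n)"
  interpret G: group G unfolding G_def by (rule units_group)
  have one: "\<one>\<^bsub>G\<^esub> = 1" by (simp add: G_def units_of_one res_one_eq)
  have inG: "v mod n \<in> carrier G" if "[v\<^sup>2 = 1] (mod n)" for v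
  proof -
    have "[v * v = 1] (mod n)" using that by (simp add: power2_eq_square)
    hence "coprime v n" by (rule coprime_iff_invertible_int[THEN iffD2, OF exI])
    thus ?thesis using n by (simp add: G_def units_of_carrier)
  qed
  have sq: "(v mod n) \<otimes>\<^bsub>G\<^esub> (v mod n) = \<one>\<^bsub>G\<^esub>" if "[v\<^sup>2 = 1] (mod n)" for v
    using that n unfolding one
    by (simp add: G_def units_of_mult mult_cong cong_def power2_eq_square)
  obtain g where g: "g \<in> carrier G" "carrier G = range (\<lambda>k::int. g [^]\<^bsub>G\<^esub> k)"
    using cyc unfolding G_def[symmetric] G.cyclic_group by blast
  define N where "N = int (G.ord g)"
  have ex: "\<exists>k. v mod n = g [^]\<^bsub>G\<^esub> k \<and> N dvd 2 * k" if v: "[v\<^sup>2 = 1] (mod n)" for v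
  proof -
    obtain k :: int where k: "v mod n = g [^]\<^bsub>G\<^esub> k" using inG[OF v] g(2) by blast
    have "g [^]\<^bsub>G\<^esub> (2 * k) = g [^]\<^bsub>G\<^esub> k \<otimes>\<^bsub>G\<^esub> g [^]\<^bsub>G\<^esub> k"
      using G.int_pow_mult[OF g(1), of k k] by simp
    also have "\<dots> = \<one>\<^bsub>G\<^esub>" using sq[OF v] k by simp
    finally show ?thesis using k G.int_pow_eq_id[OF g(1)] by (auto simp: N_def)
  qed
  obtain k where k: "u mod n = g [^]\<^bsub>G\<^esub> k" "N dvd 2 * k" using ex[OF u] by blast
  obtain j where j: "(-1) mod n = g [^]\<^bsub>G\<^esub> j" "N dvd 2 * j" using ex[of "-1"] by auto
  have j0: "\<not> N dvd j"
  proof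
    assume "N dvd j"
    hence "(-1) mod n = 1" using j(1) G.int_pow_eq_id[OF g(1), of j] one by (simp add: N_def)
    thus False using n by (simp add: zmod_minus1)
  qed
  show ?thesis
  proof (cases "N dvd k")
    case True
    hence "u mod n = 1" using k(1) G.int_pow_eq_id[OF g(1), of k] one by (simp add: N_def)
    thus ?thesis using n by (simp add: cong_def)
  next
    case False
    obtain a where a: "2 * k = N * a" using k(2) by blast
    obtain b where b: "2 * j = N * b" using j(2) by blast
    have "odd a"
    proof
      assume "even a"
      then obtain c where "a = 2 * c" by blast
      thus False using a False by simp
    qed
    moreover have "odd b"
    proof
      assume "even b"
      then obtain c where "b = 2 * c" by blast
      thus False using b j0 by simp
    qed
    ultimately obtain c where c: "a - b = 2 * c" by (metis evenE odd_even_add even_diff)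
    have "2 * (k - j) = N * (a - b)" using a b by (simp add: algebra_simps)
    hence "k - j = N * c" unfolding c by simp
    hence "N dvd k - j" by simp
    hence "u mod n = (-1) mod n" using G.int_pow_eq[OF g(1), of k j] k(1) j(1)
      by (simp add: N_def dvd_diff_commute)
    thus ?thesis by (simp add: cong_def)
  qed
qed

definition perp :: "'a::field_char_0 set \<Rightarrow> 'a \<Rightarrow> 'a" where
  "perp K x = of_nat (nf_degree K) * x - of_rat (field_trace K x)"

lemma perp_integers: "integers_perp K = perp K ` ring_of_integers K"
  by (simp add: integers_perp_def perp_def)

lemma perp_itrace: "number_field K \<Longrightarrow> x \<in> ring_of_integers K \<Longrightarrow>
    perp K x = of_int (int (nf_degree K)) * x - of_int (itrace K x)"
  by (simp add: perp_def itrace[symmetric])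

lemma perp_add:
  assumes K: "number_field K" and xy: "x \<in> ring_of_integers K" "y \<in> ring_of_integers K"
  shows "perp K (x + y) = perp K x + perp K y"
  using xy by (simp add: perp_itrace[OF K] roi_closed[OF number_fieldD[OF K]] itrace_closed[OF K] algebra_simps)

lemma perp_scale:
  assumes K: "number_field K" and x: "x \<in> ring_of_integers K"
  shows "perp K (of_int c * x) = of_int c * perp K x"
proof -
  have "of_int c * x \<in> ring_of_integers K" by (rule roi_closed(4)[OF number_fieldD[OF K] roi_closed(1)[OF number_fieldD[OF K]] x])
  thus ?thesis using itrace_closed(3)[OF K x x, of c] by (simp add: perp_itrace[OF K] x right_diff_distrib mult.left_commute)
qed

lemma perp_of_int: "number_field K \<Longrightarrow> perp K (of_int k) = 0"
  by (simp add: perp_itrace roi_closed(1) number_fieldD itrace_of_int)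

lemma perp_integral:
  assumes K: "number_field K" and x: "x \<in> ring_of_integers K"
  shows "perp K x \<in> ring_of_integers K" "itrace K (perp K x) = 0"
proof -
  note Kf = number_fieldD[OF K]
  have nx: "of_int (int (nf_degree K)) * x \<in> ring_of_integers K" by (rule roi_closed(4)[OF Kf roi_closed(1)[OF Kf] x])
  show "perp K x \<in> ring_of_integers K"
    unfolding perp_itrace[OF K x] by (rule roi_closed(3)[OF Kf nx roi_closed(1)[OF Kf]])
  show "itrace K (perp K x) = 0"
    unfolding perp_itrace[OF K x] itrace_closed(2)[OF K nx roi_closed(1)[OF Kf]]
      itrace_closed(3)[OF K x x] itrace_of_int[OF K] by simp
qed

lemma itrace_perp_mult:
  assumes K: "number_field K" and x: "x \<in> ring_of_integers K" and y: "y \<in> ring_of_integers K"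
  shows "itrace K (perp K x * y) = perp_form K x y"
    "itrace K (perp K x * perp K y) = int (nf_degree K) * perp_form K x y"
proof -
  note Kf = number_fieldD[OF K]
  have *: "itrace K (perp K x * z) = int (nf_degree K) * itrace K (x * z) - itrace K x * itrace K z"
    if z: "z \<in> ring_of_integers K" for z
  proof -
    have "perp K x * z = of_int (int (nf_degree K)) * (x * z) - of_int (itrace K x) * z"
      by (simp add: perp_itrace[OF K x] algebra_simps)
    moreover have xz: "x * z \<in> ring_of_integers K" by (rule roi_closed(4)[OF Kf x z])
    ultimately show ?thesis
      using z by (simp add: itrace_closed(2,3)[OF K] roi_closed(1,4)[OF Kf] del: of_int_of_nat_eq)
  qed
  show 1: "itrace K (perp K x * y) = perp_form K x y" unfolding *[OF y] perp_form_def ..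
  have "itrace K (x * perp K y) = perp_form K x y"
  proof -
    have "x * perp K y = of_int (int (nf_degree K)) * (x * y) - of_int (itrace K y) * x"
      by (simp add: perp_itrace[OF K y] algebra_simps)
    moreover have "x * y \<in> ring_of_integers K" by (rule roi_closed(4)[OF Kf x y])
    ultimately show ?thesis using x
      by (simp add: itrace_closed(2,3)[OF K] roi_closed(1,4)[OF Kf] perp_form_def mult.commute[of "itrace K x"]
          del: of_int_of_nat_eq)
  qed
  thus "itrace K (perp K x * perp K y) = int (nf_degree K) * perp_form K x y"
    unfolding *[OF perp_integral(1)[OF K y]] perp_integral(2)[OF K y] by simp
qed

lemma trace_form_itrace:
  assumes "number_field K" "x \<in> ring_of_integers K" "y \<in> ring_of_integers K"
  shows "trace_form K x y = of_int (itrace K (x * y))"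
  unfolding trace_form_def using itrace[OF assms(1) roi_closed(4)[OF number_fieldD[OF assms(1)] assms(2,3)]] by simp

lemma additive_on_integers:
  assumes K: "number_field K" and h: "\<And>x y. x \<in> ring_of_integers K \<Longrightarrow> y \<in> ring_of_integers K \<Longrightarrow> h (x + y) = h x + h y"
  shows "h 0 = (0 :: 'b::ab_group_add)" "x \<in> ring_of_integers K \<Longrightarrow> h (- x) = - h x"
proof -
  note Kf = number_fieldD[OF K]
  have 0: "0 \<in> ring_of_integers K" using roi_closed(1)[OF Kf, of 0] by simp
  show h0: "h 0 = 0" using h[OF 0 0] by simp
  show "h (- x) = - h x" if x: "x \<in> ring_of_integers K"
    using h[OF x roi_closed(5)[OF Kf x]] h0 by (simp add: add_eq_0_iff)
qed

lemma additive_on_integers_scale: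
  fixes h :: "'a::field_char_0 \<Rightarrow> 'b::field_char_0"
  assumes K: "number_field K" and h: "\<And>x y. x \<in> ring_of_integers K \<Longrightarrow> y \<in> ring_of_integers K \<Longrightarrow> h (x + y) = h x + h y"
    and x: "x \<in> ring_of_integers K"
  shows "h (of_int c * x) = of_int c * h x"
proof -
  note Kf = number_fieldD[OF K]
  have nat: "h (of_nat k * x) = of_nat k * h x" for k
  proof (induction k)
    case 0
    show ?case using additive_on_integers(1)[of K h, OF K h] by simp
  next
    case (Suc k)
    have "of_nat k * x \<in> ring_of_integers K" using roi_closed(4)[OF Kf roi_closed(1)[OF Kf, of "int k"] x] by simp
    thus ?case using h[OF _ x, of "of_nat k * x"] Suc by (simp add: algebra_simps)
  qed
  show ?thesis
  proof (cases c rule: int_cases2)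
    case (nonneg k)
    thus ?thesis using nat[of k] by simp
  next
    case (nonpos k)
    have "of_nat k * x \<in> ring_of_integers K" using roi_closed(4)[OF Kf roi_closed(1)[OF Kf, of "int k"] x] by simp
    thus ?thesis using additive_on_integers(2)[of K h "of_nat k * x", OF K h] nat[of k] nonpos by simp
  qed
qed

lemma additive_on_int_combination:
  fixes h :: "'a::field_char_0 \<Rightarrow> 'b::field_char_0" and n :: nat
  assumes K: "number_field K" and h: "\<And>x y. x \<in> ring_of_integers K \<Longrightarrow> y \<in> ring_of_integers K \<Longrightarrow> h (x + y) = h x + h y"
    and e: "\<And>j. j < n \<Longrightarrow> e j \<in> ring_of_integers K"
  shows "h (\<Sum>j<n. of_int (q j) * e j) = (\<Sum>j<n. of_int (q j) * h (e j))"
  using e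
proof (induction n)
  case 0
  show ?case using additive_on_integers(1)[of K h, OF K h] by simp
next
  case (Suc n)
  have 1: "(\<Sum>j<n. of_int (q j) * e j) \<in> ring_of_integers K" by (rule int_combination_integral[OF K]) (use Suc in auto)
  have 2: "of_int (q n) * e n \<in> ring_of_integers K"
    using Suc.prems by (intro roi_closed(1,4)[OF number_fieldD[OF K]]) auto
  show ?case using h[OF 1 2] Suc additive_on_integers_scale[of K h "e n" "q n", OF K h] by simp
qed

text \<open>The degree is determined by the rank of \<open>O\<^sup>\<bottom>\<close>: adding traces back, an injective additive map
  between trace zero elements carries a basis of \<open>K\<close> to linearly independent elements.\<close>

lemma degree_le_if_perp_embeds:
  fixes K :: "'a::field_char_0 set" and L :: "'b::field_char_0 set"
  assumes K: "number_field K" and L: "number_field L"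
    and h: "\<And>x y. x \<in> ring_of_integers K \<Longrightarrow> y \<in> ring_of_integers K \<Longrightarrow> h (x + y) = h x + h y"
    and hL: "\<And>x. x \<in> ring_of_integers K \<Longrightarrow> h x \<in> ring_of_integers L \<and> itrace L (h x) = 0"
    and ker: "\<And>x. x \<in> ring_of_integers K \<Longrightarrow> h x = 0 \<Longrightarrow> perp K x = 0"
  shows "nf_degree K \<le> nf_degree L"
proof (rule ccontr)
  assume lt: "\<not> nf_degree K \<le> nf_degree L"
  note Kf = number_fieldD[OF K] and Lf = number_fieldD[OF L]
  obtain e where e: "zbasis K e" using ex_zbasis[OF K] by blast
  have eO: "e j \<in> ring_of_integers K" if "j < nf_degree K" for j using zbasisD(1)[OF e that] .
  obtain B where B: "finite B" "rat_basis L B" "card B = nf_degree L" using number_field_basis[OF L] by blast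
  define f where "f j = of_int (itrace K (e j)) + h (e j)" for j
  have fO: "f j \<in> ring_of_integers L" if "j < nf_degree K" for j
    unfolding f_def using hL[OF eO[OF that]] by (intro roi_closed(1,2)[OF Lf]) blast
  obtain u where u: "\<exists>i<nf_degree K. u i \<noteq> 0" "(\<Sum>i<nf_degree K. of_rat (u i) * f i) = 0"
    using rat_dependent_sequence[OF B(1), of "nf_degree K" f] fO roiD(1) B(2,3) lt
    unfolding rat_basis_def by (metis not_le)
  obtain N :: int where N: "N > 0" "\<forall>i<nf_degree K. \<exists>k::int. of_int N * u i = of_int k"
    using common_denominator[of "{..<nf_degree K}" u] by auto
  then obtain c :: "nat \<Rightarrow> int" where c: "\<And>i. i < nf_degree K \<Longrightarrow> of_int N * u i = of_int (c i)" by metis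
  have "(\<Sum>i<nf_degree K. of_int (c i) * f i) = of_int N * (\<Sum>i<nf_degree K. of_rat (u i) * f i)"
    unfolding sum_distrib_left
  proof (intro sum.cong refl)
    fix i assume "i \<in> {..<nf_degree K}"
    hence "(of_rat (of_int N * u i) :: 'b) = of_rat (of_int (c i))" using c by simp
    thus "of_int (c i) * f i = of_int N * (of_rat (u i) * f i)" by (simp add: of_rat_mult mult.assoc)
  qed
  hence 0: "(\<Sum>i<nf_degree K. of_int (c i) * f i) = 0" using u(2) by simp
  define x where "x = (\<Sum>i<nf_degree K. of_int (c i) * e i)"
  have xO: "x \<in> ring_of_integers K" unfolding x_def by (rule int_combination_integral[OF K eO])
  have trx: "itrace K x = (\<Sum>i<nf_degree K. c i * itrace K (e i))"
    using itrace_int_combination[OF K eO roi_1[OF Kf], where q = c] by (simp add: x_def)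
  have "h x = (\<Sum>i<nf_degree K. of_int (c i) * h (e i))"
    unfolding x_def by (rule additive_on_int_combination[of K h, OF K h eO])
  hence "(\<Sum>i<nf_degree K. of_int (c i) * f i) = of_int (itrace K x) + h x"
    unfolding trx by (simp add: f_def distrib_left sum.distrib)
  hence hx: "of_int (itrace K x) + h x = 0" using 0 by simp
  have "itrace L (of_int (itrace K x) + h x) = int (nf_degree L) * itrace K x"
    using itrace_closed(1)[OF L roi_closed(1)[OF Lf]] hL[OF xO] itrace_of_int[OF L] by simp
  hence "int (nf_degree L) * itrace K x = 0" unfolding hx using itrace_of_int[OF L, of 0] by simp
  moreover have "nf_degree L \<noteq> 0"
  proof
    assume "nf_degree L = 0"
    hence "B = {}" using B(1,3) by simp
    hence "L = {0}" using B(2) by (simp add: rat_basis_def)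
    thus False using subfieldD(2)[OF Lf] by simp
  qed
  ultimately have tr0: "itrace K x = 0" by simp
  hence "perp K x = 0" using hx ker[OF xO] by simp
  hence "of_nat (nf_degree K) * x = 0" using tr0 perp_itrace[OF K xO] by simp
  moreover have "nf_degree K \<noteq> 0" using lt by simp
  ultimately have "(\<Sum>i<nf_degree K. of_int (c i) * e i) = (\<Sum>i<nf_degree K. of_int 0 * e i)" by (simp add: x_def)
  hence "c i = 0" if "i < nf_degree K" for i by (rule int_combination_unique[OF K e _ that])
  hence "u i = 0" if "i < nf_degree K" for i using c[OF that] N(1) that by simp
  thus False using u(1) by blast
qed

text \<open>An isometry \<open>g\<close> of \<open>O\<^sub>A\<^sup>\<bottom>\<close> into \<open>O\<^sub>B\<^sup>\<bottom>\<close> preserves \<open>n tr (x y) - tr x tr y\<close>, so it changes traces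
  modulo \<open>n\<close> by a factor whose square is 1. As \<open>(\<int>/n)\<^sup>\<times>\<close> is cyclic, this factor is a sign
  \<open>\<epsilon>\<close>, and \<open>\<epsilon> g\<close> extends to \<open>O\<^sub>A\<close>, fixing 1.\<close>

locale perp_isometry =
  fixes A :: "'a::field_char_0 set" and B :: "'b::field_char_0 set" and n :: nat and g :: "'a \<Rightarrow> 'b"
  assumes A: "number_field A" and B: "number_field B" and n: "nf_degree A = n" "nf_degree B = n" "n \<ge> 3"
    and cyc: "cyclic_group (units_of (residue_ring (int n)))"
    and trace_1: "\<exists>x\<in>ring_of_integers A. itrace A x = 1"
    and g_add: "\<And>x y. x \<in> integers_perp A \<Longrightarrow> y \<in> integers_perp A \<Longrightarrow> g (x + y) = g x + g y"
    and g_perp: "\<And>x. x \<in> integers_perp A \<Longrightarrow> g x \<in> integers_perp B"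
    and g_form: "\<And>x y. x \<in> integers_perp A \<Longrightarrow> y \<in> integers_perp A \<Longrightarrow> trace_form B (g x) (g y) = trace_form A x y"
begin

lemmas Af = number_fieldD[OF A] and Bf = number_fieldD[OF B]

definition h :: "'a \<Rightarrow> 'b" where "h x = g (perp A x)"

lemma h_add: "x \<in> ring_of_integers A \<Longrightarrow> y \<in> ring_of_integers A \<Longrightarrow> h (x + y) = h x + h y"
  unfolding h_def perp_add[OF A] by (rule g_add) (auto simp: perp_integers)

lemma h_perp: "x \<in> ring_of_integers A \<Longrightarrow> \<exists>y\<in>ring_of_integers B. h x = perp B y"
  using g_perp[of "perp A x"] by (auto simp: perp_integers h_def)

lemma h_form:
  assumes x: "x \<in> ring_of_integers A" "x' \<in> ring_of_integers A" and y: "y \<in> ring_of_integers B" "y' \<in> ring_of_integers B"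
    and h: "h x = perp B y" "h x' = perp B y'"
  shows "perp_form B y y' = perp_form A x x'"
proof -
  have "trace_form B (h x) (h x') = trace_form A (perp A x) (perp A x')"
    unfolding h_def using x by (intro g_form) (simp_all add: perp_integers)
  hence "itrace B (perp B y * perp B y') = itrace A (perp A x * perp A x')"
    unfolding h using x y by (simp add: trace_form_itrace A B perp_integral)
  thus ?thesis using n x y by (simp add: itrace_perp_mult A B)
qed

lemma sign:
  obtains \<epsilon> :: int where "\<epsilon> = 1 \<or> \<epsilon> = -1"
    "\<And>x y. x \<in> ring_of_integers A \<Longrightarrow> y \<in> ring_of_integers B \<Longrightarrow> h x = perp B y \<Longrightarrow> [itrace B y = \<epsilon> * itrace A x] (mod int n)"
proof -
  obtain x1 where x1: "x1 \<in> ring_of_integers A" "itrace A x1 = 1" using trace_1 by blast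
  obtain y1 where y1: "y1 \<in> ring_of_integers B" "h x1 = perp B y1" using h_perp[OF x1(1)] by blast
  define u where "u = itrace B y1"
  have mod: "[itrace B y * itrace B y' = itrace A x * itrace A x'] (mod int n)"
    if "x \<in> ring_of_integers A" "x' \<in> ring_of_integers A" "y \<in> ring_of_integers B" "y' \<in> ring_of_integers B"
      "h x = perp B y" "h x' = perp B y'" for x x' y y'
  proof -
    have "itrace B y * itrace B y' - itrace A x * itrace A x' =
        int n * (itrace B (y * y') - itrace A (x * x'))"
      using h_form[OF that] n by (simp add: perp_form_def algebra_simps)
    thus ?thesis by (simp add: cong_iff_dvd_diff)
  qed
  have uu: "[u * u = 1] (mod int n)" using mod[OF x1(1) x1(1) y1(1) y1(1) y1(2) y1(2)] x1(2) by (simp add: u_def)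
  have "[u = 1] (mod int n) \<or> [u = -1] (mod int n)"
    by (rule square_roots_of_1_mod_cyclic[OF _ cyc]) (use uu n(3) in \<open>simp_all add: power2_eq_square\<close>)
  then obtain \<epsilon> :: int where \<epsilon>: "\<epsilon> = 1 \<or> \<epsilon> = -1" "[u = \<epsilon>] (mod int n)" by blast
  show ?thesis
  proof (rule that[OF \<epsilon>(1)])
    fix x y assume xy: "x \<in> ring_of_integers A" "y \<in> ring_of_integers B" "h x = perp B y"
    have "[itrace B y * u = itrace A x] (mod int n)"
      using mod[OF xy(1) x1(1) xy(2) y1(1) xy(3) y1(2)] x1(2) by (simp add: u_def)
    hence 1: "[itrace B y * u * u = itrace A x * \<epsilon>] (mod int n)" using \<epsilon>(2) by (rule cong_mult)
    have "[itrace B y * (u * u) = itrace B y * 1] (mod int n)" using uu by (intro cong_mult cong_refl)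
    hence "[itrace B y = itrace B y * u * u] (mod int n)" by (simp add: mult.assoc cong_sym_eq)
    from cong_trans[OF this 1] show "[itrace B y = \<epsilon> * itrace A x] (mod int n)" by (simp only: mult.commute)
  qed
qed

text \<open>The extension is \<open>\<Phi> x = (tr x + \<epsilon> g (n x - tr x)) / n\<close>, the only one that preserves traces; the congruence of
  traces makes it integral.\<close>

lemma extension:
  "\<exists>\<epsilon>::int. \<exists>\<Phi>. (\<epsilon> = 1 \<or> \<epsilon> = -1) \<and>
    (\<forall>x\<in>ring_of_integers A. of_nat n * \<Phi> x = of_int (itrace A x) + of_int \<epsilon> * h x) \<and>
    (\<forall>x\<in>ring_of_integers A. \<Phi> x \<in> ring_of_integers B) \<and>
    (\<forall>x\<in>ring_of_integers A. \<forall>y\<in>ring_of_integers A. \<Phi> (x + y) = \<Phi> x + \<Phi> y) \<and>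
    (\<forall>x\<in>ring_of_integers A. \<forall>y\<in>ring_of_integers A. itrace B (\<Phi> x * \<Phi> y) = itrace A (x * y)) \<and>
    \<Phi> 1 = 1"
proof -
  obtain \<epsilon> :: int where \<epsilon>: "\<epsilon> = 1 \<or> \<epsilon> = -1"
    and cong: "\<And>x y. x \<in> ring_of_integers A \<Longrightarrow> y \<in> ring_of_integers B \<Longrightarrow> h x = perp B y \<Longrightarrow>
      [itrace B y = \<epsilon> * itrace A x] (mod int n)" using sign by metis
  have \<epsilon>\<epsilon>: "\<epsilon> * \<epsilon> = 1" using \<epsilon> by auto
  define \<Phi> where "\<Phi> x = (of_int (itrace A x) + of_int \<epsilon> * h x) / of_nat n" for x
  have n0: "(of_nat n :: 'b) \<noteq> 0" using n(3) by simp
  have n\<Phi>: "of_nat n * \<Phi> x = of_int (itrace A x) + of_int \<epsilon> * h x" for x using n0 by (simp add: \<Phi>_def)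
  have ex: "\<exists>y\<in>ring_of_integers B. \<Phi> x = y \<and> itrace B y = itrace A x \<and> h x = of_int \<epsilon> * perp B y \<and>
      (\<exists>y'\<in>ring_of_integers B. h x = perp B y' \<and> (\<exists>k. y = of_int \<epsilon> * y' + of_int k))"
    if x: "x \<in> ring_of_integers A" for x
  proof -
    obtain y' where y': "y' \<in> ring_of_integers B" "h x = perp B y'" using h_perp[OF x] by blast
    obtain k where k: "\<epsilon> * itrace A x - itrace B y' = int n * k"
      using cong[OF x y'] unfolding cong_iff_dvd_diff dvd_diff_commute[of _ "itrace B y'"] by blast
    define y where "y = of_int \<epsilon> * y' + of_int (\<epsilon> * k)"
    have \<epsilon>y: "of_int \<epsilon> * y' \<in> ring_of_integers B" by (rule roi_closed(4)[OF Bf roi_closed(1)[OF Bf] y'(1)])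
    have yO: "y \<in> ring_of_integers B" unfolding y_def by (rule roi_closed(2)[OF Bf \<epsilon>y roi_closed(1)[OF Bf]])
    have "itrace B y = \<epsilon> * itrace B y' + \<epsilon> * (int n * k)"
      unfolding y_def itrace_closed(1)[OF B \<epsilon>y roi_closed(1)[OF Bf]] itrace_closed(3)[OF B y'(1) y'(1)] itrace_of_int[OF B] n(2)
      by (simp add: algebra_simps)
    also have "\<dots> = (\<epsilon> * \<epsilon>) * itrace A x" unfolding k[symmetric] by (simp add: algebra_simps)
    finally have ty: "itrace B y = itrace A x" using \<epsilon>\<epsilon> by simp
    have "perp B y = of_int \<epsilon> * perp B y'"
      unfolding y_def perp_add[OF B \<epsilon>y roi_closed(1)[OF Bf]] perp_scale[OF B y'(1)]
      by (simp only: perp_of_int[OF B] add_0_right)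
    hence py: "h x = of_int \<epsilon> * perp B y" using y'(2) \<epsilon> by auto
    have sq: "of_int \<epsilon> * (of_int \<epsilon> * z) = z" for z :: 'b using \<epsilon> by auto
    have "of_nat n * \<Phi> x = of_nat n * y"
      unfolding n\<Phi> py perp_itrace[OF B yO] ty n(2) sq by simp
    hence "\<Phi> x = y" using n0 by simp
    thus ?thesis using yO ty py y' y_def by blast
  qed
  have \<Phi>: "\<Phi> x \<in> ring_of_integers B" "itrace B (\<Phi> x) = itrace A x" "h x = of_int \<epsilon> * perp B (\<Phi> x)"
    if "x \<in> ring_of_integers A" for x using ex[OF that] by auto
  show ?thesis
  proof (intro exI[of _ \<epsilon>] exI[of _ \<Phi>] conjI ballI \<epsilon> n\<Phi> \<Phi>(1))
    show "\<Phi> (x + y) = \<Phi> x + \<Phi> y" if "x \<in> ring_of_integers A" "y \<in> ring_of_integers A" for x y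
      using that by (simp add: \<Phi>_def h_add itrace_closed[OF A] add_divide_distrib algebra_simps)
    show "itrace B (\<Phi> x * \<Phi> y) = itrace A (x * y)" if xy: "x \<in> ring_of_integers A" "y \<in> ring_of_integers A" for x y
    proof -
      have e\<Phi>: "of_int \<epsilon> * \<Phi> x \<in> ring_of_integers B" "of_int \<epsilon> * \<Phi> y \<in> ring_of_integers B"
        using \<Phi>(1) xy roi_closed(1,4)[OF Bf] by blast+
      have "perp_form B (of_int \<epsilon> * \<Phi> x) (of_int \<epsilon> * \<Phi> y) = perp_form A x y"
        using xy e\<Phi> by (intro h_form) (simp_all add: \<Phi> perp_scale[OF B])
      moreover have "of_int \<epsilon> * \<Phi> x * (of_int \<epsilon> * \<Phi> y) = \<Phi> x * \<Phi> y" using \<epsilon> by auto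
      moreover have "itrace B (of_int \<epsilon> * \<Phi> x) * itrace B (of_int \<epsilon> * \<Phi> y) = itrace A x * itrace A y"
        unfolding itrace_closed(3)[OF B \<Phi>(1)[OF xy(1)] \<Phi>(1)[OF xy(1)]]
          itrace_closed(3)[OF B \<Phi>(1)[OF xy(2)] \<Phi>(1)[OF xy(2)]] \<Phi>(2)[OF xy(1)] \<Phi>(2)[OF xy(2)]
        using \<epsilon> by auto
      ultimately have "int n * itrace B (\<Phi> x * \<Phi> y) = int n * itrace A (x * y)"
        using n by (simp add: perp_form_def)
      thus ?thesis using n(3) by simp
    qed
    have "perp A 1 = 0" using field_trace_of_rat[OF A, of 1] by (simp add: perp_def)
    moreover have "h 0 = 0" by (rule additive_on_integers(1)[of A h, OF A h_add])
    moreover have "perp A 0 = 0" using field_trace_of_rat[OF A, of 0] by (simp add: perp_def)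
    ultimately have "h 1 = 0" by (simp add: h_def)
    moreover have "itrace A 1 = int n" using itrace_of_int[OF A, of 1] n by simp
    ultimately show "\<Phi> 1 = 1" using n0 by (simp add: \<Phi>_def)
  qed
qed

end

lemma bases_of_isometric_integers:
  assumes A: "number_field A" and B: "number_field B" and n: "nf_degree A = nf_degree B"
    and in_B: "\<And>x. x \<in> ring_of_integers A \<Longrightarrow> \<Phi> x \<in> ring_of_integers B"
    and add: "\<And>x y. x \<in> ring_of_integers A \<Longrightarrow> y \<in> ring_of_integers A \<Longrightarrow> \<Phi> (x + y) = \<Phi> x + \<Phi> y"
    and form: "\<And>x y. x \<in> ring_of_integers A \<Longrightarrow> y \<in> ring_of_integers A \<Longrightarrow> itrace B (\<Phi> x * \<Phi> y) = itrace A (x * y)"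
    and one: "\<Phi> 1 = 1" and onto: "\<And>y. y \<in> ring_of_integers B \<Longrightarrow> \<exists>x\<in>ring_of_integers A. \<Phi> x = y"
  obtains e e' and \<kappa> :: "int vec" where "zbasis A e" "zbasis B e'" "gram A e = gram B e'"
    "1 = (\<Sum>j<nf_degree A. of_int (\<kappa> $ j) * e j)" "1 = (\<Sum>j<nf_degree A. of_int (\<kappa> $ j) * e' j)"
proof -
  obtain e where e: "zbasis A e" using ex_zbasis[OF A] by blast
  have eO: "e j \<in> ring_of_integers A" if "j < nf_degree A" for j using zbasisD(1)[OF e that] .
  have comb: "\<Phi> (\<Sum>j<nf_degree A. of_int (q j) * e j) = (\<Sum>j<nf_degree A. of_int (q j) * \<Phi> (e j))" for q
    by (rule additive_on_int_combination[OF A add eO])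
  obtain q where q: "1 = (\<Sum>j<nf_degree A. of_int (q j) * e j)" using zbasisD(2)[OF e roi_1[OF number_fieldD[OF A]]] by blast
  show ?thesis
  proof (rule that[of e "\<lambda>j. \<Phi> (e j)" "vec (nf_degree A) q"])
    show "zbasis B (\<lambda>j. \<Phi> (e j))"
      unfolding zbasis_def
    proof (intro conjI allI impI ballI)
      fix y assume "y \<in> ring_of_integers B"
      then obtain x where x: "x \<in> ring_of_integers A" "\<Phi> x = y" using onto by blast
      obtain q where "x = (\<Sum>j<nf_degree A. of_int (q j) * e j)" using zbasisD(2)[OF e x(1)] by blast
      thus "\<exists>q. y = (\<Sum>j<nf_degree B. of_int (q j) * \<Phi> (e j))" using comb x(2) n by metis
    qed (use eO in_B n in simp)
    show "gram A e = gram B (\<lambda>j. \<Phi> (e j))"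
      unfolding gram_def n[symmetric] by (rule cong_mat) (simp_all add: form eO)
    show "1 = (\<Sum>j<nf_degree A. of_int (vec (nf_degree A) q $ j) * e j)" using q by simp
    show "1 = (\<Sum>j<nf_degree A. of_int (vec (nf_degree A) q $ j) * \<Phi> (e j))" using comb[of q] q one by simp
  qed (rule e)
qed

section \<open>Isometries force isomorphisms\<close>

lemma trace_zero_integers_eq:
  assumes "number_field K"
  shows "trace_zero_integers K = {x \<in> ring_of_integers K. itrace K x = 0}"
proof -
  have "field_trace K x = 0 \<longleftrightarrow> itrace K x = 0" if "x \<in> ring_of_integers K" for x
    unfolding itrace[OF assms that, symmetric] by simp
  thus ?thesis unfolding trace_zero_integers_def by blast
qed

lemma integers_perp_subset: "number_field K \<Longrightarrow> integers_perp K \<subseteq> trace_zero_integers K"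
  by (auto simp: perp_integers trace_zero_integers_eq perp_integral)

lemma trace_zero_closed:
  assumes K: "number_field K" and xy: "x \<in> trace_zero_integers K" "y \<in> trace_zero_integers K"
  shows "x + y \<in> trace_zero_integers K" "of_int c * x \<in> trace_zero_integers K"
proof -
  note Kf = number_fieldD[OF K]
  have x: "x \<in> ring_of_integers K" "itrace K x = 0" and y: "y \<in> ring_of_integers K" "itrace K y = 0"
    using xy by (simp_all add: trace_zero_integers_eq[OF K])
  show "x + y \<in> trace_zero_integers K"
    using x y roi_closed(2)[OF Kf x(1) y(1)] itrace_closed(1)[OF K x(1) y(1)] by (simp add: trace_zero_integers_eq[OF K])
  show "of_int c * x \<in> trace_zero_integers K"
    using x roi_closed(4)[OF Kf roi_closed(1)[OF Kf] x(1)] itrace_closed(3)[OF K x(1) x(1)]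
    by (simp add: trace_zero_integers_eq[OF K])
qed

lemma integers_perp_add:
  assumes K: "number_field K" and xy: "x \<in> integers_perp K" "y \<in> integers_perp K"
  shows "x + y \<in> integers_perp K"
proof -
  obtain a b where ab: "x = perp K a" "y = perp K b" "a \<in> ring_of_integers K" "b \<in> ring_of_integers K"
    using xy by (auto simp: perp_integers)
  show ?thesis
    unfolding perp_integers ab(1,2) perp_add[OF K ab(3,4), symmetric]
    by (rule imageI) (rule roi_closed(2)[OF number_fieldD[OF K] ab(3,4)])
qed

lemma additive_inverse:
  assumes bij: "bij_betw f M N" and add: "\<And>x y. x \<in> M \<Longrightarrow> y \<in> M \<Longrightarrow> f (x + y) = f x + f y"
    and M: "\<And>x y. x \<in> M \<Longrightarrow> y \<in> M \<Longrightarrow> x + y \<in> M"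
  obtains g where "bij_betw g N M" "\<And>x y. x \<in> N \<Longrightarrow> y \<in> N \<Longrightarrow> g (x + y) = g x + g y"
    "\<And>y. y \<in> N \<Longrightarrow> f (g y) = y" "\<And>x. x \<in> M \<Longrightarrow> g (f x) = x"
proof -
  define g where "g = inv_into M f"
  have g: "bij_betw g N M" unfolding g_def by (rule bij_betw_inv_into[OF bij])
  have fg: "f (g y) = y" if "y \<in> N" for y unfolding g_def by (rule bij_betw_inv_into_right[OF bij that])
  have gf: "g (f x) = x" if "x \<in> M" for x unfolding g_def by (rule bij_betw_inv_into_left[OF bij that])
  have gM: "g y \<in> M" if "y \<in> N" for y using g that by (auto simp: bij_betw_def)
  have "g (x + y) = g x + g y" if "x \<in> N" "y \<in> N" for x y
  proof -
    have "x + y = f (g x + g y)" using add[OF gM gM] that fg by simp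
    thus ?thesis using gf[OF M[OF gM gM]] that by simp
  qed
  thus ?thesis using that g fg gf by blast
qed

lemma degree_le_if_additive_embedding:
  assumes K: "number_field K" and L: "number_field L"
    and M: "integers_perp K \<subseteq> M" and f: "inj_on f M" "f ` M \<subseteq> trace_zero_integers L"
    and add: "\<And>x y. x \<in> M \<Longrightarrow> y \<in> M \<Longrightarrow> f (x + y) = f x + f y"
  shows "nf_degree K \<le> nf_degree L"
proof (rule degree_le_if_perp_embeds[OF K L])
  have pM: "perp K x \<in> M" if "x \<in> ring_of_integers K" for x using M that by (auto simp: perp_integers)
  have 0: "0 \<in> M" using pM[OF roi_closed(1)[OF number_fieldD[OF K], of 0]] perp_of_int[OF K, of 0] by simp
  have f0: "f 0 = 0" using add[OF 0 0] by simp
  fix x assume x: "x \<in> ring_of_integers K"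
  show "f (perp K x) \<in> ring_of_integers L \<and> itrace L (f (perp K x)) = 0"
    using f(2) pM[OF x] by (auto simp: trace_zero_integers_eq[OF L])
  show "perp K x = 0" if "f (perp K x) = 0" using f(1) pM[OF x] 0 f0 that by (metis inj_onD)
  fix y assume y: "y \<in> ring_of_integers K"
  show "f (perp K (x + y)) = f (perp K x) + f (perp K y)"
    unfolding perp_add[OF K x y] by (rule add[OF pM[OF x] pM[OF y]])
qed

lemma degree_eq_if_additive_bij:
  assumes K: "number_field K" and L: "number_field L" and bij: "bij_betw f M N"
    and M: "integers_perp K \<subseteq> M" "M \<subseteq> trace_zero_integers K" "\<And>x y. x \<in> M \<Longrightarrow> y \<in> M \<Longrightarrow> x + y \<in> M"
    and N: "integers_perp L \<subseteq> N" "N \<subseteq> trace_zero_integers L"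
    and add: "\<And>x y. x \<in> M \<Longrightarrow> y \<in> M \<Longrightarrow> f (x + y) = f x + f y"
  shows "nf_degree L = nf_degree K"
proof (rule antisym)
  show "nf_degree K \<le> nf_degree L"
    using bij N(2) by (intro degree_le_if_additive_embedding[OF K L M(1) _ _ add]) (auto simp: bij_betw_def)
  obtain g where g: "bij_betw g N M" "\<And>x y. x \<in> N \<Longrightarrow> y \<in> N \<Longrightarrow> g (x + y) = g x + g y"
    using additive_inverse[OF bij add M(3)] by metis
  show "nf_degree L \<le> nf_degree K"
    using g(1) M(2) by (intro degree_le_if_additive_embedding[OF L K N(1) _ _ g(2)]) (auto simp: bij_betw_def)
qed

text \<open>The extension is onto: if \<open>g (n x - tr x) = n y - tr y\<close>, then \<open>\<Phi> x\<close> and \<open>\<epsilon> y\<close> differ by a rational number,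
  which is an integer.\<close>

theorem field_isomorphic_if_isometric_perp:
  fixes K :: "'a::field_char_0 set" and L :: "'b::field_char_0 set"
  assumes K: "number_field K" and L: "number_field L" and n: "n = nf_degree K" "n \<ge> 3"
    and real: "totally_real K" and fund: "fundamental_discriminant (discriminant K)"
    and cyc: "cyclic_group (units_of (residue_ring (int n)))"
    and iso: "isometric (integers_perp K) (trace_form K) (integers_perp L) (trace_form L)"
  shows "field_isomorphic K L"
proof -
  obtain f where bij: "bij_betw f (integers_perp K) (integers_perp L)"
    and add: "\<And>x y. x \<in> integers_perp K \<Longrightarrow> y \<in> integers_perp K \<Longrightarrow> f (x + y) = f x + f y"
    and form: "\<And>x y. x \<in> integers_perp K \<Longrightarrow> y \<in> integers_perp K \<Longrightarrow> trace_form L (f x) (f y) = trace_form K x y"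
    using iso unfolding isometric_def by blast
  have nL: "nf_degree L = nf_degree K"
    by (rule degree_eq_if_additive_bij[OF K L bij order_refl integers_perp_subset[OF K] integers_perp_add[OF K]
        order_refl integers_perp_subset[OF L] add])
  interpret perp_isometry K L n f
  proof unfold_locales
    show "\<exists>x\<in>ring_of_integers K. itrace K x = 1" using n by (intro fundamental_discriminant_trace_1[OF K fund]) simp
    show "f x \<in> integers_perp L" if "x \<in> integers_perp K" for x using bij that by (auto simp: bij_betw_def)
  qed (use K L n nL cyc add form in simp_all)
  obtain \<epsilon> :: int and \<Phi> where ext: "\<epsilon> = 1 \<or> \<epsilon> = -1"
    "\<forall>x\<in>ring_of_integers K. of_nat n * \<Phi> x = of_int (itrace K x) + of_int \<epsilon> * h x"
    "\<forall>x\<in>ring_of_integers K. \<Phi> x \<in> ring_of_integers L"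
    "\<forall>x\<in>ring_of_integers K. \<forall>y\<in>ring_of_integers K. \<Phi> (x + y) = \<Phi> x + \<Phi> y"
    "\<forall>x\<in>ring_of_integers K. \<forall>y\<in>ring_of_integers K. itrace L (\<Phi> x * \<Phi> y) = itrace K (x * y)" "\<Phi> 1 = 1"
    using extension by (elim exE conjE) (rule that; assumption)
  note \<epsilon> = ext(1) and n\<Phi> = ext(2)[rule_format] and \<Phi> = ext(3-6)[rule_format]
  have onto: "\<exists>x\<in>ring_of_integers K. \<Phi> x = y" if y: "y \<in> ring_of_integers L" for y
  proof -
    have "perp L y \<in> f ` integers_perp K" using bij y by (auto simp: bij_betw_def perp_integers)
    then obtain x where x: "x \<in> ring_of_integers K" "h x = perp L y" by (auto simp: perp_integers h_def)
    define k where "k = itrace K x - \<epsilon> * itrace L y"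
    have "of_nat n * (\<Phi> x - of_int \<epsilon> * y) = of_int k"
      using n\<Phi>[OF x(1)] n nL unfolding x(2) perp_itrace[OF L y] by (simp add: k_def algebra_simps)
    moreover have \<epsilon>y: "of_int \<epsilon> * y \<in> ring_of_integers L" by (rule roi_closed(4)[OF Bf roi_closed(1)[OF Bf] y])
    hence z: "\<Phi> x - of_int \<epsilon> * y \<in> ring_of_integers L" by (rule roi_closed(3)[OF Bf \<Phi>(1)[OF x(1)]])
    moreover have "itrace L (of_int (int n) * (\<Phi> x - of_int \<epsilon> * y)) = int n * itrace L (\<Phi> x - of_int \<epsilon> * y)"
      by (rule itrace_closed(3)[OF L z z])
    ultimately have "int n * itrace L (\<Phi> x - of_int \<epsilon> * y) = int n * k"
      using itrace_of_int[OF L, of k] n nL by simp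
    hence k: "itrace L (\<Phi> x - of_int \<epsilon> * y) = k" using n by simp
    have q: "(of_rat (of_int k / of_nat n) :: 'b) = \<Phi> x - of_int \<epsilon> * y"
      using \<open>of_nat n * (\<Phi> x - of_int \<epsilon> * y) = of_int k\<close> n by (simp add: of_rat_divide field_simps)
    have "algebraic_int (of_rat (of_int k / of_nat n) :: 'b)" unfolding q by (rule roiD(2)[OF z])
    hence "(of_rat (of_int k / of_nat n) :: 'b) \<in> \<int>" by (rule rational_algebraic_int_is_int) simp
    then obtain m where "(of_rat (of_int k / of_nat n) :: 'b) = of_int m" by (elim Ints_cases)
    hence m: "\<Phi> x = of_int \<epsilon> * y + of_int m"
      unfolding q by (simp add: algebra_simps)
    define x' where "x' = of_int \<epsilon> * x + of_int (- \<epsilon> * m) * 1"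
    have 1: "of_int \<epsilon> * x \<in> ring_of_integers K" "of_int (- \<epsilon> * m) * 1 \<in> ring_of_integers K"
      using x(1) roi_1[OF Af] roi_closed(1,4)[OF Af] by blast+
    have sc: "\<Phi> (of_int c * z) = of_int c * \<Phi> z" if "z \<in> ring_of_integers K" for c z
      by (rule additive_on_integers_scale[OF K \<Phi>(2) that])
    have "\<Phi> x' = of_int \<epsilon> * \<Phi> x + of_int (- \<epsilon> * m) * \<Phi> 1"
      unfolding x'_def \<Phi>(2)[OF 1] sc[OF x(1)] sc[OF roi_1[OF Af]] ..
    also have "\<dots> = y" using \<epsilon> by (auto simp: m \<Phi>(4))
    finally show ?thesis by (rule bexI[of _ x']) (unfold x'_def, rule roi_closed(2)[OF Af 1])
  qed
  obtain e e' and \<kappa> :: "int vec" where e: "zbasis K e" "zbasis L e'" "gram K e = gram L e'"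
    "1 = (\<Sum>j<nf_degree K. of_int (\<kappa> $ j) * e j)" "1 = (\<Sum>j<nf_degree K. of_int (\<kappa> $ j) * e' j)"
    by (rule bases_of_isometric_integers[of K L \<Phi>, OF K L nL[symmetric] \<Phi> onto])
  show ?thesis
    by (rule field_isomorphic_if_gram_eq[OF K L refl nL[symmetric] _ real fund e]) (use n in simp)
qed

lemma b_form_totally_real:
  assumes K: "number_field K" and real: "totally_real K" and xy: "x \<in> K" "y \<in> K"
  shows "b_form K x y = of_rat (trace_form K x y)"
proof -
  have s: "Re (\<sigma> x * cnj (\<sigma> y)) = Re (\<sigma> (x * y))" if "\<sigma> \<in> embeddings K" for \<sigma>
  proof -
    have "cnj (\<sigma> y) = \<sigma> y" using real that xy(2) by (auto simp: totally_real_def Reals_cnj_iff)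
    thus ?thesis using field_homD(3)[OF embeddingsD(1)[OF that] xy] by simp
  qed
  have "b_form K x y = Re (\<Sum>\<sigma>\<in>embeddings K. \<sigma> (x * y))"
    unfolding b_form_def Re_sum by (intro sum.cong refl s)
  also have "(\<Sum>\<sigma>\<in>embeddings K. \<sigma> (x * y)) = (\<Sum>i<nf_degree K. emb K i (x * y))"
    by (rule sum.reindex_bij_betw[OF emb_bij[OF K], symmetric])
  also have "\<dots> = of_rat (trace_form K x y)"
    unfolding trace_form_def by (rule of_rat_field_trace[OF K subfieldD(4)[OF number_fieldD[OF K] xy], symmetric])
  also have "Re (of_rat (trace_form K x y)) = of_rat (trace_form K x y)"
    by (cases "trace_form K x y") (simp add: of_rat_rat)
  finally show ?thesis .
qed

text \<open>The factor is a quotient \<open>a / b\<close> of values of the integral forms \<open>perp_form\<close>, so it is rational, and a prime that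
  divides \<open>a\<close> or \<open>b\<close> divides all values of one of these primitive forms. For \<open>p = 2\<close> and \<open>n = 3\<close> the diagonal
  values of the other form are even as well, which makes the diagonal values of this one divisible by 4. A
  negative factor contradicts positivity of the real forms.\<close>

theorem field_isomorphic_if_same_shape:
  fixes K :: "'a::field_char_0 set" and L :: "'b::field_char_0 set"
  assumes K: "number_field K" and L: "number_field L" and n: "n = nf_degree K" "n \<ge> 3"
    and realK: "totally_real K" and fundK: "fundamental_discriminant (discriminant K)"
    and realL: "totally_real L" and fundL: "fundamental_discriminant (discriminant L)"
    and cyc: "cyclic_group (units_of (residue_ring (int n)))"
    and shape: "same_shape K L"
  shows "field_isomorphic K L"
proof -
  note Kf = number_fieldD[OF K] and Lf = number_fieldD[OF L]
  obtain c f where c: "c \<noteq> 0" and bij: "bij_betw f (integers_perp K) (integers_perp L)"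
    and add: "\<And>x y. x \<in> integers_perp K \<Longrightarrow> y \<in> integers_perp K \<Longrightarrow> f (x + y) = f x + f y"
    and bform: "\<And>x y. x \<in> integers_perp K \<Longrightarrow> y \<in> integers_perp K \<Longrightarrow> c * b_form L (f x) (f y) = b_form K x y"
    using shape unfolding same_shape_def isometric_def by blast
  have nL: "nf_degree L = nf_degree K"
    by (rule degree_eq_if_additive_bij[OF K L bij order_refl integers_perp_subset[OF K] integers_perp_add[OF K]
        order_refl integers_perp_subset[OF L] add])
  have perpK: "z \<in> K" if "z \<in> integers_perp K" for z
    using integers_perp_subset[OF K] that by (auto simp: trace_zero_integers_def dest: roiD(1))
  have perpL: "z \<in> L" if "z \<in> integers_perp L" for z
    using integers_perp_subset[OF L] that by (auto simp: trace_zero_integers_def dest: roiD(1))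
  have fL: "f z \<in> integers_perp L" if "z \<in> integers_perp K" for z using bij that by (auto simp: bij_betw_def)
  have form: "c * of_rat (trace_form L (f x) (f y)) = of_rat (trace_form K x y)"
    if "x \<in> integers_perp K" "y \<in> integers_perp K" for x y
    using bform[OF that] that b_form_totally_real[OF K realK] b_form_totally_real[OF L realL] perpK perpL fL by simp
  have X: "c * of_int (perp_form L y y') = of_int (perp_form K x x')"
    if x: "x \<in> ring_of_integers K" "x' \<in> ring_of_integers K" and y: "y \<in> ring_of_integers L" "y' \<in> ring_of_integers L"
      and f: "f (perp K x) = perp L y" "f (perp K x') = perp L y'" for x x' y y'
  proof -
    have "c * of_rat (trace_form L (perp L y) (perp L y')) = of_rat (trace_form K (perp K x) (perp K x'))"
      using form[of "perp K x" "perp K x'"] x f by (simp add: perp_integers)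
    hence "c * (of_nat n * of_int (perp_form L y y')) = of_nat n * of_int (perp_form K x x')"
      using x y n nL by (simp add: trace_form_itrace K L perp_integral itrace_perp_mult(2) of_rat_mult)
    thus ?thesis using n by simp
  qed
  have toL: "\<exists>y\<in>ring_of_integers L. f (perp K x) = perp L y" if "x \<in> ring_of_integers K" for x
    using fL[of "perp K x"] that by (auto simp: perp_integers)
  have toK: "\<exists>x\<in>ring_of_integers K. f (perp K x) = perp L y" if "y \<in> ring_of_integers L" for y
  proof -
    have "perp L y \<in> f ` integers_perp K" using bij that by (auto simp: bij_betw_def perp_integers)
    thus ?thesis by (auto simp: perp_integers)
  qed
  obtain x0 x0' where x0: "x0 \<in> ring_of_integers K" "x0' \<in> ring_of_integers K" "perp_form K x0 x0' \<noteq> 0"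
    using perp_form_primitive[OF K fundK _ two_is_prime] n by (metis dvd_0_right)
  obtain y0 y0' where y0: "y0 \<in> ring_of_integers L" "y0' \<in> ring_of_integers L"
    "f (perp K x0) = perp L y0" "f (perp K x0') = perp L y0'" using toL x0 by metis
  have X0: "c * of_int (perp_form L y0 y0') = of_int (perp_form K x0 x0')" by (rule X[OF x0(1,2) y0])
  hence "of_int (perp_form L y0 y0') \<noteq> (0::real)" using x0(3) by auto
  hence "c = of_int (perp_form K x0 x0') / of_int (perp_form L y0 y0')" using X0 by (simp add: field_simps)
  hence "c \<in> \<rat>" by simp
  then obtain a b :: int where ab: "b > 0" "coprime a b" "c = of_int a / of_int b" by (elim Rats_cases')
  have abX: "a * perp_form L y y' = b * perp_form K x x'"
    if "x \<in> ring_of_integers K" "x' \<in> ring_of_integers K" "y \<in> ring_of_integers L" "y' \<in> ring_of_integers L"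
      "f (perp K x) = perp L y" "f (perp K x') = perp L y'" for x x' y y'
  proof -
    have "real_of_int (a * perp_form L y y') = of_int (b * perp_form K x x')"
      using X[OF that] ab(1,3) by (simp add: field_simps)
    thus ?thesis by (simp only: of_int_eq_iff)
  qed
  have even3: "even (perp_form F x x)" if F: "number_field F" "nf_degree F = 3" "x \<in> ring_of_integers F"
    for F :: "'c::field_char_0 set" and x
    using even_trace_square[OF F(1,3)] F(2) by (simp add: perp_form_def power2_eq_square)
  have pa: False if p: "prime p" "p dvd a" for p
  proof -
    have pb: "\<not> p dvd b" using p ab(2) by (metis coprime_common_divisor not_prime_unit)
    show False
    proof (rule perp_form_primitive[OF K fundK _ p(1)])
      show "p dvd perp_form K x x'" if x: "x \<in> ring_of_integers K" "x' \<in> ring_of_integers K" for x x'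
      proof -
        obtain y y' where "y \<in> ring_of_integers L" "y' \<in> ring_of_integers L"
          "f (perp K x) = perp L y" "f (perp K x') = perp L y'" using toL x by metis
        from abX[OF x this] have "p dvd b * perp_form K x x'" using p(2) by (metis dvd_mult2)
        thus ?thesis using pb p(1) by (simp add: prime_dvd_mult_iff)
      qed
      show "4 dvd perp_form K x x" if p2: "p = 2" and K3: "nf_degree K = 3" and x: "x \<in> ring_of_integers K" for x
      proof -
        obtain y where y: "y \<in> ring_of_integers L" "f (perp K x) = perp L y" using toL x by metis
        have "even (perp_form L y y)" by (rule even3[OF L _ y(1)]) (use nL K3 in simp)
        moreover have "even a" "odd b" using p(2) pb p2 by simp_all
        ultimately have "2 * 2 dvd a * perp_form L y y" by (intro mult_dvd_mono)
        hence "4 dvd b * perp_form K x x" unfolding abX[OF x x y(1) y(1) y(2) y(2)] by simp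
        moreover have "coprime (2\<^sup>2) b" using \<open>odd b\<close> by (simp only: coprime_power_left_iff coprime_left_2_iff_odd) simp
        ultimately show ?thesis by (simp add: coprime_dvd_mult_right_iff)
      qed
    qed (use n in simp)
  qed
  have pb: False if p: "prime p" "p dvd b" for p
  proof -
    have pa: "\<not> p dvd a" using p ab(2) by (metis coprime_common_divisor not_prime_unit)
    show False
    proof (rule perp_form_primitive[OF L fundL _ p(1)])
      show "p dvd perp_form L y y'" if y: "y \<in> ring_of_integers L" "y' \<in> ring_of_integers L" for y y'
      proof -
        obtain x x' where x: "x \<in> ring_of_integers K" "x' \<in> ring_of_integers K"
          and f: "f (perp K x) = perp L y" "f (perp K x') = perp L y'" using toK y by metis
        from abX[OF x y f] have "p dvd a * perp_form L y y'" using p(2) by (metis dvd_mult2)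
        thus ?thesis using pa p(1) by (simp add: prime_dvd_mult_iff)
      qed
      show "4 dvd perp_form L y y" if p2: "p = 2" and L3: "nf_degree L = 3" and y: "y \<in> ring_of_integers L" for y
      proof -
        obtain x where x: "x \<in> ring_of_integers K" "f (perp K x) = perp L y" using toK y by metis
        have "even (perp_form K x x)" by (rule even3[OF K _ x(1)]) (use nL L3 in simp)
        moreover have "even b" "odd a" using p(2) pa p2 by simp_all
        ultimately have "2 * 2 dvd b * perp_form K x x" by (intro mult_dvd_mono)
        hence "4 dvd a * perp_form L y y" unfolding abX[OF x(1) x(1) y y x(2) x(2)] by simp
        moreover have "coprime (2\<^sup>2) a" using \<open>odd a\<close> by (simp only: coprime_power_left_iff coprime_left_2_iff_odd) simp
        ultimately show ?thesis by (simp add: coprime_dvd_mult_right_iff)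
      qed
    qed (use n nL in simp)
  qed
  have "is_unit b" using prime_divisor_exists[of b] pb ab(1) by auto
  hence b1: "b = 1" using ab(1) by simp
  have "a \<noteq> 0" using c ab(3) by auto
  hence "is_unit a" using prime_divisor_exists[of a] pa by auto
  hence c1: "c = 1 \<or> c = -1" using ab(3) b1 by (auto simp: zdvd1_eq abs_if split: if_splits)
  have "c \<noteq> -1"
  proof
    assume c: "c = -1"
    have "perp K x = 0" if x: "x \<in> ring_of_integers K" for x
    proof -
      have pK: "perp K x \<in> integers_perp K" using x by (simp add: perp_integers)
      have geL: "b_form L z z \<ge> 0" for z unfolding b_form_diag by (intro sum_nonneg) simp
      have "b_form K (perp K x) (perp K x) \<le> 0" using bform[OF pK pK] geL[of "f (perp K x)"] c by simp
      hence "(\<Sum>\<sigma>\<in>embeddings K. (cmod (\<sigma> (perp K x)))\<^sup>2) = 0"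
        unfolding b_form_diag by (intro antisym sum_nonneg) simp_all
      hence z: "\<sigma> (perp K x) = 0" if "\<sigma> \<in> embeddings K" for \<sigma>
        using sum_nonneg_eq_0_iff[OF card_embeddings(1)[OF K], of "\<lambda>\<sigma>. (cmod (\<sigma> (perp K x)))\<^sup>2"] that by simp
      have 0: "0 < nf_degree K" using n by simp
      show ?thesis
        using z[OF emb_in[OF K 0]] field_hom_eq_0_iff[OF Kf emb_hom[OF K 0] perpK[OF pK]] by simp
    qed
    hence "perp_form K x0 x0' = 0"
      using itrace_perp_mult(1)[OF K x0(1,2)] x0(1) itrace_of_int[OF K, of 0] by simp
    thus False using x0(3) by simp
  qed
  hence c1: "c = 1" using c1 by simp
  have "isometric (integers_perp K) (trace_form K) (integers_perp L) (trace_form L)"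
    unfolding isometric_def using bij add form unfolding c1 by auto
  thus ?thesis by (rule field_isomorphic_if_isometric_perp[OF K L n realK fundK cyc])
qed

text \<open>If \<open>n\<close> is prime to the discriminant, \<open>O\<^sup>\<bottom>\<close> is determined by the lattice \<open>O\<^sup>0\<close>: it consists of the
  \<open>y\<close> in \<open>O\<^sup>0\<close> for which \<open>n\<close> divides \<open>tr (y w)\<close> for all \<open>w\<close> in \<open>O\<^sup>0\<close>. Such a vector \<open>y\<close> differs from
  an element of \<open>n O\<close> by the integer \<open>tr (y x\<^sub>1)\<close>, where \<open>x\<^sub>1\<close> has trace 1, because the Gram
  matrix of \<open>O\<close> is invertible modulo \<open>n\<close>.\<close>

lemma mem_integers_perp_if_dvd:
  assumes K: "number_field K" and cop: "coprime (int (nf_degree K)) (discriminant K)" and n0: "nf_degree K \<noteq> 0"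
    and x1: "x1 \<in> ring_of_integers K" "itrace K x1 = 1" and y: "y \<in> trace_zero_integers K"
    and dvd: "\<And>w. w \<in> trace_zero_integers K \<Longrightarrow> int (nf_degree K) dvd itrace K (y * w)"
  shows "y \<in> integers_perp K"
proof -
  note Kf = number_fieldD[OF K]
  define n where "n = nf_degree K"
  define c where "c = itrace K (y * x1)"
  have yO: "y \<in> ring_of_integers K" and y0: "itrace K y = 0" using y by (simp_all add: trace_zero_integers_eq[OF K])
  have vO: "y - of_int c \<in> ring_of_integers K" by (rule roi_closed(3)[OF Kf yO roi_closed(1)[OF Kf]])
  have div: "int n dvd itrace K (x * (y - of_int c))" if x: "x \<in> ring_of_integers K" for x
  proof -
    define w where "w = x - of_int (itrace K x) * x1"
    have tx1: "of_int (itrace K x) * x1 \<in> ring_of_integers K" by (rule roi_closed(4)[OF Kf roi_closed(1)[OF Kf] x1(1)])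
    have wO: "w \<in> ring_of_integers K" unfolding w_def by (rule roi_closed(3)[OF Kf x tx1])
    have "itrace K w = 0"
      unfolding w_def itrace_closed(2)[OF K x tx1] itrace_closed(3)[OF K x1(1) x1(1)] x1(2) by simp
    hence w: "w \<in> trace_zero_integers K" using wO by (simp add: trace_zero_integers_eq[OF K])
    have yx1: "y * x1 \<in> ring_of_integers K" by (rule roi_closed(4)[OF Kf yO x1(1)])
    have yw: "y * w \<in> ring_of_integers K" by (rule roi_closed(4)[OF Kf yO wO])
    have t: "of_int (itrace K x) * (y * x1) \<in> ring_of_integers K" "of_int c * x \<in> ring_of_integers K"
      using roi_closed(4)[OF Kf roi_closed(1)[OF Kf]] yx1 x by blast+
    have s: "y * w + of_int (itrace K x) * (y * x1) \<in> ring_of_integers K" by (rule roi_closed(2)[OF Kf yw t(1)])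
    have "x * (y - of_int c) = y * w + of_int (itrace K x) * (y * x1) - of_int c * x"
      by (simp add: w_def algebra_simps)
    hence "itrace K (x * (y - of_int c)) = itrace K (y * w) + itrace K x * itrace K (y * x1) - c * itrace K x"
      by (simp only: itrace_closed(2)[OF K s t(2)] itrace_closed(1)[OF K yw t(1)]
          itrace_closed(3)[OF K yx1 yx1] itrace_closed(3)[OF K x x])
    thus ?thesis using dvd[OF w] by (simp add: n_def c_def mult.commute)
  qed
  obtain e where e: "zbasis K e" using ex_zbasis[OF K] by blast
  obtain q where q: "y - of_int c = (\<Sum>j<n. of_int (q j) * e j)" using zbasisD(2)[OF e vO] by (auto simp: n_def)
  define S where "S = gram K e"
  have S: "S \<in> carrier_mat n n" by (simp add: S_def n_def)
  define z where "z = S *\<^sub>v vec n q"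
  have z: "z \<in> carrier_vec n" using S by (simp add: z_def)
  have zdvd: "int n dvd z $ i" if i: "i < n" for i
    using div[OF zbasisD(1)[OF e]] i gram_mult_vec[OF K e, of i q] q by (simp add: z_def S_def n_def)
  have A: "adj_mat S \<in> carrier_mat n n" by (rule adj_mat(1)[OF S])
  have qn: "int n dvd q j" if j: "j < n" for j
  proof -
    have "adj_mat S *\<^sub>v z = (adj_mat S * S) *\<^sub>v vec n q"
      unfolding z_def using assoc_mult_mat_vec[OF A S, of "vec n q"] by simp
    also have "\<dots> = det S \<cdot>\<^sub>v vec n q" unfolding adj_mat(3)[OF S] by (intro eq_vecI) simp_all
    finally have "(adj_mat S *\<^sub>v z) $ j = det S * q j" using j by simp
    hence "det S * q j = (\<Sum>i<n. adj_mat S $$ (j, i) * z $ i)" using mult_mat_vec_index_sum[OF A z j] by simp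
    also have "int n dvd \<dots>" using zdvd by (intro dvd_sum dvd_mult) simp
    finally show ?thesis
      using cop discriminant_eq_det_gram[OF K e] by (simp add: S_def n_def coprime_dvd_mult_right_iff)
  qed
  define x where "x = (\<Sum>j<n. of_int (q j div int n) * e j)"
  have xO: "x \<in> ring_of_integers K"
    unfolding x_def by (rule int_combination_integral[OF K]) (simp add: n_def zbasisD(1)[OF e])
  have "of_int (int n) * x = (\<Sum>j<n. of_int (int n * (q j div int n)) * e j)"
    unfolding x_def sum_distrib_left by (simp add: mult.assoc)
  also have "\<dots> = y - of_int c" unfolding q using qn by (intro sum.cong refl) simp
  finally have yx: "y = of_int (int n) * x + of_int c" by simp
  have nx: "of_int (int n) * x \<in> ring_of_integers K" by (rule roi_closed(4)[OF Kf roi_closed(1)[OF Kf] xO])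
  have "itrace K y = int n * itrace K x + int n * c"
    unfolding yx itrace_closed(1)[OF K nx roi_closed(1)[OF Kf]] itrace_closed(3)[OF K xO xO] itrace_of_int[OF K]
    by (simp add: n_def)
  hence "int n * (itrace K x + c) = 0" unfolding y0 by (simp add: distrib_left)
  hence "c = - itrace K x" using n0 by (simp add: n_def)
  hence "y = perp K x" unfolding yx perp_itrace[OF K xO] by (simp add: n_def)
  thus ?thesis using xO by (simp add: perp_integers)
qed

text \<open>A prime dividing all traces would divide the degree, so it does not divide the discriminant of \<open>K\<close>. It would
  also divide the traces of all products in \<open>O\<^sub>L\<^sup>0\<close>, hence in \<open>O\<^sub>K\<^sup>0\<close>, and the trace form of \<open>K\<close> would have
  rank at most 2 modulo it.\<close>

lemma trace_1_if_isometric_trace_zero: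
  fixes K :: "'a::field_char_0 set" and L :: "'b::field_char_0 set"
  assumes K: "number_field K" and L: "number_field L" and n: "nf_degree K = n" "nf_degree L = n" "n \<ge> 3"
    and cop: "coprime (int n) (discriminant K)" and x1: "x1 \<in> ring_of_integers K" "itrace K x1 = 1"
    and fL: "\<And>x. x \<in> trace_zero_integers K \<Longrightarrow> f x \<in> trace_zero_integers L"
    and form: "\<And>x y. x \<in> trace_zero_integers K \<Longrightarrow> y \<in> trace_zero_integers K \<Longrightarrow>
      itrace L (f x * f y) = itrace K (x * y)"
  shows "\<exists>y\<in>ring_of_integers L. itrace L y = 1"
proof (rule trace_1_if_not_divisible[OF L], rule ccontr)
  note Kf = number_fieldD[OF K] and Lf = number_fieldD[OF L]
  fix p :: int assume p: "prime p" and "\<not> (\<exists>y\<in>ring_of_integers L. \<not> p dvd itrace L y)"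
  hence div: "p dvd itrace L y" if "y \<in> ring_of_integers L" for y using that by blast
  have "p dvd int n" using div[OF roi_1[OF Lf]] itrace_of_int[OF L, of 1] n by simp
  hence pd: "\<not> p ^ Suc 0 dvd discriminant K"
    using cop p by (metis coprime_common_divisor not_prime_unit power_Suc0_right)
  have div0: "p dvd itrace K (x * y)" if xy: "x \<in> trace_zero_integers K" "y \<in> trace_zero_integers K" for x y
  proof -
    have "f x * f y \<in> ring_of_integers L"
      using fL[OF xy(1)] fL[OF xy(2)] by (intro roi_closed(4)[OF Lf]) (simp_all add: trace_zero_integers_eq[OF L])
    thus ?thesis using div form[OF xy] by metis
  qed
  obtain e where e: "zbasis K e" using ex_zbasis[OF K] by blast
  have eO: "e j \<in> ring_of_integers K" if "j < n" for j using zbasisD(1)[OF e] that n(1) by simp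
  obtain I where I: "I \<subseteq> {..<n}" "card I \<le> 0" and rad:
    "\<And>q. (\<forall>x\<in>ring_of_integers K. p dvd itrace K (x * (\<Sum>j<n. of_int (q j) * e j))) \<Longrightarrow>
      (\<forall>a\<in>I. p dvd q a) \<Longrightarrow> \<forall>b<n. p dvd q b"
    using radical_mod_prime[OF K e p pd] unfolding n(1) by blast
  have I0: "I = {}" using I finite_subset[OF I(1)] by simp
  obtain q b where q: "q \<in> carrier_vec n" "b < n" "\<not> p dvd q $ b"
    "p dvd (\<Sum>j<n. itrace K (e j) * q $ j)" "p dvd (\<Sum>j<n. itrace K (x1 * e j) * q $ j)"
    by (rule two_congruences_solution[OF p n(3)])
  define v where "v = (\<Sum>j<n. of_int (q $ j) * e j)"
  have vO: "v \<in> ring_of_integers K" unfolding v_def by (rule int_combination_integral[OF K eO])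
  have tr: "itrace K (x * v) = (\<Sum>j<n. itrace K (x * e j) * q $ j)" if "x \<in> ring_of_integers K" for x
    using itrace_int_combination[OF K eO that, where q = "\<lambda>j. q $ j"] by (simp add: v_def mult.commute)
  have tv: "p dvd itrace K v" using tr[OF roi_1[OF Kf]] q(4) by simp
  have tx1v: "p dvd itrace K (x1 * v)" using tr[OF x1(1)] q(5) by simp
  have proj: "\<exists>w\<in>trace_zero_integers K. x = w + of_int (itrace K x) * x1" if x: "x \<in> ring_of_integers K" for x
  proof -
    have tx1: "of_int (itrace K x) * x1 \<in> ring_of_integers K" by (rule roi_closed(4)[OF Kf roi_closed(1)[OF Kf] x1(1)])
    have "x - of_int (itrace K x) * x1 \<in> ring_of_integers K" by (rule roi_closed(3)[OF Kf x tx1])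
    moreover have "itrace K (x - of_int (itrace K x) * x1) = 0"
      unfolding itrace_closed(2)[OF K x tx1] itrace_closed(3)[OF K x1(1) x1(1)] x1(2) by simp
    ultimately show ?thesis
      by (intro bexI[of _ "x - of_int (itrace K x) * x1"]) (simp_all add: trace_zero_integers_eq[OF K])
  qed
  have "\<forall>b<n. p dvd q $ b"
  proof (rule rad, intro ballI)
    fix x assume x: "x \<in> ring_of_integers K"
    obtain w where w: "w \<in> trace_zero_integers K" "x = w + of_int (itrace K x) * x1" using proj[OF x] by blast
    obtain v' where v': "v' \<in> trace_zero_integers K" "v = v' + of_int (itrace K v) * x1" using proj[OF vO] by blast
    have O: "w \<in> ring_of_integers K" "v' \<in> ring_of_integers K"
      using w(1) v'(1) by (simp_all add: trace_zero_integers_eq[OF K])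
    have wv: "w * v' \<in> ring_of_integers K" and wx: "w * x1 \<in> ring_of_integers K" and xv: "x1 * v \<in> ring_of_integers K"
      using O vO x1(1) by (simp_all add: roi_closed(4)[OF Kf])
    have a: "of_int (itrace K v) * (w * x1) \<in> ring_of_integers K" "of_int (itrace K x) * (x1 * v) \<in> ring_of_integers K"
      using roi_closed(4)[OF Kf roi_closed(1)[OF Kf]] wx xv by blast+
    have ab: "of_int (itrace K v) * (w * x1) + of_int (itrace K x) * (x1 * v) \<in> ring_of_integers K"
      by (rule roi_closed(2)[OF Kf a])
    have "x * v = w * v + of_int (itrace K x) * (x1 * v)" by (subst w(2)) (simp add: algebra_simps)
    also have "w * v = w * v' + of_int (itrace K v) * (w * x1)" by (subst v'(2)) (simp add: algebra_simps)
    finally have "x * v = w * v' + (of_int (itrace K v) * (w * x1) + of_int (itrace K x) * (x1 * v))" by (simp add: add.assoc)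
    hence "itrace K (x * v) = itrace K (w * v') + (itrace K v * itrace K (w * x1) + itrace K x * itrace K (x1 * v))"
      by (simp only: itrace_closed(1)[OF K wv ab] itrace_closed(1)[OF K a]
          itrace_closed(3)[OF K wx wx] itrace_closed(3)[OF K xv xv])
    thus "p dvd itrace K (x * (\<Sum>j<n. of_int (q $ j) * e j))"
      unfolding v_def[symmetric] using div0[OF w(1) v'(1)] tv tx1v by simp
  qed (simp add: I0)
  thus False using q(2,3) by blast
qed

text \<open>The inverse isometry maps \<open>O\<^sub>L\<^sup>\<bottom>\<close> into \<open>O\<^sub>K\<^sup>\<bottom>\<close>, so it extends to a map from \<open>O\<^sub>L\<close> to \<open>O\<^sub>K\<close>, whose image
  contains \<open>O\<^sub>K\<^sup>0\<close> and an element of trace 1.\<close>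

theorem field_isomorphic_if_isometric_trace_zero:
  fixes K :: "'a::field_char_0 set" and L :: "'b::field_char_0 set"
  assumes K: "number_field K" and L: "number_field L" and n: "n = nf_degree K" "n \<ge> 3"
    and real: "totally_real K" and fund: "fundamental_discriminant (discriminant K)"
    and cyc: "cyclic_group (units_of (residue_ring (int n)))" and cop: "coprime (int n) (discriminant K)"
    and iso: "isometric (trace_zero_integers K) (trace_form K) (trace_zero_integers L) (trace_form L)"
  shows "field_isomorphic K L"
proof -
  note Kf = number_fieldD[OF K] and Lf = number_fieldD[OF L]
  obtain f where bij: "bij_betw f (trace_zero_integers K) (trace_zero_integers L)"
    and add: "\<And>x y. x \<in> trace_zero_integers K \<Longrightarrow> y \<in> trace_zero_integers K \<Longrightarrow> f (x + y) = f x + f y"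
    and tform: "\<And>x y. x \<in> trace_zero_integers K \<Longrightarrow> y \<in> trace_zero_integers K \<Longrightarrow>
      trace_form L (f x) (f y) = trace_form K x y"
    using iso unfolding isometric_def by blast
  have nL: "nf_degree L = n"
    unfolding n(1) by (rule degree_eq_if_additive_bij[OF K L bij integers_perp_subset[OF K] order_refl
        trace_zero_closed(1)[OF K] integers_perp_subset[OF L] order_refl add])
  have OK: "x \<in> ring_of_integers K" if "x \<in> trace_zero_integers K" for x using that by (simp add: trace_zero_integers_eq[OF K])
  have OL: "x \<in> ring_of_integers L" if "x \<in> trace_zero_integers L" for x using that by (simp add: trace_zero_integers_eq[OF L])
  have fL: "f x \<in> trace_zero_integers L" if "x \<in> trace_zero_integers K" for x using bij that by (auto simp: bij_betw_def)
  have form: "itrace L (f x * f y) = itrace K (x * y)" if "x \<in> trace_zero_integers K" "y \<in> trace_zero_integers K" for x y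
    using tform[OF that] that by (simp add: trace_form_itrace K L OK OL fL)
  obtain x1 where x1: "x1 \<in> ring_of_integers K" "itrace K x1 = 1"
    using fundamental_discriminant_trace_1[OF K fund] n by blast
  have ex1: "\<exists>y\<in>ring_of_integers L. itrace L y = 1"
    by (rule trace_1_if_isometric_trace_zero[OF K L n(1)[symmetric] nL n(2) cop x1 fL form])
  then obtain y1 where y1: "y1 \<in> ring_of_integers L" "itrace L y1 = 1" by blast
  obtain g where bg: "bij_betw g (trace_zero_integers L) (trace_zero_integers K)"
    and g_add: "\<And>x y. x \<in> trace_zero_integers L \<Longrightarrow> y \<in> trace_zero_integers L \<Longrightarrow> g (x + y) = g x + g y"
    and fg: "\<And>y. y \<in> trace_zero_integers L \<Longrightarrow> f (g y) = y" and gf: "\<And>x. x \<in> trace_zero_integers K \<Longrightarrow> g (f x) = x"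
    using additive_inverse[OF bij add trace_zero_closed(1)[OF K]] by metis
  have gK: "g y \<in> trace_zero_integers K" if "y \<in> trace_zero_integers L" for y using bg that by (auto simp: bij_betw_def)
  have perpL: "y \<in> trace_zero_integers L" if "y \<in> integers_perp L" for y using that integers_perp_subset[OF L] by blast
  interpret P: perp_isometry L K n g
  proof unfold_locales
    fix y assume y: "y \<in> integers_perp L"
    then obtain a where a: "a \<in> ring_of_integers L" "y = perp L a" by (auto simp: perp_integers)
    show "g y \<in> integers_perp K"
    proof (rule mem_integers_perp_if_dvd[OF K _ _ x1 gK[OF perpL[OF y]]])
      fix w assume w: "w \<in> trace_zero_integers K"
      have "itrace K (g y * w) = itrace L (perp L a * f w)"
        using form[OF gK[OF perpL[OF y]] w] fg[OF perpL[OF y]] a(2) by simp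
      also have "\<dots> = int n * itrace L (a * f w)"
        unfolding itrace_perp_mult(1)[OF L a(1) OL[OF fL[OF w]]] perp_form_def nL
        using fL[OF w] by (simp add: trace_zero_integers_eq[OF L])
      finally show "int (nf_degree K) dvd itrace K (g y * w)" using n(1) by simp
    qed (use cop n in simp_all)
  next
    fix x y assume xy: "x \<in> integers_perp L" "y \<in> integers_perp L"
    show "g (x + y) = g x + g y" by (rule g_add[OF perpL[OF xy(1)] perpL[OF xy(2)]])
    show "trace_form K (g x) (g y) = trace_form L x y"
      using tform[OF gK[OF perpL[OF xy(1)]] gK[OF perpL[OF xy(2)]]] fg[OF perpL[OF xy(1)]] fg[OF perpL[OF xy(2)]] by simp
  qed (use K L n nL cyc ex1 in simp_all)
  obtain \<epsilon> :: int and \<Phi> where ext: "\<epsilon> = 1 \<or> \<epsilon> = -1"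
    "\<forall>x\<in>ring_of_integers L. of_nat n * \<Phi> x = of_int (itrace L x) + of_int \<epsilon> * P.h x"
    "\<forall>x\<in>ring_of_integers L. \<Phi> x \<in> ring_of_integers K"
    "\<forall>x\<in>ring_of_integers L. \<forall>y\<in>ring_of_integers L. \<Phi> (x + y) = \<Phi> x + \<Phi> y"
    "\<forall>x\<in>ring_of_integers L. \<forall>y\<in>ring_of_integers L. itrace K (\<Phi> x * \<Phi> y) = itrace L (x * y)" "\<Phi> 1 = 1"
    using P.extension by (elim exE conjE) (rule that; assumption)
  note \<epsilon> = ext(1) and n\<Phi> = ext(2)[rule_format] and \<Phi> = ext(3-6)[rule_format]
  have sc: "\<Phi> (of_int c * z) = of_int c * \<Phi> z" if "z \<in> ring_of_integers L" for c z
    by (rule additive_on_integers_scale[OF L \<Phi>(2) that])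
  \<comment> \<open>on elements of trace zero the extension is \<open>\<epsilon> g\<close>, so its image contains \<open>O\<^sub>K\<^sup>0\<close>\<close>
  have \<Phi>0: "\<Phi> w = of_int \<epsilon> * g w" if w: "w \<in> trace_zero_integers L" for w
  proof -
    have "g (of_nat (Suc k) * w) = of_nat (Suc k) * g w" for k
    proof (induction k)
      case (Suc k)
      have kw: "of_nat (Suc k) * w \<in> trace_zero_integers L"
        using trace_zero_closed(2)[OF L w w, of "int (Suc k)"] by (simp only: of_int_of_nat_eq)
      have "of_nat (Suc (Suc k)) * w = w + of_nat (Suc k) * w" by (simp add: algebra_simps)
      hence "g (of_nat (Suc (Suc k)) * w) = g w + g (of_nat (Suc k) * w)" using g_add[OF w kw] by (simp only:)
      also have "\<dots> = of_nat (Suc (Suc k)) * g w" unfolding Suc by (simp add: algebra_simps)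
      finally show ?case .
    qed simp
    moreover have "Suc (n - 1) = n" using n(2) by simp
    ultimately have "g (of_nat n * w) = of_nat n * g w" by metis
    moreover have "perp L w = of_nat n * w" "itrace L w = 0"
      using w nL perp_itrace[OF L OL[OF w]] by (simp_all add: trace_zero_integers_eq[OF L])
    ultimately have "of_nat n * \<Phi> w = of_nat n * (of_int \<epsilon> * g w)"
      using n\<Phi>[OF OL[OF w]] by (simp add: P.h_def)
    thus ?thesis using n(2) by simp
  qed
  have onto: "\<exists>x\<in>ring_of_integers L. \<Phi> x = y" if y: "y \<in> ring_of_integers K" for y
  proof -
    have \<Phi>y1: "\<Phi> y1 \<in> ring_of_integers K" "itrace K (\<Phi> y1) = 1"
      using \<Phi>(1)[OF y1(1)] \<Phi>(3)[OF y1(1) roi_1[OF Lf]] \<Phi>(4) y1(2) by simp_all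
    define t where "t = itrace K y"
    have ty: "of_int t * \<Phi> y1 \<in> ring_of_integers K" by (rule roi_closed(4)[OF Kf roi_closed(1)[OF Kf] \<Phi>y1(1)])
    have "y - of_int t * \<Phi> y1 \<in> ring_of_integers K" by (rule roi_closed(3)[OF Kf y ty])
    moreover have "itrace K (y - of_int t * \<Phi> y1) = 0"
      unfolding itrace_closed(2)[OF K y ty] itrace_closed(3)[OF K \<Phi>y1(1) \<Phi>y1(1)] \<Phi>y1(2) by (simp add: t_def)
    ultimately have y0: "y - of_int t * \<Phi> y1 \<in> trace_zero_integers K" by (simp add: trace_zero_integers_eq[OF K])
    define w where "w = f (y - of_int t * \<Phi> y1)"
    have w: "w \<in> trace_zero_integers L" "g w = y - of_int t * \<Phi> y1" using fL[OF y0] gf[OF y0] by (simp_all add: w_def)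
    have O: "of_int \<epsilon> * w \<in> ring_of_integers L" "of_int t * y1 \<in> ring_of_integers L"
      using roi_closed(4)[OF Lf roi_closed(1)[OF Lf]] OL[OF w(1)] y1(1) by blast+
    have "\<Phi> (of_int \<epsilon> * w + of_int t * y1) = of_int \<epsilon> * (of_int \<epsilon> * g w) + of_int t * \<Phi> y1"
      unfolding \<Phi>(2)[OF O] sc[OF OL[OF w(1)]] sc[OF y1(1)] \<Phi>0[OF w(1)] ..
    also have "\<dots> = y" using \<epsilon> by (auto simp: w(2))
    finally show ?thesis by (rule bexI) (rule roi_closed(2)[OF Lf O])
  qed
  obtain e e' and \<kappa> :: "int vec" where e: "zbasis L e" "zbasis K e'" "gram L e = gram K e'"
    "1 = (\<Sum>j<nf_degree L. of_int (\<kappa> $ j) * e j)" "1 = (\<Sum>j<nf_degree L. of_int (\<kappa> $ j) * e' j)"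
    by (rule bases_of_isometric_integers[of L K \<Phi>, OF L K _ \<Phi> onto]) (use n nL in simp)
  show ?thesis
    by (rule field_isomorphic_if_gram_eq[OF K L n(1) nL[symmetric] n(2) real fund e(2,1) e(3)[symmetric] e(5,4)[unfolded nL]])
qed

section \<open>Isomorphic fields\<close>

locale field_isomorphism =
  fixes K :: "'a::field_char_0 set" and L :: "'b::field_char_0 set" and f :: "'a \<Rightarrow> 'b"
  assumes K: "number_field K" and L: "number_field L" and hom: "field_hom K L f" and bij: "bij_betw f K L"
begin

lemmas Kf = number_fieldD[OF K] and Lf = number_fieldD[OF L]

lemma hom_UNIV: "field_hom K UNIV f" using hom by (auto simp: field_hom_def)

lemma f_mem: "x \<in> K \<Longrightarrow> f x \<in> L" using hom by (auto simp: field_hom_def)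

lemmas f_add = field_homD(2)[OF hom_UNIV] and f_mult = field_homD(3)[OF hom_UNIV]

lemma embeddings_bij: "bij_betw (\<lambda>\<sigma>. restrict (\<lambda>x. \<sigma> (f x)) K) (embeddings L) (embeddings K)"
proof (rule bij_betwI')
  fix \<sigma> \<tau> assume s: "\<sigma> \<in> embeddings L" "\<tau> \<in> embeddings L"
  show "restrict (\<lambda>x. \<sigma> (f x)) K = restrict (\<lambda>x. \<tau> (f x)) K \<longleftrightarrow> \<sigma> = \<tau>"
  proof
    assume eq: "restrict (\<lambda>x. \<sigma> (f x)) K = restrict (\<lambda>x. \<tau> (f x)) K"
    show "\<sigma> = \<tau>"
    proof (rule embeddings_eqI[OF s])
      fix y assume "y \<in> L"
      then obtain x where "x \<in> K" "y = f x" using bij by (auto simp: bij_betw_def)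
      thus "\<sigma> y = \<tau> y" using fun_cong[OF eq, of x] by simp
    qed
  qed simp
next
  fix \<sigma> assume "\<sigma> \<in> embeddings L"
  hence s: "field_hom L UNIV \<sigma>" by (rule embeddingsD)
  show "restrict (\<lambda>x. \<sigma> (f x)) K \<in> embeddings K"
    by (auto simp: embeddings_def field_hom_def subfieldD[OF Kf] f_mem f_add f_mult field_homD[OF s] field_homD(1)[OF hom_UNIV])
next
  fix \<tau> assume t: "\<tau> \<in> embeddings K"
  define g where "g = inv_into K f"
  have g: "g y \<in> K" "f (g y) = y" if "y \<in> L" for y
    using bij that by (simp_all add: g_def bij_betw_def inv_into_into f_inv_into_f)
  have gf: "g (f x) = x" if "x \<in> K" for x using bij_betw_inv_into_left[OF bij that] by (simp add: g_def)
  have g_hom: "g 1 = 1" "g (x + y) = g x + g y" "g (x * y) = g x * g y" if "x \<in> L" "y \<in> L" for x y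
  proof -
    show "g 1 = 1" using gf[OF subfieldD(2)[OF Kf]] field_homD(1)[OF hom_UNIV] by simp
    have "f (g x + g y) = x + y" using that g by (simp add: f_add)
    thus "g (x + y) = g x + g y" using gf[of "g x + g y"] that g subfieldD(3)[OF Kf] by simp
    have "f (g x * g y) = x * y" using that g by (simp add: f_mult)
    thus "g (x * y) = g x * g y" using gf[of "g x * g y"] that g subfieldD(4)[OF Kf] by simp
  qed
  have L1: "1 \<in> L" by (rule subfieldD(2)[OF Lf])
  note th = embeddingsD(1)[OF t]
  have "restrict (\<lambda>y. \<tau> (g y)) L \<in> embeddings L"
    using g_hom(1)[OF L1 L1]
    by (auto simp: embeddings_def field_hom_def subfieldD[OF Lf] g g_hom field_homD[OF th])
  moreover have "\<tau> = restrict (\<lambda>x. restrict (\<lambda>y. \<tau> (g y)) L (f x)) K"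
    using embeddingsD(2)[OF t] by (auto simp: fun_eq_iff extensional_def f_mem gf)
  ultimately show "\<exists>\<sigma>\<in>embeddings L. \<tau> = restrict (\<lambda>x. \<sigma> (f x)) K" by blast
qed

lemma sum_embeddings: "(\<And>\<sigma>. F (restrict (\<lambda>x. \<sigma> (f x)) K) = G \<sigma>) \<Longrightarrow> (\<Sum>\<sigma>\<in>embeddings L. G \<sigma>) = (\<Sum>\<sigma>\<in>embeddings K. F \<sigma>)"
  using sum.reindex_bij_betw[OF embeddings_bij, of F] by simp

lemma degree: "nf_degree L = nf_degree K"
  using bij_betw_same_card[OF embeddings_bij] card_embeddings(2)[OF K] card_embeddings(2)[OF L] by simp

lemma trace: assumes x: "x \<in> K" shows "field_trace L (f x) = field_trace K x"
proof -
  have "of_rat (field_trace L (f x)) = (\<Sum>\<sigma>\<in>embeddings L. \<sigma> (f x))"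
    unfolding of_rat_field_trace[OF L f_mem[OF x]] by (rule sum.reindex_bij_betw[OF emb_bij[OF L]])
  also have "\<dots> = (\<Sum>\<sigma>\<in>embeddings K. \<sigma> x)" by (rule sum_embeddings) (simp add: x)
  also have "\<dots> = (of_rat (field_trace K x) :: complex)"
    unfolding of_rat_field_trace[OF K x] by (rule sum.reindex_bij_betw[OF emb_bij[OF K], symmetric])
  finally show ?thesis by (simp only: of_rat_eq_iff)
qed

lemma form: "x \<in> K \<Longrightarrow> y \<in> K \<Longrightarrow> trace_form L (f x) (f y) = trace_form K x y"
  unfolding trace_form_def by (simp add: trace[symmetric] f_mult subfieldD(4)[OF Kf])

lemma real: assumes "totally_real K" shows "totally_real L"
  unfolding totally_real_def
proof (intro ballI)
  fix \<sigma> y assume s: "\<sigma> \<in> embeddings L" and "y \<in> L"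
  then obtain x where x: "x \<in> K" "y = f x" using bij by (auto simp: bij_betw_def)
  have "restrict (\<lambda>x. \<sigma> (f x)) K \<in> embeddings K" using embeddings_bij s by (auto simp: bij_betw_def)
  hence "restrict (\<lambda>x. \<sigma> (f x)) K x \<in> \<real>" using assms x(1) unfolding totally_real_def by blast
  thus "\<sigma> y \<in> \<real>" using x by simp
qed

lemma integers: "bij_betw f (ring_of_integers K) (ring_of_integers L)"
  unfolding bij_betw_def
proof (intro conjI equalityI subsetI)
  show "inj_on f (ring_of_integers K)"
    using bij by (auto simp: bij_betw_def intro: inj_on_subset dest: roiD(1))
  show "y \<in> ring_of_integers L" if "y \<in> f ` ring_of_integers K" for y
    using that algebraic_int_hom[OF Kf hom_UNIV] by (auto simp: ring_of_integers_def f_mem)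
  fix y assume y: "y \<in> ring_of_integers L"
  then obtain x where x: "x \<in> K" "y = f x" using bij by (auto simp: bij_betw_def dest: roiD(1))
  obtain p where p: "poly (map_poly of_int p) y = 0" "lead_coeff p = 1"
    using roiD(2)[OF y] algebraic_int_altdef_ipoly by blast
  define P where "P = (map_poly of_int p :: 'a poly)"
  have cK: "coeff P i * x ^ i \<in> K" for i
    unfolding P_def using x(1) by (simp add: subfieldD(4)[OF Kf] subfield_of_int[OF Kf] subfield_power[OF Kf])
  have fp: "f (x ^ i) = f x ^ i" for i
    by (induction i) (simp_all add: field_homD(1)[OF hom_UNIV] f_mult x(1) subfield_power[OF Kf])
  have deg: "degree (map_poly (of_int :: int \<Rightarrow> 'b) p) = degree P" by (simp add: P_def)
  have "f (poly P x) = (\<Sum>i\<le>degree P. f (coeff P i * x ^ i))"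
    unfolding poly_altdef by (rule field_hom_sum[OF Kf hom_UNIV cK])
  also have "\<dots> = poly (map_poly of_int p) y"
    unfolding poly_altdef deg x(2)
    by (intro sum.cong refl) (simp add: P_def f_mult field_hom_of_int[OF Kf hom_UNIV] subfield_of_int[OF Kf]
        subfield_power[OF Kf] x(1) fp)
  finally have "f (poly P x) = 0" using p(1) by simp
  moreover have "poly P x \<in> K" unfolding poly_altdef by (rule subfield_sum[OF Kf cK])
  ultimately have "poly P x = 0" using field_hom_eq_0_iff[OF Kf hom_UNIV] by blast
  hence "algebraic_int x" using p(2) algebraic_int_altdef_ipoly unfolding P_def by blast
  thus "y \<in> f ` ring_of_integers K" using x by (auto simp: ring_of_integers_def)
qed

lemma f_integral: "x \<in> ring_of_integers K \<Longrightarrow> f x \<in> ring_of_integers L"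
  using integers by (auto simp: bij_betw_def)

lemma f_perp:
  assumes x: "x \<in> ring_of_integers K"
  shows "f (perp K x) = perp L (f x)"
proof -
  have "itrace L (f x) = itrace K x" unfolding itrace_def trace[OF roiD(1)[OF x]] ..
  thus ?thesis
    unfolding perp_itrace[OF K x] perp_itrace[OF L f_integral[OF x]] degree
    using roiD(1)[OF x] by (simp add: field_hom_diff[OF Kf hom_UNIV] f_mult subfield_of_int[OF Kf] subfieldD(4)[OF Kf]
        field_hom_of_int[OF Kf hom_UNIV] del: of_int_of_nat_eq)
qed

lemma discriminant: "discriminant L = discriminant K"
proof -
  obtain e where e: "zbasis K e" using ex_zbasis[OF K] by blast
  have eO: "e j \<in> ring_of_integers K" if "j < nf_degree K" for j using zbasisD(1)[OF e that] .
  have "zbasis L (\<lambda>j. f (e j))"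
    unfolding zbasis_def degree
  proof (intro conjI allI impI ballI)
    fix y assume "y \<in> ring_of_integers L"
    then obtain x where x: "x \<in> ring_of_integers K" "y = f x" using integers by (auto simp: bij_betw_def)
    obtain q where q: "x = (\<Sum>j<nf_degree K. of_int (q j) * e j)" using zbasisD(2)[OF e x(1)] by blast
    have "y = (\<Sum>j<nf_degree K. of_int (q j) * f (e j))"
      unfolding x(2) q by (rule additive_on_int_combination[OF K _ eO]) (simp add: f_add roiD(1))
    thus "\<exists>q. y = (\<Sum>j<nf_degree K. of_int (q j) * f (e j))" by blast
  qed (simp add: f_integral eO)
  moreover have "gram L (\<lambda>j. f (e j)) = gram K e"
    unfolding gram_def degree
    by (rule cong_mat) (simp_all add: itrace_def trace f_mult[symmetric] subfieldD(4)[OF Kf] roiD(1)[OF eO])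
  ultimately show ?thesis using discriminant_eq_det_gram[OF K e] discriminant_eq_det_gram[OF L] by metis
qed

lemma perp_bij: "bij_betw f (integers_perp K) (integers_perp L)"
  unfolding bij_betw_def
proof
  have "integers_perp K \<subseteq> K"
    using integers_perp_subset[OF K] by (auto simp: trace_zero_integers_def dest: roiD(1))
  thus "inj_on f (integers_perp K)" using bij by (auto simp: bij_betw_def intro: inj_on_subset)
  have "f ` integers_perp K = (\<lambda>x. perp L (f x)) ` ring_of_integers K"
    unfolding perp_integers image_image by (rule image_cong) (simp_all add: f_perp)
  also have "\<dots> = perp L ` (f ` ring_of_integers K)" by (simp only: image_image)
  also have "\<dots> = integers_perp L" using integers unfolding perp_integers bij_betw_def by simp
  finally show "f ` integers_perp K = integers_perp L" .
qed

lemma trace_zero_bij: "bij_betw f (trace_zero_integers K) (trace_zero_integers L)"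
  unfolding bij_betw_def
proof
  have "trace_zero_integers K \<subseteq> K" by (auto simp: trace_zero_integers_def dest: roiD(1))
  thus "inj_on f (trace_zero_integers K)" using bij by (auto simp: bij_betw_def intro: inj_on_subset)
  show "f ` trace_zero_integers K = trace_zero_integers L"
  proof (intro equalityI subsetI)
    show "y \<in> trace_zero_integers L" if "y \<in> f ` trace_zero_integers K" for y
      using that by (auto simp: trace_zero_integers_def trace f_integral roiD(1))
    fix y assume y: "y \<in> trace_zero_integers L"
    then obtain x where x: "x \<in> ring_of_integers K" "y = f x"
      using integers by (auto simp: trace_zero_integers_def bij_betw_def)
    have "x \<in> trace_zero_integers K" using y x trace[OF roiD(1)[OF x(1)]] by (simp add: trace_zero_integers_def)
    thus "y \<in> f ` trace_zero_integers K" using x(2) by blast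
  qed
qed

lemma b_form: "x \<in> K \<Longrightarrow> y \<in> K \<Longrightarrow> b_form L (f x) (f y) = b_form K x y"
  unfolding b_form_def by (rule sum_embeddings) simp

lemma isometries:
  "isometric (integers_perp K) (trace_form K) (integers_perp L) (trace_form L)"
  "isometric (trace_zero_integers K) (trace_form K) (trace_zero_integers L) (trace_form L)"
  "same_shape K L"
proof -
  have t: "x \<in> K" if "x \<in> trace_zero_integers K" for x using that by (auto simp: trace_zero_integers_def dest: roiD(1))
  hence p: "x \<in> K" if "x \<in> integers_perp K" for x using that integers_perp_subset[OF K] by blast
  show "isometric (integers_perp K) (trace_form K) (integers_perp L) (trace_form L)"
    unfolding isometric_def using perp_bij p by (intro exI[of _ f]) (simp add: f_add form)
  show "isometric (trace_zero_integers K) (trace_form K) (trace_zero_integers L) (trace_form L)"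
    unfolding isometric_def using trace_zero_bij t by (intro exI[of _ f]) (simp add: f_add form)
  show "same_shape K L"
    unfolding same_shape_def isometric_def using perp_bij p
    by (intro exI[of _ 1] conjI exI[of _ f]) (simp_all add: f_add b_form)
qed

end

theorem theorem2p12:
  fixes K :: "'a::field_char_0 set" and L :: "'b::field_char_0 set" and n :: nat
  assumes "number_field K" and "totally_real K"
    and "fundamental_discriminant (discriminant K)"
    and "n = nf_degree K" and "n \<ge> 3"
    and "cyclic_group (units_of (residue_ring (int n)))"
    and "number_field L"
  shows "(field_isomorphic K L \<longleftrightarrow>
            isometric (integers_perp K) (trace_form K) (integers_perp L) (trace_form L)) \<and>
         (field_isomorphic K L \<longleftrightarrow>
            same_shape K L \<and> totally_real L \<and> fundamental_discriminant (discriminant L)) \<and>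
         (gcd (int n) (discriminant K) = 1 \<longrightarrow>
           (field_isomorphic K L \<longleftrightarrow>
              isometric (trace_zero_integers K) (trace_form K)
                (trace_zero_integers L) (trace_form L)))"
proof -
  note K = assms(1) and real = assms(2) and fund = assms(3) and n = assms(4,5) and cyc = assms(6) and L = assms(7)
  have forward: "isometric (integers_perp K) (trace_form K) (integers_perp L) (trace_form L) \<and>
      isometric (trace_zero_integers K) (trace_form K) (trace_zero_integers L) (trace_form L) \<and>
      same_shape K L \<and> totally_real L \<and> fundamental_discriminant (discriminant L)"
    if iso: "field_isomorphic K L"
  proof -
    obtain f where f: "field_hom K L f" "bij_betw f K L" using iso unfolding field_isomorphic_def by blast
    interpret f: field_isomorphism K L f by unfold_locales (rule K L f)+
    show ?thesis using f.isometries f.real[OF real] f.discriminant fund by simp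
  qed
  have ii: "field_isomorphic K L" if "isometric (integers_perp K) (trace_form K) (integers_perp L) (trace_form L)"
    using that by (rule field_isomorphic_if_isometric_perp[OF K L n real fund cyc])
  have iii: "field_isomorphic K L"
    if "same_shape K L" "totally_real L" "fundamental_discriminant (discriminant L)"
    by (rule field_isomorphic_if_same_shape[OF K L n real fund that(2,3) cyc that(1)])
  have iv: "field_isomorphic K L" if "gcd (int n) (discriminant K) = 1"
    "isometric (trace_zero_integers K) (trace_form K) (trace_zero_integers L) (trace_form L)"
    using that by (intro field_isomorphic_if_isometric_trace_zero[OF K L n real fund cyc])
      (simp_all add: coprime_iff_gcd_eq_1)
  show ?thesis using forward ii iii iv by (intro conjI impI iffI) simp_all
qed

end
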